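(* Let $X$, $\nu$, $\Psi$, $\mu$, $\varphi_\Delta$, $f$, $\theta$, $K$ and the estimator $\hat\theta_{\Delta,h,n}$ be as described in the context (in particular all assumptions on $X$, $f$ and $K$ listed there are satisfied). Then there is a universal constant $C>0$ such that, with $T:=\Delta n$ and $$C_1:=C\Big(\int|\Psi''(x)|\,dx+2\int|\Psi'(x)|^2\,dx\Big)\in[0,\infty],\qquad C_2:=C\big(\|\Psi''\|_\infty+2\|\Psi'\|_\infty^2\big)<\infty,$$ one has for every bandwidth $h>0$ $$\mathbb E\big[|\theta-\hat\theta_{\Delta,h,n}|^2\big]\le 2\left|\int f(x)\,\mu(dx)-\int f(x)\,(K_h*\mu)(dx)\right|^2+\frac{T^{-1}}{2\pi^2}\left\{C_1\int|\mathcal FK(hu)|^2\left|\frac{\mathcal Ff(-u)}{\varphi_\Delta(u)}\right|^2du\ \wedge\ C_2\left(\int|\mathcal FK(hu)|\left|\frac{\mathcal Ff(-u)}{\varphi_\Delta(u)}\right|du\right)^2\right\}.$$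
   Context: $a\wedge b=\min(a,b)$. Fourier transforms are $\mathcal Fg(u)=\int e^{iux}g(x)\,dx$, $\mathcal F\mu(u)=\int e^{iux}\mu(dx)$; for a compactly supported distribution $f$, $\mathcal Ff$ is the usual (smooth) function $u\mapsto\langle f,e^{iu\cdot}\rangle$. Process: $X=(X_t)_{t\ge0}$ is a real-valued Lévy process with Lévy measure $\nu$, of pure jump type (no Gaussian part), with $\int_{\{|x|\le1\}}|x|\,\nu(dx)<\infty$, without drift component, and with finite second moments, i.e. $\int|x|^2\nu(dx)<\infty$. Thus $\varphi_\Delta(u):=\mathbb E[e^{iuX_\Delta}]=e^{\Delta\Psi(u)}$ with $\Psi(u)=\int(e^{iux}-1)\,\nu(dx)$. The finite signed measure $\mu$ is $\mu(dx):=x\,\nu(dx)$. Functional: $f$ is a distribution on $\mathbb R$ such that one of the following holds: (i) $f$ is regular, identified with a function $f\in L^1(\mathbb R)$ with $\sup_x|f(x)|<\infty$; or (ii) $f$ is compactly supported, of order $k$, and for some open interval $D\supseteq\mathrm{supp}(f)$ the restriction $\mu|_D$ has a density $g_D\in C^k(D)$. The parameter is $\theta:=\langle f,\mu\rangle$ (in case (i), $\theta=\int f(x)\mu(dx)$; in case (ii), $f$ applied to the density $g_D$). Formally one writes $\int f(x)\,\mu(dx):=\langle f,\mu\rangle$ even if $f$ is non-regular, and likewise $\int f(x)(K_h*\mu)(dx):=\langle f,K_h*\mu\rangle$. Kernel: $K$ is a kernel function, $K_h(x):=h^{-1}K(x/h)$ (so $\mathcal FK_h(u)=\mathcal FK(hu)$),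 such that for every $h>0$, $u\mapsto\mathcal FK_h(u)\mathcal Ff(-u)$ is in $L^1(\mathbb R)$, and, if $f$ is non-regular of order $k$, $K$ is $k$ times continuously differentiable. Observations and estimator: $\Delta>0$ is fixed, $X$ is observed at times $\Delta,2\Delta,\dots,2n\Delta$, and $Z_{\Delta,k}:=X_{k\Delta}-X_{(k-1)\Delta}$, $k=1,\dots,2n$. Put $$\hat\varphi_{\Delta,n}(u):=\frac1n\sum_{k=1}^ne^{iuZ_{\Delta,k}},\quad \hat\varphi'_{\Delta,n}(u):=\frac1n\sum_{k=n+1}^{2n}iZ_{\Delta,k}e^{iuZ_{\Delta,k}},\quad \frac1{\tilde\varphi_{\Delta,n}(u)}:=\frac{\mathbf 1(|\hat\varphi_{\Delta,n}(u)|\ge(\Delta n)^{-1/2})}{\hat\varphi_{\Delta,n}(u)},$$ $$\hat\theta_{\Delta,h,n}:=\frac1{2\pi}\int\mathcal Ff(-u)\,\mathcal FK_h(u)\,\frac{\frac1\Delta\hat\varphi'_{\Delta,n}(u)}{i\,\tilde\varphi_{\Delta,n}(u)}\,du .$$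
   Formalization: The constant C depends on an upper bound for Δ (one C for all Δ>0 is impossible: take ν=δ₁, Ff concentrated near ±π, Δ→∞), and for non-regular f the bound is stated whenever ⟨f,K_h*μ⟩ is defined, i.e. K_h*μ has a C^k density near supp f. *)

theory Defs
  imports "HOL-Probability.Probability"
begin

section \<open>Levy processes\<close>

definition cadlag_on_nonneg :: "(real \<Rightarrow> real) \<Rightarrow> bool" where
  "cadlag_on_nonneg x \<longleftrightarrow>
     (\<forall>t\<ge>0. continuous (at_right t) x \<and> (0 < t \<longrightarrow> (\<exists>l. (x \<longlongrightarrow> l) (at_left t))))"

definition levy_process :: "'a measure \<Rightarrow> (real \<Rightarrow> 'a \<Rightarrow> real) \<Rightarrow> bool" where
  "levy_process M X \<longleftrightarrow>
     prob_space M \<and>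
     (\<forall>t\<ge>0. X t \<in> borel_measurable M) \<and>
     (AE \<omega> in M. X 0 \<omega> = 0) \<and>
     (\<forall>(t :: nat \<Rightarrow> real) m. 0 \<le> t 0 \<and> mono t \<longrightarrow>
        prob_space.indep_vars M (\<lambda>_. borel) (\<lambda>i \<omega>. X (t (Suc i)) \<omega> - X (t i) \<omega>) {..<m}) \<and>
     (\<forall>s\<ge>0. \<forall>t\<ge>0. distr M borel (\<lambda>\<omega>. X (s + t) \<omega> - X s \<omega>) = distr M borel (X t)) \<and>
     (\<forall>t\<ge>0. \<forall>\<epsilon>>0.
        ((\<lambda>s. measure M {\<omega> \<in> space M. \<epsilon> < \<bar>X s \<omega> - X t \<omega>\<bar>}) \<longlongrightarrow> 0) (at t within {0..})) \<and>
     (AE \<omega> in M. cadlag_on_nonneg (\<lambda>t. X t \<omega>))"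

text \<open>Characteristic triplet in the Levy-Khintchine formula, with truncation function
  \<open>x 1(|x| \<le> 1)\<close>; \<open>\<sigma>2\<close> is the variance of the Gaussian part.\<close>

definition has_levy_triplet ::
    "'a measure \<Rightarrow> (real \<Rightarrow> 'a \<Rightarrow> real) \<Rightarrow> real \<Rightarrow> real \<Rightarrow> real measure \<Rightarrow> bool" where
  "has_levy_triplet M X \<gamma> \<sigma>2 \<nu> \<longleftrightarrow>
     0 \<le> \<sigma>2 \<and> sets \<nu> = sets borel \<and> emeasure \<nu> {0} = 0 \<and>
     (\<integral>\<^sup>+ x. ennreal (min 1 (x\<^sup>2)) \<partial>\<nu>) < \<infinity> \<and>
     (\<forall>t\<ge>0. \<forall>u. char (distr M borel (X t)) u =
        exp (complex_of_real t *
          (\<i> * complex_of_real (\<gamma> * u) - complex_of_real (\<sigma>2 * u\<^sup>2 / 2) +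
           (\<integral> x. iexp (u * x) - 1 - \<i> * complex_of_real (u * x * indicator {-1..1} x) \<partial>\<nu>))))"

text \<open>For jumps of finite variation the drift is \<open>\<gamma> - \<integral>\<^bsub>|x| \<le> 1\<^esub> x \<nu>(dx)\<close>.\<close>

definition pure_jump_levy ::
    "'a measure \<Rightarrow> (real \<Rightarrow> 'a \<Rightarrow> real) \<Rightarrow> real measure \<Rightarrow> bool" where
  "pure_jump_levy M X \<nu> \<longleftrightarrow>
     levy_process M X \<and>
     set_integrable \<nu> {-1..1} (\<lambda>x. \<bar>x\<bar>) \<and>
     integrable \<nu> (\<lambda>x. x\<^sup>2) \<and>
     (\<exists>\<gamma>. has_levy_triplet M X \<gamma> 0 \<nu> \<and> \<gamma> - (LINT x:{-1..1}|\<nu>. x) = 0)"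

definition levy_Psi :: "real measure \<Rightarrow> real \<Rightarrow> complex" where
  "levy_Psi \<nu> u = (\<integral> x. iexp (u * x) - 1 \<partial>\<nu>)"

definition char_at :: "'a measure \<Rightarrow> (real \<Rightarrow> 'a \<Rightarrow> real) \<Rightarrow> real \<Rightarrow> real \<Rightarrow> complex" where
  "char_at M X \<Delta> = char (distr M borel (X \<Delta>))"

section \<open>Derivatives and distributions\<close>

definition nderiv :: "nat \<Rightarrow> (real \<Rightarrow> 'b::real_normed_vector) \<Rightarrow> real \<Rightarrow> 'b" where
  "nderiv j g = ((\<lambda>g x. vector_derivative g (at x)) ^^ j) g"

text \<open>Meant for open \<open>S\<close>.\<close>

definition Ck_on :: "nat \<Rightarrow> real set \<Rightarrow> (real \<Rightarrow> 'b::real_normed_vector) \<Rightarrow> bool" where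
  "Ck_on k S g \<longleftrightarrow>
     (\<forall>j<k. \<forall>x\<in>S. nderiv j g differentiable (at x)) \<and>
     (\<forall>j\<le>k. continuous_on S (nderiv j g))"

definition fun_supp :: "(real \<Rightarrow> complex) \<Rightarrow> real set" where
  "fun_supp \<phi> = closure {x. \<phi> x \<noteq> 0}"

definition test_function :: "(real \<Rightarrow> complex) \<Rightarrow> bool" where
  "test_function \<phi> \<longleftrightarrow> (\<forall>k. Ck_on k UNIV \<phi>) \<and> compact (fun_supp \<phi>)"

text \<open>A distribution is a functional of which only the values at test functions matter.\<close>

type_synonym distr_functional = "(real \<Rightarrow> complex) \<Rightarrow> complex"

definition Ck_bounded :: "nat \<Rightarrow> real set \<Rightarrow> distr_functional \<Rightarrow> bool" where
  "Ck_bounded k L T \<longleftrightarrow>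
     (\<exists>c. \<forall>\<phi>. test_function \<phi> \<and> fun_supp \<phi> \<subseteq> L \<longrightarrow>
        norm (T \<phi>) \<le> c * (\<Sum>j\<le>k. SUP x. norm (nderiv j \<phi> x)))"

definition distribution :: "distr_functional \<Rightarrow> bool" where
  "distribution T \<longleftrightarrow>
     (\<forall>\<phi> \<psi> a b. test_function \<phi> \<and> test_function \<psi> \<longrightarrow>
        T (\<lambda>x. a * \<phi> x + b * \<psi> x) = a * T \<phi> + b * T \<psi>) \<and>
     (\<forall>L. compact L \<longrightarrow> (\<exists>k. Ck_bounded k L T))"

definition has_order :: "distr_functional \<Rightarrow> nat \<Rightarrow> bool" where
  "has_order T k \<longleftrightarrow>
     (\<forall>L. compact L \<longrightarrow> Ck_bounded k L T) \<and>
     (\<forall>j<k. \<not> (\<forall>L. compact L \<longrightarrow> Ck_bounded j L T))"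

definition dist_supp :: "distr_functional \<Rightarrow> real set" where
  "dist_supp T =
     - \<Union> {U. open U \<and> (\<forall>\<phi>. test_function \<phi> \<and> fun_supp \<phi> \<subseteq> U \<longrightarrow> T \<phi> = 0)}"

text \<open>The continuous extension of a compactly supported distribution of order \<open>k\<close> to functions
  that are \<open>k\<close> times continuously differentiable near its support. The value does not depend on
  the approximating sequence.\<close>

definition dist_apply :: "distr_functional \<Rightarrow> nat \<Rightarrow> (real \<Rightarrow> complex) \<Rightarrow> complex" where
  "dist_apply T k g =
     (THE v. \<exists>U \<phi>. open U \<and> dist_supp T \<subseteq> U \<and> Ck_on k U g \<and>
        (\<forall>m. test_function (\<phi> m)) \<and>
        (\<forall>j\<le>k. uniform_limit U (\<lambda>m. nderiv j (\<phi> m)) (nderiv j g) sequentially) \<and>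
        (\<lambda>m. T (\<phi> m)) \<longlonglongrightarrow> v)"

section \<open>The functional\<close>

text \<open>\<open>Regular f\<close> is a function; \<open>Distr k T\<close> is a compactly supported distribution of
  order \<open>k\<close>.\<close>

datatype functional = Regular "real \<Rightarrow> complex" | Distr nat distr_functional

definition fourier :: "(real \<Rightarrow> complex) \<Rightarrow> real \<Rightarrow> complex" where
  "fourier g u = (\<integral> x. iexp (u * x) * g x \<partial>lborel)"

fun fourier_fnl :: "functional \<Rightarrow> real \<Rightarrow> complex" where
  "fourier_fnl (Regular f) u = fourier f u"
| "fourier_fnl (Distr k T) u = dist_apply T k (\<lambda>x. iexp (u * x))"

text \<open>A finite signed measure is represented by a measure \<open>N\<close> and an \<open>N\<close>-integrable \<open>s\<close>, and
  stands for \<open>s(x) N(dx)\<close>. Thus \<open>\<mu>\<close> is given by \<open>\<nu>\<close> and \<open>\<lambda>x. x\<close>.\<close>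

definition has_Ck_density_on ::
    "nat \<Rightarrow> real set \<Rightarrow> real measure \<Rightarrow> (real \<Rightarrow> real) \<Rightarrow> (real \<Rightarrow> real) \<Rightarrow> bool" where
  "has_Ck_density_on k D N s g \<longleftrightarrow>
     Ck_on k D g \<and> set_integrable lborel D g \<and>
     (\<forall>A\<in>sets borel. A \<subseteq> D \<longrightarrow> (LINT x:A|N. s x) = (LINT x:A|lborel. g x))"

text \<open>\<open>has_pairing F N s v\<close>: the pairing of \<open>F\<close> with \<open>s(x) N(dx)\<close> is defined and equals \<open>v\<close>.
  For a distribution of order \<open>k\<close> this needs a \<open>C\<^sup>k\<close> density near its support.\<close>

fun has_pairing ::
    "functional \<Rightarrow> real measure \<Rightarrow> (real \<Rightarrow> real) \<Rightarrow> complex \<Rightarrow> bool" where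
  "has_pairing (Regular f) N s v \<longleftrightarrow> v = (\<integral> x. f x * complex_of_real (s x) \<partial>N)"
| "has_pairing (Distr k T) N s v \<longleftrightarrow>
     (\<exists>D g. open D \<and> is_interval D \<and> dist_supp T \<subseteq> D \<and> has_Ck_density_on k D N s g \<and>
        v = dist_apply T k (\<lambda>x. complex_of_real (g x)))"

fun admissible_functional :: "functional \<Rightarrow> bool" where
  "admissible_functional (Regular f) \<longleftrightarrow> integrable lborel f \<and> bounded (range f)"
| "admissible_functional (Distr k T) \<longleftrightarrow>
     distribution T \<and> compact (dist_supp T) \<and> has_order T k"

section \<open>The kernel\<close>

definition scaled :: "(real \<Rightarrow> real) \<Rightarrow> real \<Rightarrow> real \<Rightarrow> real" where
  "scaled K h x = K (x / h) / h"

definition fourier_real :: "(real \<Rightarrow> real) \<Rightarrow> real \<Rightarrow> complex" where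
  "fourier_real K = fourier (\<lambda>x. complex_of_real (K x))"

fun smooth_enough :: "functional \<Rightarrow> (real \<Rightarrow> real) \<Rightarrow> bool" where
  "smooth_enough (Regular f) K \<longleftrightarrow> True"
| "smooth_enough (Distr k T) K \<longleftrightarrow> Ck_on k UNIV K"

definition admissible_kernel :: "functional \<Rightarrow> (real \<Rightarrow> real) \<Rightarrow> bool" where
  "admissible_kernel F K \<longleftrightarrow>
     integrable lborel K \<and> (\<integral> x. K x \<partial>lborel) = 1 \<and>
     (\<forall>h>0. integrable lborel (\<lambda>u. fourier_real (scaled K h) u * fourier_fnl F (- u))) \<and>
     smooth_enough F K"

text \<open>The Lebesgue density of \<open>K * \<mu>\<close>.\<close>

definition conv_mu :: "(real \<Rightarrow> real) \<Rightarrow> real measure \<Rightarrow> real \<Rightarrow> real" where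
  "conv_mu K \<nu> x = (\<integral> y. K (x - y) * y \<partial>\<nu>)"

section \<open>The estimator\<close>

definition incr :: "(real \<Rightarrow> 'a \<Rightarrow> real) \<Rightarrow> real \<Rightarrow> nat \<Rightarrow> 'a \<Rightarrow> real" where
  "incr X \<Delta> k \<omega> = X (real k * \<Delta>) \<omega> - X ((real k - 1) * \<Delta>) \<omega>"

definition phi_hat :: "(real \<Rightarrow> 'a \<Rightarrow> real) \<Rightarrow> real \<Rightarrow> nat \<Rightarrow> 'a \<Rightarrow> real \<Rightarrow> complex" where
  "phi_hat X \<Delta> n \<omega> u = (\<Sum>k=1..n. iexp (u * incr X \<Delta> k \<omega>)) / of_nat n"

definition phi_hat' :: "(real \<Rightarrow> 'a \<Rightarrow> real) \<Rightarrow> real \<Rightarrow> nat \<Rightarrow> 'a \<Rightarrow> real \<Rightarrow> complex" where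
  "phi_hat' X \<Delta> n \<omega> u =
     (\<Sum>k=n+1..2*n. \<i> * complex_of_real (incr X \<Delta> k \<omega>) * iexp (u * incr X \<Delta> k \<omega>)) / of_nat n"

definition inv_phi_tilde :: "(real \<Rightarrow> 'a \<Rightarrow> real) \<Rightarrow> real \<Rightarrow> nat \<Rightarrow> 'a \<Rightarrow> real \<Rightarrow> complex" where
  "inv_phi_tilde X \<Delta> n \<omega> u =
     (if norm (phi_hat X \<Delta> n \<omega> u) \<ge> (\<Delta> * real n) powr (- 1 / 2)
      then 1 / phi_hat X \<Delta> n \<omega> u else 0)"

definition theta_hat ::
    "functional \<Rightarrow> (real \<Rightarrow> real) \<Rightarrow> (real \<Rightarrow> 'a \<Rightarrow> real) \<Rightarrow> real \<Rightarrow> real \<Rightarrow> nat \<Rightarrow> 'a \<Rightarrow> complex" where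
  "theta_hat F K X \<Delta> h n \<omega> =
     1 / (2 * complex_of_real pi) *
     (\<integral> u. fourier_fnl F (- u) * fourier_real (scaled K h) u *
        (phi_hat' X \<Delta> n \<omega> u / complex_of_real \<Delta> / \<i> * inv_phi_tilde X \<Delta> n \<omega> u) \<partial>lborel)"

section \<open>The constants\<close>

definition C1_const :: "real \<Rightarrow> real measure \<Rightarrow> ennreal" where
  "C1_const C \<nu> = ennreal C *
     ((\<integral>\<^sup>+ x. ennreal (norm (nderiv 2 (levy_Psi \<nu>) x)) \<partial>lborel) +
      2 * (\<integral>\<^sup>+ x. ennreal ((norm (nderiv 1 (levy_Psi \<nu>) x))\<^sup>2) \<partial>lborel))"

definition C2_const :: "real \<Rightarrow> real measure \<Rightarrow> ennreal" where
  "C2_const C \<nu> = ennreal C *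
     ((SUP x. ennreal (norm (nderiv 2 (levy_Psi \<nu>) x))) +
      2 * (SUP x. ennreal (norm (nderiv 1 (levy_Psi \<nu>) x)))\<^sup>2)"

end

theory Submission
  imports Defs
begin

text \<open>
  Write \<open>A(u) = Ff(-u) FK\<^sub>h(u)\<close>, \<open>\<phi> = \<phi>\<^sub>\<Delta>\<close> and \<open>T = \<Delta> n\<close>. The theorem is a bias-variance decomposition on
  the Fourier side. Differentiating \<open>\<phi> = exp(\<Delta> \<Psi>)\<close> gives \<open>\<phi>'/\<phi> = \<Delta> \<Psi>' = i \<Delta> F\<mu>\<close>, so the estimator is
  \<open>1/(2\<pi>) \<integral> A(u) F\<mu>(u) du\<close> with \<open>F\<mu>\<close> replaced by an empirical version of \<open>\<phi>'/(i \<Delta> \<phi>)\<close>.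

  The bias: the integral with the true \<open>F\<mu>\<close> is the pairing of \<open>f\<close> with \<open>K\<^sub>h * \<mu>\<close> (\<open>pairing_fourier\<close>). If
  \<open>f\<close> is a function, this is Fubini's theorem and Fourier inversion of the convolution of \<open>K\<^sub>h\<close> with the
  reflected \<open>f\<close>. The inversion has to hold at every point, since \<open>\<mu>\<close> may have atoms; it does, because
  the convolution of a bounded integrable function with an integrable one is continuous
  (\<open>conv_inversion\<close>). If \<open>f\<close> is a distribution, \<open>K\<^sub>h * \<mu>\<close> is known to coincide with a \<open>C\<^sup>k\<close> density only
  almost everywhere near the support of \<open>f\<close>. Convolved with a mollifier it becomes a Fourier integral
  with a rapidly decreasing integrand, and a distribution commutes with such an integral
  (\<open>distribution_fourier_exchange\<close>); the mollified functions converge in \<open>C\<^sup>k\<close> near the support to the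
  density, and the Fourier side converges by dominated convergence. That the value of \<open>f\<close> at a \<open>C\<^sup>k\<close>
  function is well defined at all rests on smooth cutoffs (\<open>cutoff\<close>, \<open>distribution_vanish\<close>).

  The variance: let \<open>R(u)\<close> be the empirical version of \<open>\<phi>'/\<phi>\<close> minus \<open>\<phi>'/\<phi>\<close>. By Fubini's theorem,
  \<open>E |\<integral> A R|\<^sup>2\<close> is the integral of \<open>A(u) cnj (A(v)) E[R(u) cnj (R(v))]\<close> over \<open>u\<close> and \<open>v\<close>. Here
  \<open>R = (\<phi>'\<^sub>n - \<phi>')/\<phi>\<^sub>n + \<phi>' (1/\<phi>\<^sub>n - 1/\<phi>)\<close>, where \<open>\<phi>'\<^sub>n\<close> depends on the second half of the sample and the
  truncated inverse \<open>1/\<phi>\<^sub>n\<close> on the first. By independence the mixed terms vanish, and the product of the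
  first terms splits into the covariance of \<open>\<phi>'\<^sub>n\<close>, which equals
  \<open>-(\<phi>''(u - v) + \<phi>'(u) cnj (\<phi>'(v)))/n\<close>, and a moment of \<open>1/\<phi>\<^sub>n\<close>. The truncation yields
  \<open>E |1/\<phi>\<^sub>n|\<^sup>2 \<le> c/|\<phi>|\<^sup>2\<close> and \<open>E |1/\<phi>\<^sub>n - 1/\<phi>|\<^sup>2 \<le> c/(T |\<phi>|\<^sup>4)\<close> (\<open>truncated_inverse_error\<close>, with second and
  fourth moments of the empirical characteristic function), and with
  \<open>\<phi>'' = (\<Delta> \<Psi>'' + \<Delta>\<^sup>2 \<Psi>'\<^sup>2) \<phi>\<close> the result is
  \<open>|E[R(u) cnj (R(v))]| \<le> c \<Delta>\<^sup>2 (|\<Psi>''(u - v)| + |\<Psi>'(u - v)|\<^sup>2 + |\<Psi>'(u) \<Psi>'(v)|) / (T |\<phi>(u) \<phi>(v)|)\<close>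
  (\<open>ratio_error_covariance_le\<close>). Estimating this quadratic form by the inequalities of Young and
  Cauchy-Schwarz gives the bound with \<open>C\<^sub>1\<close>, and estimating the kernel by its supremum gives the bound
  with \<open>C\<^sub>2\<close> (\<open>quadratic_form_bounds\<close>). The constant \<open>c\<close> is a polynomial in \<open>\<Delta>\<close>, which is where the
  upper bound on \<open>\<Delta>\<close> enters.
\<close>

section \<open>Iterated derivatives on open sets\<close>

lemma nderiv_0 [simp]: "nderiv 0 g = g"
  by (simp add: nderiv_def)

text \<open>
  An iterated derivative is defined by differentiating the previous one, whereas an induction on the
  order differentiates the function first. Exchanging the two turns the closure properties of \<open>C\<^sup>k\<close>
  functions below into plain inductions on \<open>k\<close> for all functions at once.
\<close>

lemma nderiv_Suc: "nderiv (Suc j) g = nderiv j (\<lambda>x. vector_derivative g (at x))"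
  by (simp add: nderiv_def funpow_Suc_right del: funpow.simps)

lemma nderiv_Suc_outer: "nderiv (Suc j) g = (\<lambda>x. vector_derivative (nderiv j g) (at x))"
  by (simp add: nderiv_def)

lemma vector_derivative_cong_open:
  fixes f g :: "real \<Rightarrow> 'b::real_normed_vector"
  assumes "open S" "x \<in> S" "\<And>y. y \<in> S \<Longrightarrow> f y = g y"
  shows "vector_derivative f (at x) = vector_derivative g (at x)"
proof -
  have "eventually (\<lambda>y. f y = g y) (nhds x)"
    using assms eventually_nhds by blast
  then show ?thesis
    by (intro vector_derivative_cong_eq) (use assms in auto)
qed

lemma differentiable_cong_open:
  fixes f g :: "real \<Rightarrow> 'b::real_normed_vector"
  assumes "open S" "x \<in> S" "\<And>y. y \<in> S \<Longrightarrow> f y = g y" "f differentiable (at x)"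
  shows "g differentiable (at x)"
proof -
  obtain D where "(f has_derivative D) (at x)"
    using assms(4) by (auto simp: differentiable_def)
  then have "(g has_derivative D) (at x)"
    by (rule has_derivative_transform_within_open[OF _ assms(1,2,3)])
  then show ?thesis by (auto simp: differentiable_def)
qed

lemma nderiv_cong_open:
  fixes f g :: "real \<Rightarrow> 'b::real_normed_vector"
  assumes "open S" "\<And>y. y \<in> S \<Longrightarrow> f y = g y"
  shows "x \<in> S \<Longrightarrow> nderiv j f x = nderiv j g x"
proof (induction j arbitrary: x)
  case 0 then show ?case using assms by simp
next
  case (Suc j)
  show ?case unfolding nderiv_Suc_outer
    by (rule vector_derivative_cong_open[OF assms(1) Suc.prems]) (rule Suc.IH)
qed

lemma Ck_on_0: "Ck_on 0 S g \<longleftrightarrow> continuous_on S g"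
  by (simp add: Ck_on_def)

lemma Ck_on_Suc:
  fixes g :: "real \<Rightarrow> 'b::real_normed_vector"
  shows "Ck_on (Suc k) S g \<longleftrightarrow>
    (\<forall>x\<in>S. g differentiable (at x)) \<and> Ck_on k S (\<lambda>x. vector_derivative g (at x))"
proof
  assume *: "Ck_on (Suc k) S g"
  then show "(\<forall>x\<in>S. g differentiable (at x)) \<and> Ck_on k S (\<lambda>x. vector_derivative g (at x))"
    unfolding Ck_on_def nderiv_Suc[symmetric]
    by (metis Suc_le_mono Suc_less_eq nderiv_0 zero_less_Suc)
next
  assume *: "(\<forall>x\<in>S. g differentiable (at x)) \<and> Ck_on k S (\<lambda>x. vector_derivative g (at x))"
  then have c: "continuous_on S g"
    by (meson continuous_at_imp_continuous_on differentiable_imp_continuous_within)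
  have 1: "nderiv j g differentiable (at x)" if "j < Suc k" "x \<in> S" for j x
    using * that by (cases j) (auto simp: Ck_on_def nderiv_Suc)
  have 2: "continuous_on S (nderiv j g)" if "j \<le> Suc k" for j
    using * that c by (cases j) (auto simp: Ck_on_def nderiv_Suc)
  show "Ck_on (Suc k) S g"
    using 1 2 by (auto simp: Ck_on_def)
qed

lemma Ck_on_mono: "Ck_on k S g \<Longrightarrow> j \<le> k \<Longrightarrow> Ck_on j S g"
  by (auto simp: Ck_on_def)

lemma Ck_on_subset: "Ck_on k S g \<Longrightarrow> S' \<subseteq> S \<Longrightarrow> Ck_on k S' g"
  unfolding Ck_on_def by (meson continuous_on_subset subset_iff)

lemma Ck_on_continuous: "Ck_on k S g \<Longrightarrow> continuous_on S g"
  by (metis Ck_on_0 Ck_on_mono le0)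

lemma Ck_on_cong:
  fixes f g :: "real \<Rightarrow> 'b::real_normed_vector"
  assumes "open S" "Ck_on k S f" "\<And>y. y \<in> S \<Longrightarrow> f y = g y"
  shows "Ck_on k S g"
proof -
  have eq: "nderiv j f x = nderiv j g x" if "x \<in> S" for j x
    by (rule nderiv_cong_open[OF assms(1) _ that]) (rule assms(3))
  show ?thesis
    unfolding Ck_on_def
  proof (intro conjI allI impI ballI)
    fix j x assume "j < k" "x \<in> S"
    then show "nderiv j g differentiable at x"
      using differentiable_cong_open[OF assms(1) \<open>x \<in> S\<close> eq] assms(2) by (auto simp: Ck_on_def)
  next
    fix j assume "j \<le> k"
    then have "continuous_on S (nderiv j f)" using assms(2) by (auto simp: Ck_on_def)
    then show "continuous_on S (nderiv j g)"
      using eq by (simp cong: continuous_on_cong)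
  qed
qed

lemma Ck_on_SucI:
  fixes g g' :: "real \<Rightarrow> 'b::real_normed_vector"
  assumes "open S" "\<And>x. x \<in> S \<Longrightarrow> (g has_vector_derivative g' x) (at x)" "Ck_on k S g'"
  shows "Ck_on (Suc k) S g"
  unfolding Ck_on_Suc
proof
  show "\<forall>x\<in>S. g differentiable at x"
    using assms(2) by (meson differentiableI_vector)
  show "Ck_on k S (\<lambda>x. vector_derivative g (at x))"
    by (rule Ck_on_cong[OF assms(1,3)]) (simp add: vector_derivative_at[OF assms(2)])
qed

lemma nderiv_SucI:
  fixes g g' :: "real \<Rightarrow> 'b::real_normed_vector"
  assumes "open S" "\<And>x. x \<in> S \<Longrightarrow> (g has_vector_derivative g' x) (at x)" "x \<in> S"
  shows "nderiv (Suc j) g x = nderiv j g' x"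
  unfolding nderiv_Suc
  by (rule nderiv_cong_open[OF assms(1) _ assms(3)]) (simp add: assms(2) vector_derivative_at)

lemma Ck_on_SucD:
  fixes g :: "real \<Rightarrow> 'b::real_normed_vector"
  assumes "Ck_on (Suc k) S g"
  shows "\<And>x. x \<in> S \<Longrightarrow> (g has_vector_derivative nderiv (Suc 0) g x) (at x)" "Ck_on k S (nderiv (Suc 0) g)"
  using assms unfolding Ck_on_Suc by (auto simp: nderiv_Suc vector_derivative_works)

lemma Ck_on_add:
  fixes f g :: "real \<Rightarrow> 'b::real_normed_vector"
  assumes "open S"
  shows "Ck_on k S f \<Longrightarrow> Ck_on k S g \<Longrightarrow> Ck_on k S (\<lambda>x. f x + g x)"
proof (induction k arbitrary: f g)
  case 0 then show ?case by (auto simp: Ck_on_0 intro: continuous_intros)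
next
  case (Suc k)
  show ?case
    by (rule Ck_on_SucI[OF assms, where g' = "\<lambda>x. nderiv (Suc 0) f x + nderiv (Suc 0) g x"])
       (auto intro!: derivative_intros Suc.IH Ck_on_SucD[OF Suc.prems(1)] Ck_on_SucD[OF Suc.prems(2)])
qed

lemma Ck_on_mult:
  fixes f g :: "real \<Rightarrow> 'b::real_normed_algebra"
  assumes "open S"
  shows "Ck_on k S f \<Longrightarrow> Ck_on k S g \<Longrightarrow> Ck_on k S (\<lambda>x. f x * g x)"
proof (induction k arbitrary: f g)
  case 0 then show ?case by (auto simp: Ck_on_0 intro: continuous_intros)
next
  case (Suc k)
  show ?case
    by (rule Ck_on_SucI[OF assms, where g' = "\<lambda>x. f x * nderiv (Suc 0) g x + nderiv (Suc 0) f x * g x"])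
       (auto intro!: Ck_on_add[OF assms] has_vector_derivative_mult Suc.IH
          Ck_on_SucD[OF Suc.prems(1)] Ck_on_SucD[OF Suc.prems(2)]
          intro: Ck_on_mono[OF Suc.prems(1)] Ck_on_mono[OF Suc.prems(2)])
qed

lemma Ck_on_const: "Ck_on k S (\<lambda>_. c :: 'b::real_normed_vector)"
proof (rule Ck_on_subset[of k UNIV])
  show "Ck_on k UNIV (\<lambda>_. c)"
  proof (induction k arbitrary: c)
    case 0 then show ?case by (simp add: Ck_on_0)
  next
    case (Suc k)
    show ?case by (rule Ck_on_SucI[where g' = "\<lambda>_. 0"]) (auto intro!: derivative_intros Suc.IH)
  qed
qed auto

lemma Ck_on_affine:
  fixes f :: "real \<Rightarrow> 'b::real_normed_vector"
  shows "Ck_on k UNIV f \<Longrightarrow> Ck_on k UNIV (\<lambda>x. f (a * x + b))"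
proof (induction k arbitrary: f)
  case 0 then show ?case
    unfolding Ck_on_0 by (auto intro!: continuous_on_compose2[OF 0[unfolded Ck_on_0]] continuous_intros)
next
  case (Suc k)
  have d: "((\<lambda>x. f (a * x + b)) has_vector_derivative a *\<^sub>R nderiv (Suc 0) f (a * x + b)) (at x)" for x
  proof -
    have "((f \<circ> (\<lambda>x. a * x + b)) has_vector_derivative a *\<^sub>R nderiv (Suc 0) f (a * x + b)) (at x)"
      by (rule vector_diff_chain_at)
         (auto intro!: derivative_eq_intros Ck_on_SucD[OF Suc.prems])
    then show ?thesis by (simp add: o_def)
  qed
  have "Ck_on k UNIV (\<lambda>x. a *\<^sub>R nderiv (Suc 0) f (a * x + b))"
  proof -
    have s: "Ck_on k UNIV h \<Longrightarrow> Ck_on k UNIV (\<lambda>x. a *\<^sub>R h x)" for h :: "real \<Rightarrow> 'b"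
    proof (induction k arbitrary: h)
      case 0 then show ?case by (auto simp: Ck_on_0 intro: continuous_intros)
    next
      case (Suc k) show ?case
        by (rule Ck_on_SucI[where g' = "\<lambda>x. a *\<^sub>R nderiv (Suc 0) h x"])
           (auto intro!: derivative_eq_intros Suc.IH Ck_on_SucD[OF Suc.prems])
    qed
    show ?thesis by (rule s, rule Suc.IH, rule Ck_on_SucD[OF Suc.prems])
  qed
  then show ?case by (intro Ck_on_SucI[OF _ d]) auto
qed

lemma Ck_on_Un:
  fixes f :: "real \<Rightarrow> 'b::real_normed_vector"
  assumes "open S" "open S'" "Ck_on k S f" "Ck_on k S' f"
  shows "Ck_on k (S \<union> S') f"
  using assms by (auto simp: Ck_on_def intro: continuous_on_open_Un)

lemma Ck_on_bounded_linear:
  assumes h: "bounded_linear h" and S: "open S"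
  shows "Ck_on k S f \<Longrightarrow> Ck_on k S (\<lambda>x. h (f x))"
proof (induction k arbitrary: f)
  case 0 then show ?case
    by (auto simp: Ck_on_0 intro: linear_continuous_on_compose bounded_linear.continuous_on[OF h])
next
  case (Suc k) show ?case
    by (rule Ck_on_SucI[OF S, where g' = "\<lambda>x. h (nderiv (Suc 0) f x)"])
       (auto intro!: bounded_linear.has_vector_derivative[OF h] Suc.IH Ck_on_SucD[OF Suc.prems])
qed

lemma nderiv_bounded_linear:
  assumes h: "bounded_linear h" and S: "open S"
  shows "Ck_on k S f \<Longrightarrow> j \<le> k \<Longrightarrow> x \<in> S \<Longrightarrow> nderiv j (\<lambda>x. h (f x)) x = h (nderiv j f x)"
proof (induction j arbitrary: f k)
  case 0 then show ?case by simp
next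
  case (Suc j)
  then obtain k' where k: "k = Suc k'" "j \<le> k'" by (cases k) auto
  note C = Ck_on_SucD[OF Suc.prems(1)[unfolded k(1)]]
  have "nderiv (Suc j) (\<lambda>x. h (f x)) x = nderiv j (\<lambda>x. h (nderiv (Suc 0) f x)) x"
    by (rule nderiv_SucI[OF S]) (auto intro!: bounded_linear.has_vector_derivative[OF h] C Suc.prems)
  also have "\<dots> = h (nderiv j (nderiv (Suc 0) f) x)"
    by (rule Suc.IH[OF C(2) k(2) Suc.prems(3)])
  finally show ?case by (simp add: nderiv_Suc)
qed

lemma nderiv_add:
  fixes f g :: "real \<Rightarrow> 'b::real_normed_vector"
  assumes S: "open S"
  shows "Ck_on k S f \<Longrightarrow> Ck_on k S g \<Longrightarrow> j \<le> k \<Longrightarrow> x \<in> S \<Longrightarrow>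
    nderiv j (\<lambda>x. f x + g x) x = nderiv j f x + nderiv j g x"
proof (induction j arbitrary: f g k)
  case 0 then show ?case by simp
next
  case (Suc j)
  then obtain k' where k: "k = Suc k'" "j \<le> k'" by (cases k) auto
  note C = Ck_on_SucD[OF Suc.prems(1)[unfolded k(1)]] and C' = Ck_on_SucD[OF Suc.prems(2)[unfolded k(1)]]
  have "nderiv (Suc j) (\<lambda>x. f x + g x) x = nderiv j (\<lambda>x. nderiv (Suc 0) f x + nderiv (Suc 0) g x) x"
    by (rule nderiv_SucI[OF S]) (auto intro!: derivative_intros C C' Suc.prems)
  also have "\<dots> = nderiv j (nderiv (Suc 0) f) x + nderiv j (nderiv (Suc 0) g) x"
    by (rule Suc.IH[OF C(2) C'(2) k(2) Suc.prems(4)])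
  finally show ?case by (simp add: nderiv_Suc)
qed

definition smooth :: "(real \<Rightarrow> complex) \<Rightarrow> bool" where
  "smooth f \<longleftrightarrow> (\<forall>k. Ck_on k UNIV f)"

lemma test_function_smooth: "test_function \<phi> \<longleftrightarrow> smooth \<phi> \<and> compact (fun_supp \<phi>)"
  by (simp add: test_function_def smooth_def)

lemma smooth_mult: "smooth f \<Longrightarrow> smooth g \<Longrightarrow> smooth (\<lambda>x. f x * g x)"
  by (auto simp: smooth_def intro: Ck_on_mult)

lemma smooth_add: "smooth f \<Longrightarrow> smooth g \<Longrightarrow> smooth (\<lambda>x. f x + g x)"
  by (auto simp: smooth_def intro: Ck_on_add)

lemma smooth_const: "smooth (\<lambda>_. c)"
  by (auto simp: smooth_def intro: Ck_on_const)

lemma smooth_diff: "smooth f \<Longrightarrow> smooth g \<Longrightarrow> smooth (\<lambda>x. f x - g x)"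
  using smooth_add[OF _ smooth_mult[OF smooth_const[of "-1"]], of f g] by simp

lemma nderiv_diff_smooth:
  assumes "smooth f" "smooth g"
  shows "nderiv j (\<lambda>x. f x - g x) x = nderiv j f x - nderiv j g x"
proof -
  have "smooth (\<lambda>x. - 1 * g x)" by (intro smooth_mult smooth_const assms)
  then have "nderiv j (\<lambda>x. f x + - 1 * g x) x = nderiv j f x + nderiv j (\<lambda>x. - 1 * g x) x"
    by (intro nderiv_add[of UNIV j]) (use assms in \<open>auto simp: smooth_def\<close>)
  also have "nderiv j (\<lambda>x. - 1 * g x) x = - 1 * nderiv j g x"
    by (rule nderiv_bounded_linear[of "\<lambda>z. - 1 * z" UNIV j])
       (use assms in \<open>auto simp: smooth_def bounded_linear_mult_right bounded_linear_minus\<close>)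
  finally show ?thesis by simp
qed

lemma smooth_affine: "smooth f \<Longrightarrow> smooth (\<lambda>x. f (a * x + b))"
  by (auto simp: smooth_def intro: Ck_on_affine)

lemma smooth_deriv: "smooth f \<Longrightarrow> smooth (nderiv (Suc 0) f)"
  unfolding smooth_def using Ck_on_SucD(2) by blast

lemma smooth_nderiv: "smooth f \<Longrightarrow> smooth (nderiv j f)"
proof (induction j)
  case (Suc j)
  have "nderiv (Suc j) f = nderiv (Suc 0) (nderiv j f)" by (simp add: nderiv_def)
  then show ?case using smooth_deriv[OF Suc.IH[OF Suc.prems]] by simp
qed simp

lemma smooth_has_deriv: "smooth f \<Longrightarrow> (f has_vector_derivative nderiv (Suc 0) f x) (at x)"
  unfolding smooth_def using Ck_on_SucD(1) by blast

lemma smooth_continuous: "smooth f \<Longrightarrow> continuous_on S (nderiv j f)"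
  unfolding smooth_def
  by (meson Ck_on_def continuous_on_subset le_refl top_greatest)

lemma smoothI_deriv:
  assumes "\<And>x. (f has_vector_derivative f' x) (at x)" "smooth f'"
  shows "smooth f"
  unfolding smooth_def
proof
  fix k
  have "Ck_on (Suc k) UNIV f"
    by (rule Ck_on_SucI) (use assms in \<open>auto simp: smooth_def\<close>)
  then show "Ck_on k UNIV f" by (rule Ck_on_mono) simp
qed

lemma fun_supp_outside: "x \<notin> fun_supp f \<Longrightarrow> f x = 0"
  using closure_subset[of "{x. f x \<noteq> 0}"] by (auto simp: fun_supp_def)

lemma fun_supp_subsetI: "closed S \<Longrightarrow> (\<And>x. x \<notin> S \<Longrightarrow> f x = 0) \<Longrightarrow> fun_supp f \<subseteq> S"
  unfolding fun_supp_def by (rule closure_minimal) auto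

lemma closed_fun_supp [simp]: "closed (fun_supp f)"
  by (simp add: fun_supp_def)

lemma nderiv_zero_outside:
  assumes "x \<notin> fun_supp f" shows "nderiv j f x = 0"
proof -
  have "nderiv j f x = nderiv j (\<lambda>_. 0) x"
    by (rule nderiv_cong_open[of "- fun_supp f"]) (use assms fun_supp_outside in auto)
  also have "\<dots> = 0"
  proof -
    have "nderiv j (\<lambda>_::real. 0::complex) = (\<lambda>_. 0)"
      by (induction j) (auto simp: nderiv_Suc_outer)
    then show ?thesis by simp
  qed
  finally show ?thesis .
qed

lemma fun_supp_nderiv: "fun_supp (nderiv j f) \<subseteq> fun_supp f"
  by (rule fun_supp_subsetI) (auto intro: nderiv_zero_outside)

lemma test_function_mult:
  assumes "test_function \<zeta>" "smooth f"
  shows "test_function (\<lambda>x. \<zeta> x * f x)" "fun_supp (\<lambda>x. \<zeta> x * f x) \<subseteq> fun_supp \<zeta>"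
proof -
  show s: "fun_supp (\<lambda>x. \<zeta> x * f x) \<subseteq> fun_supp \<zeta>"
    by (rule fun_supp_subsetI) (auto dest: fun_supp_outside)
  have "compact (fun_supp \<zeta> \<inter> fun_supp (\<lambda>x. \<zeta> x * f x))"
    using assms by (intro compact_Int_closed) (auto simp: test_function_def)
  then show "test_function (\<lambda>x. \<zeta> x * f x)"
    using assms s by (auto simp: test_function_smooth smooth_mult Int_absorb1)
qed

lemma test_function_nderiv: "test_function \<zeta> \<Longrightarrow> test_function (nderiv j \<zeta>)"
  using fun_supp_nderiv[of j \<zeta>] unfolding test_function_smooth
  by (metis closed_fun_supp compact_Int_closed inf.absorb_iff2 smooth_nderiv)

section \<open>Smooth bumps and cutoffs\<close>

text \<open>
  The exponential beats every power of \<open>1/x\<close>; hence all derivatives of the functions below extend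
  continuously by 0.
\<close>

lemma tendsto_poly_exp_0:
  fixes p :: "real poly"
  shows "((\<lambda>x::real. poly p (inverse x) * exp (- inverse x)) \<longlongrightarrow> 0) (at_right 0)"
proof -
  have "((\<lambda>y. poly p y * exp (- y)) \<longlongrightarrow> 0) at_top"
  proof -
    have "((\<lambda>y. \<Sum>i\<le>degree p. coeff p i * (y ^ i / exp y)) \<longlongrightarrow> (\<Sum>i\<le>degree p. coeff p i * 0)) at_top"
      by (intro tendsto_sum tendsto_mult tendsto_const tendsto_power_div_exp_0)
    moreover have "(\<lambda>y. \<Sum>i\<le>degree p. coeff p i * (y ^ i / exp y)) = (\<lambda>y. poly p y * exp (- y))"
      by (simp add: poly_altdef exp_minus divide_inverse sum_distrib_right mult.assoc)
    ultimately show ?thesis by simp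
  qed
  from filterlim_compose[OF this filterlim_inverse_at_top_right] show ?thesis by simp
qed

text \<open>
  For \<open>p = 1\<close> this is the classical smooth function that is flat at the origin. The family over all
  polynomials \<open>p\<close> is closed under differentiation, so that smoothness is an induction on the order.
\<close>

definition flat_exp :: "real poly \<Rightarrow> real \<Rightarrow> real" where
  "flat_exp p x = (if x > 0 then poly p (inverse x) * exp (- inverse x) else 0)"

lemma flat_exp_deriv:
  "(flat_exp p has_real_derivative flat_exp ([:0,0,1:] * (p - pderiv p)) x) (at x)"
proof -
  consider "x > 0" | "x < 0" | "x = 0" by linarith
  then show ?thesis
  proof cases
    case 1
    have "((\<lambda>x. poly p (inverse x) * exp (- inverse x)) has_real_derivative
        flat_exp ([:0,0,1:] * (p - pderiv p)) x) (at x)"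
      using 1 by (auto intro!: derivative_eq_intros DERIV_chain2[OF poly_DERIV]
          simp: flat_exp_def algebra_simps power2_eq_square divide_simps)
    then show ?thesis
      by (rule has_field_derivative_transform_within_open[of _ _ _ "{0<..}"]) (use 1 in \<open>auto simp: flat_exp_def\<close>)
  next
    case 2
    have "((\<lambda>x. 0) has_real_derivative flat_exp ([:0,0,1:] * (p - pderiv p)) x) (at x)"
      using 2 by (auto simp: flat_exp_def)
    then show ?thesis
      by (rule has_field_derivative_transform_within_open[of _ _ _ "{..<0}"]) (use 2 in \<open>auto simp: flat_exp_def\<close>)
  next
    case 3
    have "((\<lambda>y. flat_exp p y / y) \<longlongrightarrow> 0) (at 0)"
      unfolding filterlim_at_split
    proof
      show "((\<lambda>y. flat_exp p y / y) \<longlongrightarrow> 0) (at_left 0)"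
        by (rule Lim_transform_eventually[OF tendsto_const])
           (auto simp: flat_exp_def eventually_at_filter)
      have "\<forall>\<^sub>F y in at_right 0. poly ([:0,1:] * p) (inverse y) * exp (- inverse y) = flat_exp p y / y"
        by (auto simp: flat_exp_def eventually_at_filter divide_simps)
      from Lim_transform_eventually[OF tendsto_poly_exp_0 this]
      show "((\<lambda>y. flat_exp p y / y) \<longlongrightarrow> 0) (at_right 0)" .
    qed
    then show ?thesis
      using 3 by (simp add: has_field_derivative_iff flat_exp_def)
  qed
qed

lemma smooth_flat_exp: "smooth (\<lambda>x. complex_of_real (flat_exp p x))"
  unfolding smooth_def
proof
  fix k show "Ck_on k UNIV (\<lambda>x. complex_of_real (flat_exp p x))"
  proof (induction k arbitrary: p)
    case 0
    have "continuous_on UNIV (flat_exp p)"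
      by (meson DERIV_continuous continuous_at_imp_continuous_on flat_exp_deriv)
    then show ?case by (auto simp: Ck_on_0 intro: continuous_intros)
  next
    case (Suc k)
    show ?case
      by (rule Ck_on_SucI[where g' = "\<lambda>x. complex_of_real (flat_exp ([:0,0,1:] * (p - pderiv p)) x)"])
         (rule UNIV_I open_UNIV Suc.IH has_vector_derivative_of_real flat_exp_deriv)+
  qed
qed

definition bump :: "real \<Rightarrow> real" where
  "bump x = flat_exp 1 (1 - x) * flat_exp 1 (1 + x)"

lemma bump_nonneg: "bump x \<ge> 0"
  by (simp add: bump_def flat_exp_def)

lemma bump_pos: "-1 < x \<Longrightarrow> x < 1 \<Longrightarrow> bump x > 0"
  by (simp add: bump_def flat_exp_def)

lemma bump_zero: "x \<le> -1 \<or> x \<ge> 1 \<Longrightarrow> bump x = 0"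
  by (auto simp: bump_def flat_exp_def)

lemma smooth_bump: "smooth (\<lambda>x. complex_of_real (bump x))"
proof -
  have "smooth (\<lambda>x. complex_of_real (flat_exp 1 (-1 * x + 1)) * complex_of_real (flat_exp 1 (1 * x + 1)))"
    by (intro smooth_mult smooth_affine[OF smooth_flat_exp])
  then show ?thesis by (simp add: bump_def add.commute)
qed

lemma continuous_on_bump: "continuous_on S bump"
proof -
  have c: "continuous_on UNIV (flat_exp 1)"
    by (meson DERIV_continuous continuous_at_imp_continuous_on flat_exp_deriv)
  have "continuous_on UNIV (\<lambda>x. flat_exp 1 (1 - x) * flat_exp 1 (1 + x))"
    by (intro continuous_on_mult continuous_on_compose2[OF c] continuous_intros) auto
  then show ?thesis unfolding bump_def[abs_def] by (rule continuous_on_subset) simp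
qed

definition bump_mass :: real where "bump_mass = integral {-1..1} bump"

lemma bump_integrable_on: "bump integrable_on {a..b}"
  by (rule integrable_continuous_real[OF continuous_on_bump])

lemma bump_mass_pos: "bump_mass > 0"
proof -
  have "bump_mass \<ge> 0"
    unfolding bump_mass_def by (rule integral_nonneg[OF bump_integrable_on]) (simp add: bump_nonneg)
  moreover have "bump_mass \<noteq> 0"
  proof
    assume "bump_mass = 0"
    then have "(bump has_integral 0) (cbox (-1) 1)"
      using bump_integrable_on[of "-1" 1] by (simp add: bump_mass_def has_integral_integral)
    from has_integral_0_cbox_imp_0[OF continuous_on_bump _ this, of 0]
    have "bump 0 = 0" by (simp add: bump_nonneg)
    then show False using bump_pos[of 0] by simp
  qed
  ultimately show ?thesis by linarith
qed

text \<open>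
  An antiderivative of the bump, normalised to rise from 0 to 1; smoothness is inherited from its
  derivative.
\<close>

definition smooth_step :: "real \<Rightarrow> real" where
  "smooth_step x = (if x \<le> -1 then 0 else integral {-1..x} bump / bump_mass)"

lemma smooth_step_0: "x \<le> -1 \<Longrightarrow> smooth_step x = 0"
  by (simp add: smooth_step_def)

lemma smooth_step_1: "x \<ge> 1 \<Longrightarrow> smooth_step x = 1"
proof -
  assume x: "x \<ge> 1"
  have "integral {-1..1} bump + integral {1..x} bump = integral {-1..x} bump"
    by (rule Henstock_Kurzweil_Integration.integral_combine) (use x bump_integrable_on in auto)
  moreover have "integral {1..x} bump = 0"
    using integral_cong[of "{1..x}" bump "\<lambda>_. 0"] bump_zero by auto
  ultimately show ?thesis using x bump_mass_pos by (simp add: smooth_step_def bump_mass_def)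
qed

lemma smooth_step_deriv: "(smooth_step has_real_derivative bump x / bump_mass) (at x)"
proof -
  consider "x < -1" | "x \<ge> -1" by linarith
  then show ?thesis
  proof cases
    case 1
    have "((\<lambda>x. 0) has_real_derivative bump x / bump_mass) (at x)"
      using 1 by (simp add: bump_zero)
    then show ?thesis
      by (rule has_field_derivative_transform_within_open[of _ _ _ "{..<-1}"]) (use 1 in \<open>auto simp: smooth_step_def\<close>)
  next
    case 2
    have i: "integral {-2..y} bump = integral {-1..y} bump" if "y \<ge> -1" for y
    proof -
      have "integral {-2..-1} bump + integral {-1..y} bump = integral {-2..y} bump"
        by (rule Henstock_Kurzweil_Integration.integral_combine) (use that bump_integrable_on in auto)
      moreover have "integral {-2..-1} bump = 0"
        using integral_cong[of "{-2..-1}" bump "\<lambda>_. 0"] bump_zero by auto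
      ultimately show ?thesis by simp
    qed
    have i2: "integral {-2..y} bump = 0" if "y \<le> -1" for y
      using integral_cong[of "{-2..y}" bump "\<lambda>_. 0"] bump_zero that by auto
    have "((\<lambda>y. integral {-2..y} bump) has_real_derivative bump x) (at x within {-2..x+1})"
      by (rule integral_has_real_derivative[OF continuous_on_bump]) (use 2 in auto)
    then have "((\<lambda>y. integral {-2..y} bump) has_real_derivative bump x) (at x)"
      using 2 by (simp add: at_within_Icc_at)
    then have "((\<lambda>y. integral {-2..y} bump / bump_mass) has_real_derivative bump x / bump_mass) (at x)"
      by (rule DERIV_cdivide)
    moreover have "integral {-2..y} bump / bump_mass = smooth_step y" for y
      using i[of y] i2[of y] by (auto simp: smooth_step_def)
    ultimately show ?thesis by simp
  qed
qed

lemma smooth_smooth_step: "smooth (\<lambda>x. complex_of_real (smooth_step x))"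
proof (rule smoothI_deriv)
  show "((\<lambda>x. complex_of_real (smooth_step x)) has_vector_derivative complex_of_real (bump x / bump_mass)) (at x)" for x
    by (intro has_vector_derivative_of_real) (use smooth_step_deriv in \<open>simp add: has_real_derivative_iff_has_vector_derivative\<close>)
  show "smooth (\<lambda>x. complex_of_real (bump x / bump_mass))"
    using smooth_mult[OF smooth_bump smooth_const[of "complex_of_real (1 / bump_mass)"]] by simp
qed

text \<open>
  A rising step times a falling one, each passing from 0 to 1 over a distance \<open>2 r\<close>.
\<close>

lemma local_cutoff:
  fixes c r :: real assumes "r > 0"
  obtains \<beta> :: "real \<Rightarrow> complex" where "smooth \<beta>" "\<And>x. x \<in> ball c r \<Longrightarrow> \<beta> x = 1"
    "\<And>x. x \<notin> cball c (3 * r) \<Longrightarrow> \<beta> x = 0"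
proof
  define \<beta> where "\<beta> = (\<lambda>x. complex_of_real (smooth_step ((1/r) * x + (2 - c / r))) *
      complex_of_real (smooth_step ((-1/r) * x + (2 + c / r))))"
  show "smooth \<beta>" unfolding \<beta>_def by (intro smooth_mult smooth_affine[OF smooth_smooth_step])
  show "\<beta> x = 1" if "x \<in> ball c r" for x
  proof -
    have "-1 \<le> (x - c) / r" "(x - c) / r \<le> 1"
      using that assms by (auto simp: dist_real_def pos_le_divide_eq pos_divide_le_eq)
    then have "1 \<le> (1/r) * x + (2 - c / r)" "1 \<le> (-1/r) * x + (2 + c / r)"
      by (simp_all add: diff_divide_distrib)
    then show ?thesis by (simp add: \<beta>_def smooth_step_1)
  qed
  show "\<beta> x = 0" if "x \<notin> cball c (3 * r)" for x
  proof -
    have "(x - c) / r \<le> -3 \<or> 3 \<le> (x - c) / r"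
      using that assms by (auto simp: dist_real_def pos_le_divide_eq pos_divide_le_eq)
    then have "(1/r) * x + (2 - c / r) \<le> -1 \<or> (-1/r) * x + (2 + c / r) \<le> -1"
      by (auto simp: diff_divide_distrib)
    then show ?thesis by (auto simp: \<beta>_def smooth_step_0)
  qed
qed

text \<open>
  The product of the functions \<open>1 - \<beta>\<^sub>i\<close> replaces a partition of unity and needs no normalisation: it
  vanishes near \<open>K\<close>, while \<open>1\<close> minus the product is a combination of terms each of which contains a
  factor \<open>\<beta>\<^sub>i\<close> and therefore lives in one member of the cover.
\<close>

lemma cutoff_cover:
  fixes K :: "real set" and \<U> :: "real set set"
  assumes "compact K" "\<And>U. U \<in> \<U> \<Longrightarrow> open U" "K \<subseteq> \<Union>\<U>"
  obtains F :: "real set" and \<beta> :: "real \<Rightarrow> real \<Rightarrow> complex" and W where "finite F" "open W" "K \<subseteq> W"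
    "\<And>i. i \<in> F \<Longrightarrow> test_function (\<beta> i) \<and> (\<exists>U\<in>\<U>. fun_supp (\<beta> i) \<subseteq> U)"
    "\<And>x. x \<in> W \<Longrightarrow> (\<Prod>i\<in>F. 1 - \<beta> i x) = 0"
proof -
  have "\<exists>r>0. \<exists>U\<in>\<U>. cball c (3 * r) \<subseteq> U" if "c \<in> K" for c
  proof -
    obtain U where U: "U \<in> \<U>" "c \<in> U" using assms(3) \<open>c \<in> K\<close> by auto
    then obtain e where "e > 0" "cball c e \<subseteq> U" using assms(2) open_contains_cball by blast
    then show ?thesis using U by (intro exI[of _ "e / 3"]) auto
  qed
  then obtain r where r: "\<And>c. c \<in> K \<Longrightarrow> r c > 0 \<and> (\<exists>U\<in>\<U>. cball c (3 * r c) \<subseteq> U)" by metis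
  have "K \<subseteq> (\<Union>c\<in>K. ball c (r c))" using r by force
  then obtain F where F: "F \<subseteq> K" "finite F" "K \<subseteq> (\<Union>c\<in>F. ball c (r c))"
    using compactE_image[OF assms(1), of K "\<lambda>c. ball c (r c)"] by (metis open_ball)
  have "\<exists>b. smooth b \<and> (\<forall>x\<in>ball c (r c). b x = 1) \<and> (\<forall>x. x \<notin> cball c (3 * r c) \<longrightarrow> b x = 0)"
    if "c \<in> F" for c
    using local_cutoff[of "r c" c] r F(1) that by (metis subsetD)
  then obtain \<beta> :: "real \<Rightarrow> real \<Rightarrow> complex"
    where \<beta>: "\<And>c. c \<in> F \<Longrightarrow> smooth (\<beta> c)" "\<And>c x. c \<in> F \<Longrightarrow> x \<in> ball c (r c) \<Longrightarrow> \<beta> c x = 1"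
      "\<And>c x. c \<in> F \<Longrightarrow> x \<notin> cball c (3 * r c) \<Longrightarrow> \<beta> c x = 0" by metis
  show thesis
  proof
    show "finite F" by fact
    show "open (\<Union>c\<in>F. ball c (r c))" by blast
    show "K \<subseteq> (\<Union>c\<in>F. ball c (r c))" by fact
    show "(\<Prod>i\<in>F. 1 - \<beta> i x) = 0" if "x \<in> (\<Union>c\<in>F. ball c (r c))" for x
    proof -
      obtain c where "c \<in> F" "x \<in> ball c (r c)" using \<open>x \<in> _\<close> by auto
      then show ?thesis using \<beta>(2) F(2) by (auto simp: prod_zero_iff)
    qed
    show "test_function (\<beta> i) \<and> (\<exists>U\<in>\<U>. fun_supp (\<beta> i) \<subseteq> U)" if "i \<in> F" for i
    proof -
      have s: "fun_supp (\<beta> i) \<subseteq> cball i (3 * r i)"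
        by (rule fun_supp_subsetI) (use \<beta>(3)[OF that] in auto)
      then have "compact (fun_supp (\<beta> i))"
        by (metis closed_fun_supp compact_Int_closed compact_cball inf.absorb_iff2)
      moreover obtain U where "U \<in> \<U>" "cball i (3 * r i) \<subseteq> U" using r F(1) \<open>i \<in> F\<close> by blast
      ultimately show ?thesis using s \<beta>(1)[OF that] unfolding test_function_smooth by blast
    qed
  qed
qed

lemma smooth_prod1: "finite F \<Longrightarrow> (\<And>i. i \<in> F \<Longrightarrow> smooth (\<beta> i)) \<Longrightarrow> smooth (\<lambda>x. \<Prod>i\<in>F. 1 - \<beta> i x)"
proof (induction F rule: finite_induct)
  case (insert i F)
  have "smooth (\<lambda>x. (1 + (- 1) * \<beta> i x) * (\<Prod>i\<in>F. 1 - \<beta> i x))"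
    using insert by (intro smooth_mult smooth_add smooth_const) auto
  then show ?case using insert by simp
qed (simp add: smooth_const)

lemma cutoff:
  assumes "compact K" "open U" "K \<subseteq> U"
  obtains \<zeta> W where "test_function \<zeta>" "fun_supp \<zeta> \<subseteq> U" "open W" "K \<subseteq> W" "\<And>x. x \<in> W \<Longrightarrow> \<zeta> x = 1"
proof -
  have "\<exists>F \<beta> W. finite F \<and> open W \<and> K \<subseteq> W \<and>
      (\<forall>i\<in>F. test_function (\<beta> i) \<and> fun_supp (\<beta> i) \<subseteq> U) \<and>
      (\<forall>x\<in>W. (\<Prod>i\<in>(F::real set). 1 - \<beta> i x) = (0::complex))"
  proof (rule cutoff_cover[OF assms(1), of "{U}"])
    fix F :: "real set" and \<beta> :: "real \<Rightarrow> real \<Rightarrow> complex" and W :: "real set"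
    assume a: "finite F" "open W" "K \<subseteq> W"
      "\<And>i. i \<in> F \<Longrightarrow> test_function (\<beta> i) \<and> (\<exists>U\<in>{U}. fun_supp (\<beta> i) \<subseteq> U)"
      "\<And>x. x \<in> W \<Longrightarrow> (\<Prod>i\<in>F. 1 - \<beta> i x) = 0"
    show ?thesis
      by (rule exI[of _ F], rule exI[of _ \<beta>], rule exI[of _ W]) (use a in blast)
  qed (use assms(2,3) in auto)
  then obtain F :: "real set" and \<beta> W where *: "finite F" "open W" "K \<subseteq> W"
    "\<And>i. i \<in> F \<Longrightarrow> test_function (\<beta> i) \<and> fun_supp (\<beta> i) \<subseteq> U"
    "\<And>x. x \<in> W \<Longrightarrow> (\<Prod>i\<in>F. 1 - \<beta> i x) = (0::complex)"
    by metis
  define \<zeta> where "\<zeta> = (\<lambda>x. 1 + (-1) * (\<Prod>i\<in>F. 1 - \<beta> i x))"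
  have sub: "fun_supp \<zeta> \<subseteq> (\<Union>i\<in>F. fun_supp (\<beta> i))"
  proof (rule fun_supp_subsetI)
    show "closed (\<Union>i\<in>F. fun_supp (\<beta> i))" using *(1) by auto
    show "\<zeta> x = 0" if "x \<notin> (\<Union>i\<in>F. fun_supp (\<beta> i))" for x
      using that by (auto simp: \<zeta>_def fun_supp_outside)
  qed
  have comp: "compact (\<Union>i\<in>F. fun_supp (\<beta> i))"
    using * by (auto simp: test_function_def)
  show thesis
  proof
    show "test_function \<zeta>"
      unfolding test_function_smooth
    proof
      show "smooth \<zeta>" unfolding \<zeta>_def using *
        by (intro smooth_add smooth_mult smooth_const smooth_prod1) (auto simp: test_function_smooth)
      show "compact (fun_supp \<zeta>)"
        using comp sub by (metis closed_fun_supp compact_Int_closed inf.absorb_iff2)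
    qed
    show "fun_supp \<zeta> \<subseteq> U" using sub *(4) by blast
    show "\<zeta> x = 1" if "x \<in> W" for x using *(5)[OF that] by (simp add: \<zeta>_def)
  qed fact+
qed

section \<open>Distributions of finite order\<close>

lemma test_function_zero: "test_function (\<lambda>_. 0)"
  by (simp add: test_function_smooth smooth_const fun_supp_def)

lemma test_function_lincomb:
  assumes "test_function \<phi>" "test_function \<psi>"
  shows "test_function (\<lambda>x. a * \<phi> x + b * \<psi> x)"
proof -
  have "fun_supp (\<lambda>x. a * \<phi> x + b * \<psi> x) \<subseteq> fun_supp \<phi> \<union> fun_supp \<psi>"
    by (rule fun_supp_subsetI) (auto simp: fun_supp_outside)
  moreover have "compact (fun_supp \<phi> \<union> fun_supp \<psi>)"
    using assms by (auto simp: test_function_def)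
  ultimately have "compact (fun_supp (\<lambda>x. a * \<phi> x + b * \<psi> x))"
    by (metis closed_fun_supp compact_Int_closed inf.absorb_iff2)
  then show ?thesis using assms
    by (auto simp: test_function_smooth intro!: smooth_add smooth_mult smooth_const)
qed

lemma distribution_lincomb:
  "distribution T \<Longrightarrow> test_function \<phi> \<Longrightarrow> test_function \<psi> \<Longrightarrow>
    T (\<lambda>x. a * \<phi> x + b * \<psi> x) = a * T \<phi> + b * T \<psi>"
  by (auto simp: distribution_def)

lemma distribution_zero: "distribution T \<Longrightarrow> T (\<lambda>_. 0) = 0"
  using distribution_lincomb[OF _ test_function_zero test_function_zero, of T 0 0] by simp

lemma distribution_diff:
  "distribution T \<Longrightarrow> test_function \<phi> \<Longrightarrow> test_function \<psi> \<Longrightarrow>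
    T (\<lambda>x. \<phi> x - \<psi> x) = T \<phi> - T \<psi>"
  using distribution_lincomb[of T \<phi> \<psi> 1 "-1"] by simp

lemma distribution_sum:
  assumes "distribution T" "finite I" "\<And>i. i \<in> I \<Longrightarrow> test_function (\<phi> i)"
  shows "T (\<lambda>x. \<Sum>i\<in>I. w i * \<phi> i x) = (\<Sum>i\<in>I. w i * T (\<phi> i)) \<and> test_function (\<lambda>x. \<Sum>i\<in>I. w i * \<phi> i x)"
  using assms(2,3)
proof (induction I rule: finite_induct)
  case empty
  then show ?case by (simp add: distribution_zero[OF assms(1)] test_function_zero)
next
  case (insert i I)
  then show ?case
    using distribution_lincomb[OF assms(1), of "\<phi> i" "\<lambda>x. \<Sum>i\<in>I. w i * \<phi> i x" "w i" 1]
      test_function_lincomb[of "\<phi> i" "\<lambda>x. \<Sum>i\<in>I. w i * \<phi> i x" "w i" 1] by simp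
qed

text \<open>
  The support is defined by open sets on which \<open>T\<close> vanishes, so locality has to be glued over a finite
  cover. Multiplying the test function by one factor \<open>1 - \<beta>\<^sub>i\<close> at a time does not change the value of
  \<open>T\<close>, and the full product annihilates the function.
\<close>

lemma distribution_vanish:
  assumes T: "distribution T" and \<phi>: "test_function \<phi>" and disj: "fun_supp \<phi> \<inter> dist_supp T = {}"
  shows "T \<phi> = 0"
proof -
  define \<U> where "\<U> = {U. open U \<and> (\<forall>\<phi>. test_function \<phi> \<and> fun_supp \<phi> \<subseteq> U \<longrightarrow> T \<phi> = 0)}"
  have cov: "fun_supp \<phi> \<subseteq> \<Union>\<U>" using disj unfolding dist_supp_def \<U>_def by blast
  have comp: "compact (fun_supp \<phi>)" using \<phi> by (simp add: test_function_def)
  have opn: "\<And>U. U \<in> \<U> \<Longrightarrow> open U" by (simp add: \<U>_def)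
  show ?thesis
  proof (rule cutoff_cover[OF comp opn cov])
    fix F :: "real set" and \<beta> :: "real \<Rightarrow> real \<Rightarrow> complex" and W :: "real set"
    assume a: "finite F" "open W" "fun_supp \<phi> \<subseteq> W"
      "\<And>i. i \<in> F \<Longrightarrow> test_function (\<beta> i) \<and> (\<exists>U\<in>\<U>. fun_supp (\<beta> i) \<subseteq> U)"
      "\<And>x. x \<in> W \<Longrightarrow> (\<Prod>i\<in>F. 1 - \<beta> i x) = 0"
    have "G \<subseteq> F \<Longrightarrow> T (\<lambda>x. \<phi> x * (\<Prod>i\<in>G. 1 - \<beta> i x)) = T \<phi>" if "finite G" for G
      using that
    proof (induction G rule: finite_induct)
      case (insert i G)
      define P where "P = (\<lambda>x. \<Prod>i\<in>G. 1 - \<beta> i x)"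
      have bi: "test_function (\<beta> i)" using a(4) insert.prems by blast
      obtain U where U: "U \<in> \<U>" "fun_supp (\<beta> i) \<subseteq> U" using a(4) insert.prems by blast
      have P: "smooth P" unfolding P_def
        using a(4) insert by (intro smooth_prod1) (auto simp: test_function_smooth)
      have t1: "test_function (\<lambda>x. \<phi> x * P x)" using \<phi> P by (rule test_function_mult)
      have sm: "smooth (\<lambda>x. \<phi> x * P x)" using t1 by (simp add: test_function_smooth)
      have t2: "test_function (\<lambda>x. \<beta> i x * (\<phi> x * P x))" using bi sm by (rule test_function_mult)
      have "fun_supp (\<lambda>x. \<beta> i x * (\<phi> x * P x)) \<subseteq> U"
        using test_function_mult(2)[OF bi sm] U(2) by blast
      then have z: "T (\<lambda>x. \<beta> i x * (\<phi> x * P x)) = 0" using t2 U(1) by (auto simp: \<U>_def)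
      have "T (\<lambda>x. \<phi> x * (\<Prod>i\<in>insert i G. 1 - \<beta> i x)) = T (\<lambda>x. \<phi> x * P x - \<beta> i x * (\<phi> x * P x))"
        using insert by (simp add: P_def algebra_simps)
      also have "\<dots> = T (\<lambda>x. \<phi> x * P x)" using distribution_diff[OF T t1 t2] z by simp
      also have "\<dots> = T \<phi>" using insert by (simp add: P_def)
      finally show ?case .
    qed simp
    from this[OF a(1)] have "T \<phi> = T (\<lambda>x. \<phi> x * (\<Prod>i\<in>F. 1 - \<beta> i x))" by simp
    also have "(\<lambda>x. \<phi> x * (\<Prod>i\<in>F. 1 - \<beta> i x)) = (\<lambda>_. 0)"
    proof
      fix x show "\<phi> x * (\<Prod>i\<in>F. 1 - \<beta> i x) = 0"
        using a(3) a(5)[of x] fun_supp_outside[of x \<phi>] by auto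
    qed
    finally show "T \<phi> = 0" using distribution_zero[OF T] by simp
  qed
qed

lemma test_function_bounded:
  assumes "test_function \<phi>" obtains c where "c \<ge> 0" "\<And>x. norm (\<phi> x) \<le> c"
proof -
  have "compact (\<phi> ` fun_supp \<phi>)"
    using assms smooth_continuous[of \<phi> "fun_supp \<phi>" 0]
    by (intro compact_continuous_image) (auto simp: test_function_smooth)
  then obtain c where c: "c > 0" "\<And>x. x \<in> fun_supp \<phi> \<Longrightarrow> norm (\<phi> x) \<le> c"
    using compact_imp_bounded bounded_pos by (metis imageI)
  have "norm (\<phi> x) \<le> c" for x
    using c fun_supp_outside[of x \<phi>] by (cases "x \<in> fun_supp \<phi>") auto
  with c(1) show ?thesis using that by (metis less_imp_le)
qed

text \<open>
  By induction on the order, from \<open>(\<zeta> \<psi>)' = \<zeta> \<psi>' + \<zeta>' \<psi>\<close>. Derivatives of \<open>\<psi>\<close> matter only on the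
  support of the cutoff, which is what makes estimates on a neighbourhood sufficient later.
\<close>

lemma leibniz_bound:
  assumes "test_function \<zeta>"
  shows "\<exists>c\<ge>0. \<forall>\<psi> B. smooth \<psi> \<longrightarrow> 0 \<le> B \<longrightarrow>
    (\<forall>i\<le>k. \<forall>x\<in>fun_supp \<zeta>. norm (nderiv i \<psi> x) \<le> B) \<longrightarrow>
    (\<forall>i\<le>k. \<forall>x. norm (nderiv i (\<lambda>x. \<zeta> x * \<psi> x) x) \<le> c * B)"
  using assms
proof (induction k arbitrary: \<zeta>)
  case 0
  obtain c where c: "c \<ge> 0" "\<And>x. norm (\<zeta> x) \<le> c" using test_function_bounded[OF 0] by blast
  show ?case
  proof (rule exI[of _ c], intro conjI allI impI)
    fix \<psi> :: "real \<Rightarrow> complex" and B i x assume a: "0 \<le> B" "\<forall>i\<le>0. \<forall>x\<in>fun_supp \<zeta>. norm (nderiv i \<psi> x) \<le> B" "i \<le> (0::nat)"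
    show "norm (nderiv i (\<lambda>x. \<zeta> x * \<psi> x) x) \<le> c * B"
    proof (cases "x \<in> fun_supp \<zeta>")
      case True
      then show ?thesis using a c by (simp add: norm_mult mult_mono)
    next
      case False
      then show ?thesis using a c by (simp add: fun_supp_outside)
    qed
  qed (rule c)
next
  case (Suc k)
  obtain c where c: "c \<ge> 0" "\<And>x. norm (\<zeta> x) \<le> c" using test_function_bounded[OF Suc.prems] by blast
  obtain c1 where c1: "c1 \<ge> 0" "\<And>\<psi> B i x. smooth \<psi> \<Longrightarrow> 0 \<le> B \<Longrightarrow>
     (\<forall>i\<le>k. \<forall>x\<in>fun_supp (nderiv (Suc 0) \<zeta>). norm (nderiv i \<psi> x) \<le> B) \<Longrightarrow> i \<le> k \<Longrightarrow>
      norm (nderiv i (\<lambda>x. nderiv (Suc 0) \<zeta> x * \<psi> x) x) \<le> c1 * B"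
    using Suc.IH[OF test_function_nderiv[OF Suc.prems, of "Suc 0"]] by metis
  obtain c2 where c2: "c2 \<ge> 0" "\<And>\<psi> B i x. smooth \<psi> \<Longrightarrow> 0 \<le> B \<Longrightarrow>
     (\<forall>i\<le>k. \<forall>x\<in>fun_supp \<zeta>. norm (nderiv i \<psi> x) \<le> B) \<Longrightarrow> i \<le> k \<Longrightarrow>
      norm (nderiv i (\<lambda>x. \<zeta> x * \<psi> x) x) \<le> c2 * B"
    using Suc.IH[OF Suc.prems] by metis
  have sz: "smooth \<zeta>" using Suc.prems by (simp add: test_function_smooth)
  show ?case
  proof (rule exI[of _ "c + c1 + c2"], intro conjI allI impI)
    fix \<psi> B i x assume a: "smooth \<psi>" "0 \<le> B" "i \<le> Suc k"
      "\<forall>i\<le>Suc k. \<forall>x\<in>fun_supp \<zeta>. norm (nderiv i \<psi> x) \<le> B"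
    have nn: "0 \<le> c * B" "0 \<le> c1 * B" "0 \<le> c2 * B" using a(2) c c1 c2 by auto
    show "norm (nderiv i (\<lambda>x. \<zeta> x * \<psi> x) x) \<le> (c + c1 + c2) * B"
    proof (cases i)
      case 0
      have "norm (\<zeta> x * \<psi> x) \<le> c * B"
      proof (cases "x \<in> fun_supp \<zeta>")
        case True
        then have "norm (\<psi> x) \<le> B" using a(4)[rule_format, of 0 x] by simp
        then show ?thesis using a c by (simp add: norm_mult mult_mono)
      qed (use nn in \<open>simp add: fun_supp_outside\<close>)
      then show ?thesis using 0 nn by (simp add: algebra_simps)
    next
      case (Suc j)
      have j: "j \<le> k" using Suc a(3) by simp
      have "nderiv (Suc j) (\<lambda>x. \<zeta> x * \<psi> x) x =
          nderiv j (\<lambda>x. \<zeta> x * nderiv (Suc 0) \<psi> x + nderiv (Suc 0) \<zeta> x * \<psi> x) x"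
        by (rule nderiv_SucI[of UNIV])
           (auto intro!: has_vector_derivative_mult smooth_has_deriv sz a)
      also have "\<dots> = nderiv j (\<lambda>x. \<zeta> x * nderiv (Suc 0) \<psi> x) x + nderiv j (\<lambda>x. nderiv (Suc 0) \<zeta> x * \<psi> x) x"
        by (rule nderiv_add[of UNIV j])
           (use sz a smooth_mult[OF sz smooth_deriv[OF a(1)]] smooth_mult[OF smooth_deriv[OF sz] a(1)]
             in \<open>auto simp: smooth_def\<close>)
      finally have e: "nderiv i (\<lambda>x. \<zeta> x * \<psi> x) x = \<dots>" using Suc by simp
      have "norm (nderiv j (\<lambda>x. \<zeta> x * nderiv (Suc 0) \<psi> x) x) \<le> c2 * B"
      proof (rule c2(2)[OF smooth_deriv[OF a(1)] a(2) _ j], intro allI impI ballI)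
        fix i x assume "i \<le> k" "x \<in> fun_supp \<zeta>"
        then have "norm (nderiv (Suc i) \<psi> x) \<le> B" using a(4) by simp
        then show "norm (nderiv i (nderiv (Suc 0) \<psi>) x) \<le> B" by (simp add: nderiv_Suc)
      qed
      moreover have "norm (nderiv j (\<lambda>x. nderiv (Suc 0) \<zeta> x * \<psi> x) x) \<le> c1 * B"
        by (rule c1(2)[OF a(1,2) _ j]) (use a(4) fun_supp_nderiv[of "Suc 0" \<zeta>] in force)
      ultimately show ?thesis unfolding e using nn by (intro norm_triangle_le) (simp add: algebra_simps)
    qed
  qed (use c c1 c2 in auto)
qed

text \<open>
  Continuity in \<open>C\<^sup>k\<close> near the support of a cutoff: every passage to a limit under a distribution goes
  through this estimate.
\<close>

lemma distribution_estimate: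
  assumes "Ck_bounded k (fun_supp \<zeta>) T" and \<zeta>: "test_function \<zeta>"
  shows "\<exists>C\<ge>0. \<forall>\<psi> B. smooth \<psi> \<longrightarrow> 0 \<le> B \<longrightarrow>
    (\<forall>i\<le>k. \<forall>x\<in>fun_supp \<zeta>. norm (nderiv i \<psi> x) \<le> B) \<longrightarrow>
    norm (T (\<lambda>x. \<zeta> x * \<psi> x)) \<le> C * B"
proof -
  obtain c where c: "\<And>\<phi>. test_function \<phi> \<and> fun_supp \<phi> \<subseteq> fun_supp \<zeta> \<Longrightarrow>
      norm (T \<phi>) \<le> c * (\<Sum>j\<le>k. SUP x. norm (nderiv j \<phi> x))"
    using assms(1) unfolding Ck_bounded_def by blast
  obtain c1 where c1: "c1 \<ge> 0" "\<And>\<psi> B i x. smooth \<psi> \<Longrightarrow> 0 \<le> B \<Longrightarrow>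
     (\<forall>i\<le>k. \<forall>x\<in>fun_supp \<zeta>. norm (nderiv i \<psi> x) \<le> B) \<Longrightarrow> i \<le> k \<Longrightarrow>
      norm (nderiv i (\<lambda>x. \<zeta> x * \<psi> x) x) \<le> c1 * B"
    using leibniz_bound[OF \<zeta>, of k] by metis
  show ?thesis
  proof (rule exI[of _ "\<bar>c\<bar> * (real (Suc k) * c1)"], intro conjI allI impI)
    show "0 \<le> \<bar>c\<bar> * (real (Suc k) * c1)" using c1 by simp
    fix \<psi> B assume a: "smooth \<psi>" "0 \<le> B"
      "\<forall>i\<le>k. \<forall>x\<in>fun_supp \<zeta>. norm (nderiv i \<psi> x) \<le> B"
    let ?f = "\<lambda>x. \<zeta> x * \<psi> x"
    have b: "norm (nderiv i ?f x) \<le> c1 * B" if "i \<le> k" for i x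
      by (rule c1(2)) (use a that in auto)
    have s1: "(SUP x. norm (nderiv i ?f x)) \<le> c1 * B" if "i \<le> k" for i
      by (rule cSUP_least) (use b[OF that] in auto)
    have s0: "0 \<le> (SUP x. norm (nderiv i ?f x))" if "i \<le> k" for i
      by (rule cSUP_upper2[of _ _ _ 0]) (use b[OF that] in \<open>auto intro!: bdd_aboveI2\<close>)
    have "norm (T ?f) \<le> c * (\<Sum>j\<le>k. SUP x. norm (nderiv j ?f x))"
      by (rule c) (use test_function_mult[OF \<zeta> a(1)] in blast)
    also have "\<dots> \<le> \<bar>c\<bar> * (\<Sum>j\<le>k. SUP x. norm (nderiv j ?f x))"
      by (intro mult_right_mono sum_nonneg) (use s0 in auto)
    also have "(\<Sum>j\<le>k. SUP x. norm (nderiv j ?f x)) \<le> (\<Sum>j\<le>k. c1 * B)"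
      by (intro sum_mono) (use s1 in auto)
    finally have "norm (T ?f) \<le> \<bar>c\<bar> * (\<Sum>j\<le>k. c1 * B)"
      by (simp add: mult_left_mono)
    then show "norm (T ?f) \<le> \<bar>c\<bar> * (real (Suc k) * c1) * B"
      by (simp add: algebra_simps)
  qed
qed

text \<open>
  Everything that the definition of \<open>dist_apply\<close> asks of the neighbourhood \<open>U\<close> and of the sequence \<open>\<phi>\<close>,
  apart from the convergence of the values.
\<close>

definition Ck_approx :: "distr_functional \<Rightarrow> nat \<Rightarrow> (real \<Rightarrow> complex) \<Rightarrow> real set \<Rightarrow> (nat \<Rightarrow> real \<Rightarrow> complex) \<Rightarrow> bool" where
  "Ck_approx T k g U \<phi> \<longleftrightarrow> open U \<and> dist_supp T \<subseteq> U \<and> Ck_on k U g \<and> (\<forall>m. test_function (\<phi> m)) \<and>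
    (\<forall>j\<le>k. uniform_limit U (\<lambda>m. nderiv j (\<phi> m)) (nderiv j g) sequentially)"

text \<open>
  Two approximating sequences may live on different neighbourhoods of the support, and their
  difference is small only on the intersection. A cutoff supported there changes it by a function
  that vanishes near the support of \<open>T\<close>, hence not its value under \<open>T\<close>.
\<close>

lemma Ck_approx_diff_tendsto_0:
  assumes T: "distribution T" "compact (dist_supp T)" "has_order T k"
    and a: "Ck_approx T k g U \<phi>" and b: "Ck_approx T k g V \<psi>"
  shows "(\<lambda>m. T (\<phi> m) - T (\<psi> m)) \<longlonglongrightarrow> 0"
proof -
  have op: "open (U \<inter> V)" "dist_supp T \<subseteq> U \<inter> V" using a b by (auto simp: Ck_approx_def)
  obtain \<zeta> W where z: "test_function \<zeta>" "fun_supp \<zeta> \<subseteq> U \<inter> V" "open W" "dist_supp T \<subseteq> W"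
      "\<And>x. x \<in> W \<Longrightarrow> \<zeta> x = 1"
    using cutoff[OF T(2) op] by blast
  have Cb: "Ck_bounded k (fun_supp \<zeta>) T" using T(3) z(1) by (auto simp: has_order_def test_function_def)
  obtain C where C: "C \<ge> 0" "\<And>\<psi> B. smooth \<psi> \<Longrightarrow> 0 \<le> B \<Longrightarrow>
    (\<forall>i\<le>k. \<forall>x\<in>fun_supp \<zeta>. norm (nderiv i \<psi> x) \<le> B) \<Longrightarrow>
    norm (T (\<lambda>x. \<zeta> x * \<psi> x)) \<le> C * B"
    using distribution_estimate[OF Cb z(1)] by blast
  define d where "d = (\<lambda>m x. \<phi> m x - \<psi> m x)"
  have t: "test_function (\<phi> m)" "test_function (\<psi> m)" for m using a b by (auto simp: Ck_approx_def)
  have td: "test_function (d m)" for m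
    using test_function_lincomb[OF t[of m], of 1 "-1"] by (simp add: d_def)
  then have sd: "smooth (d m)" for m by (simp add: test_function_smooth)
  have eq: "T (\<phi> m) - T (\<psi> m) = T (\<lambda>x. \<zeta> x * d m x)" for m
  proof -
    have t2: "test_function (\<lambda>x. \<zeta> x * d m x)" by (rule test_function_mult[OF z(1) sd])
    have t3: "test_function (\<lambda>x. d m x - \<zeta> x * d m x)"
      using test_function_lincomb[OF td[of m] t2, of 1 "-1"] by simp
    have "fun_supp (\<lambda>x. d m x - \<zeta> x * d m x) \<subseteq> - W"
      by (rule fun_supp_subsetI) (use z in \<open>auto simp: closed_Compl\<close>)
    then have "T (\<lambda>x. d m x - \<zeta> x * d m x) = 0"
      using z(4) by (intro distribution_vanish[OF T(1) t3]) auto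
    then show ?thesis using distribution_diff[OF T(1) td t2] distribution_diff[OF T(1) t] by (simp add: d_def)
  qed
  have nd: "nderiv i (d m) x = nderiv i (\<phi> m) x - nderiv i (\<psi> m) x" for i m x
    unfolding d_def using t by (intro nderiv_diff_smooth) (auto simp: test_function_smooth)
  show ?thesis unfolding eq
  proof (rule LIMSEQ_I)
    fix e :: real assume e: "e > 0"
    \<comment> \<open>\<open>C + 1\<close> instead of \<open>C\<close>, which may be 0\<close>
    define B where "B = e / 2 / (C + 1)"
    have B0: "B > 0" using e C(1) by (simp add: B_def)
    have "C * B \<le> (C + 1) * B" using B0 by (simp add: algebra_simps)
    also have "\<dots> = e / 2"
    proof -
      have "q * (e / 2 / q) = e / 2" if "q \<noteq> 0" for q :: real using that by simp
      from this[of "C + 1"] show ?thesis using C(1) unfolding B_def by linarith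
    qed
    also have "\<dots> < e" using e by simp
    finally have B: "B > 0" "C * B < e" using B0 by auto
    have "\<forall>i\<in>{..k}. \<forall>\<^sub>F m in sequentially. \<forall>x\<in>U \<inter> V. norm (nderiv i (d m) x) \<le> B"
    proof
      fix i assume i: "i \<in> {..k}"
      have "uniform_limit U (\<lambda>m. nderiv i (\<phi> m)) (nderiv i g) sequentially"
        "uniform_limit V (\<lambda>m. nderiv i (\<psi> m)) (nderiv i g) sequentially"
        using a b i by (auto simp: Ck_approx_def)
      then have "uniform_limit (U \<inter> V) (\<lambda>m x. nderiv i (\<phi> m) x - nderiv i (\<psi> m) x)
          (\<lambda>x. nderiv i g x - nderiv i g x) sequentially"
        by (intro uniform_limit_minus) (auto intro: uniform_limit_on_subset)
      from uniform_limitD[OF this B(1)]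
      show "\<forall>\<^sub>F m in sequentially. \<forall>x\<in>U \<inter> V. norm (nderiv i (d m) x) \<le> B"
        by (rule eventually_mono) (auto simp: nd dist_norm less_imp_le)
    qed
    then have "\<forall>\<^sub>F m in sequentially. \<forall>i\<in>{..k}. \<forall>x\<in>U \<inter> V. norm (nderiv i (d m) x) \<le> B"
      by (intro eventually_ball_finite) auto
    then have "\<forall>\<^sub>F m in sequentially. norm (T (\<lambda>x. \<zeta> x * d m x)) \<le> C * B"
    proof (rule eventually_mono)
      fix m assume "\<forall>i\<in>{..k}. \<forall>x\<in>U \<inter> V. norm (nderiv i (d m) x) \<le> B"
      then show "norm (T (\<lambda>x. \<zeta> x * d m x)) \<le> C * B"
        using z(2) B(1) by (intro C(2)[OF sd]) auto
    qed
    then show "\<exists>no. \<forall>n\<ge>no. norm (T (\<lambda>x. \<zeta> x * d n x) - 0) < e"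
      using B(2) by (auto simp: eventually_sequentially intro: le_less_trans)
  qed
qed

lemma dist_apply_eq:
  assumes T: "distribution T" "compact (dist_supp T)" "has_order T k"
    and a: "Ck_approx T k g U \<phi>" and lim: "(\<lambda>m. T (\<phi> m)) \<longlonglongrightarrow> v"
  shows "dist_apply T k g = v"
  unfolding dist_apply_def
proof (rule the_equality)
  show "\<exists>U \<phi>. open U \<and> dist_supp T \<subseteq> U \<and> Ck_on k U g \<and> (\<forall>m. test_function (\<phi> m)) \<and>
      (\<forall>j\<le>k. uniform_limit U (\<lambda>m. nderiv j (\<phi> m)) (nderiv j g) sequentially) \<and> (\<lambda>m. T (\<phi> m)) \<longlonglongrightarrow> v"
    using a lim unfolding Ck_approx_def by blast
  fix w assume "\<exists>U \<phi>. open U \<and> dist_supp T \<subseteq> U \<and> Ck_on k U g \<and> (\<forall>m. test_function (\<phi> m)) \<and>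
      (\<forall>j\<le>k. uniform_limit U (\<lambda>m. nderiv j (\<phi> m)) (nderiv j g) sequentially) \<and> (\<lambda>m. T (\<phi> m)) \<longlonglongrightarrow> w"
  then obtain V \<psi> where b: "Ck_approx T k g V \<psi>" and lw: "(\<lambda>m. T (\<psi> m)) \<longlonglongrightarrow> w"
    unfolding Ck_approx_def by blast
  have "(\<lambda>m. T (\<phi> m) - T (\<psi> m)) \<longlonglongrightarrow> v - w" by (intro tendsto_diff lim lw)
  from LIMSEQ_unique[OF this Ck_approx_diff_tendsto_0[OF T a b]] show "w = v" by simp
qed

text \<open>
  The constant sequence \<open>\<zeta> g\<close> approximates \<open>g\<close> on the set where the cutoff \<open>\<zeta>\<close> is 1.
\<close>

lemma dist_apply_smooth:
  assumes T: "distribution T" "compact (dist_supp T)" "has_order T k"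
    and g: "smooth g" and z: "test_function \<zeta>" "open W" "dist_supp T \<subseteq> W" "\<And>x. x \<in> W \<Longrightarrow> \<zeta> x = 1"
  shows "dist_apply T k g = T (\<lambda>x. \<zeta> x * g x)"
proof (rule dist_apply_eq[OF T])
  show "Ck_approx T k g W (\<lambda>m x. \<zeta> x * g x)"
    unfolding Ck_approx_def
  proof (intro conjI allI impI)
    show "Ck_on k W g" using g by (auto simp: smooth_def intro: Ck_on_subset)
    show "test_function (\<lambda>x. \<zeta> x * g x)" by (rule test_function_mult[OF z(1) g])
    fix j
    have "nderiv j (\<lambda>x. \<zeta> x * g x) x = nderiv j g x" if "x \<in> W" for x
      by (rule nderiv_cong_open[OF z(2) _ that]) (simp add: z(4))
    then show "uniform_limit W (\<lambda>m. nderiv j (\<lambda>x. \<zeta> x * g x)) (nderiv j g) sequentially"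
      by (auto simp: uniform_limit_iff)
  qed fact+
qed simp

section \<open>Differentiation of Fourier integrals\<close>

lemma norm_iexp [simp]: "norm (iexp a) = 1"
  by simp

lemma iexp_diff_le: "norm (iexp a - iexp b) \<le> \<bar>a - b\<bar>"
proof -
  have e: "iexp a = iexp b * iexp (a - b)"
    by (simp add: exp_add[symmetric] algebra_simps)
  have "iexp a - iexp b = iexp b * (iexp (a - b) - 1)"
    unfolding e by (simp add: algebra_simps)
  then have "norm (iexp a - iexp b) = norm (iexp (a - b) - 1)" by (simp add: norm_mult)
  also have "\<dots> \<le> \<bar>a - b\<bar>" using iexp_approx1[of "a - b" 0] by simp
  finally show ?thesis .
qed

lemma iexp_measurable [measurable]: "f \<in> borel_measurable M \<Longrightarrow> (\<lambda>x. iexp (f x)) \<in> borel_measurable M"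
  by (rule measurable_compose[of f M borel iexp])
     (auto intro!: borel_measurable_continuous_onI continuous_intros)

lemma integrable_iexp_mult:
  fixes w :: "'a \<Rightarrow> complex"
  assumes "integrable N w" "f \<in> borel_measurable N"
  shows "integrable N (\<lambda>x. iexp (f x) * w x)"
proof (rule Bochner_Integration.integrable_bound[OF assms(1)])
  have "w \<in> borel_measurable N" using assms(1) by simp
  then show "(\<lambda>x. iexp (f x) * w x) \<in> borel_measurable N" using assms(2) by measurable
qed (auto simp: norm_mult)

lemma has_vector_derivative_iff_quotient:
  fixes f :: "real \<Rightarrow> 'b::real_normed_vector"
  shows "(f has_vector_derivative D) (at u) \<longleftrightarrow> ((\<lambda>h. (f (u + h) - f u) /\<^sub>R h) \<longlongrightarrow> D) (at 0)"
proof -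
  have "\<forall>\<^sub>F h in at 0. norm (f (u + h) - f u - h *\<^sub>R D) / norm h = norm ((f (u + h) - f u) /\<^sub>R h - D)"
    unfolding eventually_at_filter
  proof (intro always_eventually allI impI)
    fix h :: real assume "h \<noteq> 0"
    then have "(f (u + h) - f u) /\<^sub>R h - D = (f (u + h) - f u - h *\<^sub>R D) /\<^sub>R h"
      by (simp only: scaleR_diff_right scaleR_scaleR) simp
    then show "norm (f (u + h) - f u - h *\<^sub>R D) / norm h = norm ((f (u + h) - f u) /\<^sub>R h - D)"
      by (simp only: norm_scaleR) (simp add: divide_inverse)
  qed
  then have "((\<lambda>h. norm (f (u + h) - f u - h *\<^sub>R D) / norm h) \<longlongrightarrow> 0) (at 0) \<longleftrightarrow>
      ((\<lambda>h. norm ((f (u + h) - f u) /\<^sub>R h - D)) \<longlongrightarrow> 0) (at 0)"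
    by (rule tendsto_cong)
  then show ?thesis
    unfolding has_vector_derivative_def has_derivative_at tendsto_norm_zero_iff Lim_null[symmetric]
    by (simp add: bounded_linear_scaleR_left)
qed

lemma iexp_has_vector_derivative:
  "((\<lambda>x. iexp (v * x)) has_vector_derivative \<i> * v * iexp (v * x)) (at x)"
proof -
  have "((iexp \<circ> (\<lambda>x. v * x)) has_vector_derivative v *\<^sub>R (\<i> * iexp (v * x))) (at x)"
    by (rule vector_diff_chain_at) (auto intro!: derivative_eq_intros)
  then show ?thesis by (simp add: o_def scaleR_conv_of_real algebra_simps)
qed

text \<open>
  Dominated convergence, the difference quotients being at most \<open>|x w(x)|\<close>. The constant \<open>c\<close> is 0 for
  Fourier transforms of finite measures and 1 for the exponent \<open>\<Psi>\<close>, whose measure may be infinite.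
\<close>

lemma fourier_integral_deriv:
  fixes w :: "real \<Rightarrow> complex"
  assumes N: "sets N = sets borel"
    and i: "\<And>u. integrable N (\<lambda>x. (iexp (u * x) - c) * w x)"
    and i1: "integrable N (\<lambda>x. complex_of_real x * w x)" and w[measurable]: "w \<in> borel_measurable borel"
  shows "((\<lambda>u. \<integral>x. (iexp (u * x) - c) * w x \<partial>N) has_vector_derivative
     (\<integral>x. iexp (u * x) * (\<i> * x * w x) \<partial>N)) (at u)"
  unfolding has_vector_derivative_iff_quotient tendsto_at_iff_sequentially o_def
proof (intro allI impI)
  note [measurable_cong] = N
  fix X :: "nat \<Rightarrow> real" assume X: "\<forall>i. X i \<in> UNIV - {0}" "X \<longlonglongrightarrow> 0"
  let ?F = "\<lambda>u. \<integral>x. (iexp (u * x) - c) * w x \<partial>N"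
  let ?D = "\<integral>x. iexp (u * x) * (\<i> * x * w x) \<partial>N"
  have "(?F (u + X n) - ?F u) /\<^sub>R X n = (\<integral>x. (iexp ((u + X n) * x) - iexp (u * x)) /\<^sub>R X n * w x \<partial>N)" for n
    by (subst Bochner_Integration.integral_diff[symmetric, OF i i])
       (auto simp flip: integral_scaleR_right intro!: Bochner_Integration.integral_cong simp: algebra_simps)
  moreover have "(\<lambda>n. \<integral>x. (iexp ((u + X n) * x) - iexp (u * x)) /\<^sub>R X n * w x \<partial>N) \<longlonglongrightarrow> ?D"
  proof (rule integral_dominated_convergence[where w = "\<lambda>x. norm (complex_of_real x * w x)"])
    show "(\<lambda>x. iexp (u * x) * (\<i> * complex_of_real x * w x)) \<in> borel_measurable N" by measurable
    show "(\<lambda>x. (iexp ((u + X n) * x) - iexp (u * x)) /\<^sub>R X n * w x) \<in> borel_measurable N" for n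
      by measurable
    show "integrable N (\<lambda>x. norm (complex_of_real x * w x))" using i1 by simp
    show "AE x in N. norm ((iexp ((u + X n) * x) - iexp (u * x)) /\<^sub>R X n * w x) \<le> norm (complex_of_real x * w x)" for n
    proof (rule AE_I2)
      fix x
      have "norm (z /\<^sub>R c) \<le> \<bar>x\<bar>" if "norm z \<le> \<bar>c * x\<bar>" "c \<noteq> 0" for z :: complex and c
        using that by (simp add: abs_mult field_simps)
      moreover have "norm (iexp ((u + X n) * x) - iexp (u * x)) \<le> \<bar>X n * x\<bar>"
        using iexp_diff_le[of "(u + X n) * x" "u * x"] by (simp add: algebra_simps)
      ultimately have "norm ((iexp ((u + X n) * x) - iexp (u * x)) /\<^sub>R X n) \<le> \<bar>x\<bar>" using X(1) by blast
      then show "norm ((iexp ((u + X n) * x) - iexp (u * x)) /\<^sub>R X n * w x) \<le> norm (complex_of_real x * w x)"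
        unfolding norm_mult by (intro mult_right_mono) auto
    qed
    show "AE x in N. (\<lambda>n. (iexp ((u + X n) * x) - iexp (u * x)) /\<^sub>R X n * w x) \<longlonglongrightarrow> iexp (u * x) * (\<i> * complex_of_real x * w x)"
    proof (rule AE_I2)
      fix x
      have "((\<lambda>v. iexp (v * x)) has_vector_derivative \<i> * x * iexp (x * u)) (at u)"
        using iexp_has_vector_derivative[of x u] by (simp only: mult.commute[of x])
      then have "(\<lambda>n. (iexp ((u + X n) * x) - iexp (u * x)) /\<^sub>R X n) \<longlonglongrightarrow> \<i> * x * iexp (x * u)"
        using X unfolding has_vector_derivative_iff_quotient tendsto_at_iff_sequentially o_def by blast
      then have "(\<lambda>n. (iexp ((u + X n) * x) - iexp (u * x)) /\<^sub>R X n * w x) \<longlonglongrightarrow> \<i> * x * iexp (x * u) * w x"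
        by (intro tendsto_mult tendsto_const)
      then show "(\<lambda>n. (iexp ((u + X n) * x) - iexp (u * x)) /\<^sub>R X n * w x) \<longlonglongrightarrow> iexp (u * x) * (\<i> * complex_of_real x * w x)"
        by (simp add: ac_simps)
    qed
  qed
  ultimately show "(\<lambda>n. (?F (u + X n) - ?F u) /\<^sub>R X n) \<longlonglongrightarrow> ?D" by (simp only:)
qed

lemma integrable_ix:
  assumes "integrable N (\<lambda>x. x)" shows "integrable N (\<lambda>x. \<i> * complex_of_real x)"
  by (intro integrable_mult_right) (use assms in simp)

lemma integrable_ix2:
  assumes "integrable N (\<lambda>x. x\<^sup>2)" shows "integrable N (\<lambda>x. \<i> * complex_of_real x * (\<i> * x))"
proof -
  have "integrable N (\<lambda>x. - complex_of_real (x\<^sup>2))"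
    by (intro Bochner_Integration.integrable_minus integrable_of_real assms)
  moreover have "\<i> * complex_of_real x * (\<i> * x) = - complex_of_real (x\<^sup>2)" for x
    by (simp add: power2_eq_square algebra_simps flip: of_real_mult)
  ultimately show ?thesis by simp
qed

lemma fourier_integral_second_deriv:
  assumes N[measurable_cong]: "sets N = sets borel"
    and i: "integrable N (\<lambda>x. x)" "integrable N (\<lambda>x. x\<^sup>2)"
  shows "((\<lambda>u. \<integral>x. iexp (u * x) * (\<i> * x) \<partial>N) has_vector_derivative
     (\<integral>x. iexp (u * x) * (\<i> * x * (\<i> * x)) \<partial>N)) (at u)"
proof -
  have "((\<lambda>u. \<integral>x. (iexp (u * x) - 0) * (\<i> * x) \<partial>N) has_vector_derivative
     (\<integral>x. iexp (u * x) * (\<i> * x * (\<i> * x)) \<partial>N)) (at u)"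
  proof (rule fourier_integral_deriv[OF N])
    show "integrable N (\<lambda>x. (iexp (v * x) - 0) * (\<i> * complex_of_real x))" for v
    proof -
      have "(\<lambda>x. v * x) \<in> borel_measurable N" by measurable
      from integrable_iexp_mult[OF integrable_ix[OF i(1)] this] show ?thesis by simp
    qed
    have "integrable N (\<lambda>x. (- \<i>) * (\<i> * complex_of_real x * (\<i> * x)))"
      by (intro integrable_mult_right integrable_ix2 i)
    then show "integrable N (\<lambda>x. complex_of_real x * (\<i> * complex_of_real x))" by (simp add: mult.assoc)
  qed auto
  then show ?thesis by simp
qed

lemma fourier_integral_isCont:
  fixes w :: "real \<Rightarrow> complex"
  assumes N: "sets N = sets borel" and w: "integrable N w"
  shows "isCont (\<lambda>u. \<integral>x. iexp (u * x) * w x \<partial>N) u"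
  unfolding continuous_at_sequentially o_def
proof (intro allI impI)
  note [measurable_cong] = N
  have [measurable]: "w \<in> borel_measurable N" using w by simp
  fix X assume X: "X \<longlonglongrightarrow> u"
  show "(\<lambda>n. \<integral>x. iexp (X n * x) * w x \<partial>N) \<longlonglongrightarrow> (\<integral>x. iexp (u * x) * w x \<partial>N)"
  proof (rule integral_dominated_convergence[where w = "\<lambda>x. norm (w x)"])
    show "AE x in N. (\<lambda>n. iexp (X n * x) * w x) \<longlonglongrightarrow> iexp (u * x) * w x"
      using X by (auto intro!: tendsto_intros)
  qed (use w in \<open>auto simp: norm_mult\<close>)
qed

lemma iexp_scaled_has_vector_derivative:
  "((\<lambda>x. c * iexp (v * x)) has_vector_derivative c * (\<i> * v) * iexp (v * x)) (at x)"
  using has_vector_derivative_mult_right[OF iexp_has_vector_derivative] by (simp add: mult.assoc)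

lemma nderiv_iexp: "nderiv j (\<lambda>x. c * iexp (v * x)) x = c * (\<i> * v) ^ j * iexp (v * x)"
proof (induction j arbitrary: c)
  case (Suc j)
  have "nderiv (Suc j) (\<lambda>x. c * iexp (v * x)) x = nderiv j (\<lambda>x. c * (\<i> * v) * iexp (v * x)) x"
    by (rule nderiv_SucI[of UNIV]) (use iexp_scaled_has_vector_derivative in auto)
  also have "\<dots> = c * (\<i> * v) * (\<i> * v) ^ j * iexp (v * x)" by (rule Suc.IH)
  finally show ?case by simp
qed simp

lemma smooth_iexp: "smooth (\<lambda>x. iexp (v * x))"
proof -
  have "Ck_on k UNIV (\<lambda>x. c * iexp (v * x))" for k c
  proof (induction k arbitrary: c)
    case 0 then show ?case by (auto simp: Ck_on_0 intro!: continuous_intros)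
  next
    case (Suc k)
    show ?case by (rule Ck_on_SucI[OF _ iexp_scaled_has_vector_derivative Suc.IH]) auto
  qed
  from this[of _ 1] show ?thesis by (simp add: smooth_def)
qed

lemma fourier_moment_deriv:
  fixes W :: "real \<Rightarrow> complex"
  assumes W: "\<And>j. integrable lborel (\<lambda>u. complex_of_real u ^ j * W u)"
  shows "((\<lambda>x. \<integral>u. iexp (x * u) * ((\<i> * u) ^ j * W u) \<partial>lborel) has_vector_derivative
          (\<integral>u. iexp (x * u) * ((\<i> * u) ^ Suc j * W u) \<partial>lborel)) (at x)"
proof -
  have [measurable]: "W \<in> borel_measurable borel"
    using W[of 0] by simp
  have Wj: "integrable lborel (\<lambda>u. (\<i> * complex_of_real u) ^ j * W u)" for j
  proof -
    have "integrable lborel (\<lambda>u. \<i> ^ j * (complex_of_real u ^ j * W u))" by (rule integrable_mult_right) (rule W)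
    then show ?thesis by (simp add: power_mult_distrib mult.assoc)
  qed
  have "((\<lambda>x. \<integral>u. (iexp (x * u) - 0) * ((\<i> * u) ^ j * W u) \<partial>lborel) has_vector_derivative
          (\<integral>u. iexp (x * u) * (\<i> * u * ((\<i> * u) ^ j * W u)) \<partial>lborel)) (at x)"
  proof (rule fourier_integral_deriv)
    show "integrable lborel (\<lambda>u. (iexp (v * u) - 0) * ((\<i> * complex_of_real u) ^ j * W u))" for v
      using integrable_iexp_mult[OF Wj[of j], of "\<lambda>u. v * u"] by simp
    have "integrable lborel (\<lambda>u. (-\<i>) * ((\<i> * complex_of_real u) ^ Suc j * W u))"
      by (rule integrable_mult_right) (rule Wj)
    then show "integrable lborel (\<lambda>u. complex_of_real u * ((\<i> * complex_of_real u) ^ j * W u))"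
      by (simp add: algebra_simps)
  qed auto
  then show ?thesis by (simp add: mult.assoc)
qed

lemma fourier_moment_smooth:
  fixes W :: "real \<Rightarrow> complex"
  assumes W: "\<And>j. integrable lborel (\<lambda>u. complex_of_real u ^ j * W u)"
  shows "smooth (\<lambda>x. \<integral>u. iexp (x * u) * W u \<partial>lborel)"
    and "nderiv j (\<lambda>x. \<integral>u. iexp (x * u) * W u \<partial>lborel) x = (\<integral>u. iexp (x * u) * ((\<i> * u) ^ j * W u) \<partial>lborel)"
proof -
  note d = fourier_moment_deriv[OF W]
  have "Ck_on k UNIV (\<lambda>x. \<integral>u. iexp (x * u) * ((\<i> * u) ^ j * W u) \<partial>lborel)" for k j
  proof (induction k arbitrary: j)
    case 0
    show ?case unfolding Ck_on_0
      by (intro continuous_at_imp_continuous_on ballI has_vector_derivative_continuous) (rule d)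
  next
    case (Suc k) show ?case by (rule Ck_on_SucI[OF _ d Suc.IH]) auto
  qed
  from this[of _ 0] show "smooth (\<lambda>x. \<integral>u. iexp (x * u) * W u \<partial>lborel)" by (simp add: smooth_def)
  have "nderiv j (\<lambda>x. \<integral>u. iexp (x * u) * ((\<i> * u) ^ i * W u) \<partial>lborel) x = (\<integral>u. iexp (x * u) * ((\<i> * u) ^ (j + i) * W u) \<partial>lborel)" for i
  proof (induction j arbitrary: i)
    case (Suc j)
    have "nderiv (Suc j) (\<lambda>x. \<integral>u. iexp (x * u) * ((\<i> * u) ^ i * W u) \<partial>lborel) x =
        nderiv j (\<lambda>x. \<integral>u. iexp (x * u) * ((\<i> * u) ^ Suc i * W u) \<partial>lborel) x"
      by (rule nderiv_SucI[of UNIV]) (use d in auto)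
    also have "\<dots> = (\<integral>u. iexp (x * u) * ((\<i> * u) ^ (j + Suc i) * W u) \<partial>lborel)" by (rule Suc.IH)
    finally show ?case by simp
  qed simp
  from this[of 0] show "nderiv j (\<lambda>x. \<integral>u. iexp (x * u) * W u \<partial>lborel) x = (\<integral>u. iexp (x * u) * ((\<i> * u) ^ j * W u) \<partial>lborel)"
    by simp
qed

section \<open>Distributions under a Fourier integral\<close>

lemma iexp_power_diff_le:
  assumes "\<bar>x\<bar> \<le> R"
  shows "norm ((\<i> * complex_of_real u) ^ j * iexp (u * x) - (\<i> * complex_of_real v) ^ j * iexp (v * x))
    \<le> \<bar>u ^ j - v ^ j\<bar> + \<bar>v\<bar> ^ j * \<bar>u - v\<bar> * R"
proof -
  have "(\<i> * complex_of_real u) ^ j * iexp (u * x) - (\<i> * complex_of_real v) ^ j * iexp (v * x) =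
    \<i> ^ j * (complex_of_real (u ^ j - v ^ j) * iexp (u * x) + complex_of_real v ^ j * (iexp (u * x) - iexp (v * x)))"
    by (simp add: power_mult_distrib algebra_simps)
  then have "norm ((\<i> * complex_of_real u) ^ j * iexp (u * x) - (\<i> * complex_of_real v) ^ j * iexp (v * x)) =
    norm (complex_of_real (u ^ j - v ^ j) * iexp (u * x) + complex_of_real v ^ j * (iexp (u * x) - iexp (v * x)))"
    by (simp add: norm_mult norm_power)
  also have "\<dots> \<le> \<bar>u ^ j - v ^ j\<bar> + \<bar>v\<bar> ^ j * norm (iexp (u * x) - iexp (v * x))"
    by (rule order_trans[OF norm_triangle_ineq])
       (simp only: norm_mult norm_power norm_iexp norm_of_real mult_1_right order_refl)
  also have "norm (iexp (u * x) - iexp (v * x)) \<le> \<bar>u - v\<bar> * R"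
    using iexp_diff_le[of "u * x" "v * x"] assms mult_left_mono[of "\<bar>x\<bar>" R "\<bar>u - v\<bar>"]
    by (simp add: abs_mult left_diff_distrib[symmetric])
  finally show ?thesis by (simp add: mult_left_mono mult.assoc)
qed

lemma nderiv_sum_iexp:
  "finite I \<Longrightarrow> nderiv j (\<lambda>x. \<Sum>v\<in>I. w v * iexp (v * x)) x = (\<Sum>v\<in>I. w v * ((\<i> * complex_of_real v) ^ j * iexp (v * x)))
    \<and> smooth (\<lambda>x. \<Sum>v\<in>I. w v * iexp (v * x))"
proof (induction I rule: finite_induct)
  case empty
  have "nderiv j (\<lambda>_::real. 0::complex) = (\<lambda>_. 0)" by (induction j) (auto simp: nderiv_Suc_outer)
  then show ?case by (simp add: smooth_const)
next
  case (insert v I)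
  have s1: "smooth (\<lambda>x. w v * iexp (v * x))" by (intro smooth_mult smooth_const smooth_iexp)
  have "nderiv j (\<lambda>x. w v * iexp (v * x) + (\<Sum>v\<in>I. w v * iexp (v * x))) x =
      nderiv j (\<lambda>x. w v * iexp (v * x)) x + nderiv j (\<lambda>x. \<Sum>v\<in>I. w v * iexp (v * x)) x"
    by (rule nderiv_add[of UNIV j]) (use s1 insert in \<open>auto simp: smooth_def\<close>)
  also have "nderiv j (\<lambda>x. w v * iexp (v * x)) x = w v * ((\<i> * complex_of_real v) ^ j * iexp (v * x))"
    by (simp only: nderiv_iexp mult.assoc)
  finally show ?case using insert smooth_add[OF s1] by simp
qed

text \<open>
  Replacing the frequency by a simple function \<open>s\<close> turns a Fourier integral into a finite exponential
  sum, to which linearity of a distribution applies.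
\<close>

lemma simple_sum_integral:
  fixes W :: "real \<Rightarrow> complex" and f :: "real \<Rightarrow> complex"
  assumes s: "simple_function lborel s" and W: "integrable lborel W"
  defines "w v \<equiv> (\<integral>u. indicator {u. s u = v} u *\<^sub>R W u \<partial>lborel)"
  shows "(\<Sum>v\<in>range s. w v * f v) = (\<integral>u. W u * f (s u) \<partial>lborel)"
    and "integrable lborel (\<lambda>u. W u * f (s u))"
proof -
  have fin: "finite (range s)" using s by (simp add: simple_function_def)
  have m: "{u. s u = v} \<in> sets lborel" for v
    using simple_functionD(2)[OF s, of "{v}"] by (simp add: vimage_def)
  have i: "integrable lborel (\<lambda>u. indicator {u. s u = v} u *\<^sub>R W u)" for v
    by (rule integrable_mult_indicator[OF m W])
  have e: "(\<Sum>v\<in>range s. (indicator {u. s u = v} u *\<^sub>R W u) * f v) = W u * f (s u)" for u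
  proof -
    have "(\<Sum>v\<in>range s. (indicator {u. s u = v} u *\<^sub>R W u) * f v) = (\<Sum>v\<in>{s u}. W u * f v)"
      by (rule sum.mono_neutral_cong_right[OF fin]) (auto simp: indicator_def)
    then show ?thesis by simp
  qed
  have "(\<Sum>v\<in>range s. w v * f v) = (\<Sum>v\<in>range s. \<integral>u. (indicator {u. s u = v} u *\<^sub>R W u) * f v \<partial>lborel)"
    unfolding w_def by (simp only: integral_mult_left_zero)
  also have "\<dots> = (\<integral>u. (\<Sum>v\<in>range s. (indicator {u. s u = v} u *\<^sub>R W u) * f v) \<partial>lborel)"
    by (rule Bochner_Integration.integral_sum[symmetric]) (rule integrable_mult_left[OF i])
  finally show "(\<Sum>v\<in>range s. w v * f v) = (\<integral>u. W u * f (s u) \<partial>lborel)" by (simp only: e)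
  have "integrable lborel (\<lambda>u. \<Sum>v\<in>range s. (indicator {u. s u = v} u *\<^sub>R W u) * f v)"
    by (intro Bochner_Integration.integrable_sum integrable_mult_left i)
  then show "integrable lborel (\<lambda>u. W u * f (s u))" by (simp only: e)
qed

text \<open>
  Simple functions \<open>s\<^sub>m\<close> with \<open>s\<^sub>m(u) \<rightarrow> u\<close> and \<open>|s\<^sub>m(u)| \<le> 2 |u|\<close> make the Fourier integral a finite sum,
  for which the claim is linearity. The finite sums converge to the integral in \<open>C\<^sup>k\<close> on the support
  of the cutoff, dominated by moments of \<open>W\<close>, and \<open>\<tau>\<close> is continuous and of polynomial growth, so both
  sides pass to the limit.
\<close>

lemma distribution_fourier_exchange:
  fixes W :: "real \<Rightarrow> complex"
  assumes T: "distribution T" "has_order T k" and z: "test_function \<zeta>"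
    and W: "\<And>j. integrable lborel (\<lambda>u. complex_of_real u ^ j * W u)"
  defines "\<tau> \<equiv> \<lambda>u. T (\<lambda>x. \<zeta> x * iexp (u * x))"
  shows "T (\<lambda>x. \<zeta> x * (\<integral>u. iexp (x * u) * W u \<partial>lborel)) = (\<integral>u. W u * \<tau> u \<partial>lborel)"
    and "continuous_on UNIV \<tau>"
proof -
  have Cb: "Ck_bounded k (fun_supp \<zeta>) T" using T(2) z by (auto simp: has_order_def test_function_def)
  obtain C where C: "C \<ge> 0" "\<And>\<psi> B. smooth \<psi> \<Longrightarrow> 0 \<le> B \<Longrightarrow>
    (\<forall>i\<le>k. \<forall>x\<in>fun_supp \<zeta>. norm (nderiv i \<psi> x) \<le> B) \<Longrightarrow>
    norm (T (\<lambda>x. \<zeta> x * \<psi> x)) \<le> C * B"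
    using distribution_estimate[OF Cb z] by blast
  have "bounded (fun_supp \<zeta>)" using z by (simp add: test_function_def compact_imp_bounded)
  then obtain R where R: "R > 0" "\<And>x. x \<in> fun_supp \<zeta> \<Longrightarrow> \<bar>x\<bar> \<le> R"
    by (metis bounded_pos real_norm_def)
  define \<rho>1 where "\<rho>1 = (\<lambda>j u v::real. \<bar>u ^ j - v ^ j\<bar> + \<bar>v\<bar> ^ j * \<bar>u - v\<bar> * R)"
  define \<rho> where "\<rho> = (\<lambda>u v. \<Sum>j\<le>k. \<rho>1 j u v)"
  have \<rho>1_nn: "0 \<le> \<rho>1 j u v" for j u v using R(1) by (simp add: \<rho>1_def)
  have \<rho>1_le: "\<rho>1 j u v \<le> \<rho> u v" if "j \<le> k" for j u v
    unfolding \<rho>_def by (rule member_le_sum) (use that \<rho>1_nn in auto)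
  have \<rho>_nn: "0 \<le> \<rho> u v" for u v unfolding \<rho>_def by (intro sum_nonneg \<rho>1_nn)
  have e\<rho>: "norm ((\<i> * complex_of_real u) ^ j * iexp (u * x) - (\<i> * complex_of_real v) ^ j * iexp (v * x)) \<le> \<rho> u v"
    if "j \<le> k" "x \<in> fun_supp \<zeta>" for j u v x
    using iexp_power_diff_le[OF R(2)[OF that(2)], of u j v] \<rho>1_le[OF that(1), of u v] by (simp add: \<rho>1_def)
  have nd: "nderiv j (\<lambda>x. iexp (v * x)) x = (\<i> * v) ^ j * iexp (v * x)" for j v x
    using nderiv_iexp[of j 1 v x] by simp
  have tf: "test_function (\<lambda>x. \<zeta> x * iexp (v * x))" for v by (rule test_function_mult[OF z smooth_iexp])
  have \<tau>_diff: "norm (\<tau> u - \<tau> v) \<le> C * \<rho> u v" for u v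
  proof -
    have "\<tau> u - \<tau> v = T (\<lambda>x. \<zeta> x * (iexp (u * x) - iexp (v * x)))"
      unfolding \<tau>_def distribution_diff[OF T(1) tf tf, symmetric] by (simp only: right_diff_distrib)
    moreover have "norm (T (\<lambda>x. \<zeta> x * (iexp (u * x) - iexp (v * x)))) \<le> C * \<rho> u v"
      by (intro C(2) smooth_diff smooth_iexp \<rho>_nn allI impI ballI)
         (simp only: nderiv_diff_smooth[OF smooth_iexp smooth_iexp] nd e\<rho>)
    ultimately show ?thesis by simp
  qed
  have \<rho>_lim: "(\<lambda>m. \<rho> u (s m)) \<longlonglongrightarrow> 0" if "s \<longlonglongrightarrow> u" for s u
  proof -
    have "(\<lambda>m. \<rho> u (s m)) \<longlonglongrightarrow> (\<Sum>j\<le>k. \<bar>u ^ j - u ^ j\<bar> + \<bar>u\<bar> ^ j * \<bar>u - u\<bar> * R)"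
      unfolding \<rho>_def \<rho>1_def by (intro tendsto_intros that)
    then show ?thesis by simp
  qed
  have \<tau>_seq: "(\<lambda>m. \<tau> (s m)) \<longlonglongrightarrow> \<tau> u" if "s \<longlonglongrightarrow> u" for s u
  proof -
    have "(\<lambda>m. C * \<rho> u (s m)) \<longlonglongrightarrow> 0" using tendsto_mult_right_zero[OF \<rho>_lim[OF that]] by blast
    then have "(\<lambda>m. \<tau> u - \<tau> (s m)) \<longlonglongrightarrow> 0"
      by (rule Lim_null_comparison[rotated]) (use \<tau>_diff in auto)
    then have "(\<lambda>m. \<tau> u - (\<tau> u - \<tau> (s m))) \<longlonglongrightarrow> \<tau> u - 0" by (intro tendsto_intros)
    then show ?thesis by simp
  qed
  show cont: "continuous_on UNIV \<tau>"
    by (auto simp: continuous_on_sequentially o_def intro: \<tau>_seq)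
  have [measurable]: "\<tau> \<in> borel_measurable borel" using cont by (rule borel_measurable_continuous_onI)
  have \<tau>_le: "norm (\<tau> v) \<le> C * (\<Sum>j\<le>k. \<bar>v\<bar> ^ j)" for v
    unfolding \<tau>_def
  proof (intro C(2) smooth_iexp sum_nonneg allI impI ballI)
    fix i x assume "i \<le> k"
    have "norm (nderiv i (\<lambda>x. iexp (v * x)) x) = \<bar>v\<bar> ^ i"
      unfolding nd by (simp only: norm_mult norm_power norm_iexp norm_ii norm_of_real mult_1_left mult_1_right)
    also have "\<dots> \<le> (\<Sum>j\<le>k. \<bar>v\<bar> ^ j)" by (rule member_le_sum) (use \<open>i \<le> k\<close> in auto)
    finally show "norm (nderiv i (\<lambda>x. iexp (v * x)) x) \<le> (\<Sum>j\<le>k. \<bar>v\<bar> ^ j)" .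
  qed simp
  have W0: "integrable lborel W" using W[of 0] by simp
  have [measurable]: "W \<in> borel_measurable borel" using W0 by simp
  have Wabs: "integrable lborel (\<lambda>u. \<bar>u\<bar> ^ j * norm (W u))" for j
    using integrable_norm[OF W[of j]] by (simp add: norm_mult norm_power)
  obtain s :: "nat \<Rightarrow> real \<Rightarrow> real" where s: "\<And>i. simple_function lborel (s i)" "\<And>u. (\<lambda>i. s i u) \<longlonglongrightarrow> u"
    "\<And>i u. \<bar>s i u\<bar> \<le> 2 * \<bar>u\<bar>"
    using borel_measurable_implies_sequence_metric[of "\<lambda>u::real. u" lborel 0] by auto
  have [measurable]: "s i \<in> borel_measurable borel" for i
    using borel_measurable_simple_function[OF s(1)[of i]] by simp
  have fin: "finite (range (s i))" for i using s(1)[of i] by (simp add: simple_function_def)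
  define w where "w = (\<lambda>m v. \<integral>u. indicator {u. s m u = v} u *\<^sub>R W u \<partial>lborel)"
  have ss: "(\<Sum>v\<in>range (s m). w m v * f v) = (\<integral>u. W u * f (s m u) \<partial>lborel)"
    "integrable lborel (\<lambda>u. W u * f (s m u))" for m and f :: "real \<Rightarrow> complex"
    unfolding w_def by (rule simple_sum_integral[OF s(1) W0])+
  define H where "H = (\<lambda>x. \<integral>u. iexp (x * u) * W u \<partial>lborel)"
  define Hm where "Hm = (\<lambda>m x. \<Sum>v\<in>range (s m). w m v * iexp (v * x))"
  have sH: "smooth H" unfolding H_def by (rule fourier_moment_smooth(1)[OF W])
  have ndH: "nderiv j H x = (\<integral>u. W u * ((\<i> * u) ^ j * iexp (u * x)) \<partial>lborel)" for j x
    unfolding H_def fourier_moment_smooth(2)[OF W] by (intro Bochner_Integration.integral_cong) (simp_all add: ac_simps)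
  have sHm: "smooth (Hm m)" for m unfolding Hm_def using nderiv_sum_iexp[OF fin] by blast
  have ndHm: "nderiv j (Hm m) x = (\<integral>u. W u * ((\<i> * s m u) ^ j * iexp (s m u * x)) \<partial>lborel)" for j m x
    unfolding Hm_def nderiv_sum_iexp[OF fin, THEN conjunct1] by (rule ss)
  have iHm: "integrable lborel (\<lambda>u. W u * ((\<i> * s m u) ^ j * iexp (s m u * x)))" for j m x
    by (rule ss(2))
  have iH: "integrable lborel (\<lambda>u. W u * ((\<i> * u) ^ j * iexp (u * x)))" for j x
  proof -
    have "integrable lborel (\<lambda>u. \<i> ^ j * (iexp (u * x) * (complex_of_real u ^ j * W u)))"
      by (intro integrable_mult_right integrable_iexp_mult W) simp
    then show ?thesis by (simp add: power_mult_distrib ac_simps)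
  qed
  have T_Hm: "T (\<lambda>x. \<zeta> x * Hm m x) = (\<integral>u. W u * \<tau> (s m u) \<partial>lborel)" for m
  proof -
    have "(\<lambda>x. \<zeta> x * Hm m x) = (\<lambda>x. \<Sum>v\<in>range (s m). w m v * (\<zeta> x * iexp (v * x)))"
      by (simp add: Hm_def sum_distrib_left ac_simps)
    then have "T (\<lambda>x. \<zeta> x * Hm m x) = (\<Sum>v\<in>range (s m). w m v * \<tau> v)"
      using distribution_sum[OF T(1) fin, of m "\<lambda>v x. \<zeta> x * iexp (v * x)" "w m"] tf by (simp add: \<tau>_def)
    then show ?thesis using ss(1)[of m \<tau>] by simp
  qed
  define dom where "dom = (\<lambda>u. \<Sum>j\<le>k. \<bar>u\<bar> ^ j * (1 + 2 ^ j) + 3 * R * 2 ^ j * \<bar>u\<bar> ^ (Suc j))"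
  have \<rho>_dom: "\<rho> u (s m u) \<le> dom u" for m u
    unfolding \<rho>_def dom_def
  proof (rule sum_mono)
    fix j
    have a: "\<bar>s m u\<bar> ^ j \<le> 2 ^ j * \<bar>u\<bar> ^ j" using power_mono[OF s(3)[of m u], of j] by (simp add: power_mult_distrib)
    have b: "\<bar>u - s m u\<bar> \<le> 3 * \<bar>u\<bar>" using s(3)[of m u] by linarith
    have c: "\<bar>s m u\<bar> ^ j * \<bar>u - s m u\<bar> \<le> (2 ^ j * \<bar>u\<bar> ^ j) * (3 * \<bar>u\<bar>)" by (intro mult_mono a b) auto
    have "\<bar>u ^ j - s m u ^ j\<bar> \<le> \<bar>u\<bar> ^ j + \<bar>s m u\<bar> ^ j" by (metis abs_triangle_ineq4 power_abs)
    then have "\<rho>1 j u (s m u) \<le> (\<bar>u\<bar> ^ j + 2 ^ j * \<bar>u\<bar> ^ j) + (2 ^ j * \<bar>u\<bar> ^ j) * (3 * \<bar>u\<bar>) * R"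
      unfolding \<rho>1_def using a mult_right_mono[OF c, of R] R(1) by linarith
    then show "\<rho>1 j u (s m u) \<le> \<bar>u\<bar> ^ j * (1 + 2 ^ j) + 3 * R * 2 ^ j * \<bar>u\<bar> ^ Suc j"
      by (simp add: algebra_simps)
  qed
  have i_dom: "integrable lborel (\<lambda>u. norm (W u) * dom u)"
  proof -
    have "integrable lborel (\<lambda>u. \<Sum>j\<le>k. (1 + 2 ^ j) * (\<bar>u\<bar> ^ j * norm (W u)) + (3 * R * 2 ^ j) * (\<bar>u\<bar> ^ Suc j * norm (W u)))"
      by (intro Bochner_Integration.integrable_sum Bochner_Integration.integrable_add integrable_mult_right Wabs)
    then show ?thesis by (simp add: dom_def sum_distrib_left algebra_simps)
  qed
  have \<rho>_meas[measurable]: "(\<lambda>u. \<rho> u (s m u)) \<in> borel_measurable borel" for m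
    unfolding \<rho>_def \<rho>1_def by measurable
  have dom_nn: "0 \<le> dom u" for u using \<rho>_nn[of u "s 0 u"] \<rho>_dom[of u 0] by linarith
  define B where "B = (\<lambda>m. \<integral>u. norm (W u) * \<rho> u (s m u) \<partial>lborel)"
  have iB: "integrable lborel (\<lambda>u. norm (W u) * \<rho> u (s m u))" for m
    by (rule Bochner_Integration.integrable_bound[OF i_dom])
       (auto simp: abs_mult \<rho>_nn dom_nn intro!: mult_left_mono \<rho>_dom)
  have B_nn: "0 \<le> B m" for m unfolding B_def by (intro integral_nonneg_AE) (auto simp: \<rho>_nn)
  have "B \<longlonglongrightarrow> (\<integral>u. (0::real) \<partial>(lborel :: real measure))"
    unfolding B_def
  proof (rule integral_dominated_convergence[OF _ _ i_dom])
    show "AE u in lborel. (\<lambda>m. norm (W u) * \<rho> u (s m u)) \<longlonglongrightarrow> 0"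
      by (intro AE_I2 tendsto_mult_right_zero \<rho>_lim s)
    show "AE u in lborel. norm (norm (W u) * \<rho> u (s m u)) \<le> norm (W u) * dom u" for m
      by (auto simp: abs_mult \<rho>_nn dom_nn intro!: mult_left_mono \<rho>_dom)
  qed auto
  then have B0: "B \<longlonglongrightarrow> 0" by simp
  have "norm (T (\<lambda>x. \<zeta> x * H x) - T (\<lambda>x. \<zeta> x * Hm m x)) \<le> C * B m" for m
  proof -
    have "T (\<lambda>x. \<zeta> x * H x) - T (\<lambda>x. \<zeta> x * Hm m x) = T (\<lambda>x. \<zeta> x * (H x - Hm m x))"
      unfolding distribution_diff[OF T(1) test_function_mult(1)[OF z sH] test_function_mult(1)[OF z sHm], symmetric]
      by (simp only: right_diff_distrib)
    moreover have "norm (T (\<lambda>x. \<zeta> x * (H x - Hm m x))) \<le> C * B m"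
    proof (intro C(2) smooth_diff sH sHm B_nn allI impI ballI)
      fix i x assume i: "i \<le> k" "x \<in> fun_supp \<zeta>"
      have "nderiv i (\<lambda>x. H x - Hm m x) x =
          (\<integral>u. W u * ((\<i> * u) ^ i * iexp (u * x)) - W u * ((\<i> * s m u) ^ i * iexp (s m u * x)) \<partial>lborel)"
        unfolding nderiv_diff_smooth[OF sH sHm] ndH ndHm by (rule Bochner_Integration.integral_diff[symmetric, OF iH iHm])
      moreover have "norm \<dots> \<le> B m"
        unfolding B_def
      proof (rule Bochner_Integration.integral_norm_bound_integral[OF _ iB])
        fix u
        have "norm (W u * ((\<i> * u) ^ i * iexp (u * x)) - W u * ((\<i> * s m u) ^ i * iexp (s m u * x))) =
          norm (W u) * norm ((\<i> * u) ^ i * iexp (u * x) - (\<i> * s m u) ^ i * iexp (s m u * x))"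
          by (simp only: norm_mult[symmetric] right_diff_distrib)
        also have "\<dots> \<le> norm (W u) * \<rho> u (s m u)" by (intro mult_left_mono e\<rho> i) simp
        finally show "norm (W u * ((\<i> * u) ^ i * iexp (u * x)) - W u * ((\<i> * s m u) ^ i * iexp (s m u * x))) \<le> norm (W u) * \<rho> u (s m u)" .
      qed (intro Bochner_Integration.integrable_diff iH iHm)
      ultimately show "norm (nderiv i (\<lambda>x. H x - Hm m x) x) \<le> B m" by simp
    qed
    ultimately show ?thesis by simp
  qed
  then have "(\<lambda>m. T (\<lambda>x. \<zeta> x * H x) - T (\<lambda>x. \<zeta> x * Hm m x)) \<longlonglongrightarrow> 0"
    by (intro Lim_null_comparison[OF _ tendsto_mult_right_zero[OF B0, of C]]) auto
  then have "(\<lambda>m. T (\<lambda>x. \<zeta> x * H x) - (T (\<lambda>x. \<zeta> x * H x) - T (\<lambda>x. \<zeta> x * Hm m x))) \<longlonglongrightarrow> T (\<lambda>x. \<zeta> x * H x) - 0"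
    by (intro tendsto_intros)
  then have l1: "(\<lambda>m. \<integral>u. W u * \<tau> (s m u) \<partial>lborel) \<longlonglongrightarrow> T (\<lambda>x. \<zeta> x * H x)" by (simp add: T_Hm)
  have l2: "(\<lambda>m. \<integral>u. W u * \<tau> (s m u) \<partial>lborel) \<longlonglongrightarrow> (\<integral>u. W u * \<tau> u \<partial>lborel)"
  proof (rule integral_dominated_convergence[where w = "\<lambda>u. \<Sum>j\<le>k. C * 2 ^ j * (\<bar>u\<bar> ^ j * norm (W u))"])
    show "integrable lborel (\<lambda>u. \<Sum>j\<le>k. C * 2 ^ j * (\<bar>u\<bar> ^ j * norm (W u)))"
      by (intro Bochner_Integration.integrable_sum integrable_mult_right Wabs)
    show "AE u in lborel. (\<lambda>m. W u * \<tau> (s m u)) \<longlonglongrightarrow> W u * \<tau> u"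
      by (intro AE_I2 tendsto_intros \<tau>_seq s)
    show "AE u in lborel. norm (W u * \<tau> (s m u)) \<le> (\<Sum>j\<le>k. C * 2 ^ j * (\<bar>u\<bar> ^ j * norm (W u)))" for m
    proof (rule AE_I2)
      fix u
      have "norm (\<tau> (s m u)) \<le> C * (\<Sum>j\<le>k. \<bar>s m u\<bar> ^ j)" by (rule \<tau>_le)
      also have "\<dots> \<le> C * (\<Sum>j\<le>k. 2 ^ j * \<bar>u\<bar> ^ j)"
      proof (intro mult_left_mono sum_mono C)
        fix j show "\<bar>s m u\<bar> ^ j \<le> 2 ^ j * \<bar>u\<bar> ^ j" using power_mono[OF s(3)[of m u], of j] by (simp add: power_mult_distrib)
      qed
      finally have "norm (W u) * norm (\<tau> (s m u)) \<le> norm (W u) * (C * (\<Sum>j\<le>k. 2 ^ j * \<bar>u\<bar> ^ j))"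
        by (rule mult_left_mono) simp
      then show "norm (W u * \<tau> (s m u)) \<le> (\<Sum>j\<le>k. C * 2 ^ j * (\<bar>u\<bar> ^ j * norm (W u)))"
        by (simp add: norm_mult sum_distrib_left ac_simps)
    qed
  qed auto
  show "T (\<lambda>x. \<zeta> x * (\<integral>u. iexp (x * u) * W u \<partial>lborel)) = (\<integral>u. W u * \<tau> u \<partial>lborel)"
    using LIMSEQ_unique[OF l1 l2] by (simp add: H_def)
qed

section \<open>Fourier inversion\<close>

lemma integrable_pairI:
  fixes f :: "'a \<times> 'b \<Rightarrow> 'c::{banach, second_countable_topology}"
  assumes "sigma_finite_measure M1" "sigma_finite_measure M2" and f[measurable]: "f \<in> borel_measurable (M1 \<Otimes>\<^sub>M M2)"
    and fin: "(\<integral>\<^sup>+x. \<integral>\<^sup>+y. ennreal (norm (f (x, y))) \<partial>M2 \<partial>M1) < \<infinity>"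
  shows "integrable (M1 \<Otimes>\<^sub>M M2) f"
proof (rule integrableI_bounded)
  interpret pair_sigma_finite M1 M2 using assms(1,2) by (rule pair_sigma_finite.intro)
  show "(\<integral>\<^sup>+p. ennreal (norm (f p)) \<partial>(M1 \<Otimes>\<^sub>M M2)) < \<infinity>"
    using fin by (subst M2.nn_integral_fst[symmetric]) auto
qed (rule f)

lemma fubini_swap:
  fixes f :: "'a \<Rightarrow> 'b \<Rightarrow> 'c::{banach, second_countable_topology}"
  assumes "sigma_finite_measure M1" "sigma_finite_measure M2" "(\<lambda>p. f (fst p) (snd p)) \<in> borel_measurable (M1 \<Otimes>\<^sub>M M2)"
    and fin: "(\<integral>\<^sup>+x. \<integral>\<^sup>+y. ennreal (norm (f x y)) \<partial>M2 \<partial>M1) < \<infinity>"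
  shows "(\<integral>x. \<integral>y. f x y \<partial>M2 \<partial>M1) = (\<integral>y. \<integral>x. f x y \<partial>M1 \<partial>M2)"
    and "integrable M1 (\<lambda>x. \<integral>y. f x y \<partial>M2)"
proof -
  interpret pair_sigma_finite M1 M2 using assms(1,2) by (rule pair_sigma_finite.intro)
  have i: "integrable (M1 \<Otimes>\<^sub>M M2) (\<lambda>p. f (fst p) (snd p))"
    by (rule integrable_pairI[OF assms(1,2,3)]) (use fin in simp)
  then have i': "integrable (M1 \<Otimes>\<^sub>M M2) (\<lambda>(x, y). f x y)" by (simp add: case_prod_beta')
  show "(\<integral>x. \<integral>y. f x y \<partial>M2 \<partial>M1) = (\<integral>y. \<integral>x. f x y \<partial>M1 \<partial>M2)"
    by (rule Fubini_integral[OF i', symmetric])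
  show "integrable M1 (\<lambda>x. \<integral>y. f x y \<partial>M2)" by (rule integrable_fst[OF i'])
qed

lemma fourier_norm_le:
  assumes "integrable lborel g" shows "norm (fourier g u) \<le> (\<integral>x. norm (g x) \<partial>lborel)"
proof -
  have "norm (fourier g u) \<le> (\<integral>x. norm (iexp (u * x) * g x) \<partial>lborel)"
    unfolding fourier_def by (rule integral_norm_bound)
  then show ?thesis by (simp only: norm_mult norm_iexp mult_1_left)
qed

lemma fourier_measurable [measurable]:
  assumes "integrable lborel g" shows "fourier g \<in> borel_measurable borel"
proof -
  have "continuous_on UNIV (fourier g)"
    unfolding fourier_def[abs_def]
    by (intro continuous_at_imp_continuous_on ballI fourier_integral_isCont) (use assms in auto)
  then show ?thesis by (rule borel_measurable_continuous_onI)
qed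

lemma std_normal_fourier:
  "complex_of_real (std_normal_density z) =
    complex_of_real (1 / sqrt (2 * pi)) * (\<integral>v. iexp (z * v) * complex_of_real (std_normal_density v) \<partial>lborel)"
proof -
  have "(\<integral>v. iexp (z * v) * complex_of_real (std_normal_density v) \<partial>lborel) = char std_normal_distribution z"
    unfolding char_def
    by (subst integral_density) (auto simp: scaleR_conv_of_real mult.commute)
  also have "\<dots> = complex_of_real (exp (- z\<^sup>2 / 2))" by (simp add: char_std_normal_distribution)
  finally show ?thesis unfolding std_normal_density_def by simp
qed

lemma std_normal_le: "std_normal_density x \<le> 1"
proof -
  have "1 / sqrt (2 * pi) \<le> 1"
    using pi_gt3 by (simp add: real_le_rsqrt)
  moreover have "exp (- x\<^sup>2 / 2) \<le> 1" by simp
  ultimately have "1 / sqrt (2 * pi) * exp (- x\<^sup>2 / 2) \<le> 1 * 1" by (intro mult_mono) auto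
  then show ?thesis by (simp add: std_normal_density_def)
qed

text \<open>
  The Gaussian density is its own Fourier transform up to a factor. A Gaussian average of \<open>q\<close> is
  therefore, after Fubini's theorem and two substitutions, an inversion integral damped by a Gaussian
  factor, which converges absolutely for every integrable \<open>q\<close>.
\<close>

lemma gaussian_smoothing:
  fixes q :: "real \<Rightarrow> complex"
  assumes q: "integrable lborel q" and e: "e > 0"
  shows "(\<integral>z. q (y + e * z) * std_normal_density z \<partial>lborel) =
     complex_of_real (1 / sqrt (2 * pi)) *
     (\<integral>u. std_normal_density (e * u) * (iexp (- (u * y)) * fourier q u) \<partial>lborel)"
proof -
  let ?g = "\<lambda>v. complex_of_real (std_normal_density v)"
  have qe: "integrable lborel (\<lambda>z. q (y + e * z))"
    using lborel_integrable_real_affine[OF q, of e y] e by simp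
  have [measurable]: "q \<in> borel_measurable borel" using q by simp
  have gi: "integrable lborel ?g" by (simp add: integrable_of_real)
  have gi': "(\<integral>\<^sup>+v. ennreal (norm (?g v)) \<partial>lborel) < \<infinity>"
    using gi unfolding integrable_iff_bounded by simp
  have qi': "(\<integral>\<^sup>+z. ennreal (norm (q (y + e * z))) \<partial>lborel) < \<infinity>"
    using qe unfolding integrable_iff_bounded by simp
  have "(\<integral>z. q (y + e * z) * ?g z \<partial>lborel) =
     complex_of_real (1 / sqrt (2 * pi)) * (\<integral>z. q (y + e * z) * (\<integral>v. iexp (z * v) * ?g v \<partial>lborel) \<partial>lborel)"
    by (subst std_normal_fourier) (simp add: mult.left_commute flip: integral_mult_right_zero)
  also have "(\<integral>z. q (y + e * z) * (\<integral>v. iexp (z * v) * ?g v \<partial>lborel) \<partial>lborel) =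
     (\<integral>z. \<integral>v. q (y + e * z) * (iexp (z * v) * ?g v) \<partial>lborel \<partial>lborel)"
    by simp
  also have "\<dots> = (\<integral>v. \<integral>z. q (y + e * z) * (iexp (z * v) * ?g v) \<partial>lborel \<partial>lborel)"
  proof (rule fubini_swap)
    have "(\<integral>\<^sup>+z. \<integral>\<^sup>+v. ennreal (norm (q (y + e * z) * (iexp (z * v) * ?g v))) \<partial>lborel \<partial>lborel) =
        (\<integral>\<^sup>+z. \<integral>\<^sup>+v. ennreal (norm (q (y + e * z))) * ennreal (norm (?g v)) \<partial>lborel \<partial>lborel)"
      by (simp only: norm_mult norm_iexp mult_1_left ennreal_mult norm_ge_zero)
    also have "\<dots> = (\<integral>\<^sup>+z. ennreal (norm (q (y + e * z))) \<partial>lborel) * (\<integral>\<^sup>+v. ennreal (norm (?g v)) \<partial>lborel)"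
      by (simp add: nn_integral_cmult nn_integral_multc)
    also have "\<dots> < \<infinity>" using gi' qi' by (simp add: ennreal_mult_less_top)
    finally show "(\<integral>\<^sup>+z. \<integral>\<^sup>+v. ennreal (norm (q (y + e * z) * (iexp (z * v) * ?g v))) \<partial>lborel \<partial>lborel) < \<infinity>" .
    show "(\<lambda>p. q (y + e * fst p) * (iexp (fst p * snd p) * ?g (snd p))) \<in> borel_measurable (lborel \<Otimes>\<^sub>M lborel)"
      by measurable
  qed (rule lborel.sigma_finite_measure_axioms)+
  also have "\<dots> = (\<integral>v. ?g v * (\<integral>z. iexp (z * v) * q (y + e * z) \<partial>lborel) \<partial>lborel)"
    by (simp add: ac_simps flip: integral_mult_right_zero)
  also have "\<dots> = (\<integral>v. ?g v * ((1 / e) * (iexp (- (v / e * y)) * fourier q (v / e))) \<partial>lborel)"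
  proof (intro Bochner_Integration.integral_cong arg_cong[where f = "\<lambda>x. _ * x"] refl)
    fix v
    have "fourier q (v / e) = e *\<^sub>R (\<integral>z. iexp (v / e * (y + e * z)) * q (y + e * z) \<partial>lborel)"
      unfolding fourier_def by (subst lborel_integral_real_affine[where c = e and t = y]) (use e in auto)
    also have "(\<lambda>z. iexp (v / e * (y + e * z)) * q (y + e * z)) = (\<lambda>z. iexp (v / e * y) * (iexp (z * v) * q (y + e * z)))"
      using e by (auto simp: field_simps exp_add[symmetric])
    finally have "fourier q (v / e) = e *\<^sub>R (iexp (v / e * y) * (\<integral>z. iexp (z * v) * q (y + e * z) \<partial>lborel))"
      by (simp only: integral_mult_right_zero)
    moreover have "iexp (- (v / e * y)) * iexp (v / e * y) = 1"
      by (simp add: exp_add[symmetric])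
    ultimately show "(\<integral>z. iexp (z * v) * q (y + e * z) \<partial>lborel) = (1 / e) * (iexp (- (v / e * y)) * fourier q (v / e))"
      using e by (simp add: scaleR_conv_of_real mult.left_commute mult.assoc[symmetric])
  qed
  also have "\<dots> = e *\<^sub>R (\<integral>u. ?g (e * u) * ((1 / e) * (iexp (- (e * u / e * y)) * fourier q (e * u / e))) \<partial>lborel)"
    by (subst lborel_integral_real_affine[where c = e and t = 0]) (use e in auto)
  also have "(\<lambda>u. ?g (e * u) * ((1 / e) * (iexp (- (e * u / e * y)) * fourier q (e * u / e)))) =
      (\<lambda>u. (1 / e) * (?g (e * u) * (iexp (- (u * y)) * fourier q u)))"
    using e by (auto simp: fun_eq_iff)
  also have "e *\<^sub>R (\<integral>u. (1 / e) * (?g (e * u) * (iexp (- (u * y)) * fourier q u)) \<partial>lborel) =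
      (\<integral>u. ?g (e * u) * (iexp (- (u * y)) * fourier q u) \<partial>lborel)"
    unfolding integral_mult_right_zero using e by (simp add: scaleR_conv_of_real)
  finally show ?thesis .
qed

text \<open>
  As the width of the Gaussian shrinks, the averages of \<open>q\<close> tend to its value by continuity and the
  damping disappears. Continuity yields the formula at every point, not only almost everywhere.
\<close>

lemma fourier_inversion:
  fixes q :: "real \<Rightarrow> complex"
  assumes q: "integrable lborel q" and c: "\<And>x. isCont q x" and b: "\<And>x. norm (q x) \<le> B"
    and Fq: "integrable lborel (fourier q)"
  shows "q y = complex_of_real (1 / (2 * pi)) * (\<integral>u. iexp (- (u * y)) * fourier q u \<partial>lborel)"
proof -
  let ?g = "\<lambda>v. complex_of_real (std_normal_density v)"
  define e where "e = (\<lambda>n. 1 / real (Suc n))"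
  have e0: "e \<longlonglongrightarrow> 0" unfolding e_def by (rule LIMSEQ_Suc[OF lim_1_over_n])
  have e_pos: "e n > 0" for n by (simp add: e_def)
  have [measurable]: "q \<in> borel_measurable borel" "fourier q \<in> borel_measurable borel" using q Fq by auto
  have gi: "integrable lborel ?g" by (simp add: integrable_of_real)
  have gcont: "isCont std_normal_density x" for x
    unfolding std_normal_density_def[abs_def] by (intro continuous_intros) auto
  have l1: "(\<lambda>n. \<integral>z. q (y + e n * z) * ?g z \<partial>lborel) \<longlonglongrightarrow> (\<integral>z. q y * ?g z \<partial>lborel)"
  proof (rule integral_dominated_convergence[where w = "\<lambda>z. B * std_normal_density z"])
    show "AE z in lborel. (\<lambda>n. q (y + e n * z) * ?g z) \<longlonglongrightarrow> q y * ?g z"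
    proof (rule AE_I2)
      fix z
      have "(\<lambda>n. y + e n * z) \<longlonglongrightarrow> y + 0 * z" by (intro tendsto_intros e0)
      then show "(\<lambda>n. q (y + e n * z) * ?g z) \<longlonglongrightarrow> q y * ?g z"
        by (intro tendsto_mult tendsto_const isCont_tendsto_compose[OF c]) simp
    qed
    show "AE z in lborel. norm (q (y + e n * z) * ?g z) \<le> B * std_normal_density z" for n
      by (auto simp: norm_mult intro!: mult_right_mono b)
  qed auto
  have "integral\<^sup>L lborel std_normal_density = 1" using integral_std_normal_moment_even[of 0] by simp
  then have i1: "(\<integral>z. q y * ?g z \<partial>lborel) = q y" by simp
  have l2: "(\<lambda>n. \<integral>u. ?g (e n * u) * (iexp (- (u * y)) * fourier q u) \<partial>lborel) \<longlonglongrightarrow>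
     (\<integral>u. ?g 0 * (iexp (- (u * y)) * fourier q u) \<partial>lborel)"
  proof (rule integral_dominated_convergence[where w = "\<lambda>u. norm (fourier q u)"])
    show "AE u in lborel. (\<lambda>n. ?g (e n * u) * (iexp (- (u * y)) * fourier q u)) \<longlonglongrightarrow> ?g 0 * (iexp (- (u * y)) * fourier q u)"
    proof (rule AE_I2)
      fix u
      have "(\<lambda>n. e n * u) \<longlonglongrightarrow> 0 * u" by (intro tendsto_intros e0)
      then have "(\<lambda>n. std_normal_density (e n * u)) \<longlonglongrightarrow> std_normal_density 0"
        by (intro isCont_tendsto_compose[OF gcont]) simp
      then show "(\<lambda>n. ?g (e n * u) * (iexp (- (u * y)) * fourier q u)) \<longlonglongrightarrow> ?g 0 * (iexp (- (u * y)) * fourier q u)"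
        by (intro tendsto_mult tendsto_const tendsto_of_real)
    qed
    show "AE u in lborel. norm (?g (e n * u) * (iexp (- (u * y)) * fourier q u)) \<le> norm (fourier q u)" for n
    proof (rule AE_I2)
      fix u
      have "norm (?g (e n * u)) \<le> 1" using std_normal_le[of "e n * u"] by simp
      then have "norm (?g (e n * u)) * norm (fourier q u) \<le> 1 * norm (fourier q u)" by (intro mult_right_mono) auto
      then show "norm (?g (e n * u) * (iexp (- (u * y)) * fourier q u)) \<le> norm (fourier q u)"
        by (simp only: norm_mult norm_iexp mult_1_left)
    qed
  qed (use Fq in auto)
  have "(\<lambda>n. complex_of_real (1 / sqrt (2 * pi)) * (\<integral>u. ?g (e n * u) * (iexp (- (u * y)) * fourier q u) \<partial>lborel)) \<longlonglongrightarrow>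
     complex_of_real (1 / sqrt (2 * pi)) * (\<integral>u. ?g 0 * (iexp (- (u * y)) * fourier q u) \<partial>lborel)"
    by (rule tendsto_mult[OF tendsto_const l2])
  then have "(\<lambda>n. \<integral>z. q (y + e n * z) * ?g z \<partial>lborel) \<longlonglongrightarrow>
     complex_of_real (1 / sqrt (2 * pi)) * (\<integral>u. ?g 0 * (iexp (- (u * y)) * fourier q u) \<partial>lborel)"
    by (simp only: gaussian_smoothing[OF q e_pos])
  from LIMSEQ_unique[OF l1[unfolded i1] this]
  have "q y = complex_of_real (1 / sqrt (2 * pi)) * (?g 0 * (\<integral>u. iexp (- (u * y)) * fourier q u \<partial>lborel))"
    by (simp only: integral_mult_right_zero)
  moreover have "1 / sqrt (2 * pi) * std_normal_density 0 = 1 / (2 * pi)"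
    by (simp add: std_normal_density_def)
  ultimately show ?thesis by (simp only: mult.assoc[symmetric] of_real_mult[symmetric])
qed

section \<open>Convolution of a bounded integrable function with an integrable function\<close>

lemma integrable_complex_indicator:
  assumes "A \<in> sets borel" "emeasure lborel A < \<infinity>"
  shows "integrable lborel (\<lambda>x. indicator A x :: complex)"
proof -
  have "integrable lborel (\<lambda>x. complex_of_real (indicator A x))"
    using assms by (intro integrable_of_real) (simp add: integrable_indicator_iff)
  then show ?thesis by (simp add: indicator_def of_bool_def if_distrib cong: if_cong)
qed

locale bounded_L1 =
  fixes f :: "real \<Rightarrow> complex" and B :: real
  assumes f: "integrable lborel f" and fB: "\<And>x. norm (f x) \<le> B"
begin

definition conv :: "(real \<Rightarrow> complex) \<Rightarrow> real \<Rightarrow> complex" where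
  "conv K y = (\<integral>z. f z * K (y - z) \<partial>lborel)"

lemma f_meas [measurable]: "f \<in> borel_measurable borel" using f by simp

lemma B_nn: "B \<ge> 0" using fB[of 0] norm_ge_zero order_trans by blast

lemma reflect:
  fixes K :: "real \<Rightarrow> complex"
  assumes "integrable lborel K"
  shows "integrable lborel (\<lambda>z. K (y - z))" "(\<integral>z. norm (K (y - z)) \<partial>lborel) = (\<integral>z. norm (K z) \<partial>lborel)"
proof -
  show "integrable lborel (\<lambda>z. K (y - z))" using lborel_integrable_real_affine[OF assms, of "-1" y] by simp
  show "(\<integral>z. norm (K (y - z)) \<partial>lborel) = (\<integral>z. norm (K z) \<partial>lborel)"
    by (subst (2) lborel_integral_real_affine[where c = "-1" and t = y]) auto
qed

lemma conv_integrable: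
  assumes "integrable lborel K"
  shows "integrable lborel (\<lambda>z. f z * K (y - z))"
proof (rule Bochner_Integration.integrable_bound)
  show "integrable lborel (\<lambda>z. B * norm (K (y - z)))" by (intro integrable_mult_right integrable_norm reflect assms)
  have [measurable]: "K \<in> borel_measurable borel" using assms by simp
  show "(\<lambda>z. f z * K (y - z)) \<in> borel_measurable lborel" by measurable
  show "AE z in lborel. norm (f z * K (y - z)) \<le> norm (B * norm (K (y - z)))"
    using B_nn by (auto simp: norm_mult intro!: mult_right_mono fB)
qed

lemma conv_norm_le:
  assumes "integrable lborel K"
  shows "norm (conv K y) \<le> B * (\<integral>z. norm (K z) \<partial>lborel)"
proof -
  have "norm (conv K y) \<le> (\<integral>z. B * norm (K (y - z)) \<partial>lborel)"
    unfolding conv_def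
    by (rule Bochner_Integration.integral_norm_bound_integral[OF conv_integrable[OF assms]])
       (auto simp: norm_mult intro!: mult_right_mono fB integrable_norm reflect assms)
  then show ?thesis by (simp add: reflect[OF assms])
qed

lemma conv_diff:
  assumes "integrable lborel K" "integrable lborel L"
  shows "conv (\<lambda>z. K z - L z) y = conv K y - conv L y"
  unfolding conv_def
  by (subst Bochner_Integration.integral_diff[symmetric, OF conv_integrable[OF assms(1)] conv_integrable[OF assms(2)]])
     (simp add: right_diff_distrib)

text \<open>
  As \<open>f\<close> is bounded, \<open>K \<mapsto> f * K\<close> is continuous from \<open>L\<^sup>1\<close> to the uniform norm. Continuity of the
  convolution thus passes to \<open>L\<^sup>1\<close> limits, and it suffices to climb from continuous functions over
  open sets and measurable sets to integrable functions.
\<close>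

lemma conv_cont_limit:
  assumes K: "integrable lborel K" and L: "\<And>n. integrable lborel (L n)"
    and c: "\<And>n. continuous_on UNIV (conv (L n))"
    and lim: "(\<lambda>n. \<integral>z. norm (L n z - K z) \<partial>lborel) \<longlonglongrightarrow> 0"
  shows "continuous_on UNIV (conv K)"
proof (rule uniform_limit_theorem[where F = sequentially and f = "\<lambda>n. conv (L n)"])
  show "uniform_limit UNIV (\<lambda>n. conv (L n)) (conv K) sequentially"
  proof (rule uniform_limitI)
    fix e :: real assume e: "e > 0"
    have "(\<lambda>n. B * (\<integral>z. norm (L n z - K z) \<partial>lborel)) \<longlonglongrightarrow> B * 0" by (intro tendsto_intros lim)
    then have "\<forall>\<^sub>F n in sequentially. B * (\<integral>z. norm (L n z - K z) \<partial>lborel) < e"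
      using e by (intro order_tendstoD(2)[of _ "B * 0"]) auto
    then show "\<forall>\<^sub>F n in sequentially. \<forall>y\<in>UNIV. dist (conv (L n) y) (conv K y) < e"
    proof (rule eventually_mono, intro ballI)
      fix n y assume "B * (\<integral>z. norm (L n z - K z) \<partial>lborel) < e"
      moreover have "dist (conv (L n) y) (conv K y) \<le> B * (\<integral>z. norm (L n z - K z) \<partial>lborel)"
        unfolding dist_norm conv_diff[OF L K, symmetric] by (rule conv_norm_le) (use L K in auto)
      ultimately show "dist (conv (L n) y) (conv K y) < e" by linarith
    qed
  qed
qed (use c in auto)

lemma conv_cont_of_cont:
  assumes g: "continuous_on UNIV g" "\<And>x. norm (g x) \<le> 1"
  shows "continuous_on UNIV (conv g)"
  unfolding conv_def[abs_def] continuous_on_sequentially o_def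
proof (intro allI impI ballI)
  fix X and y :: real assume "(\<forall>n. X n \<in> UNIV) \<and> X \<longlonglongrightarrow> y"
  then have X: "X \<longlonglongrightarrow> y" by simp
  have [measurable]: "g \<in> borel_measurable borel" using g(1) by (rule borel_measurable_continuous_onI)
  have gc: "isCont g x" for x using g(1) by (simp add: continuous_on_eq_continuous_at)
  show "(\<lambda>n. \<integral>z. f z * g (X n - z) \<partial>lborel) \<longlonglongrightarrow> (\<integral>z. f z * g (y - z) \<partial>lborel)"
  proof (rule integral_dominated_convergence[where w = "\<lambda>z. norm (f z)"])
    show "AE z in lborel. (\<lambda>n. f z * g (X n - z)) \<longlonglongrightarrow> f z * g (y - z)"
      by (intro AE_I2 tendsto_mult tendsto_const isCont_tendsto_compose[OF gc] tendsto_diff X)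
    show "AE z in lborel. norm (f z * g (X n - z)) \<le> norm (f z)" for n
      using g(2) by (auto simp: norm_mult intro!: mult_left_le)
  qed (use f in auto)
qed

text \<open>
  The indicator of an open set is the \<open>L\<^sup>1\<close> limit of the continuous functions
  \<open>min 1 (n dist(x, - U))\<close>.
\<close>

lemma conv_cont_open:
  assumes U: "open U" "emeasure lborel U < \<infinity>"
  shows "continuous_on UNIV (conv (\<lambda>x. indicator U x))"
proof (rule conv_cont_limit)
  define g where "g = (\<lambda>n x. complex_of_real (min 1 (real n * infdist x (- U))))"
  have [measurable]: "U \<in> sets borel" using U(1) by simp
  have iU: "integrable lborel (\<lambda>x. indicator U x :: real)"
    using U by (simp add: integrable_indicator_iff)
  show iUc: "integrable lborel (\<lambda>x. indicator U x :: complex)"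
    using U by (intro integrable_complex_indicator) auto
  have gc: "continuous_on UNIV (g n)" for n
    unfolding g_def by (intro continuous_intros)
  then have [measurable]: "g n \<in> borel_measurable borel" for n by (rule borel_measurable_continuous_onI)
  have ne: "- U \<noteq> {}"
  proof
    assume "- U = {}" then have "U = UNIV" by auto
    then show False using U(2) by simp
  qed
  have g_le: "norm (g n x) \<le> indicator U x" for n x
  proof (cases "x \<in> U")
    case False
    then have "infdist x (- U) = 0" by simp
    then show ?thesis using False by (simp add: g_def)
  qed (auto simp: g_def infdist_nonneg)
  show ig: "integrable lborel (g n)" for n
    by (rule Bochner_Integration.integrable_bound[OF iU]) (use g_le in auto)
  show "continuous_on UNIV (conv (g n))" for n
    by (rule conv_cont_of_cont[OF gc]) (rule order_trans[OF g_le], simp add: indicator_def)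
  have "(\<lambda>n. \<integral>z. norm (g n z - indicator U z) \<partial>lborel) \<longlonglongrightarrow> (\<integral>z. (0::real) \<partial>(lborel :: real measure))"
  proof (rule integral_dominated_convergence[where w = "\<lambda>x. 2 * indicator U x"])
    show "AE x in lborel. norm (norm (g n x - indicator U x)) \<le> 2 * indicator U x" for n
    proof (rule AE_I2)
      fix x
      show "norm (norm (g n x - indicator U x)) \<le> 2 * indicator U x"
        using norm_triangle_ineq4[of "g n x" "indicator U x"] g_le[of n x] by (auto simp: indicator_def split: if_splits)
    qed
    show "AE x in lborel. (\<lambda>n. norm (g n x - indicator U x)) \<longlonglongrightarrow> 0"
    proof (rule AE_I2)
      fix x
      have "\<forall>\<^sub>F n in sequentially. g n x = indicator U x"
      proof (cases "x \<in> U")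
        case True
        have d: "infdist x (- U) > 0"
          using in_closed_iff_infdist_zero[OF closed_Compl[OF U(1)] ne, of x] True infdist_nonneg[of x "- U"]
          by (metis ComplD less_eq_real_def)
        obtain N :: nat where N: "1 / infdist x (- U) \<le> real N" using real_arch_simple by blast
        have "g n x = 1" if "n \<ge> N" for n
        proof -
          have "1 / infdist x (- U) \<le> real n" using N that by (meson of_nat_mono order_trans)
          then have "1 \<le> real n * infdist x (- U)" using d by (simp add: divide_le_eq)
          then show ?thesis by (simp add: g_def)
        qed
        then show ?thesis using True by (auto simp: eventually_sequentially)
      next
        case False then show ?thesis using g_le[of _ x] by simp
      qed
      then have "\<forall>\<^sub>F n in sequentially. norm (g n x - indicator U x) = 0" by (rule eventually_mono) simp
      then show "(\<lambda>n. norm (g n x - indicator U x)) \<longlonglongrightarrow> 0" by (rule tendsto_eventually)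
    qed
  qed (use iU in auto)
  then show "(\<lambda>n. \<integral>z. norm (g n z - indicator U z) \<partial>lborel) \<longlonglongrightarrow> 0" by simp
qed

text \<open>
  Outer regularity of Lebesgue measure approximates the set by open sets.
\<close>

lemma conv_cont_indicator:
  assumes A: "A \<in> sets borel" "emeasure lborel A < \<infinity>"
  shows "continuous_on UNIV (conv (\<lambda>x. indicator A x))"
proof -
  have "\<forall>n. \<exists>U. open U \<and> A \<subseteq> U \<and> emeasure lborel (U - A) < ennreal (1 / real (Suc n))"
    using outer_regular_lborel[OF A(1)] by (metis of_nat_0_less_iff zero_less_Suc zero_less_divide_1_iff)
  then obtain U where U: "\<And>n. open (U n)" "\<And>n. A \<subseteq> U n" "\<And>n. emeasure lborel (U n - A) < ennreal (1 / real (Suc n))"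
    by metis
  have [measurable]: "A \<in> sets borel" "\<And>n. U n \<in> sets borel" using A U by auto
  have fin: "emeasure lborel (U n) < \<infinity>" for n
  proof -
    have "emeasure lborel (U n) \<le> emeasure lborel A + emeasure lborel (U n - A)"
      using emeasure_subadditive[of A lborel "U n - A"] U(2)[of n] by (simp add: Un_absorb1 sup.absorb2)
    also have "\<dots> < \<infinity>" using A(2) U(3)[of n] by (simp add: less_top[symmetric] ) (metis ennreal_less_top order_less_trans less_top)
    finally show ?thesis .
  qed
  show ?thesis
  proof (rule conv_cont_limit)
    show "integrable lborel (\<lambda>x. indicator A x :: complex)" using A by (intro integrable_complex_indicator)
    show "integrable lborel (\<lambda>x. indicator (U n) x :: complex)" for n using fin[of n] by (intro integrable_complex_indicator) auto
    show "continuous_on UNIV (conv (\<lambda>x. indicator (U n) x))" for n by (rule conv_cont_open[OF U(1) fin])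
    have "(\<integral>z. norm (indicator (U n) z - indicator A z :: complex) \<partial>lborel) = measure lborel (U n - A)" for n
    proof -
      have "(\<lambda>z. norm (indicator (U n) z - indicator A z :: complex)) = indicator (U n - A)"
        using U(2)[of n] by (auto simp: indicator_def fun_eq_iff)
      then show ?thesis by simp
    qed
    moreover have "(\<lambda>n. measure lborel (U n - A)) \<longlonglongrightarrow> 0"
    proof (rule real_tendsto_sandwich[of "\<lambda>_. 0" _ _ "\<lambda>n. 1 / real (Suc n)"])
      show "\<forall>\<^sub>F n in sequentially. measure lborel (U n - A) \<le> 1 / real (Suc n)"
        by (auto simp: measure_def simp del: of_nat_Suc intro!: always_eventually enn2real_leI less_imp_le[OF U(3)])
      show "(\<lambda>n. 1 / real (Suc n)) \<longlonglongrightarrow> 0" by (rule LIMSEQ_Suc[OF lim_1_over_n])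
    qed auto
    ultimately show "(\<lambda>n. \<integral>z. norm (indicator (U n) z - indicator A z :: complex) \<partial>lborel) \<longlonglongrightarrow> 0" by simp
  qed
qed

lemma conv_continuous:
  assumes "integrable lborel K"
  shows "continuous_on UNIV (conv K)"
  using assms
proof (induction K rule: integrable_induct)
  case (base A c)
  have "conv (\<lambda>x. indicator A x *\<^sub>R c) = (\<lambda>y. conv (\<lambda>x. indicator A x) y * c)"
    unfolding conv_def[abs_def] integral_mult_left_zero[symmetric]
    by (intro ext Bochner_Integration.integral_cong) (auto simp: indicator_def)
  then show ?case using conv_cont_indicator[of A] base by (auto intro!: continuous_intros)
next
  case (add K L)
  have "conv (\<lambda>x. K x + L x) = (\<lambda>y. conv K y + conv L y)"
    unfolding conv_def[abs_def]
    by (subst Bochner_Integration.integral_add[symmetric, OF conv_integrable[OF add.hyps(1)] conv_integrable[OF add.hyps(2)]])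
       (simp add: distrib_left)
  then show ?case using add by (auto intro!: continuous_intros)
next
  case (lim K s)
  show ?case
  proof (rule conv_cont_limit[OF lim.hyps(4) lim.hyps(1) lim.IH])
    have [measurable]: "K \<in> borel_measurable borel" "\<And>n. s n \<in> borel_measurable borel"
      using lim.hyps(4) lim.hyps(1) by (auto dest: borel_measurable_integrable)
    have "(\<lambda>n. \<integral>z. norm (s n z - K z) \<partial>lborel) \<longlonglongrightarrow> (\<integral>z. (0::real) \<partial>(lborel :: real measure))"
    proof (rule integral_dominated_convergence[where w = "\<lambda>x. 3 * norm (K x)"])
      show "AE x in lborel. norm (norm (s n x - K x)) \<le> 3 * norm (K x)" for n
      proof (rule AE_I2)
        fix x show "norm (norm (s n x - K x)) \<le> 3 * norm (K x)"
          using norm_triangle_ineq4[of "s n x" "K x"] lim.hyps(3)[of x n] by simp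
      qed
      show "AE x in lborel. (\<lambda>n. norm (s n x - K x)) \<longlonglongrightarrow> 0"
        by (intro AE_I2 tendsto_norm_zero) (use lim.hyps(2) in \<open>simp add: LIM_zero_iff\<close>)
    qed (use lim in auto)
    then show "(\<lambda>n. \<integral>z. norm (s n z - K z) \<partial>lborel) \<longlonglongrightarrow> 0" by simp
  qed
qed

lemma conv_fourier:
  assumes K: "integrable lborel K"
  shows "integrable lborel (conv K)" "fourier (conv K) u = fourier f u * fourier K u"
proof -
  have [measurable]: "K \<in> borel_measurable borel" using K by simp
  have fin: "(\<integral>\<^sup>+y. \<integral>\<^sup>+z. ennreal (norm (iexp (u * y) * (f z * K (y - z)))) \<partial>lborel \<partial>lborel) < \<infinity>" for u
  proof -
    have "(\<integral>\<^sup>+y. \<integral>\<^sup>+z. ennreal (norm (iexp (u * y) * (f z * K (y - z)))) \<partial>lborel \<partial>lborel) =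
      (\<integral>\<^sup>+y. \<integral>\<^sup>+z. ennreal (norm (f z)) * ennreal (norm (K (y - z))) \<partial>lborel \<partial>lborel)"
      by (simp only: norm_mult norm_iexp mult_1_left ennreal_mult norm_ge_zero)
    also have "\<dots> = (\<integral>\<^sup>+z. \<integral>\<^sup>+y. ennreal (norm (f z)) * ennreal (norm (K (y - z))) \<partial>lborel \<partial>lborel)"
      by (rule lborel_pair.Fubini') measurable
    also have "\<dots> = (\<integral>\<^sup>+z. ennreal (norm (f z)) * (\<integral>\<^sup>+y. ennreal (norm (K y)) \<partial>lborel) \<partial>lborel)"
    proof (intro nn_integral_cong)
      fix z
      have "(\<integral>\<^sup>+y. ennreal (norm (K y)) \<partial>lborel) = (\<integral>\<^sup>+y. ennreal (norm (K (y - z))) \<partial>lborel)"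
        using nn_integral_real_affine[of "\<lambda>y. ennreal (norm (K y))" 1 "- z"] by simp
      then show "(\<integral>\<^sup>+y. ennreal (norm (f z)) * ennreal (norm (K (y - z))) \<partial>lborel) =
          ennreal (norm (f z)) * (\<integral>\<^sup>+y. ennreal (norm (K y)) \<partial>lborel)"
        by (simp add: nn_integral_cmult)
    qed
    also have "\<dots> = (\<integral>\<^sup>+z. ennreal (norm (f z)) \<partial>lborel) * (\<integral>\<^sup>+y. ennreal (norm (K y)) \<partial>lborel)"
      by (simp add: nn_integral_multc)
    also have "\<dots> < \<infinity>" using f K unfolding integrable_iff_bounded by (simp add: ennreal_mult_less_top)
    finally show ?thesis .
  qed
  have m: "(\<lambda>p. iexp (u * fst p) * (f (snd p) * K (fst p - snd p))) \<in> borel_measurable (lborel \<Otimes>\<^sub>M lborel)" for u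
    by measurable
  note F = fubini_swap[OF lborel.sigma_finite_measure_axioms lborel.sigma_finite_measure_axioms m fin]
  show "integrable lborel (conv K)" using F(2)[of 0] by (simp add: conv_def[abs_def])
  have "fourier (conv K) u = (\<integral>y. \<integral>z. iexp (u * y) * (f z * K (y - z)) \<partial>lborel \<partial>lborel)"
    by (simp add: fourier_def conv_def)
  also have "\<dots> = (\<integral>z. \<integral>y. iexp (u * y) * (f z * K (y - z)) \<partial>lborel \<partial>lborel)" by (rule F(1))
  also have "\<dots> = (\<integral>z. (iexp (u * z) * f z) * fourier K u \<partial>lborel)"
  proof (intro Bochner_Integration.integral_cong refl)
    fix z
    have "(\<integral>y. iexp (u * y) * (f z * K (y - z)) \<partial>lborel) = (\<integral>y. iexp (u * (z + y)) * (f z * K y) \<partial>lborel)"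
      by (subst lborel_integral_real_affine[where c = 1 and t = z]) auto
    also have "(\<lambda>y. iexp (u * (z + y)) * (f z * K y)) = (\<lambda>y. (iexp (u * z) * f z) * (iexp (u * y) * K y))"
      by (simp add: algebra_simps exp_add)
    finally show "(\<integral>y. iexp (u * y) * (f z * K (y - z)) \<partial>lborel) = (iexp (u * z) * f z) * fourier K u"
      by (simp only: fourier_def integral_mult_right_zero)
  qed
  also have "\<dots> = fourier f u * fourier K u" unfolding fourier_def by (simp only: integral_mult_left_zero)
  finally show "fourier (conv K) u = fourier f u * fourier K u" .
qed

text \<open>
  The transform of the convolution is the product of the transforms, and continuity of the convolution
  makes inversion valid at every point.
\<close>

lemma conv_inversion:
  assumes K: "integrable lborel K" and i: "integrable lborel (\<lambda>u. fourier f u * fourier K u)"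
  shows "conv K y = complex_of_real (1 / (2 * pi)) * (\<integral>u. iexp (- (u * y)) * (fourier f u * fourier K u) \<partial>lborel)"
proof -
  have "isCont (conv K) x" for x using conv_continuous[OF K] by (simp add: continuous_on_eq_continuous_at)
  moreover have "fourier (conv K) = (\<lambda>u. fourier f u * fourier K u)"
    by (rule ext) (rule conv_fourier(2)[OF K])
  ultimately show ?thesis
    using fourier_inversion[OF conv_fourier(1)[OF K] _ conv_norm_le[OF K], of y] i by simp
qed

end

section \<open>Mollifiers\<close>

lemma integrable_continuous_Icc_support:
  fixes f :: "real \<Rightarrow> 'b::euclidean_space"
  assumes c: "continuous_on UNIV f" and z: "\<And>x. x \<notin> {a..b} \<Longrightarrow> f x = 0"
  shows "integrable lborel f" "(\<integral>x. f x \<partial>lborel) = integral {a..b} f"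
proof -
  have e: "(\<lambda>x. indicator {a..b} x *\<^sub>R f x) = f" using z by (auto simp: indicator_def fun_eq_iff)
  have i: "integrable lborel (\<lambda>x. indicator {a..b} x *\<^sub>R f x)"
    by (rule borel_integrable_compact) (use c continuous_on_subset in auto)
  then show "integrable lborel f" by (simp only: e)
  have "set_integrable lborel {a..b} f" using i by (simp add: set_integrable_def)
  from set_borel_integral_eq_integral(2)[OF this]
  show "(\<integral>x. f x \<partial>lborel) = integral {a..b} f" by (simp add: set_lebesgue_integral_def e)
qed

lemma test_function_Icc:
  assumes "test_function \<phi>" obtains R where "R > 0" "\<And>x. x \<notin> {-R..R} \<Longrightarrow> \<phi> x = 0"
proof -
  have "bounded (fun_supp \<phi>)" using assms by (simp add: test_function_def compact_imp_bounded)
  then obtain R where R: "R > 0" "\<And>x. x \<in> fun_supp \<phi> \<Longrightarrow> norm x \<le> R" by (metis bounded_pos)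
  have "\<phi> x = 0" if "x \<notin> {-R..R}" for x
  proof (rule fun_supp_outside)
    show "x \<notin> fun_supp \<phi>" using R(2)[of x] that by (auto simp: abs_le_iff)
  qed
  with R(1) show ?thesis using that by blast
qed

lemma test_function_integrable:
  assumes "test_function \<phi>" shows "integrable lborel \<phi>"
proof -
  obtain R where "R > 0" "\<And>x. x \<notin> {-R..R} \<Longrightarrow> \<phi> x = 0" using test_function_Icc[OF assms] by blast
  then show ?thesis
    using smooth_continuous[of \<phi> UNIV 0] assms by (intro integrable_continuous_Icc_support) (auto simp: test_function_smooth)
qed

lemma test_function_integral_deriv:
  assumes "test_function \<phi>" shows "(\<integral>x. nderiv (Suc 0) \<phi> x \<partial>lborel) = 0"
proof -
  obtain R where R: "R > 0" "\<And>x. x \<notin> {-R..R} \<Longrightarrow> \<phi> x = 0" using test_function_Icc[OF assms] by blast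
  have sm: "smooth \<phi>" using assms by (simp add: test_function_smooth)
  have z: "nderiv (Suc 0) \<phi> x = 0" if "x \<notin> {-R..R}" for x
  proof -
    have "fun_supp \<phi> \<subseteq> {-R..R}" by (rule fun_supp_subsetI) (use R in auto)
    then show ?thesis using that nderiv_zero_outside by blast
  qed
  have "(\<integral>x. nderiv (Suc 0) \<phi> x \<partial>lborel) = integral {-R-1..R+1} (nderiv (Suc 0) \<phi>)"
    by (rule integrable_continuous_Icc_support(2)[OF smooth_continuous[OF sm]]) (use z in auto)
  also have "\<dots> = \<phi> (R + 1) - \<phi> (-R-1)"
  proof (rule integral_unique, rule fundamental_theorem_of_calculus)
    show "(\<phi> has_vector_derivative nderiv (Suc 0) \<phi> x) (at x within {-R-1..R+1})" for x
      using smooth_has_deriv[OF sm] has_vector_derivative_at_within by blast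
  qed (use R in auto)
  also have "\<dots> = 0" using R by simp
  finally show ?thesis .
qed

lemma fourier_nderiv:
  assumes "test_function \<phi>"
  shows "fourier (nderiv j \<phi>) u = (- \<i> * u) ^ j * fourier \<phi> u"
proof (induction j)
  case (Suc j)
  define \<psi> where "\<psi> = nderiv j \<phi>"
  have t: "test_function \<psi>" unfolding \<psi>_def by (rule test_function_nderiv[OF assms])
  have sm: "smooth \<psi>" using t by (simp add: test_function_smooth)
  have t': "test_function (nderiv (Suc 0) \<psi>)" by (rule test_function_nderiv[OF t])
  have te: "test_function (\<lambda>x. \<psi> x * iexp (u * x))" by (rule test_function_mult[OF t smooth_iexp])
  have d: "nderiv (Suc 0) (\<lambda>x. \<psi> x * iexp (u * x)) x = iexp (u * x) * nderiv (Suc 0) \<psi> x + \<i> * u * (iexp (u * x) * \<psi> x)" for x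
  proof -
    have "((\<lambda>x. \<psi> x * iexp (u * x)) has_vector_derivative \<psi> x * nderiv (Suc 0) (\<lambda>x. iexp (u * x)) x + nderiv (Suc 0) \<psi> x * iexp (u * x)) (at x)"
      by (intro has_vector_derivative_mult smooth_has_deriv smooth_iexp sm)
    moreover have "nderiv (Suc 0) (\<lambda>x. iexp (u * x)) x = \<i> * u * iexp (u * x)"
      using nderiv_iexp[of "Suc 0" 1 u x] by simp
    ultimately show ?thesis
      by (simp add: nderiv_Suc vector_derivative_at ac_simps)
  qed
  have i1: "integrable lborel (\<lambda>x. iexp (u * x) * nderiv (Suc 0) \<psi> x)"
    by (rule integrable_iexp_mult[OF test_function_integrable[OF t']]) simp
  have i2: "integrable lborel (\<lambda>x. \<i> * u * (iexp (u * x) * \<psi> x))"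
    by (intro integrable_mult_right integrable_iexp_mult[OF test_function_integrable[OF t]]) simp
  have "0 = (\<integral>x. nderiv (Suc 0) (\<lambda>x. \<psi> x * iexp (u * x)) x \<partial>lborel)"
    by (rule test_function_integral_deriv[OF te, symmetric])
  also have "\<dots> = (\<integral>x. iexp (u * x) * nderiv (Suc 0) \<psi> x \<partial>lborel) + (\<integral>x. \<i> * u * (iexp (u * x) * \<psi> x) \<partial>lborel)"
    unfolding d by (rule Bochner_Integration.integral_add[OF i1 i2])
  also have "\<dots> = fourier (nderiv (Suc 0) \<psi>) u + \<i> * u * fourier \<psi> u"
    unfolding fourier_def by (simp only: integral_mult_right_zero)
  finally have "fourier (nderiv (Suc 0) \<psi>) u = - \<i> * u * fourier \<psi> u"
    by (simp add: eq_neg_iff_add_eq_0 add.commute)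
  moreover have "nderiv (Suc 0) \<psi> = nderiv (Suc j) \<phi>" by (simp add: \<psi>_def nderiv_def)
  ultimately show ?case using Suc.IH by (simp add: \<psi>_def)
qed simp

text \<open>
  Differentiation becomes multiplication by \<open>u\<close>, so \<open>u\<^sup>j F\<phi>\<close> and \<open>u\<^sup>j\<^sup>+\<^sup>2 F\<phi>\<close> are bounded, and
  \<open>1/(1 + u\<^sup>2)\<close> is an integrable majorant of \<open>u\<^sup>j F\<phi>\<close> up to a factor.
\<close>

lemma fourier_test_function_moments:
  assumes "test_function \<phi>"
  shows "integrable lborel (\<lambda>u. complex_of_real u ^ j * fourier \<phi> u)"
proof -
  have b: "\<exists>c. \<forall>u. norm (complex_of_real u ^ i * fourier \<phi> u) \<le> c" for i
  proof (rule exI, rule allI)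
    fix u
    have "norm (complex_of_real u ^ i * fourier \<phi> u) = norm (fourier (nderiv i \<phi>) u)"
      unfolding fourier_nderiv[OF assms] by (simp add: norm_mult norm_power)
    also have "\<dots> \<le> (\<integral>x. norm (nderiv i \<phi> x) \<partial>lborel)"
      by (intro fourier_norm_le test_function_integrable test_function_nderiv assms)
    finally show "norm (complex_of_real u ^ i * fourier \<phi> u) \<le> (\<integral>x. norm (nderiv i \<phi> x) \<partial>lborel)" .
  qed
  obtain c0 where c0: "\<And>u. norm (complex_of_real u ^ j * fourier \<phi> u) \<le> c0" using b[of j] by blast
  obtain c2 where c2: "\<And>u. norm (complex_of_real u ^ (j + 2) * fourier \<phi> u) \<le> c2" using b[of "j + 2"] by blast
  have m[measurable]: "fourier \<phi> \<in> borel_measurable borel" by (rule fourier_measurable[OF test_function_integrable[OF assms]])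
  have i: "integrable lborel (\<lambda>u::real. inverse (1 + u\<^sup>2))"
    using integrable_inverse_1_plus_square by (simp add: set_integrable_def)
  show ?thesis
  proof (rule Bochner_Integration.integrable_bound)
    show "integrable lborel (\<lambda>u::real. (c0 + c2) * inverse (1 + u\<^sup>2))" by (rule integrable_mult_right[OF i])
    show "AE u in lborel. norm (complex_of_real u ^ j * fourier \<phi> u) \<le> norm ((c0 + c2) * inverse (1 + u\<^sup>2))"
    proof (rule AE_I2)
      fix u :: real
      have p: "0 < 1 + u\<^sup>2" by (simp add: add_pos_nonneg)
      have nn: "0 \<le> c0 + c2" using order_trans[OF norm_ge_zero c0[of 0]] order_trans[OF norm_ge_zero c2[of 0]] by simp
      have "norm (complex_of_real u ^ j * fourier \<phi> u) * (1 + u\<^sup>2) =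
        norm (complex_of_real u ^ j * fourier \<phi> u) + norm (complex_of_real u ^ (j + 2) * fourier \<phi> u)"
        by (simp add: norm_mult norm_power power_add power2_eq_square algebra_simps)
      also have "\<dots> \<le> c0 + c2" by (intro add_mono c0 c2)
      finally have "norm (complex_of_real u ^ j * fourier \<phi> u) \<le> (c0 + c2) / (1 + u\<^sup>2)"
        using p by (simp add: pos_le_divide_eq)
      then show "norm (complex_of_real u ^ j * fourier \<phi> u) \<le> norm ((c0 + c2) * inverse (1 + u\<^sup>2))"
        using p nn by (simp add: divide_inverse abs_mult)
    qed
  qed measurable
qed

definition moll :: "nat \<Rightarrow> real \<Rightarrow> real" where
  "moll m x = real (Suc m) * bump (real (Suc m) * x) / bump_mass"

lemma moll_nonneg: "0 \<le> moll m x"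
  using bump_nonneg bump_mass_pos by (simp add: moll_def)

lemma moll_zero: "\<bar>x\<bar> \<ge> 1 / real (Suc m) \<Longrightarrow> moll m x = 0"
proof -
  assume "\<bar>x\<bar> \<ge> 1 / real (Suc m)"
  then have "1 \<le> real (Suc m) * \<bar>x\<bar>" by (simp add: divide_le_eq mult.commute)
  then have "1 \<le> \<bar>real (Suc m) * x\<bar>" by (simp add: abs_mult)
  then have "real (Suc m) * x \<le> -1 \<or> real (Suc m) * x \<ge> 1" by linarith
  then show ?thesis unfolding moll_def using bump_zero by simp
qed

lemma moll_zero1: "x \<notin> {-1..1} \<Longrightarrow> moll m x = 0"
proof -
  assume "x \<notin> {-1..1}"
  then have "1 \<le> \<bar>x\<bar>" by auto
  moreover have "1 / real (Suc m) \<le> 1" by simp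
  ultimately show ?thesis by (intro moll_zero) linarith
qed

lemma moll_cont: "continuous_on S (moll m)"
  unfolding moll_def[abs_def]
  by (intro continuous_intros continuous_on_compose2[OF continuous_on_bump[of UNIV]]) (use bump_mass_pos in auto)

lemma moll_meas [measurable]: "moll m \<in> borel_measurable borel"
  using moll_cont by (rule borel_measurable_continuous_onI)

lemma moll_integrable: "integrable lborel (moll m)"
  by (rule integrable_continuous_Icc_support(1)[OF moll_cont]) (rule moll_zero1)

lemma moll_integral: "(\<integral>x. moll m x \<partial>lborel) = 1"
proof -
  have "(\<integral>x. bump x \<partial>lborel) = bump_mass"
    unfolding bump_mass_def by (rule integrable_continuous_Icc_support(2)[OF continuous_on_bump]) (auto intro: bump_zero)
  moreover have "(\<integral>x. bump x \<partial>lborel) = real (Suc m) * (\<integral>x. bump (real (Suc m) * x) \<partial>lborel)"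
    by (subst lborel_integral_real_affine[where c = "real (Suc m)" and t = 0]) auto
  ultimately show ?thesis using bump_mass_pos by (simp add: moll_def[abs_def])
qed

lemma moll_test: "test_function (\<lambda>x. complex_of_real (moll m x))"
proof -
  have "smooth (\<lambda>x. complex_of_real (real (Suc m) / bump_mass) * complex_of_real (bump (real (Suc m) * x + 0)))"
    by (rule smooth_mult[OF smooth_const smooth_affine[OF smooth_bump]])
  then have s: "smooth (\<lambda>x. complex_of_real (moll m x))" by (simp add: moll_def mult.commute mult.left_commute del: of_nat_Suc)
  have "fun_supp (\<lambda>x. complex_of_real (moll m x)) \<subseteq> {-1..1}"
    by (rule fun_supp_subsetI) (auto simp: moll_zero1)
  then show ?thesis using s unfolding test_function_smooth
    by (metis closed_fun_supp compact_Icc compact_Int_closed inf.absorb_iff2)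
qed

lemma moll_fourier_le: "norm (fourier (\<lambda>x. complex_of_real (moll m x)) u) \<le> 1"
proof -
  have "norm (fourier (\<lambda>x. complex_of_real (moll m x)) u) \<le> (\<integral>x. norm (complex_of_real (moll m x)) \<partial>lborel)"
    by (rule fourier_norm_le[OF test_function_integrable[OF moll_test]])
  then show ?thesis by (simp add: moll_nonneg moll_integral)
qed

lemma moll_fourier_tendsto: "(\<lambda>m. fourier (\<lambda>x. complex_of_real (moll m x)) u) \<longlonglongrightarrow> 1"
proof -
  have e: "fourier (\<lambda>x. complex_of_real (moll m x)) u = fourier (\<lambda>x. complex_of_real (moll 0 x)) (u / real (Suc m))" for m
  proof -
    have m0: "moll m x = real (Suc m) * moll 0 (real (Suc m) * x)" for x by (simp add: moll_def)
    have "fourier (\<lambda>x. complex_of_real (moll 0 x)) (u / real (Suc m)) =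
      \<bar>real (Suc m)\<bar> *\<^sub>R (\<integral>x. iexp (u / real (Suc m) * (0 + real (Suc m) * x)) * complex_of_real (moll 0 (0 + real (Suc m) * x)) \<partial>lborel)"
      unfolding fourier_def by (rule lborel_integral_real_affine) simp
    also have "\<dots> = (\<integral>x. \<bar>real (Suc m)\<bar> *\<^sub>R (iexp (u / real (Suc m) * (0 + real (Suc m) * x)) * complex_of_real (moll 0 (0 + real (Suc m) * x))) \<partial>lborel)"
      by (rule integral_scaleR_right[symmetric]) 
    also have "\<dots> = fourier (\<lambda>x. complex_of_real (moll m x)) u"
      unfolding fourier_def m0
      by (intro Bochner_Integration.integral_cong) (auto simp: scaleR_conv_of_real simp del: of_nat_Suc)
    finally show ?thesis by simp
  qed
  have c: "isCont (fourier (\<lambda>x. complex_of_real (moll 0 x))) v" for v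
    unfolding fourier_def[abs_def]
    by (rule fourier_integral_isCont) (auto intro: test_function_integrable moll_test)
  have "(\<lambda>m. u * (1 / real (Suc m))) \<longlonglongrightarrow> u * 0" by (intro tendsto_intros LIMSEQ_Suc[OF lim_1_over_n])
  then have "(\<lambda>m. u / real (Suc m)) \<longlonglongrightarrow> 0" by simp
  from isCont_tendsto_compose[OF c this]
  have "(\<lambda>m. fourier (\<lambda>x. complex_of_real (moll m x)) u) \<longlonglongrightarrow> fourier (\<lambda>x. complex_of_real (moll 0 x)) 0"
    by (simp only: e)
  moreover have "fourier (\<lambda>x. complex_of_real (moll 0 x)) 0 = 1"
    by (simp add: fourier_def moll_integral)
  ultimately show ?thesis by simp
qed

definition mollify :: "nat \<Rightarrow> (real \<Rightarrow> complex) \<Rightarrow> real \<Rightarrow> complex" where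
  "mollify m p x = (\<integral>z. complex_of_real (moll m z) * p (x - z) \<partial>lborel)"

lemma mollify_integrable:
  assumes "continuous_on UNIV p"
  shows "integrable lborel (\<lambda>z. complex_of_real (moll m z) * p (x - z))"
    "mollify m p x = integral {-1..1} (\<lambda>z. complex_of_real (moll m z) * p (x - z))"
proof -
  have c: "continuous_on UNIV (\<lambda>z. complex_of_real (moll m z) * p (x - z))"
    by (intro continuous_intros moll_cont continuous_on_compose2[OF assms]) auto
  show "integrable lborel (\<lambda>z. complex_of_real (moll m z) * p (x - z))"
    by (rule integrable_continuous_Icc_support(1)[OF c, of "-1" 1]) (simp add: moll_zero1)
  show "mollify m p x = integral {-1..1} (\<lambda>z. complex_of_real (moll m z) * p (x - z))"
    unfolding mollify_def by (rule integrable_continuous_Icc_support(2)[OF c]) (simp add: moll_zero1)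
qed

text \<open>
  All mollifiers live on \<open>[-1, 1]\<close>, so this is differentiation under an integral over a compact interval
  with a continuous derivative.
\<close>

lemma mollify_deriv:
  assumes p: "Ck_on (Suc k) UNIV p"
  shows "(mollify m p has_vector_derivative mollify m (nderiv (Suc 0) p) x) (at x)"
proof -
  have c: "continuous_on UNIV p" "continuous_on UNIV (nderiv (Suc 0) p)"
    using p Ck_on_continuous Ck_on_SucD(2) by blast+
  have "((\<lambda>x. integral (cbox (-1) 1) (\<lambda>z. complex_of_real (moll m z) * p (x - z))) has_vector_derivative
      integral (cbox (-1) 1) (\<lambda>z. complex_of_real (moll m z) * nderiv (Suc 0) p (x - z))) (at x within UNIV)"
  proof (rule leibniz_rule_vector_derivative)
    fix x t :: real
    have "((p \<circ> (\<lambda>x. x - t)) has_vector_derivative 1 *\<^sub>R nderiv (Suc 0) p (x - t)) (at x)"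
      by (rule vector_diff_chain_at) (auto intro!: derivative_eq_intros Ck_on_SucD(1)[OF p])
    then show "((\<lambda>x. complex_of_real (moll m t) * p (x - t)) has_vector_derivative
        complex_of_real (moll m t) * nderiv (Suc 0) p (x - t)) (at x within UNIV)"
      unfolding o_def by (intro has_vector_derivative_mult_right) simp
  next
    fix x :: real
    show "(\<lambda>z. complex_of_real (moll m z) * p (x - z)) integrable_on cbox (-1) 1"
      by (intro integrable_continuous continuous_intros moll_cont continuous_on_compose2[OF c(1)]) auto
  next
    show "continuous_on (UNIV \<times> cbox (-1) 1) (\<lambda>(x, t). complex_of_real (moll m t) * nderiv (Suc 0) p (x - t))"
      unfolding case_prod_beta'
      by (intro continuous_intros continuous_on_compose2[OF moll_cont[of UNIV]] continuous_on_compose2[OF c(2)]) auto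
  qed auto
  then show ?thesis
    by (simp add: mollify_integrable(2)[OF c(1), abs_def] mollify_integrable(2)[OF c(2)])
qed

lemma mollify_nderiv:
  "Ck_on k UNIV p \<Longrightarrow> j \<le> k \<Longrightarrow> nderiv j (mollify m p) x = mollify m (nderiv j p) x"
proof (induction j arbitrary: p k)
  case (Suc j)
  then obtain k' where k: "k = Suc k'" "j \<le> k'" by (cases k) auto
  have "nderiv (Suc j) (mollify m p) x = nderiv j (mollify m (nderiv (Suc 0) p)) x"
    by (rule nderiv_SucI[of UNIV]) (use mollify_deriv[OF Suc.prems(1)[unfolded k(1)]] in auto)
  also have "\<dots> = mollify m (nderiv j (nderiv (Suc 0) p)) x"
    by (rule Suc.IH[OF Ck_on_SucD(2)[OF Suc.prems(1)[unfolded k(1)]] k(2)])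
  finally show ?case by (simp add: nderiv_Suc)
qed simp

lemma mollify_uniform_limit:
  assumes p: "continuous_on UNIV p" and V: "bounded V"
  shows "uniform_limit V (\<lambda>m. mollify m p) p sequentially"
proof (rule uniform_limitI)
  fix e :: real assume e: "e > 0"
  obtain R where R: "\<And>x. x \<in> V \<Longrightarrow> \<bar>x\<bar> \<le> R" using V by (metis bounded_iff real_norm_def)
  have "uniformly_continuous_on {-R-1..R+1} p"
    by (rule compact_uniformly_continuous) (use p continuous_on_subset in auto)
  then obtain d where d: "d > 0" "\<And>x y. x \<in> {-R-1..R+1} \<Longrightarrow> y \<in> {-R-1..R+1} \<Longrightarrow> dist y x < d \<Longrightarrow> dist (p y) (p x) < e / 2"
    unfolding uniformly_continuous_on_def using e by (metis half_gt_zero)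
  have "\<forall>\<^sub>F m in sequentially. 1 / real (Suc m) < d"
    using d(1) LIMSEQ_Suc[OF lim_1_over_n] by (intro order_tendstoD(2)) auto
  then show "\<forall>\<^sub>F m in sequentially. \<forall>x\<in>V. dist (mollify m p x) (p x) < e"
  proof (rule eventually_mono, intro ballI)
    fix m x assume m: "1 / real (Suc m) < d" and x: "x \<in> V"
    have i2: "integrable lborel (\<lambda>z. complex_of_real (moll m z) * p x)"
      by (intro integrable_mult_left) (simp add: moll_integrable integrable_of_real)
    have "(\<integral>z. complex_of_real (moll m z) * p x \<partial>lborel) = p x"
      by (simp add: moll_integral)
    then have "mollify m p x - p x = (\<integral>z. complex_of_real (moll m z) * p (x - z) - complex_of_real (moll m z) * p x \<partial>lborel)"
      by (subst Bochner_Integration.integral_diff[OF mollify_integrable(1)[OF p] i2]) (simp add: mollify_def)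
    also have "norm \<dots> \<le> (\<integral>z. moll m z * (e / 2) \<partial>lborel)"
    proof (rule Bochner_Integration.integral_norm_bound_integral)
      show "integrable lborel (\<lambda>z. complex_of_real (moll m z) * p (x - z) - complex_of_real (moll m z) * p x)"
        by (intro Bochner_Integration.integrable_diff mollify_integrable p i2)
      show "integrable lborel (\<lambda>z. moll m z * (e / 2))" by (intro integrable_mult_left moll_integrable)
      fix z
      show "norm (complex_of_real (moll m z) * p (x - z) - complex_of_real (moll m z) * p x) \<le> moll m z * (e / 2)"
      proof (cases "\<bar>z\<bar> \<ge> 1 / real (Suc m)")
        case True then show ?thesis by (simp add: moll_zero)
      next
        case False
        have "1 / real (Suc m) \<le> 1" by simp
        then have z: "\<bar>z\<bar> \<le> 1" "\<bar>z\<bar> < d" using False m by linarith+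
        have "dist (p (x - z)) (p x) < e / 2"
          using R[OF x] z by (intro d(2)) (auto simp: dist_real_def)
        then have "norm (p (x - z) - p x) \<le> e / 2" by (simp add: dist_norm)
        then have "moll m z * norm (p (x - z) - p x) \<le> moll m z * (e / 2)"
          by (intro mult_left_mono moll_nonneg)
        moreover have "norm (complex_of_real (moll m z) * p (x - z) - complex_of_real (moll m z) * p x) = moll m z * norm (p (x - z) - p x)"
          unfolding right_diff_distrib[symmetric] norm_mult using moll_nonneg[of m z] by simp
        ultimately show ?thesis by simp
      qed
    qed
    also have "\<dots> = e / 2" by (simp add: moll_integral)
    finally show "dist (mollify m p x) (p x) < e" using e by (simp add: dist_norm)
  qed
qed

section \<open>The pairing with the smoothed jump measure\<close>

locale jump_measure =
  fixes \<nu> :: "real measure"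
  assumes sets_nu [measurable_cong]: "sets \<nu> = sets borel" and int_nu: "integrable \<nu> (\<lambda>y. y)"
begin

text \<open>
  The total variation \<open>|y| \<nu>(dy)\<close> of \<open>\<mu>\<close>. It is finite even if \<open>\<nu>\<close> is not, and \<open>\<mu>\<close> has density \<open>sgn\<close>
  with respect to it, so that Fubini's theorem is available.
\<close>

definition N :: "real measure" where "N = density \<nu> (\<lambda>y. ennreal \<bar>y\<bar>)"

definition Fmu :: "real \<Rightarrow> complex" where "Fmu u = (\<integral>y. iexp (u * y) * y \<partial>\<nu>)"

lemma sets_N [measurable_cong]: "sets N = sets borel" by (simp add: N_def sets_nu)

lemma finite_N: "finite_measure N"
proof
  have "emeasure N (space N) = (\<integral>\<^sup>+y. ennreal \<bar>y\<bar> \<partial>\<nu>)"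
    unfolding N_def by (subst emeasure_density) (auto intro!: nn_integral_cong)
  also have "\<dots> < \<infinity>" using int_nu by (simp add: integrable_iff_bounded)
  finally show "emeasure N (space N) \<noteq> \<infinity>" by simp
qed

sublocale N: finite_measure N by (rule finite_N)

lemma integral_N_sgn:
  fixes g :: "real \<Rightarrow> complex"
  assumes [measurable]: "g \<in> borel_measurable borel"
  shows "(\<integral>y. g y * complex_of_real (sgn y) \<partial>N) = (\<integral>y. g y * y \<partial>\<nu>)"
proof -
  have "(\<integral>y. g y * complex_of_real (sgn y) \<partial>N) = (\<integral>y. \<bar>y\<bar> *\<^sub>R (g y * complex_of_real (sgn y)) \<partial>\<nu>)"
    unfolding N_def by (rule integral_density) auto
  also have "\<dots> = (\<integral>y. g y * y \<partial>\<nu>)"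
    by (intro Bochner_Integration.integral_cong)
       (auto simp: scaleR_conv_of_real simp flip: of_real_mult simp: abs_mult_sgn mult.left_commute)
  finally show ?thesis .
qed

lemma Fmu_N: "Fmu u = (\<integral>y. iexp (u * y) * complex_of_real (sgn y) \<partial>N)"
  unfolding Fmu_def by (rule integral_N_sgn[symmetric]) measurable

lemma sgn_int: "integrable N (\<lambda>y. complex_of_real (sgn y))"
  by (rule N.integrable_const_bound[where B = 1]) (auto simp: sgn_if)

lemma Fmu_cont: "isCont Fmu u"
  unfolding Fmu_N[abs_def] by (rule fourier_integral_isCont[OF sets_N sgn_int])

lemma Fmu_meas [measurable]: "Fmu \<in> borel_measurable borel"
  by (intro borel_measurable_continuous_onI continuous_at_imp_continuous_on ballI Fmu_cont)

lemma Fmu_le: "norm (Fmu u) \<le> measure N (space N)"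
proof -
  have "norm (Fmu u) \<le> (\<integral>y. 1 \<partial>N)"
    unfolding Fmu_N
    by (rule Bochner_Integration.integral_norm_bound_integral[OF integrable_iexp_mult[OF sgn_int]])
       (auto simp: norm_mult sgn_if)
  then show ?thesis by simp
qed

lemma sf_N: "sigma_finite_measure N" by unfold_locales

end

lemma lborel_integral_reflect:
  fixes g :: "real \<Rightarrow> complex"
  shows "(\<integral>u. g (- u) \<partial>lborel) = (\<integral>u. g u \<partial>lborel)"
  by (subst (2) lborel_integral_real_affine[where c = "-1" and t = 0]) auto

locale jump_kernel = jump_measure +
  fixes k :: "real \<Rightarrow> real" assumes k: "integrable lborel k"
begin

lemma k_meas [measurable]: "k \<in> borel_measurable borel" using k by simp

lemma conv_mu_N: "complex_of_real (conv_mu k \<nu> x) = (\<integral>y. complex_of_real (k (x - y)) * complex_of_real (sgn y) \<partial>N)"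
  by (subst integral_N_sgn) (auto simp: conv_mu_def simp flip: integral_complex_of_real)

lemma nn_bound:
  "(\<integral>\<^sup>+x. \<integral>\<^sup>+y. ennreal (norm (c * (complex_of_real (k (x - y)) * complex_of_real (sgn y)))) \<partial>N \<partial>lborel) < \<infinity>"
proof -
  have "(\<integral>\<^sup>+x. \<integral>\<^sup>+y. ennreal (norm (c * (complex_of_real (k (x - y)) * complex_of_real (sgn y)))) \<partial>N \<partial>lborel) \<le>
    (\<integral>\<^sup>+x. \<integral>\<^sup>+y. ennreal (norm c) * ennreal (norm (k (x - y))) \<partial>N \<partial>lborel)"
    by (intro nn_integral_mono) (auto simp: norm_mult sgn_if ennreal_mult[symmetric])
  also have "\<dots> = (\<integral>\<^sup>+y. \<integral>\<^sup>+x. ennreal (norm c) * ennreal (norm (k (x - y))) \<partial>lborel \<partial>N)"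
  proof -
    interpret pair_sigma_finite lborel N by (intro pair_sigma_finite.intro lborel.sigma_finite_measure_axioms sf_N)
    show ?thesis by (rule Fubini'[symmetric]) measurable
  qed
  also have "\<dots> = (\<integral>\<^sup>+y. ennreal (norm c) * (\<integral>\<^sup>+x. ennreal (norm (k x)) \<partial>lborel) \<partial>N)"
  proof (intro nn_integral_cong)
    fix y
    have "(\<integral>\<^sup>+x. ennreal (norm (k x)) \<partial>lborel) = (\<integral>\<^sup>+x. ennreal (norm (k (x - y))) \<partial>lborel)"
      using nn_integral_real_affine[of "\<lambda>x. ennreal (norm (k x))" 1 "- y"] by simp
    then show "(\<integral>\<^sup>+x. ennreal (norm c) * ennreal (norm (k (x - y))) \<partial>lborel) = ennreal (norm c) * (\<integral>\<^sup>+x. ennreal (norm (k x)) \<partial>lborel)"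
      by (simp add: nn_integral_cmult)
  qed
  also have "\<dots> = ennreal (norm c) * (\<integral>\<^sup>+x. ennreal (norm (k x)) \<partial>lborel) * emeasure N (space N)"
    by simp
  also have "\<dots> < \<infinity>"
    using k N.emeasure_finite[of "space N"] unfolding integrable_iff_bounded by (simp add: ennreal_mult_less_top ennreal_mult_eq_top_iff less_top[symmetric])
  finally show ?thesis .
qed

lemma conv_mu_fubini:
  assumes [measurable]: "f \<in> borel_measurable borel" and fB: "\<And>x. norm (f x) \<le> B"
  shows "(\<integral>x. f x * complex_of_real (conv_mu k \<nu> x) \<partial>lborel) =
      (\<integral>y. (\<integral>x. f x * complex_of_real (k (x - y)) \<partial>lborel) * complex_of_real (sgn y) \<partial>N)"
    and "integrable lborel (\<lambda>x. f x * complex_of_real (conv_mu k \<nu> x))"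
proof -
  have fin: "(\<integral>\<^sup>+x. \<integral>\<^sup>+y. ennreal (norm (f x * (complex_of_real (k (x - y)) * complex_of_real (sgn y)))) \<partial>N \<partial>lborel) < \<infinity>"
  proof (rule order.strict_trans1[OF nn_integral_mono[OF nn_integral_mono] nn_bound[of B]])
    fix x y
    have "norm (f x) \<le> norm (complex_of_real B)" using fB[of x] by simp
    then show "ennreal (norm (f x * (complex_of_real (k (x - y)) * complex_of_real (sgn y)))) \<le>
       ennreal (norm (complex_of_real B * (complex_of_real (k (x - y)) * complex_of_real (sgn y))))"
      unfolding norm_mult by (intro ennreal_leI mult_right_mono) auto
  qed
  have m: "(\<lambda>p. f (fst p) * (complex_of_real (k (fst p - snd p)) * complex_of_real (sgn (snd p)))) \<in> borel_measurable (lborel \<Otimes>\<^sub>M N)"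
    by measurable
  note F = fubini_swap[OF lborel.sigma_finite_measure_axioms sf_N m fin]
  show "(\<integral>x. f x * complex_of_real (conv_mu k \<nu> x) \<partial>lborel) =
      (\<integral>y. (\<integral>x. f x * complex_of_real (k (x - y)) \<partial>lborel) * complex_of_real (sgn y) \<partial>N)"
    unfolding conv_mu_N integral_mult_right_zero[symmetric] F(1)
    by (simp add: mult.assoc[symmetric])
  show "integrable lborel (\<lambda>x. f x * complex_of_real (conv_mu k \<nu> x))"
    using F(2) unfolding conv_mu_N by simp
qed

lemma conv_mu_integrable: "integrable lborel (\<lambda>x. complex_of_real (conv_mu k \<nu> x))"
  using conv_mu_fubini(2)[of "\<lambda>_. 1" 1] by simp

lemma conv_mu_integrable_real: "integrable lborel (conv_mu k \<nu>)"
  using integrable_Re[OF conv_mu_integrable] by simp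

lemma fourier_conv_mu: "fourier (\<lambda>x. complex_of_real (conv_mu k \<nu> x)) u = fourier_real k u * Fmu u"
proof -
  have "fourier (\<lambda>x. complex_of_real (conv_mu k \<nu> x)) u =
     (\<integral>y. (\<integral>x. iexp (u * x) * complex_of_real (k (x - y)) \<partial>lborel) * complex_of_real (sgn y) \<partial>N)"
    unfolding fourier_def by (rule conv_mu_fubini(1)[where B = 1]) auto
  also have "\<dots> = (\<integral>y. fourier_real k u * (iexp (u * y) * complex_of_real (sgn y)) \<partial>N)"
  proof (intro Bochner_Integration.integral_cong refl)
    fix y
    have "(\<integral>x. iexp (u * x) * complex_of_real (k (x - y)) \<partial>lborel) = (\<integral>x. iexp (u * (y + x)) * complex_of_real (k x) \<partial>lborel)"
      by (subst lborel_integral_real_affine[where c = 1 and t = y]) auto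
    also have "(\<lambda>x. iexp (u * (y + x)) * complex_of_real (k x)) = (\<lambda>x. iexp (u * y) * (iexp (u * x) * complex_of_real (k x)))"
      by (simp add: algebra_simps exp_add)
    finally have "(\<integral>x. iexp (u * x) * complex_of_real (k (x - y)) \<partial>lborel) = iexp (u * y) * fourier_real k u"
      unfolding fourier_real_def fourier_def by (simp only: integral_mult_right_zero)
    then show "(\<integral>x. iexp (u * x) * complex_of_real (k (x - y)) \<partial>lborel) * complex_of_real (sgn y) =
        fourier_real k u * (iexp (u * y) * complex_of_real (sgn y))"
      by (simp only: ac_simps)
  qed
  also have "\<dots> = fourier_real k u * Fmu u" unfolding Fmu_N by (rule integral_mult_right_zero)
  finally show ?thesis .
qed

lemma fourier_real_k_meas [measurable]: "fourier_real k \<in> borel_measurable borel"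
  unfolding fourier_real_def by (rule fourier_measurable) (use k in simp)

text \<open>
  Fubini's theorem moves \<open>f\<close> onto the kernel: the inner integral is the convolution of \<open>K\<^sub>h\<close> with the
  reflected \<open>f\<close>, evaluated at the jumps, and inversion turns it into an integral over frequencies.
\<close>

lemma pairing_regular:
  assumes f: "integrable lborel f" "bounded (range f)"
    and A: "integrable lborel (\<lambda>u. fourier_real k u * fourier f (- u))"
  shows "(\<integral>x. f x * complex_of_real (conv_mu k \<nu> x) \<partial>lborel) =
     1 / (2 * complex_of_real pi) * (\<integral>u. fourier f (- u) * fourier_real k u * Fmu u \<partial>lborel)"
proof -
  obtain B where B: "\<And>x. norm (f x) \<le> B" using f(2) by (auto simp: bounded_iff)
  have [measurable]: "f \<in> borel_measurable borel" using f by simp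
  define g where "g = (\<lambda>z. f (- z))"
  have gi: "integrable lborel g"
    unfolding g_def using lborel_integrable_real_affine[OF f(1), of "-1" 0] by simp
  interpret bounded_L1 g B by unfold_locales (use gi B in \<open>auto simp: g_def\<close>)
  have Fg: "fourier g u = fourier f (- u)" for u
    unfolding fourier_def g_def
    by (subst (2) lborel_integral_real_affine[where c = "-1" and t = 0]) auto
  have kc: "integrable lborel (\<lambda>x. complex_of_real (k x))" using k by simp
  have Ai: "integrable lborel (\<lambda>u. fourier g u * fourier (\<lambda>x. complex_of_real (k x)) u)"
    using A by (simp add: Fg fourier_real_def mult.commute)
  have Am[measurable]: "(\<lambda>u. fourier f (- u) * fourier_real k u) \<in> borel_measurable borel"
    using A by (simp add: mult.commute)
  have inner: "(\<integral>x. f x * complex_of_real (k (x - y)) \<partial>lborel) =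
      complex_of_real (1 / (2 * pi)) * (\<integral>u. iexp (u * y) * (fourier f (- u) * fourier_real k u) \<partial>lborel)" for y
  proof -
    have "(\<integral>x. f x * complex_of_real (k (x - y)) \<partial>lborel) = conv (\<lambda>x. complex_of_real (k x)) (- y)"
      unfolding conv_def
      by (subst lborel_integral_real_affine[where c = "-1" and t = 0]) (auto simp: g_def minus_diff_commute)
    also have "\<dots> = complex_of_real (1 / (2 * pi)) * (\<integral>u. iexp (u * y) * (fourier f (- u) * fourier_real k u) \<partial>lborel)"
      using conv_inversion[OF kc Ai, of "- y"] by (simp add: Fg fourier_real_def)
    finally show ?thesis .
  qed
  have "(\<integral>x. f x * complex_of_real (conv_mu k \<nu> x) \<partial>lborel) =
     (\<integral>y. (complex_of_real (1 / (2 * pi)) * (\<integral>u. iexp (u * y) * (fourier f (- u) * fourier_real k u) \<partial>lborel)) * complex_of_real (sgn y) \<partial>N)"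
    by (simp only: conv_mu_fubini(1)[OF \<open>f \<in> borel_measurable borel\<close> B] inner)
  also have "\<dots> = complex_of_real (1 / (2 * pi)) *
     (\<integral>y. \<integral>u. (fourier f (- u) * fourier_real k u) * (iexp (u * y) * complex_of_real (sgn y)) \<partial>lborel \<partial>N)"
    by (simp add: ac_simps flip: integral_mult_right_zero integral_mult_left_zero)
  also have "(\<integral>y. \<integral>u. (fourier f (- u) * fourier_real k u) * (iexp (u * y) * complex_of_real (sgn y)) \<partial>lborel \<partial>N) =
     (\<integral>u. \<integral>y. (fourier f (- u) * fourier_real k u) * (iexp (u * y) * complex_of_real (sgn y)) \<partial>N \<partial>lborel)"
  proof (rule fubini_swap(1)[OF sf_N lborel.sigma_finite_measure_axioms])
    show "(\<lambda>p. (fourier f (- snd p) * fourier_real k (snd p)) * (iexp (snd p * fst p) * complex_of_real (sgn (fst p)))) \<in> borel_measurable (N \<Otimes>\<^sub>M lborel)"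
      using measurable_compose[OF measurable_snd Am[folded measurable_lborel1], of N] by measurable
    have "(\<integral>\<^sup>+y. \<integral>\<^sup>+u. ennreal (norm ((fourier f (- u) * fourier_real k u) * (iexp (u * y) * complex_of_real (sgn y)))) \<partial>lborel \<partial>N) \<le>
       (\<integral>\<^sup>+y. \<integral>\<^sup>+u. ennreal (norm (fourier f (- u) * fourier_real k u)) \<partial>lborel \<partial>N)"
      by (intro nn_integral_mono ennreal_leI) (auto simp: norm_mult sgn_if)
    also have "\<dots> = (\<integral>\<^sup>+u. ennreal (norm (fourier f (- u) * fourier_real k u)) \<partial>lborel) * emeasure N (space N)" by simp
    also have "\<dots> < \<infinity>"
      using A N.emeasure_finite[of "space N"] unfolding integrable_iff_bounded
      by (simp add: ennreal_mult_less_top ennreal_mult_eq_top_iff less_top[symmetric] mult.commute)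
    finally show "(\<integral>\<^sup>+y. \<integral>\<^sup>+u. ennreal (norm ((fourier f (- u) * fourier_real k u) * (iexp (u * y) * complex_of_real (sgn y)))) \<partial>lborel \<partial>N) < \<infinity>" .
  qed
  also have "\<dots> = (\<integral>u. fourier f (- u) * fourier_real k u * Fmu u \<partial>lborel)"
    unfolding integral_mult_right_zero Fmu_N[symmetric] ..
  finally show ?thesis by simp
qed

text \<open>
  With \<open>G\<close> the convolution of kernel and jump measure, \<open>\<eta>\<^sub>m * G\<close> is smooth and has the Fourier
  transform \<open>F\<eta>\<^sub>m FG\<close> with moments of all orders. Near the support of \<open>T\<close> it equals the mollification
  of the \<open>C\<^sup>k\<close> density \<open>g\<close>, since \<open>G = g\<close> almost everywhere there and mollifiers have small support;
  it therefore approximates \<open>g\<close> in \<open>C\<^sup>k\<close>. The values of \<open>T\<close> at \<open>\<eta>\<^sub>m * G\<close> are integrals of \<open>F\<eta>\<^sub>m FG\<close> against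
  the transform of \<open>T\<close>, and \<open>F\<eta>\<^sub>m \<rightarrow> 1\<close> boundedly.
\<close>

lemma pairing_distr:
  assumes T: "distribution T" "compact (dist_supp T)" "has_order T r"
    and A: "integrable lborel (\<lambda>u. fourier_real k u * fourier_fnl (Distr r T) (- u))"
    and P: "has_pairing (Distr r T) lborel (conv_mu k \<nu>) v"
  shows "v = 1 / (2 * complex_of_real pi) * (\<integral>u. fourier_fnl (Distr r T) (- u) * fourier_real k u * Fmu u \<partial>lborel)"
proof -
  obtain D g where D: "open D" "dist_supp T \<subseteq> D" and g: "has_Ck_density_on r D lborel (conv_mu k \<nu>) g"
    and v: "v = dist_apply T r (\<lambda>x. complex_of_real (g x))"
    using P by auto
  define gc where "gc = (\<lambda>x. complex_of_real (g x))"
  define G where "G = (\<lambda>x. complex_of_real (conv_mu k \<nu> x))"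
  have Gi: "integrable lborel G" unfolding G_def by (rule conv_mu_integrable)
  obtain \<zeta> W0 where z: "test_function \<zeta>" "fun_supp \<zeta> \<subseteq> D" "open W0" "dist_supp T \<subseteq> W0"
    "\<And>x. x \<in> W0 \<Longrightarrow> \<zeta> x = 1" using cutoff[OF T(2) D] by blast
  define W where "W = W0 \<inter> D"
  have W: "open W" "dist_supp T \<subseteq> W" "\<And>x. x \<in> W \<Longrightarrow> \<zeta> x = 1" "W \<subseteq> D"
    using z D by (auto simp: W_def)
  \<comment> \<open>multiplied by the cutoff, the density becomes a \<open>C\<^sup>k\<close> function on the whole line\<close>
  define gt where "gt = (\<lambda>x. \<zeta> x * gc x)"
  have gck: "Ck_on r D gc"
    unfolding gc_def using g D(1) by (intro Ck_on_bounded_linear[OF bounded_linear_of_real]) (auto simp: has_Ck_density_on_def)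
  have gtk: "Ck_on r UNIV gt"
  proof -
    have "Ck_on r D gt" unfolding gt_def
      using z(1) by (intro Ck_on_mult[OF D(1)] gck) (auto simp: test_function_smooth smooth_def intro: Ck_on_subset)
    moreover have "Ck_on r (- fun_supp \<zeta>) gt"
      by (rule Ck_on_cong[where f = "\<lambda>_. 0"]) (auto simp: gt_def fun_supp_outside intro: Ck_on_const)
    ultimately have "Ck_on r (D \<union> - fun_supp \<zeta>) gt" using D(1) by (intro Ck_on_Un) auto
    moreover have "D \<union> - fun_supp \<zeta> = UNIV" using z(2) by auto
    ultimately show ?thesis by simp
  qed
  have AEg: "AE x in lborel. x \<in> D \<longrightarrow> conv_mu k \<nu> x = g x"
  proof -
    have [measurable]: "D \<in> sets borel" using D(1) by simp
    have "AE x in lborel. indicator D x * conv_mu k \<nu> x = indicator D x * g x"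
    proof (rule density_unique_real)
      show "integrable lborel (\<lambda>x. indicator D x * conv_mu k \<nu> x)"
        using integrable_mult_indicator[OF _ conv_mu_integrable_real, of D] by simp
      show "integrable lborel (\<lambda>x. indicator D x * g x)"
        using g by (simp add: has_Ck_density_on_def set_integrable_def)
      fix A :: "real set" assume A: "A \<in> sets lborel"
      have "(LINT x:A \<inter> D|lborel. conv_mu k \<nu> x) = (LINT x:A \<inter> D|lborel. g x)"
        using g A by (auto simp: has_Ck_density_on_def)
      then show "(LINT x:A|lborel. indicator D x * conv_mu k \<nu> x) = (LINT x:A|lborel. indicator D x * g x)"
        by (simp add: set_lebesgue_integral_def indicator_inter_arith mult.assoc)
    qed
    then show ?thesis by (rule AE_mp) (auto intro!: AE_I2)
  qed
  obtain d where d: "d > 0" "\<And>x. x \<in> dist_supp T \<Longrightarrow> ball x d \<subseteq> W"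
    using compact_subset_open_imp_ball_epsilon_subset[OF T(2) W(1,2)] by (metis UN_subset_iff)
  \<comment> \<open>a neighbourhood whose points stay in \<open>W\<close> when moved by less than \<open>d/2\<close>\<close>
  define V where "V = (\<Union>x\<in>dist_supp T. ball x (d / 2))"
  have V: "open V" "dist_supp T \<subseteq> V" using d(1) by (auto simp: V_def)
  have VW: "x - y \<in> W" if "x \<in> V" "\<bar>y\<bar> < d / 2" for x y
  proof -
    obtain a where a: "a \<in> dist_supp T" "dist a x < d / 2" using \<open>x \<in> V\<close> by (auto simp: V_def)
    have "dist a (x - y) < d" using a(2) that(2) unfolding dist_real_def by linarith
    then show ?thesis using d(2)[OF a(1)] by auto
  qed
  have VsubW: "x \<in> W" if "x \<in> V" for x using VW[OF that, of 0] d(1) by simp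
  have Vb: "bounded V"
  proof -
    obtain R where R: "\<And>x. x \<in> dist_supp T \<Longrightarrow> \<bar>x\<bar> \<le> R"
      using compact_imp_bounded[OF T(2)] by (metis bounded_iff real_norm_def)
    then have "\<bar>x\<bar> \<le> R + d" if "x \<in> V" for x
    proof -
      obtain a where "a \<in> dist_supp T" "dist a x < d / 2" using \<open>x \<in> V\<close> by (auto simp: V_def)
      then have "\<bar>a\<bar> \<le> R" "\<bar>a - x\<bar> < d / 2" using R by (auto simp: dist_real_def)
      then show ?thesis using d(1) by linarith
    qed
    then show ?thesis by (auto simp: bounded_iff)
  qed
  define \<eta> where "\<eta> = (\<lambda>m x. complex_of_real (moll m x))"
  have te: "test_function (\<eta> m)" for m unfolding \<eta>_def by (rule moll_test)
  define q where "q = (\<lambda>m x. \<integral>w. \<eta> m w * G (x - w) \<partial>lborel)"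
  \<comment> \<open>in terms of the frequency \<open>-u\<close>, because inversion comes with \<open>e\<^sup>-\<^sup>i\<^sup>u\<^sup>x\<close> and the exchange with \<open>e\<^sup>i\<^sup>u\<^sup>x\<close>\<close>
  define Wm where "Wm = (\<lambda>m u. complex_of_real (1 / (2 * pi)) * (fourier (\<eta> m) (- u) * fourier G (- u)))"
  have FG: "fourier G u = fourier_real k u * Fmu u" for u unfolding G_def by (rule fourier_conv_mu)
  have FGm[measurable]: "fourier G \<in> borel_measurable borel" by (rule fourier_measurable[OF Gi])
  have Fem[measurable]: "fourier (\<eta> m) \<in> borel_measurable borel" for m
    by (rule fourier_measurable[OF test_function_integrable[OF te]])
  have mom: "integrable lborel (\<lambda>u. complex_of_real u ^ j * (fourier (\<eta> m) u * fourier G u))" for j m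
  proof (rule Bochner_Integration.integrable_bound)
    define c where "c = (\<integral>x. norm (G x) \<partial>lborel)"
    show "integrable lborel (\<lambda>u. (complex_of_real u ^ j * fourier (\<eta> m) u) * complex_of_real c)"
      by (intro integrable_mult_left fourier_test_function_moments te)
    have "norm (fourier G u) \<le> norm (complex_of_real c)" for u
      using fourier_norm_le[OF Gi, of u] by (simp add: c_def)
    then show "AE u in lborel. norm (complex_of_real u ^ j * (fourier (\<eta> m) u * fourier G u)) \<le>
        norm ((complex_of_real u ^ j * fourier (\<eta> m) u) * complex_of_real c)"
      unfolding norm_mult mult.assoc by (intro AE_I2 mult_left_mono) auto
  qed measurable
  have Wmom: "integrable lborel (\<lambda>u. complex_of_real u ^ j * Wm m u)" for j m
  proof -
    have "integrable lborel (\<lambda>u. complex_of_real (- u) ^ j * (fourier (\<eta> m) (- u) * fourier G (- u)))"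
      using lborel_integrable_real_affine[OF mom[of j m], of "-1" 0] by simp
    then have "integrable lborel (\<lambda>u. ((-1) ^ j * complex_of_real (1 / (2 * pi))) * (complex_of_real (- u) ^ j * (fourier (\<eta> m) (- u) * fourier G (- u))))"
      by (rule integrable_mult_right)
    moreover have "((-1) ^ j * complex_of_real (1 / (2 * pi))) * (complex_of_real (- u) ^ j * (fourier (\<eta> m) (- u) * fourier G (- u))) =
      complex_of_real u ^ j * Wm m u" for u
    proof -
      have e: "complex_of_real (- u) ^ j = (-1) ^ j * complex_of_real u ^ j" by (metis of_real_minus power_minus)
      have s: "(-1 :: complex) ^ j * (-1) ^ j = 1" by (simp flip: power_mult_distrib)
      have "((-1) ^ j * c) * (((-1) ^ j * U) * X) = ((-1) ^ j * (-1) ^ j) * (U * (c * X))" for c U X :: complex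
        by (simp only: ac_simps)
      then show ?thesis unfolding Wm_def e s by (simp only: s mult_1_left)
    qed
    ultimately show ?thesis by simp
  qed
  have q_eq: "q m x = (\<integral>u. iexp (x * u) * Wm m u \<partial>lborel)" for m x
  proof -
    obtain B where B: "\<And>x. norm (\<eta> m x) \<le> B" using test_function_bounded[OF te] by metis
    interpret bounded_L1 "\<eta> m" B by unfold_locales (use test_function_integrable[OF te] B in auto)
    have "q m x = complex_of_real (1 / (2 * pi)) * (\<integral>u. iexp (- (u * x)) * (fourier (\<eta> m) u * fourier G u) \<partial>lborel)"
      using conv_inversion[OF Gi, of x] mom[of 0 m] by (simp add: q_def conv_def)
    also have "(\<integral>u. iexp (- (u * x)) * (fourier (\<eta> m) u * fourier G u) \<partial>lborel) =
      (\<integral>u. iexp (x * u) * (fourier (\<eta> m) (- u) * fourier G (- u)) \<partial>lborel)"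
      by (subst lborel_integral_reflect[symmetric]) (simp add: mult.commute)
    finally show ?thesis unfolding Wm_def by (simp add: mult.left_commute flip: integral_mult_right_zero)
  qed
  have q_smooth: "smooth (q m)" for m
    unfolding q_eq[abs_def] by (rule fourier_moment_smooth(1)[OF Wmom])
  define \<phi> where "\<phi> = (\<lambda>m x. \<zeta> x * q m x)"
  have small: "\<forall>\<^sub>F m in sequentially. 1 / real (Suc m) < d / 2"
    using d(1) LIMSEQ_Suc[OF lim_1_over_n] by (intro order_tendstoD(2)) auto
  have phi_moll: "\<phi> m x = mollify m gt x" if "1 / real (Suc m) < d / 2" "x \<in> V" for m x
  proof -
    have "q m x = mollify m gt x"
      unfolding q_def mollify_def
    proof (rule integral_cong_AE)
      have [measurable]: "gt \<in> borel_measurable borel" using Ck_on_continuous[OF gtk] by (rule borel_measurable_continuous_onI)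
      have [measurable]: "G \<in> borel_measurable borel" "\<eta> m \<in> borel_measurable borel" using Gi test_function_integrable[OF te] by auto
      show "(\<lambda>w. \<eta> m w * G (x - w)) \<in> borel_measurable lborel" by measurable
      show "(\<lambda>z. complex_of_real (moll m z) * gt (x - z)) \<in> borel_measurable lborel" by measurable
      have "AE w in lborel. x + (-1) * w \<in> D \<longrightarrow> conv_mu k \<nu> (x + (-1) * w) = g (x + (-1) * w)"
      proof (rule AE_borel_affine[OF _ _ AEg])
        have "{x \<in> space borel. x \<in> D \<longrightarrow> conv_mu k \<nu> x = g x} = {x. indicator D x * conv_mu k \<nu> x = indicator D x * g x}"
          by (auto simp: indicator_def)
        moreover have "{x. indicator D x * conv_mu k \<nu> x = indicator D x * g x} \<in> sets borel"
        proof -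
          have [measurable]: "conv_mu k \<nu> \<in> borel_measurable borel" using conv_mu_integrable_real by simp
          have [measurable]: "(\<lambda>x. indicator D x * g x) \<in> borel_measurable borel"
            using g by (auto simp: has_Ck_density_on_def set_integrable_def dest: borel_measurable_integrable)
          have [measurable]: "D \<in> sets borel" using D(1) by simp
          show ?thesis by measurable
        qed
        ultimately show "Measurable.pred borel (\<lambda>x. x \<in> D \<longrightarrow> conv_mu k \<nu> x = g x)"
          by (simp add: pred_def)
      qed simp
      then show "AE w in lborel. \<eta> m w * G (x - w) = complex_of_real (moll m w) * gt (x - w)"
      proof (rule AE_mp, intro AE_I2 impI)
        fix w assume a: "x + (-1) * w \<in> D \<longrightarrow> conv_mu k \<nu> (x + (-1) * w) = g (x + (-1) * w)"
        show "\<eta> m w * G (x - w) = complex_of_real (moll m w) * gt (x - w)"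
        proof (cases "\<bar>w\<bar> \<ge> 1 / real (Suc m)")
          case True then show ?thesis by (simp add: \<eta>_def moll_zero)
        next
          case False
          then have "x - w \<in> W" using VW[OF that(2), of w] that(1) by simp
          then show ?thesis using a W by (auto simp: \<eta>_def G_def gt_def gc_def)
        qed
      qed
    qed
    then show ?thesis using W(3)[OF VsubW[OF that(2)]] by (simp add: \<phi>_def)
  qed
  have ap: "Ck_approx T r gc V \<phi>"
    unfolding Ck_approx_def
  proof (intro conjI allI impI)
    show "Ck_on r V gc" by (rule Ck_on_subset[OF gck]) (use VsubW W(4) in auto)
    show "test_function (\<phi> m)" for m unfolding \<phi>_def by (rule test_function_mult[OF z(1) q_smooth])
    fix j assume j: "j \<le> r"
    have gt_eq: "nderiv j gt x = nderiv j gc x" if "x \<in> V" for x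
      by (rule nderiv_cong_open[OF W(1)]) (use W(3) VsubW that in \<open>auto simp: gt_def\<close>)
    have "continuous_on UNIV (nderiv j gt)" using gtk j by (auto simp: Ck_on_def)
    from mollify_uniform_limit[OF this Vb]
    have "uniform_limit V (\<lambda>m. mollify m (nderiv j gt)) (nderiv j gc) sequentially"
      by (rule uniform_limit_cong[THEN iffD1, rotated -1]) (auto simp: gt_eq)
    then show "uniform_limit V (\<lambda>m. nderiv j (\<phi> m)) (nderiv j gc) sequentially"
    proof (rule uniform_limit_cong[THEN iffD1, rotated -1])
      show "\<forall>\<^sub>F m in sequentially. \<forall>x\<in>V. mollify m (nderiv j gt) x = nderiv j (\<phi> m) x"
        using small
      proof (rule eventually_mono, intro ballI)
        fix m x assume "1 / real (Suc m) < d / 2" "x \<in> V"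
        then have "nderiv j (\<phi> m) x = nderiv j (mollify m gt) x"
          by (intro nderiv_cong_open[OF V(1)]) (auto intro: phi_moll)
        then show "mollify m (nderiv j gt) x = nderiv j (\<phi> m) x"
          using mollify_nderiv[OF gtk j] by simp
      qed
    qed auto
  qed (use V in auto)
  define \<tau> where "\<tau> = (\<lambda>u. T (\<lambda>x. \<zeta> x * iexp (u * x)))"
  have tau: "fourier_fnl (Distr r T) u = \<tau> u" for u
    unfolding \<tau>_def fourier_fnl.simps by (rule dist_apply_smooth[OF T smooth_iexp z(1) W(1,2,3)])
  have T\<phi>: "T (\<phi> m) = complex_of_real (1 / (2 * pi)) * (\<integral>u. fourier (\<eta> m) u * (fourier G u * \<tau> (- u)) \<partial>lborel)" for m
  proof -
    have "T (\<phi> m) = (\<integral>u. Wm m u * \<tau> u \<partial>lborel)"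
      unfolding \<phi>_def q_eq \<tau>_def by (rule distribution_fourier_exchange(1)[OF T(1,3) z(1) Wmom])
    also have "\<dots> = (\<integral>u. Wm m (- u) * \<tau> (- u) \<partial>lborel)" by (rule lborel_integral_reflect[symmetric])
    also have "\<dots> = (\<integral>u. complex_of_real (1 / (2 * pi)) * (fourier (\<eta> m) u * (fourier G u * \<tau> (- u))) \<partial>lborel)"
      by (simp add: Wm_def ac_simps)
    finally show ?thesis by (simp only: integral_mult_right_zero)
  qed
  have At: "integrable lborel (\<lambda>u. fourier_real k u * \<tau> (- u))" using A by (simp only: tau)
  have Gt: "integrable lborel (\<lambda>u. fourier G u * \<tau> (- u))"
  proof (rule Bochner_Integration.integrable_bound)
    show "integrable lborel (\<lambda>u. (fourier_real k u * \<tau> (- u)) * complex_of_real (measure N (space N)))"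
      by (rule integrable_mult_left[OF At])
    have [measurable]: "(\<lambda>u. fourier_real k u * \<tau> (- u)) \<in> borel_measurable borel" using At by simp
    have e: "(\<lambda>u. fourier G u * \<tau> (- u)) = (\<lambda>u. (fourier_real k u * \<tau> (- u)) * Fmu u)" by (simp add: FG ac_simps)
    show "(\<lambda>u. fourier G u * \<tau> (- u)) \<in> borel_measurable lborel" unfolding e by measurable
    show "AE u in lborel. norm (fourier G u * \<tau> (- u)) \<le> norm ((fourier_real k u * \<tau> (- u)) * complex_of_real (measure N (space N)))"
      unfolding fun_cong[OF e] norm_mult[of _ "Fmu _"] norm_mult[of _ "complex_of_real _"]
      by (intro AE_I2 mult_left_mono) (use Fmu_le in auto)
  qed
  have l: "(\<lambda>m. \<integral>u. fourier (\<eta> m) u * (fourier G u * \<tau> (- u)) \<partial>lborel) \<longlonglongrightarrow> (\<integral>u. 1 * (fourier G u * \<tau> (- u)) \<partial>lborel)"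
  proof (rule integral_dominated_convergence[where w = "\<lambda>u. norm (fourier G u * \<tau> (- u))"])
    have [measurable]: "(\<lambda>u. fourier G u * \<tau> (- u)) \<in> borel_measurable borel" using Gt by simp
    show "(\<lambda>u. 1 * (fourier G u * \<tau> (- u))) \<in> borel_measurable lborel" by simp
    show "(\<lambda>u. fourier (\<eta> m) u * (fourier G u * \<tau> (- u))) \<in> borel_measurable lborel" for m by measurable
    show "integrable lborel (\<lambda>u. norm (fourier G u * \<tau> (- u)))" by (rule integrable_norm[OF Gt])
    show "AE u in lborel. (\<lambda>m. fourier (\<eta> m) u * (fourier G u * \<tau> (- u))) \<longlonglongrightarrow> 1 * (fourier G u * \<tau> (- u))"
      unfolding \<eta>_def by (intro AE_I2 tendsto_mult tendsto_const moll_fourier_tendsto)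
    show "AE u in lborel. norm (fourier (\<eta> m) u * (fourier G u * \<tau> (- u))) \<le> norm (fourier G u * \<tau> (- u))" for m
    proof (rule AE_I2)
      fix u
      have "norm (fourier (\<eta> m) u) * norm (fourier G u * \<tau> (- u)) \<le> 1 * norm (fourier G u * \<tau> (- u))"
        unfolding \<eta>_def by (intro mult_right_mono moll_fourier_le) simp
      then show "norm (fourier (\<eta> m) u * (fourier G u * \<tau> (- u))) \<le> norm (fourier G u * \<tau> (- u))"
        by (simp only: norm_mult[of "fourier (\<eta> m) u"] mult_1_left)
    qed
  qed
  have "(\<lambda>m. T (\<phi> m)) \<longlonglongrightarrow> complex_of_real (1 / (2 * pi)) * (\<integral>u. 1 * (fourier G u * \<tau> (- u)) \<partial>lborel)"
    unfolding T\<phi> by (rule tendsto_mult[OF tendsto_const l])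
  from dist_apply_eq[OF T ap this]
  have "v = complex_of_real (1 / (2 * pi)) * (\<integral>u. fourier G u * \<tau> (- u) \<partial>lborel)"
    by (simp add: v gc_def)
  also have "(\<lambda>u. fourier G u * \<tau> (- u)) = (\<lambda>u. fourier_fnl (Distr r T) (- u) * fourier_real k u * Fmu u)"
    unfolding tau by (simp add: FG ac_simps)
  finally show ?thesis by simp
qed

end

lemma scaled_integrable:
  assumes "integrable lborel K" "h > 0" shows "integrable lborel (scaled K h)"
proof -
  have "integrable lborel (\<lambda>x. K (0 + (1 / h) * x))"
    by (rule lborel_integrable_real_affine[OF assms(1)]) (use assms(2) in simp)
  then show ?thesis unfolding scaled_def[abs_def] using assms(2) by simp
qed

context jump_measure
begin

theorem pairing_fourier:
  assumes "admissible_functional F" "admissible_kernel F K" and h: "h > 0"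
    and P: "has_pairing F lborel (conv_mu (scaled K h) \<nu>) v"
  shows "v = 1 / (2 * complex_of_real pi) *
    (\<integral>u. fourier_fnl F (- u) * fourier_real (scaled K h) u * Fmu u \<partial>lborel)"
proof -
  have K: "integrable lborel K" using assms(2) by (simp add: admissible_kernel_def)
  interpret jump_kernel \<nu> "scaled K h" by unfold_locales (rule scaled_integrable[OF K h])
  show ?thesis
  proof (cases F)
    case (Regular f)
    then show ?thesis using assms pairing_regular[of f] by (simp add: admissible_kernel_def)
  next
    case (Distr r T)
    then show ?thesis
      using assms pairing_distr[of T r v] by (simp add: admissible_kernel_def del: fourier_fnl.simps has_pairing.simps)
  qed
qed

end

section \<open>The exponent and the moments of the increments\<close>

lemma one_minus_cos_le: "1 - cos x \<le> x\<^sup>2 / 2" for x :: real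
proof -
  have "cos x = 1 - 2 * (sin (x / 2))\<^sup>2" using cos_double_sin[of "x / 2"] by simp
  moreover have "(sin (x / 2))\<^sup>2 \<le> (x / 2)\<^sup>2" using abs_sin_x_le_abs_x[of "x / 2"] by (simp only: abs_le_square_iff)
  ultimately show ?thesis by (simp add: power2_eq_square)
qed

locale levy_measure =
  fixes \<nu> :: "real measure"
  assumes sets_nu [measurable_cong]: "sets \<nu> = sets borel"
    and int1: "integrable \<nu> (\<lambda>y. y)" and int2: "integrable \<nu> (\<lambda>y. y\<^sup>2)"
begin

sublocale jump_measure \<nu> by unfold_locales (rule sets_nu, rule int1)

definition Psi1 :: "real \<Rightarrow> complex" where "Psi1 u = (\<integral>x. iexp (u * x) * (\<i> * x) \<partial>\<nu>)"
definition Psi2 :: "real \<Rightarrow> complex" where "Psi2 u = (\<integral>x. iexp (u * x) * (\<i> * x * (\<i> * x)) \<partial>\<nu>)"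

lemma iexp_m1_int: "integrable \<nu> (\<lambda>x. iexp (u * x) - 1)"
proof (rule Bochner_Integration.integrable_bound)
  show "integrable \<nu> (\<lambda>x. u * x)" by (rule integrable_mult_right[OF int1])
  show "AE x in \<nu>. norm (iexp (u * x) - 1) \<le> norm (u * x)"
  proof (rule AE_I2)
    show "norm (iexp (u * x) - 1) \<le> norm (u * x)" for x using iexp_diff_le[of "u * x" 0] by simp
  qed
qed measurable

lemma Psi_deriv: "(levy_Psi \<nu> has_vector_derivative Psi1 u) (at u)"
proof -
  have "((\<lambda>u. \<integral>x. (iexp (u * x) - 1) * 1 \<partial>\<nu>) has_vector_derivative
     (\<integral>x. iexp (u * x) * (\<i> * x * 1) \<partial>\<nu>)) (at u)"
    by (rule fourier_integral_deriv[OF sets_nu]) (use iexp_m1_int int1 in auto)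
  then show ?thesis by (simp add: levy_Psi_def[abs_def] Psi1_def)
qed

lemma Psi1_deriv: "(Psi1 has_vector_derivative Psi2 u) (at u)"
  unfolding Psi1_def[abs_def] Psi2_def by (rule fourier_integral_second_deriv[OF sets_nu int1 int2])

lemma nderiv_Psi1: "nderiv 1 (levy_Psi \<nu>) = Psi1"
  by (rule ext) (simp add: nderiv_Suc vector_derivative_at[OF Psi_deriv])

lemma nderiv_Psi2: "nderiv 2 (levy_Psi \<nu>) = Psi2"
proof
  fix u
  have "nderiv 2 (levy_Psi \<nu>) u = nderiv (Suc (Suc 0)) (levy_Psi \<nu>) u" by (simp add: numeral_2_eq_2)
  also have "\<dots> = vector_derivative (nderiv (Suc 0) (levy_Psi \<nu>)) (at u)" by (simp only: nderiv_Suc_outer)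
  also have "nderiv (Suc 0) (levy_Psi \<nu>) = Psi1" using nderiv_Psi1 by simp
  finally show "nderiv 2 (levy_Psi \<nu>) u = Psi2 u" by (simp add: vector_derivative_at[OF Psi1_deriv])
qed

lemma Psi1_Fmu: "Psi1 u = \<i> * Fmu u"
  unfolding Psi1_def Fmu_def by (simp add: mult.left_commute flip: integral_mult_right_zero)

lemma Psi1_cont: "isCont Psi1 u" using Psi1_deriv has_vector_derivative_continuous by blast
lemma Psi2_cont: "isCont Psi2 u"
  unfolding Psi2_def[abs_def] by (rule fourier_integral_isCont[OF sets_nu integrable_ix2[OF int2]])

lemma Psi_meas [measurable]: "Psi1 \<in> borel_measurable borel" "Psi2 \<in> borel_measurable borel"
    "levy_Psi \<nu> \<in> borel_measurable borel"
  using Psi1_cont Psi2_cont Psi_deriv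
  by (auto intro!: borel_measurable_continuous_onI continuous_at_imp_continuous_on dest: has_vector_derivative_continuous)

lemma Psi1_bound: "norm (Psi1 u) \<le> (\<integral>y. \<bar>y\<bar> \<partial>\<nu>)"
proof -
  have "norm (Psi1 u) \<le> (\<integral>x. norm (iexp (u * x) * (\<i> * x)) \<partial>\<nu>)" unfolding Psi1_def by (rule integral_norm_bound)
  then show ?thesis by (simp only: norm_mult norm_iexp norm_ii norm_of_real mult_1_left)
qed

lemma Psi2_bound: "norm (Psi2 u) \<le> (\<integral>y. y\<^sup>2 \<partial>\<nu>)"
proof -
  have "norm (Psi2 u) \<le> (\<integral>x. norm (iexp (u * x) * (\<i> * x * (\<i> * x))) \<partial>\<nu>)" unfolding Psi2_def by (rule integral_norm_bound)
  then show ?thesis by (simp only: norm_mult norm_iexp norm_ii norm_of_real mult_1_left) (simp add: power2_eq_square)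
qed

lemma Psi_bound: "norm (levy_Psi \<nu> u) \<le> \<bar>u\<bar> * (\<integral>y. \<bar>y\<bar> \<partial>\<nu>)"
proof -
  have "norm (levy_Psi \<nu> u) \<le> (\<integral>x. \<bar>u\<bar> * \<bar>x\<bar> \<partial>\<nu>)" unfolding levy_Psi_def
  proof (rule Bochner_Integration.integral_norm_bound_integral[OF iexp_m1_int])
    show "integrable \<nu> (\<lambda>x. \<bar>u\<bar> * \<bar>x\<bar>)" by (intro integrable_mult_right integrable_abs int1)
    show "norm (iexp (u * x) - 1) \<le> \<bar>u\<bar> * \<bar>x\<bar>" for x using iexp_diff_le[of "u * x" 0] by (simp add: abs_mult)
  qed
  then show ?thesis by simp
qed

lemma Re_Psi_bound: "- Re (levy_Psi \<nu> u) \<le> u\<^sup>2 / 2 * (\<integral>y. y\<^sup>2 \<partial>\<nu>)"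
proof -
  have "- Re (levy_Psi \<nu> u) = (\<integral>x. 1 - cos (u * x) \<partial>\<nu>)"
    unfolding levy_Psi_def
    by (subst integral_Re[symmetric, OF iexp_m1_int], subst Bochner_Integration.integral_minus[symmetric])
       (auto intro!: Bochner_Integration.integral_cong simp: Re_exp)
  also have "\<dots> \<le> (\<integral>x. u\<^sup>2 / 2 * x\<^sup>2 \<partial>\<nu>)"
  proof (rule integral_mono)
    have "integrable \<nu> (\<lambda>x. - Re (iexp (u * x) - 1))"
      by (intro Bochner_Integration.integrable_minus integrable_Re iexp_m1_int)
    then show "integrable \<nu> (\<lambda>x. 1 - cos (u * x))" by (simp add: Re_exp)
    show "integrable \<nu> (\<lambda>x. u\<^sup>2 / 2 * x\<^sup>2)" by (rule integrable_mult_right[OF int2])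
    show "1 - cos (u * x) \<le> u\<^sup>2 / 2 * x\<^sup>2" for x
      using one_minus_cos_le[of "u * x"] by (simp add: power_mult_distrib)
  qed
  finally show ?thesis by simp
qed

end

locale levy_increment = levy_measure \<nu> + Q: real_distribution Q for \<nu> Q +
  fixes \<Delta> :: real
  assumes Delta_pos: "0 < \<Delta>" and char_Q: "char Q u = exp (complex_of_real \<Delta> * levy_Psi \<nu> u)"
begin

lemma char_nz: "char Q u \<noteq> 0" by (simp add: char_Q)

text \<open>
  Up to a multiple of \<open>|w|\<^sup>2\<close>, \<open>1 - Re e\<^sup>w\<close> equals \<open>- Re w\<close>. For \<open>w = \<Delta> \<Psi>(h)\<close> both are of order \<open>h\<^sup>2\<close>:
  \<open>- Re w \<le> \<Delta> h\<^sup>2 \<integral> y\<^sup>2 \<nu>(dy)\<close> and \<open>|w| \<le> \<Delta> |h| \<integral> |y| \<nu>(dy)\<close>.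
\<close>

lemma char_Re_bound:
  assumes "\<bar>h\<bar> \<le> 1"
  shows "1 - Re (char Q h) \<le> (exp (\<Delta> * (\<integral>y. \<bar>y\<bar> \<partial>\<nu>)) * (\<Delta> * (\<integral>y. \<bar>y\<bar> \<partial>\<nu>))\<^sup>2 + \<Delta> * (\<integral>y. y\<^sup>2 \<partial>\<nu>)) * h\<^sup>2"
proof -
  define m1 where "m1 = (\<integral>y. \<bar>y\<bar> \<partial>\<nu>)"
  define m2 where "m2 = (\<integral>y. y\<^sup>2 \<partial>\<nu>)"
  define w where "w = complex_of_real \<Delta> * levy_Psi \<nu> h"
  have m1: "0 \<le> m1" "0 \<le> m2" by (auto simp: m1_def m2_def)
  have w: "norm w \<le> \<Delta> * m1 * \<bar>h\<bar>"
    using mult_left_mono[OF Psi_bound[of h], of \<Delta>] Delta_pos by (simp add: w_def norm_mult m1_def algebra_simps)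
  have w1: "norm w \<le> \<Delta> * m1" 
  proof -
    have "\<Delta> * m1 * \<bar>h\<bar> \<le> \<Delta> * m1 * 1" using Delta_pos m1 by (intro mult_left_mono assms) simp
    then show ?thesis using w by linarith
  qed
  have "norm (exp w - (\<Sum>k\<le>1. w ^ k / fact k)) \<le> exp \<bar>Re w\<bar> * norm w ^ Suc 1 / fact 1"
    by (rule Taylor_exp)
  then have "norm (exp w - (1 + w)) \<le> exp \<bar>Re w\<bar> * (norm w)\<^sup>2" by (simp add: power2_eq_square)
  also have "\<dots> \<le> exp (\<Delta> * m1) * (\<Delta> * m1 * \<bar>h\<bar>)\<^sup>2"
    using w w1 abs_Re_le_cmod[of w] by (intro mult_mono power_mono) auto
  finally have "norm (exp w - (1 + w)) \<le> exp (\<Delta> * m1) * (\<Delta> * m1)\<^sup>2 * h\<^sup>2" by (simp add: power_mult_distrib mult.assoc)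
  moreover have "1 - Re (exp w) = - Re w - Re (exp w - (1 + w))" by simp
  moreover have "- Re (exp w - (1 + w)) \<le> norm (exp w - (1 + w))" using abs_Re_le_cmod[of "exp w - (1 + w)"] by linarith
  moreover have "- Re w \<le> \<Delta> * m2 * h\<^sup>2"
  proof -
    have "- Re w = \<Delta> * (- Re (levy_Psi \<nu> h))" by (simp add: w_def)
    also have "\<dots> \<le> \<Delta> * (h\<^sup>2 / 2 * m2)" using Re_Psi_bound[of h] Delta_pos by (intro mult_left_mono) (auto simp: m2_def)
    also have "\<dots> \<le> \<Delta> * m2 * h\<^sup>2" using Delta_pos m1 by (simp add: mult_left_mono algebra_simps)
    finally show ?thesis .
  qed
  ultimately show ?thesis unfolding char_Q w_def[symmetric] m1_def[symmetric] m2_def[symmetric] distrib_right by linarith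
qed

text \<open>
  Square integrability of the increments is read off from their characteristic function by Fatou's
  lemma, as \<open>2 (1 - cos (h z)) / h\<^sup>2 \<rightarrow> z\<^sup>2\<close>.
\<close>

lemma second_moment: "integrable Q (\<lambda>z. z\<^sup>2)"
proof -
  define c where "c = exp (\<Delta> * (\<integral>y. \<bar>y\<bar> \<partial>\<nu>)) * (\<Delta> * (\<integral>y. \<bar>y\<bar> \<partial>\<nu>))\<^sup>2 + \<Delta> * (\<integral>y. y\<^sup>2 \<partial>\<nu>)"
  define h where "h = (\<lambda>n. 1 / real (Suc n))"
  have h: "h n > 0" "\<bar>h n\<bar> \<le> 1" for n by (auto simp: h_def)
  have h0: "h \<longlonglongrightarrow> 0" unfolding h_def by (rule LIMSEQ_Suc[OF lim_1_over_n])
  define D where "D = (\<lambda>n z. 2 * (1 - cos (h n * z)) / (h n)\<^sup>2)"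
  have D_nn: "0 \<le> D n z" for n z by (simp add: D_def)
  have D_lim: "(\<lambda>n. D n z) \<longlonglongrightarrow> z\<^sup>2" for z
  proof (cases "z = 0")
    case False
    have e: "D n z = z\<^sup>2 * (sin (h n * z / 2) / (h n * z / 2))\<^sup>2" for n
    proof -
      have "1 - cos (h n * z) = 2 * (sin (h n * z / 2))\<^sup>2" using cos_double_sin[of "h n * z / 2"] by simp
      then show ?thesis using h(1)[of n] False by (simp add: D_def power_divide power_mult_distrib field_simps)
    qed
    have "(\<lambda>n. h n * z / 2) \<longlonglongrightarrow> 0 * z / 2" by (intro tendsto_intros h0) simp
    then have "filterlim (\<lambda>n. h n * z / 2) (at 0) sequentially"
      using h(1) False by (auto simp: filterlim_at less_imp_neq[THEN not_sym])
    from filterlim_compose[OF sinc_at_0 this]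
    have "(\<lambda>n. sin (h n * z / 2) / (h n * z / 2)) \<longlonglongrightarrow> 1" .
    then have "(\<lambda>n. z\<^sup>2 * (sin (h n * z / 2) / (h n * z / 2))\<^sup>2) \<longlonglongrightarrow> z\<^sup>2 * 1\<^sup>2" by (intro tendsto_intros)
    then show ?thesis by (simp add: e)
  qed (simp add: D_def)
  have D_int: "(\<integral>\<^sup>+z. ennreal (D n z) \<partial>Q) \<le> ennreal (2 * c)" for n
  proof -
    have i: "integrable Q (\<lambda>z. iexp (h n * z))" by (rule Q.integrable_iexp) auto
    have i1: "integrable Q (\<lambda>z. cos (h n * z))" using integrable_Re[OF i] by (simp add: Re_exp)
    have ch: "(\<integral>z. cos (h n * z) \<partial>Q) = Re (char Q (h n))"
      unfolding char_def by (subst integral_Re[symmetric, OF i]) (simp add: Re_exp)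
    have iD: "integrable Q (D n)" unfolding D_def by (intro integrable_divide_zero integrable_mult_right Bochner_Integration.integrable_diff i1) auto
    have "(\<integral>z. D n z \<partial>Q) = 2 * (1 - Re (char Q (h n))) / (h n)\<^sup>2"
      using i1 Q.prob_space by (simp add: D_def ch)
    also have "\<dots> \<le> 2 * c"
    proof -
      have "2 * (1 - Re (char Q (h n))) \<le> 2 * c * (h n)\<^sup>2"
        using char_Re_bound[OF h(2)[of n], folded c_def] by simp
      then show ?thesis using h(1)[of n] by (simp add: pos_divide_le_eq)
    qed
    finally have "(\<integral>z. D n z \<partial>Q) \<le> 2 * c" .
    then show ?thesis using nn_integral_eq_integral[OF iD] D_nn by (simp add: ennreal_leI)
  qed
  have "(\<integral>\<^sup>+z. ennreal (z\<^sup>2) \<partial>Q) = (\<integral>\<^sup>+z. liminf (\<lambda>n. ennreal (D n z)) \<partial>Q)"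
    by (intro nn_integral_cong lim_imp_Liminf[symmetric] tendsto_ennrealI D_lim) simp
  also have "\<dots> \<le> liminf (\<lambda>n. \<integral>\<^sup>+z. ennreal (D n z) \<partial>Q)"
    by (rule nn_integral_liminf) (simp add: D_def)
  also have "\<dots> \<le> liminf (\<lambda>n::nat. ennreal (2 * c))" by (intro Liminf_mono always_eventually allI D_int)
  also have "\<dots> = ennreal (2 * c)" by (simp add: Liminf_const)
  finally show ?thesis by (intro integrableI_nonneg) (auto simp: order_le_less_trans)
qed

lemma first_moment: "integrable Q (\<lambda>z. z)"
proof (rule Bochner_Integration.integrable_bound)
  show "integrable Q (\<lambda>z. 1 + z\<^sup>2)" using second_moment by simp
  show "AE z in Q. norm z \<le> norm (1 + z\<^sup>2)"
  proof (rule AE_I2)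
    fix z :: real
    have "0 \<le> (\<bar>z\<bar> - 1)\<^sup>2" by simp
    then have "2 * \<bar>z\<bar> \<le> 1 + z\<^sup>2" by (simp add: power2_eq_square algebra_simps)
    then show "norm z \<le> norm (1 + z\<^sup>2)" by simp
  qed
qed simp

definition phi' :: "real \<Rightarrow> complex" where "phi' u = (\<integral>z. iexp (u * z) * (\<i> * z) \<partial>Q)"
definition phi'' :: "real \<Rightarrow> complex" where "phi'' u = (\<integral>z. iexp (u * z) * (\<i> * z * (\<i> * z)) \<partial>Q)"

lemma char_deriv: "(char Q has_vector_derivative phi' u) (at u)"
proof -
  have "((\<lambda>u. \<integral>x. (iexp (u * x) - 0) * 1 \<partial>Q) has_vector_derivative
     (\<integral>x. iexp (u * x) * (\<i> * x * 1) \<partial>Q)) (at u)"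
    by (rule fourier_integral_deriv) (use Q.integrable_iexp first_moment in auto)
  then show ?thesis by (simp add: char_def[abs_def] phi'_def)
qed

lemma phi'_deriv: "(phi' has_vector_derivative phi'' u) (at u)"
  unfolding phi'_def[abs_def] phi''_def
  by (rule fourier_integral_second_deriv) (simp, rule first_moment, rule second_moment)

text \<open>
  The derivative of \<open>exp(\<Delta> \<Psi>)\<close>, by uniqueness of derivatives.
\<close>

lemma phi'_eq: "phi' u = \<Delta> * Psi1 u * char Q u"
proof -
  have "((\<lambda>u. exp (complex_of_real \<Delta> * levy_Psi \<nu> u)) has_vector_derivative
      (complex_of_real \<Delta> * Psi1 u) * exp (complex_of_real \<Delta> * levy_Psi \<nu> u)) (at u)"
    using field_vector_diff_chain_at[of "\<lambda>u. complex_of_real \<Delta> * levy_Psi \<nu> u" "complex_of_real \<Delta> * Psi1 u" u exp]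
    by (simp add: o_def has_vector_derivative_mult_right[OF Psi_deriv] DERIV_exp)
  then have "(char Q has_vector_derivative (complex_of_real \<Delta> * Psi1 u) * char Q u) (at u)"
    unfolding char_Q[abs_def] .
  then show ?thesis using char_deriv vector_derivative_unique_at by blast
qed

lemma phi''_eq: "phi'' u = (\<Delta> * Psi2 u + \<Delta>\<^sup>2 * (Psi1 u)\<^sup>2) * char Q u"
proof -
  have "((\<lambda>u. \<Delta> * Psi1 u * char Q u) has_vector_derivative (\<Delta> * Psi1 u * phi' u + \<Delta> * Psi2 u * char Q u)) (at u)"
    by (intro has_vector_derivative_mult has_vector_derivative_mult_right Psi1_deriv char_deriv)
  then have "(phi' has_vector_derivative (\<Delta> * Psi1 u * phi' u + \<Delta> * Psi2 u * char Q u)) (at u)"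
    by (simp add: phi'_eq[abs_def])
  then have "phi'' u = \<Delta> * Psi1 u * phi' u + \<Delta> * Psi2 u * char Q u" using phi'_deriv vector_derivative_unique_at by blast
  then show ?thesis by (simp add: phi'_eq power2_eq_square algebra_simps)
qed

lemma phi''_le: "norm (phi'' u) \<le> \<Delta> * norm (Psi2 u) + \<Delta>\<^sup>2 * (norm (Psi1 u))\<^sup>2"
proof -
  have "norm (phi'' u) = norm (\<Delta> * Psi2 u + \<Delta>\<^sup>2 * (Psi1 u)\<^sup>2) * norm (char Q u)" by (simp only: phi''_eq norm_mult)
  also have "\<dots> \<le> norm (\<Delta> * Psi2 u + \<Delta>\<^sup>2 * (Psi1 u)\<^sup>2) * 1" by (intro mult_left_mono Q.cmod_char_le_1) simp
  also have "\<dots> \<le> norm (\<Delta> * Psi2 u) + norm (\<Delta>\<^sup>2 * (Psi1 u)\<^sup>2)" using norm_triangle_ineq by simp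
  also have "\<dots> = \<Delta> * norm (Psi2 u) + \<Delta>\<^sup>2 * (norm (Psi1 u))\<^sup>2" using Delta_pos by (simp add: norm_mult norm_power)
  finally show ?thesis .
qed

end

text \<open>
  Vanishing drift means that \<open>\<gamma>\<close> is the integral of the small jumps, which cancels the compensator in
  the Levy-Khintchine formula and leaves \<open>\<Psi>\<close>.
\<close>

lemma pure_jump_levy_increment:
  assumes "pure_jump_levy M X \<nu>" "0 < \<Delta>"
  shows "levy_increment \<nu> (distr M borel (X \<Delta>)) \<Delta>"
proof -
  obtain \<gamma> where g: "has_levy_triplet M X \<gamma> 0 \<nu>" "\<gamma> - (LINT x:{-1..1}|\<nu>. x) = 0"
    and lp: "levy_process M X" and i1: "set_integrable \<nu> {-1..1} (\<lambda>x. \<bar>x\<bar>)" and i2: "integrable \<nu> (\<lambda>x. x\<^sup>2)"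
    using assms(1) by (auto simp: pure_jump_levy_def)
  have sets[measurable_cong]: "sets \<nu> = sets borel" using g(1) by (simp add: has_levy_triplet_def)
  have int1: "integrable \<nu> (\<lambda>y. y)"
  proof (rule Bochner_Integration.integrable_bound)
    show "integrable \<nu> (\<lambda>x. indicator {-1..1} x *\<^sub>R \<bar>x\<bar> + x\<^sup>2)"
      by (intro Bochner_Integration.integrable_add i1[unfolded set_integrable_def] i2)
    show "AE y in \<nu>. norm y \<le> norm (indicator {-1..1} y *\<^sub>R \<bar>y\<bar> + y\<^sup>2)"
    proof (rule AE_I2)
      fix y :: real
      show "norm y \<le> norm (indicator {-1..1} y *\<^sub>R \<bar>y\<bar> + y\<^sup>2)"
      proof (cases "\<bar>y\<bar> \<le> 1")
        case False
        then have "\<bar>y\<bar> * 1 \<le> \<bar>y\<bar> * \<bar>y\<bar>" by (intro mult_left_mono) auto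
        then show ?thesis using False by (auto simp: indicator_def power2_eq_square)
      qed (auto simp: indicator_def abs_le_iff)
    qed
  qed simp
  interpret levy_measure \<nu> by unfold_locales (fact sets int1 i2)+
  interpret M: prob_space M using lp by (simp add: levy_process_def)
  have X[measurable]: "X \<Delta> \<in> borel_measurable M" using lp assms(2) by (simp add: levy_process_def)
  interpret Q: real_distribution "distr M borel (X \<Delta>)" by (rule M.real_distribution_distr) (rule X)
  have si: "integrable \<nu> (\<lambda>x. indicator {-1..1} x * x)"
    by (rule Bochner_Integration.integrable_bound[OF int1]) (auto simp: indicator_def)
  have "char (distr M borel (X \<Delta>)) u = exp (complex_of_real \<Delta> * levy_Psi \<nu> u)" for u
  proof -
    have "(\<integral>x. iexp (u * x) - 1 - \<i> * complex_of_real (u * x * indicator {-1..1} x) \<partial>\<nu>) =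
       levy_Psi \<nu> u - (\<integral>x. \<i> * complex_of_real (u * x * indicator {-1..1} x) \<partial>\<nu>)"
      unfolding levy_Psi_def
    proof (rule Bochner_Integration.integral_diff[OF iexp_m1_int])
      have "integrable \<nu> (\<lambda>x. \<i> * (complex_of_real u * complex_of_real (indicator {-1..1} x * x)))"
        by (intro integrable_mult_right integrable_of_real si)
      then show "integrable \<nu> (\<lambda>x. \<i> * complex_of_real (u * x * indicator {-1..1} x))" by (simp add: ac_simps)
    qed
    also have "(\<integral>x. \<i> * complex_of_real (u * x * indicator {-1..1} x) \<partial>\<nu>) = \<i> * complex_of_real (u * \<gamma>)"
    proof -
      have "(\<integral>x. \<i> * complex_of_real (u * x * indicator {-1..1} x) \<partial>\<nu>) = (\<integral>x. \<i> * complex_of_real (u * (indicator {-1..1} x * x)) \<partial>\<nu>)"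
        by (simp add: ac_simps)
      also have "\<dots> = \<i> * complex_of_real (u * (\<integral>x. indicator {-1..1} x * x \<partial>\<nu>))"
        by (simp only: integral_mult_right_zero integral_complex_of_real)
      also have "(\<integral>x. indicator {-1..1} x * x \<partial>\<nu>) = \<gamma>" using g(2) by (simp add: set_lebesgue_integral_def)
      finally show ?thesis .
    qed
    finally show ?thesis using g(1) assms(2) by (simp add: has_levy_triplet_def mult.commute)
  qed
  then show ?thesis by unfold_locales (use assms(2) in auto)
qed

section \<open>The truncated inverse of the empirical characteristic function\<close>

text \<open>
  Everything follows from \<open>|a|\<^sup>2 \<le> 2 |x|\<^sup>2 + 2 |x - a|\<^sup>2\<close>. Below the threshold \<open>|x|\<^sup>2 \<le> 1/T\<close> and \<open>y = 0\<close>;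
  above it \<open>1/|x|\<^sup>2 \<le> T\<close>, which is used to remove the random denominator at the price of the fourth
  power of the error.
\<close>

lemma truncated_inverse_error:
  fixes a x :: complex and T :: real
  assumes T: "T > 0" and a: "a \<noteq> 0"
  defines "y \<equiv> if norm x \<ge> T powr (- 1 / 2) then 1 / x else 0"
  shows "(norm (y - 1 / a))\<^sup>2 * norm a ^ 4 \<le> 4 / T + 4 * (norm (x - a))\<^sup>2 + 2 * T * norm (x - a) ^ 4"
    and "(norm y)\<^sup>2 * (norm a)\<^sup>2 \<le> 2 + 2 * T * (norm (x - a))\<^sup>2"
    and "norm y \<le> sqrt T"
proof -
  define t where "t = T powr (- 1 / 2)"
  define d where "d = norm (x - a)"
  have t: "t > 0" "t\<^sup>2 = 1 / T"
  proof -
    show "t > 0" using T by (simp add: t_def)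
    have "t\<^sup>2 = T powr (-1)" unfolding t_def by (simp add: power2_eq_square powr_add[symmetric])
    then show "t\<^sup>2 = 1 / T" using T by (simp add: powr_minus_divide)
  qed
  have na: "norm a > 0" using a by simp
  have d0: "0 \<le> d" by (simp add: d_def)
  have tri: "norm a \<le> norm x + d" unfolding d_def by (metis add.commute norm_minus_commute norm_triangle_sub)
  have sq: "(norm a)\<^sup>2 \<le> 2 * (norm x)\<^sup>2 + 2 * d\<^sup>2"
  proof -
    have "(norm a)\<^sup>2 \<le> (norm x + d)\<^sup>2" using tri by (intro power_mono) auto
    moreover have "0 \<le> (norm x - d)\<^sup>2" by simp
    ultimately show ?thesis by (simp add: power2_eq_square algebra_simps)
  qed
  have nn: "0 \<le> 4 / T" "0 \<le> 4 * d\<^sup>2" "0 \<le> 2 * T * d ^ 4" "0 \<le> 2 * T * d\<^sup>2" using T by auto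
  have "(norm (y - 1 / a))\<^sup>2 * norm a ^ 4 \<le> 4 / T + 4 * d\<^sup>2 + 2 * T * d ^ 4
     \<and> (norm y)\<^sup>2 * (norm a)\<^sup>2 \<le> 2 + 2 * T * d\<^sup>2 \<and> norm y \<le> sqrt T"
  proof (cases "norm x \<ge> t")
    case False
    then have y: "y = 0" by (simp add: y_def t_def)
    have "(norm (y - 1 / a))\<^sup>2 * norm a ^ 4 = (norm a)\<^sup>2"
      using na by (simp add: y norm_divide power_divide power4_eq_xxxx power2_eq_square)
    also have "\<dots> \<le> 4 / T + 4 * d\<^sup>2"
    proof -
      have "(norm x)\<^sup>2 \<le> t\<^sup>2" using False by (intro power_mono) auto
      moreover have "4 / T = 4 * (1 / T)" "0 \<le> 1 / T" "0 \<le> d\<^sup>2" using T by auto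
      ultimately show ?thesis using sq t(2) by linarith
    qed
    finally have "(norm (y - 1 / a))\<^sup>2 * norm a ^ 4 \<le> 4 / T + 4 * d\<^sup>2 + 2 * T * d ^ 4" using nn by linarith
    moreover have "(norm y)\<^sup>2 * (norm a)\<^sup>2 \<le> 2 + 2 * T * d\<^sup>2" "norm y \<le> sqrt T" using nn T by (simp_all add: y)
    ultimately show ?thesis by blast
  next
    case True
    then have x: "norm x > 0" "x \<noteq> 0" using t(1) by auto
    have y: "y = 1 / x" using True by (simp add: y_def t_def)
    have inv: "1 / (norm x)\<^sup>2 \<le> T"
    proof -
      have "t\<^sup>2 \<le> (norm x)\<^sup>2" using True t(1) by (intro power_mono) auto
      then have "1 / T \<le> (norm x)\<^sup>2" using t by simp
      then show ?thesis using T x by (simp add: field_simps)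
    qed
    have "(norm (y - 1 / a))\<^sup>2 * norm a ^ 4 = d\<^sup>2 * (norm a)\<^sup>2 / (norm x)\<^sup>2"
    proof -
      have "y - 1 / a = (a - x) / (x * a)" using x a by (simp add: y field_simps)
      then have e: "norm (y - 1 / a) = d / (norm x * norm a)" by (simp add: norm_divide norm_mult d_def norm_minus_commute)
      show ?thesis unfolding e using na x by (simp add: power_divide power_mult_distrib power4_eq_xxxx power2_eq_square field_simps)
    qed
    also have "\<dots> \<le> d\<^sup>2 * (2 * (norm x)\<^sup>2 + 2 * d\<^sup>2) / (norm x)\<^sup>2"
      by (intro divide_right_mono mult_left_mono sq) auto
    also have "\<dots> = 2 * d\<^sup>2 + 2 * d ^ 4 * (1 / (norm x)\<^sup>2)"
      using x by (simp add: field_simps power4_eq_xxxx power2_eq_square)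
    also have "\<dots> \<le> 2 * d\<^sup>2 + 2 * d ^ 4 * T" by (intro add_left_mono mult_left_mono inv) auto
    also have "\<dots> = 2 * d\<^sup>2 + 2 * T * d ^ 4" by simp
    finally have 1: "(norm (y - 1 / a))\<^sup>2 * norm a ^ 4 \<le> 4 / T + 4 * d\<^sup>2 + 2 * T * d ^ 4"
      using nn by linarith
    have "(norm y)\<^sup>2 * (norm a)\<^sup>2 = (norm a)\<^sup>2 * (1 / (norm x)\<^sup>2)" by (simp add: y norm_divide power_divide)
    also have "\<dots> \<le> (2 * (norm x)\<^sup>2 + 2 * d\<^sup>2) * (1 / (norm x)\<^sup>2)" by (intro mult_right_mono sq) auto
    also have "\<dots> = 2 + 2 * d\<^sup>2 * (1 / (norm x)\<^sup>2)" using x by (simp add: field_simps)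
    also have "\<dots> \<le> 2 + 2 * d\<^sup>2 * T" by (intro add_left_mono mult_left_mono inv) auto
    finally have 2: "(norm y)\<^sup>2 * (norm a)\<^sup>2 \<le> 2 + 2 * T * d\<^sup>2" by (simp add: algebra_simps)
    have "(norm y)\<^sup>2 \<le> T" using inv by (simp add: y norm_divide power_divide)
    then have "norm y \<le> sqrt T" by (simp add: real_le_rsqrt)
    then show ?thesis using 1 2 by simp
  qed
  then show "(norm (y - 1 / a))\<^sup>2 * norm a ^ 4 \<le> 4 / T + 4 * (norm (x - a))\<^sup>2 + 2 * T * norm (x - a) ^ 4"
    "(norm y)\<^sup>2 * (norm a)\<^sup>2 \<le> 2 + 2 * T * (norm (x - a))\<^sup>2" "norm y \<le> sqrt T"
    by (auto simp: d_def)
qed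

text \<open>
  Adding an independent centred variable \<open>W\<close> to the partial sum \<open>S\<close> annihilates all terms of odd order
  in the expansion of \<open>(W + S)\<^sup>4\<close>, so the fourth moment grows by at most \<open>6 E[W\<^sup>2] E[S\<^sup>2] + E[W\<^sup>4]\<close>.
\<close>

lemma (in prob_space) centred_sum_moments:
  fixes W :: "'i \<Rightarrow> 'a \<Rightarrow> real"
  assumes "finite I" "indep_vars (\<lambda>_. borel) W I"
    "\<And>i. i \<in> I \<Longrightarrow> expectation (W i) = 0" "\<And>i \<omega>. i \<in> I \<Longrightarrow> \<bar>W i \<omega>\<bar> \<le> 2"
  shows "expectation (\<lambda>\<omega>. (\<Sum>i\<in>I. W i \<omega>)^2) \<le> 4 * card I \<and>
         expectation (\<lambda>\<omega>. (\<Sum>i\<in>I. W i \<omega>)^4) \<le> 64 * (card I)^2"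
  using assms
proof (induction I rule: finite_induct)
  case empty then show ?case by simp
next
  case (insert i I)
  define S where "S = (\<lambda>\<omega>. \<Sum>i\<in>I. W i \<omega>)"
  have iv: "indep_vars (\<lambda>_. borel) W I" using insert.prems(1) by (rule indep_vars_subset) auto
  have IH: "expectation (\<lambda>\<omega>. S \<omega>^2) \<le> 4 * card I" "expectation (\<lambda>\<omega>. S \<omega>^4) \<le> 64 * (card I)^2"
    using insert.IH[OF iv] insert.prems by (auto simp: S_def)
  have meas: "W j \<in> borel_measurable M" if "j \<in> insert i I" for j
    using insert.prems(1) that by (auto simp: indep_vars_def2)
  then have [measurable]: "W i \<in> borel_measurable M" "S \<in> borel_measurable M"
    by (auto simp: S_def intro!: borel_measurable_sum)
  have Wb: "\<bar>W i \<omega>\<bar> \<le> 2" for \<omega> using insert.prems(3) by simp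
  have Sb: "\<bar>S \<omega>\<bar> \<le> 2 * card I" for \<omega>
  proof -
    have "\<bar>S \<omega>\<bar> \<le> (\<Sum>i\<in>I. \<bar>W i \<omega>\<bar>)" unfolding S_def by (rule sum_abs)
    also have "\<dots> \<le> (\<Sum>i\<in>I. 2)" by (intro sum_mono insert.prems(3)) auto
    finally show ?thesis by simp
  qed
  have ind: "indep_var borel (W i) borel S"
    unfolding S_def by (rule indep_vars_sum[OF insert.hyps(1,2) insert.prems(1)])
  have iW: "integrable M (\<lambda>\<omega>. W i \<omega> ^ p)" for p
    by (rule integrable_const_bound[where B = "2 ^ p"]) (auto simp: power_abs intro!: power_mono Wb)
  have iS: "integrable M (\<lambda>\<omega>. S \<omega> ^ q)" for q
  proof (rule integrable_const_bound[where B = "real (2 * card I) ^ q"], rule AE_I2)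
    show "norm (S \<omega> ^ q) \<le> real (2 * card I) ^ q" for \<omega>
      unfolding real_norm_def power_abs by (intro power_mono Sb abs_ge_zero)
  qed measurable
  have prodE: "expectation (\<lambda>\<omega>. W i \<omega> ^ p * S \<omega> ^ q) = expectation (\<lambda>\<omega>. W i \<omega> ^ p) * expectation (\<lambda>\<omega>. S \<omega> ^ q)"
    and prodI: "integrable M (\<lambda>\<omega>. W i \<omega> ^ p * S \<omega> ^ q)" for p q
  proof -
    have "indep_var borel ((\<lambda>x. x ^ p) \<circ> W i) borel ((\<lambda>x. x ^ q) \<circ> S)" by (rule indep_var_compose[OF ind]) auto
    then have *: "indep_var borel (\<lambda>\<omega>. W i \<omega> ^ p) borel (\<lambda>\<omega>. S \<omega> ^ q)" by (simp add: o_def)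
    show "expectation (\<lambda>\<omega>. W i \<omega> ^ p * S \<omega> ^ q) = expectation (\<lambda>\<omega>. W i \<omega> ^ p) * expectation (\<lambda>\<omega>. S \<omega> ^ q)"
      by (rule indep_var_lebesgue_integral[OF * iW iS])
    show "integrable M (\<lambda>\<omega>. W i \<omega> ^ p * S \<omega> ^ q)" by (rule indep_var_integrable[OF * iW iS])
  qed
  define E where "E = (\<lambda>p q. expectation (\<lambda>\<omega>. W i \<omega> ^ p * S \<omega> ^ q))"
  have E1: "E (Suc 0) q = 0" for q using insert.prems(2)[of i] unfolding E_def prodE by simp
  have ES1: "expectation (\<lambda>\<omega>. S \<omega> ^ Suc 0) = 0"
  proof -
    have "expectation S = (\<Sum>i\<in>I. expectation (W i))"
      unfolding S_def
    proof (rule Bochner_Integration.integral_sum)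
      fix j assume "j \<in> I"
      then show "integrable M (W j)"
        using insert.prems(3) meas by (intro integrable_const_bound[where B = 2]) auto
    qed
    then show ?thesis using insert.prems(2) by simp
  qed
  have EW: "expectation (\<lambda>\<omega>. W i \<omega> ^ 2) \<le> 4" "expectation (\<lambda>\<omega>. W i \<omega> ^ 4) \<le> 16"
  proof -
    have "W i \<omega> ^ 2 \<le> 4" for \<omega> using power_mono[OF Wb[of \<omega>], of 2] by simp
    then have "expectation (\<lambda>\<omega>. W i \<omega> ^ 2) \<le> expectation (\<lambda>\<omega>. 4)" by (intro integral_mono iW) auto
    then show "expectation (\<lambda>\<omega>. W i \<omega> ^ 2) \<le> 4" by (simp add: prob_space)
    have "W i \<omega> ^ 4 \<le> 16" for \<omega> using power_mono[OF Wb[of \<omega>], of 4] by (simp add: power_abs[symmetric] power_even_abs)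
    then have "expectation (\<lambda>\<omega>. W i \<omega> ^ 4) \<le> expectation (\<lambda>\<omega>. 16)" by (intro integral_mono iW) auto
    then show "expectation (\<lambda>\<omega>. W i \<omega> ^ 4) \<le> 16" by (simp add: prob_space)
  qed
  have nn: "0 \<le> expectation (\<lambda>\<omega>. W i \<omega> ^ 2)" "0 \<le> expectation (\<lambda>\<omega>. S \<omega> ^ 2)" by auto
  have x2: "(w + s) ^ 2 = w ^ 2 * s ^ 0 + 2 * (w ^ Suc 0 * s ^ Suc 0) + w ^ 0 * s ^ 2" for w s :: real
    by (simp add: power2_eq_square algebra_simps)
  have x4: "(w + s) ^ 4 = w ^ 4 * s ^ 0 + 4 * (w ^ 3 * s ^ Suc 0) + 6 * (w ^ 2 * s ^ 2) + 4 * (w ^ Suc 0 * s ^ 3) + w ^ 0 * s ^ 4" for w s :: real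
    by (simp add: power4_eq_xxxx power3_eq_cube power2_eq_square algebra_simps)
  have "expectation (\<lambda>\<omega>. (W i \<omega> + S \<omega>) ^ 2) = E 2 0 + 2 * E (Suc 0) (Suc 0) + E 0 2"
    unfolding x2 E_def by (simp only: Bochner_Integration.integral_add Bochner_Integration.integrable_add prodI integrable_mult_right integral_mult_right_zero)
  also have "\<dots> \<le> 4 + 4 * card I"
    using E1 EW IH by (simp add: E_def prob_space)
  finally have e2: "expectation (\<lambda>\<omega>. (W i \<omega> + S \<omega>) ^ 2) \<le> 4 * card (insert i I)" using insert.hyps by simp
  have "expectation (\<lambda>\<omega>. (W i \<omega> + S \<omega>) ^ 4) = E 4 0 + 4 * E 3 (Suc 0) + 6 * E 2 2 + 4 * E (Suc 0) 3 + E 0 4"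
    unfolding x4 E_def by (simp only: Bochner_Integration.integral_add Bochner_Integration.integrable_add prodI integrable_mult_right integral_mult_right_zero)
  also have "\<dots> \<le> 16 + 6 * (4 * (4 * card I)) + 64 * (card I)^2"
  proof -
    have "E 3 (Suc 0) = 0" unfolding E_def prodE ES1 by simp
    moreover have "E 2 2 \<le> 4 * real (4 * card I)" unfolding E_def prodE by (intro mult_mono EW IH nn) simp
    moreover have "E 4 0 \<le> 16" "E 0 4 \<le> 64 * (card I)^2" using EW IH by (auto simp: E_def)
    ultimately show ?thesis using E1[of 3] by simp
  qed
  also have "\<dots> \<le> 64 * (card (insert i I))^2" using insert.hyps by (simp add: power2_eq_square algebra_simps)
  finally have e4: "expectation (\<lambda>\<omega>. (W i \<omega> + S \<omega>) ^ 4) \<le> 64 * (card (insert i I))^2" .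
  show ?case using e2 e4 insert.hyps by (simp add: S_def)
qed

text \<open>
  The variable \<open>Z i\<close> stands for the increment number \<open>i + 1\<close>: the first \<open>n\<close> variables enter the
  empirical characteristic function and the last \<open>n\<close> its derivative.
\<close>

locale levy_sample = levy_increment \<nu> Q \<Delta> + prob_space M for \<nu> Q \<Delta> and M :: "'a measure" +
  fixes Z :: "nat \<Rightarrow> 'a \<Rightarrow> real" and n :: nat
  assumes n1: "1 \<le> n" and indep: "indep_vars (\<lambda>_. borel) Z {..<2 * n}"
    and distr_Z: "\<And>i. i < 2 * n \<Longrightarrow> distr M borel (Z i) = Q"
begin

definition T :: real where "T = \<Delta> * n"

definition ecf :: "'a \<Rightarrow> real \<Rightarrow> complex" where "ecf \<omega> u = (\<Sum>i<n. iexp (u * Z i \<omega>)) / of_nat n"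
definition ecf' :: "'a \<Rightarrow> real \<Rightarrow> complex" where
  "ecf' \<omega> u = (\<Sum>i\<in>{n..<2*n}. \<i> * complex_of_real (Z i \<omega>) * iexp (u * Z i \<omega>)) / of_nat n"
definition inv_ecf :: "'a \<Rightarrow> real \<Rightarrow> complex" where
  "inv_ecf \<omega> u = (if norm (ecf \<omega> u) \<ge> T powr (- 1 / 2) then 1 / ecf \<omega> u else 0)"

lemma T_pos: "T > 0" using Delta_pos n1 by (simp add: T_def)

lemma Z_meas [measurable]: "i < 2 * n \<Longrightarrow> Z i \<in> borel_measurable M"
  using indep by (auto simp: indep_vars_def2)

lemma Z_integral:
  fixes g :: "real \<Rightarrow> complex"
  assumes "i < 2 * n" "g \<in> borel_measurable borel"
  shows "expectation (\<lambda>\<omega>. g (Z i \<omega>)) = (\<integral>z. g z \<partial>Q)"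
    and "integrable M (\<lambda>\<omega>. g (Z i \<omega>)) \<longleftrightarrow> integrable Q g"
proof -
  show "expectation (\<lambda>\<omega>. g (Z i \<omega>)) = (\<integral>z. g z \<partial>Q)"
    unfolding distr_Z[OF assms(1), symmetric] by (rule integral_distr[symmetric]) (use assms in auto)
  show "integrable M (\<lambda>\<omega>. g (Z i \<omega>)) \<longleftrightarrow> integrable Q g"
    unfolding distr_Z[OF assms(1), symmetric] by (rule integrable_distr_eq[symmetric]) (use assms in auto)
qed

lemma Z_integrable_real:
  fixes g :: "real \<Rightarrow> real"
  assumes "i < 2 * n" "g \<in> borel_measurable borel"
  shows "integrable M (\<lambda>\<omega>. g (Z i \<omega>)) \<longleftrightarrow> integrable Q g"
  unfolding distr_Z[OF assms(1), symmetric] by (rule integrable_distr_eq[symmetric]) (use assms in auto)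

lemma sum_deviation_moments:
  fixes g :: "real \<Rightarrow> real"
  assumes g[measurable]: "g \<in> borel_measurable borel" and gb: "\<And>z. \<bar>g z\<bar> \<le> 1"
  shows "expectation (\<lambda>\<omega>. ((\<Sum>i<n. g (Z i \<omega>)) - n * (\<integral>z. g z \<partial>Q))^2) \<le> 4 * n"
    "expectation (\<lambda>\<omega>. ((\<Sum>i<n. g (Z i \<omega>)) - n * (\<integral>z. g z \<partial>Q))^4) \<le> 64 * n^2"
proof -
  define m where "m = (\<integral>z. g z \<partial>Q)"
  define W where "W = (\<lambda>i \<omega>. g (Z i \<omega>) - m)"
  have gi: "integrable Q g" by (rule Q.integrable_const_bound[where B = 1]) (use gb in auto)
  have mb: "\<bar>m\<bar> \<le> 1"
  proof -
    have "\<bar>m\<bar> \<le> (\<integral>z. 1 \<partial>Q)" unfolding m_def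
      by (rule integral_abs_bound_integral) (use gi gb in auto)
    then show ?thesis using Q.prob_space by simp
  qed
  have sum: "(\<Sum>i<n. g (Z i \<omega>)) - n * m = (\<Sum>i<n. W i \<omega>)" for \<omega> by (simp add: W_def sum_subtractf)
  have "indep_vars (\<lambda>_. borel) Z {..<n}" by (rule indep_vars_subset[OF indep]) auto
  then have "indep_vars (\<lambda>_. borel) (\<lambda>i. (\<lambda>z. g z - m) \<circ> Z i) {..<n}" by (rule indep_vars_compose) auto
  then have iW: "indep_vars (\<lambda>_. borel) W {..<n}" by (simp add: W_def o_def)
  have EW: "expectation (W i) = 0" if "i \<in> {..<n}" for i
  proof -
    have i: "i < 2 * n" using that by simp
    have "integrable M (\<lambda>\<omega>. g (Z i \<omega>))" using Z_integrable_real[OF i g] gi by simp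
    moreover have "expectation (\<lambda>\<omega>. g (Z i \<omega>)) = m"
      unfolding m_def distr_Z[OF i, symmetric] by (rule integral_distr[symmetric]) (use i in auto)
    ultimately show ?thesis by (simp add: W_def prob_space)
  qed
  have Wb: "\<bar>W i \<omega>\<bar> \<le> 2" for i \<omega> using gb[of "Z i \<omega>"] mb by (simp add: W_def)
  have "expectation (\<lambda>\<omega>. (\<Sum>i<n. W i \<omega>)^2) \<le> 4 * card {..<n} \<and> expectation (\<lambda>\<omega>. (\<Sum>i<n. W i \<omega>)^4) \<le> 64 * (card {..<n})^2"
    by (rule centred_sum_moments[OF _ iW EW Wb]) auto
  then show "expectation (\<lambda>\<omega>. ((\<Sum>i<n. g (Z i \<omega>)) - n * (\<integral>z. g z \<partial>Q))^2) \<le> 4 * n"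
    "expectation (\<lambda>\<omega>. ((\<Sum>i<n. g (Z i \<omega>)) - n * (\<integral>z. g z \<partial>Q))^4) \<le> 64 * n^2"
    by (simp_all add: m_def[symmetric] sum)
qed

lemma ecf_meas [measurable]: "(\<lambda>\<omega>. ecf \<omega> u) \<in> borel_measurable M"
  unfolding ecf_def by (intro borel_measurable_divide borel_measurable_sum borel_measurable_const) auto

lemma ecf_le: "norm (ecf \<omega> u) \<le> 1"
proof -
  have "norm (\<Sum>i<n. iexp (u * Z i \<omega>)) \<le> (\<Sum>i<n. norm (iexp (u * Z i \<omega>)))" by (rule norm_sum)
  also have "\<dots> = real n" by (simp only: norm_iexp) simp
  finally show ?thesis using n1 unfolding ecf_def norm_divide by (simp add: divide_le_eq)
qed

lemma ecf_error_moments: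
  "expectation (\<lambda>\<omega>. (norm (ecf \<omega> u - char Q u))^2) \<le> 8 / n"
  "expectation (\<lambda>\<omega>. norm (ecf \<omega> u - char Q u) ^ 4) \<le> 256 / n^2"
proof -
  define a where "a = (\<lambda>\<omega>. (\<Sum>i<n. cos (u * Z i \<omega>)) - n * (\<integral>z. cos (u * z) \<partial>Q))"
  define b where "b = (\<lambda>\<omega>. (\<Sum>i<n. sin (u * Z i \<omega>)) - n * (\<integral>z. sin (u * z) \<partial>Q))"
  have i: "integrable Q (\<lambda>z. iexp (u * z))" by (rule Q.integrable_iexp) auto
  have Re: "Re (char Q u) = (\<integral>z. cos (u * z) \<partial>Q)"
    unfolding char_def by (subst integral_Re[symmetric, OF i]) (simp add: Re_exp)
  have Im: "Im (char Q u) = (\<integral>z. sin (u * z) \<partial>Q)"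
    unfolding char_def by (subst integral_Im[symmetric, OF i]) (simp add: Im_exp)
  have am[measurable]: "a \<in> borel_measurable M" "b \<in> borel_measurable M"
    unfolding a_def b_def by (auto intro!: borel_measurable_diff borel_measurable_sum)
  have ab: "\<bar>a \<omega>\<bar> \<le> 2 * n" "\<bar>b \<omega>\<bar> \<le> 2 * n" for \<omega>
  proof -
    have c1: "\<bar>\<Sum>i<n. cos (u * Z i \<omega>)\<bar> \<le> (\<Sum>i<n. 1)" "\<bar>\<Sum>i<n. sin (u * Z i \<omega>)\<bar> \<le> (\<Sum>i<n. 1)"
      by (rule order_trans[OF sum_abs sum_mono]; simp)+
    have "\<bar>\<integral>z. cos (u * z) \<partial>Q\<bar> \<le> 1" "\<bar>\<integral>z. sin (u * z) \<partial>Q\<bar> \<le> 1"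
      using abs_Re_le_cmod[of "char Q u"] abs_Im_le_cmod[of "char Q u"] Q.cmod_char_le_1[of u] unfolding Re Im by linarith+
    then have "\<bar>n * (\<integral>z. cos (u * z) \<partial>Q)\<bar> \<le> n" "\<bar>n * (\<integral>z. sin (u * z) \<partial>Q)\<bar> \<le> n"
      by (simp_all add: abs_mult mult_left_le)
    then show "\<bar>a \<omega>\<bar> \<le> 2 * n" "\<bar>b \<omega>\<bar> \<le> 2 * n" using c1 unfolding a_def b_def by simp_all
  qed
  have ip: "integrable M (\<lambda>\<omega>. a \<omega> ^ p)" "integrable M (\<lambda>\<omega>. b \<omega> ^ p)" for p
  proof -
    have "norm (a \<omega> ^ p) \<le> real (2 * n) ^ p" "norm (b \<omega> ^ p) \<le> real (2 * n) ^ p" for \<omega>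
      unfolding real_norm_def power_abs by (intro power_mono ab abs_ge_zero)+
    then show "integrable M (\<lambda>\<omega>. a \<omega> ^ p)" "integrable M (\<lambda>\<omega>. b \<omega> ^ p)"
      by (intro integrable_const_bound[where B = "real (2 * n) ^ p"] AE_I2; simp)+
  qed
  have mom: "expectation (\<lambda>\<omega>. a \<omega> ^ 2) \<le> 4 * n" "expectation (\<lambda>\<omega>. a \<omega> ^ 4) \<le> 64 * n^2"
     "expectation (\<lambda>\<omega>. b \<omega> ^ 2) \<le> 4 * n" "expectation (\<lambda>\<omega>. b \<omega> ^ 4) \<le> 64 * n^2"
    using sum_deviation_moments[of "\<lambda>z. cos (u * z)"] sum_deviation_moments[of "\<lambda>z. sin (u * z)"]
    unfolding a_def b_def by auto
  have e2: "(norm (ecf \<omega> u - char Q u))^2 = (a \<omega> ^ 2 + b \<omega> ^ 2) / n^2" for \<omega>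
  proof -
    have r: "Re (ecf \<omega> u - char Q u) = a \<omega> / n" "Im (ecf \<omega> u - char Q u) = b \<omega> / n"
      using n1 by (simp_all add: ecf_def a_def b_def Re Im Re_sum Im_sum Re_exp Im_exp Re_divide_of_nat Im_divide_of_nat diff_divide_distrib)
    show ?thesis unfolding cmod_power2 r by (simp add: power_divide add_divide_distrib)
  qed
  have "expectation (\<lambda>\<omega>. (norm (ecf \<omega> u - char Q u))^2) = (expectation (\<lambda>\<omega>. a \<omega> ^ 2) + expectation (\<lambda>\<omega>. b \<omega> ^ 2)) / n^2"
    unfolding e2 using ip by simp
  also have "\<dots> \<le> (real (4 * n) + real (4 * n)) / n^2" by (intro divide_right_mono add_mono mom) auto
  also have "\<dots> = 8 / n" using n1 by (simp add: power2_eq_square)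
  finally show "expectation (\<lambda>\<omega>. (norm (ecf \<omega> u - char Q u))^2) \<le> 8 / n" .
  have e4: "norm (ecf \<omega> u - char Q u) ^ 4 \<le> (2 * a \<omega> ^ 4 + 2 * b \<omega> ^ 4) / n^4" for \<omega>
  proof -
    have "norm (ecf \<omega> u - char Q u) ^ 4 = ((norm (ecf \<omega> u - char Q u))^2)^2" by simp
    also have "\<dots> = (a \<omega> ^ 2 + b \<omega> ^ 2)^2 / n^4" unfolding e2 by (simp add: power_divide)
    also have "\<dots> \<le> (2 * a \<omega> ^ 4 + 2 * b \<omega> ^ 4) / n^4"
    proof (rule divide_right_mono)
      have "0 \<le> (a \<omega> ^ 2 - b \<omega> ^ 2)^2" by simp
      then show "(a \<omega> ^ 2 + b \<omega> ^ 2)^2 \<le> 2 * a \<omega> ^ 4 + 2 * b \<omega> ^ 4"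
        by (simp add: power4_eq_xxxx power2_eq_square algebra_simps)
    qed simp
    finally show ?thesis .
  qed
  have "expectation (\<lambda>\<omega>. norm (ecf \<omega> u - char Q u) ^ 4) \<le> expectation (\<lambda>\<omega>. (2 * a \<omega> ^ 4 + 2 * b \<omega> ^ 4) / n^4)"
  proof (rule integral_mono)
    have "norm (ecf \<omega> u - char Q u) \<le> 2" for \<omega>
      using norm_triangle_ineq4[of "ecf \<omega> u" "char Q u"] ecf_le[of \<omega> u] Q.cmod_char_le_1[of u] by linarith
    then have "norm (norm (ecf \<omega> u - char Q u) ^ 4) \<le> 2 ^ 4" for \<omega>
      using power_mono[OF _ norm_ge_zero, of "ecf \<omega> u - char Q u" 2 4] by simp
    then show "integrable M (\<lambda>\<omega>. norm (ecf \<omega> u - char Q u) ^ 4)"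
      by (intro integrable_const_bound[where B = "2 ^ 4"] AE_I2) simp_all
  qed (use ip e4 in auto)
  also have "\<dots> = (2 * expectation (\<lambda>\<omega>. a \<omega> ^ 4) + 2 * expectation (\<lambda>\<omega>. b \<omega> ^ 4)) / n^4" using ip by simp
  also have "\<dots> \<le> (2 * real (64 * n^2) + 2 * real (64 * n^2)) / n^4" by (intro divide_right_mono add_mono mult_left_mono mom) auto
  also have "\<dots> = 256 / n^2" using n1 by (simp add: power4_eq_xxxx power2_eq_square)
  finally show "expectation (\<lambda>\<omega>. norm (ecf \<omega> u - char Q u) ^ 4) \<le> 256 / n^2" .
qed

lemma inv_ecf_meas [measurable]: "(\<lambda>\<omega>. inv_ecf \<omega> u) \<in> borel_measurable M"
  unfolding inv_ecf_def by measurable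

lemma inv_ecf_le: "norm (inv_ecf \<omega> u) \<le> sqrt T"
  unfolding inv_ecf_def by (rule truncated_inverse_error(3)[OF T_pos char_nz])

text \<open>
  The moment bounds for the empirical characteristic function with \<open>1/n = \<Delta>/T\<close> inserted.
\<close>

definition moment_const :: real where "moment_const = 4 + 32 * \<Delta> + 512 * \<Delta>^2"

lemma inv_ecf_moments:
  "expectation (\<lambda>\<omega>. (norm (inv_ecf \<omega> u - 1 / char Q u))\<^sup>2) * norm (char Q u) ^ 4 \<le> moment_const / T"
  "expectation (\<lambda>\<omega>. (norm (inv_ecf \<omega> u))\<^sup>2) * (norm (char Q u))\<^sup>2 \<le> moment_const"
proof -
  note tb = truncated_inverse_error[OF T_pos char_nz[of u], of "ecf \<omega> u" for \<omega>, folded inv_ecf_def]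
  have b2: "norm (ecf \<omega> u - char Q u) \<le> 2" for \<omega>
    using norm_triangle_ineq4[of "ecf \<omega> u" "char Q u"] ecf_le[of \<omega> u] Q.cmod_char_le_1[of u] by linarith
  have ip: "integrable M (\<lambda>\<omega>. norm (ecf \<omega> u - char Q u) ^ p)" for p
    by (intro integrable_const_bound[where B = "2 ^ p"]) (auto intro!: power_mono b2)
  have iY: "integrable M (\<lambda>\<omega>. (norm (inv_ecf \<omega> u))\<^sup>2)"
    by (intro integrable_const_bound[where B = "(sqrt T)\<^sup>2"]) (auto simp del: real_sqrt_pow2_iff intro!: AE_I2 power_mono inv_ecf_le)
  have iYd: "integrable M (\<lambda>\<omega>. (norm (inv_ecf \<omega> u - 1 / char Q u))\<^sup>2)"
  proof (intro integrable_const_bound[where B = "(sqrt T + norm (1 / char Q u))\<^sup>2"] AE_I2)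
    fix \<omega>
    have "norm (inv_ecf \<omega> u - 1 / char Q u) \<le> sqrt T + norm (1 / char Q u)"
      using norm_triangle_ineq4[of "inv_ecf \<omega> u" "1 / char Q u"] inv_ecf_le[of \<omega> u] by linarith
    then show "norm ((norm (inv_ecf \<omega> u - 1 / char Q u))\<^sup>2) \<le> (sqrt T + norm (1 / char Q u))\<^sup>2"
      by (simp add: power_mono)
  qed measurable
  have nT: "1 / real n = \<Delta> / T" using n1 Delta_pos by (simp add: T_def)
  have "expectation (\<lambda>\<omega>. (norm (inv_ecf \<omega> u - 1 / char Q u))\<^sup>2) * norm (char Q u) ^ 4 =
      expectation (\<lambda>\<omega>. (norm (inv_ecf \<omega> u - 1 / char Q u))\<^sup>2 * norm (char Q u) ^ 4)" by simp
  also have "\<dots> \<le> expectation (\<lambda>\<omega>. 4 / T + 4 * (norm (ecf \<omega> u - char Q u))\<^sup>2 + 2 * T * norm (ecf \<omega> u - char Q u) ^ 4)"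
    by (rule integral_mono) (use tb(1) iYd ip in auto)
  also have "\<dots> = 4 / T + 4 * expectation (\<lambda>\<omega>. (norm (ecf \<omega> u - char Q u))\<^sup>2) + 2 * T * expectation (\<lambda>\<omega>. norm (ecf \<omega> u - char Q u) ^ 4)"
    using ip by (simp add: prob_space)
  also have "\<dots> \<le> 4 / T + 4 * (8 / n) + 2 * T * (256 / n^2)"
    using T_pos by (intro add_mono mult_left_mono ecf_error_moments) auto
  also have "\<dots> = 4 / T + 32 * (1 / n) + 512 * T * (1 / n)^2" by (simp add: power_divide)
  also have "\<dots> = moment_const / T" unfolding nT moment_const_def using T_pos by (simp add: field_simps power2_eq_square)
  finally show "expectation (\<lambda>\<omega>. (norm (inv_ecf \<omega> u - 1 / char Q u))\<^sup>2) * norm (char Q u) ^ 4 \<le> moment_const / T" .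
  have "expectation (\<lambda>\<omega>. (norm (inv_ecf \<omega> u))\<^sup>2) * (norm (char Q u))\<^sup>2 = expectation (\<lambda>\<omega>. (norm (inv_ecf \<omega> u))\<^sup>2 * (norm (char Q u))\<^sup>2)" by simp
  also have "\<dots> \<le> expectation (\<lambda>\<omega>. 2 + 2 * T * (norm (ecf \<omega> u - char Q u))\<^sup>2)"
    by (rule integral_mono) (use tb(2) iY ip in auto)
  also have "\<dots> = 2 + 2 * T * expectation (\<lambda>\<omega>. (norm (ecf \<omega> u - char Q u))\<^sup>2)" using ip by (simp add: prob_space)
  also have "\<dots> \<le> 2 + 2 * T * (8 / n)" using T_pos by (intro add_mono mult_left_mono ecf_error_moments) auto
  also have "\<dots> = 2 + 16 * T * (1 / n)" by simp
  also have "\<dots> = 2 + 16 * \<Delta>" unfolding nT using T_pos by simp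
  also have "\<dots> \<le> moment_const" using Delta_pos by (simp add: moment_const_def)
  finally show "expectation (\<lambda>\<omega>. (norm (inv_ecf \<omega> u))\<^sup>2) * (norm (char Q u))\<^sup>2 \<le> moment_const" .
qed

end

lemma cnj_measurable [measurable (raw)]: "f \<in> borel_measurable M \<Longrightarrow> (\<lambda>x. cnj (f x)) \<in> borel_measurable M"
  by (rule measurable_compose[of f M borel cnj]) (auto intro!: borel_measurable_continuous_onI continuous_intros)

section \<open>Covariance of the estimation error at two frequencies\<close>

text \<open>
  The inequality of the arithmetic and geometric means under the expectation. The weights \<open>a\<close> and \<open>b\<close>
  are the powers of \<open>|\<phi>|\<close> at two frequencies that make the second moments uniformly bounded.
\<close>

lemma (in prob_space) scaled_covariance_le:
  fixes f g :: "'a \<Rightarrow> complex"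
  assumes [measurable]: "f \<in> borel_measurable M" "g \<in> borel_measurable M"
    and bd: "\<And>\<omega>. norm (f \<omega>) \<le> A" "\<And>\<omega>. norm (g \<omega>) \<le> B"
    and m: "expectation (\<lambda>\<omega>. (norm (f \<omega>))\<^sup>2) * a\<^sup>2 \<le> c" "expectation (\<lambda>\<omega>. (norm (g \<omega>))\<^sup>2) * b\<^sup>2 \<le> c"
    and ab: "0 \<le> a" "0 \<le> b"
  shows "a * b * norm (expectation (\<lambda>\<omega>. f \<omega> * cnj (g \<omega>))) \<le> c"
proof -
  have sq: "integrable M (\<lambda>\<omega>. (norm (h \<omega>))\<^sup>2)" if "h \<in> borel_measurable M" "\<And>\<omega>. norm (h \<omega>) \<le> C" for h :: "'a \<Rightarrow> complex" and C
  proof (intro integrable_const_bound[where B = "C\<^sup>2"] AE_I2)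
    show "norm ((norm (h \<omega>))\<^sup>2) \<le> C\<^sup>2" for \<omega>
      using power_mono[OF that(2) norm_ge_zero, of \<omega> 2] by (simp only: real_norm_def power_abs abs_norm_cancel)
  qed (use that(1) in measurable)
  have i2: "integrable M (\<lambda>\<omega>. (norm (f \<omega>))\<^sup>2)" "integrable M (\<lambda>\<omega>. (norm (g \<omega>))\<^sup>2)"
    by (rule sq[of _ A] sq[of _ B]; simp add: bd)+
  have i1: "integrable M (\<lambda>\<omega>. f \<omega> * cnj (g \<omega>))"
  proof (intro integrable_const_bound[where B = "A * B"] AE_I2)
    have "0 \<le> A" using order_trans[OF norm_ge_zero bd(1)] .
    then show "norm (f \<omega> * cnj (g \<omega>)) \<le> A * B" for \<omega>
      unfolding norm_mult complex_mod_cnj by (intro mult_mono bd) auto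
  qed measurable
  have "a * b * norm (expectation (\<lambda>\<omega>. f \<omega> * cnj (g \<omega>))) \<le> a * b * expectation (\<lambda>\<omega>. norm (f \<omega> * cnj (g \<omega>)))"
    using ab by (intro mult_left_mono integral_norm_bound) auto
  also have "\<dots> = expectation (\<lambda>\<omega>. a * norm (f \<omega>) * (b * norm (g \<omega>)))"
    by (simp add: norm_mult ac_simps flip: integral_mult_right_zero)
  also have "\<dots> \<le> expectation (\<lambda>\<omega>. ((norm (f \<omega>))\<^sup>2 * a\<^sup>2 + (norm (g \<omega>))\<^sup>2 * b\<^sup>2) / 2)"
  proof (rule integral_mono)
    have "integrable M (\<lambda>\<omega>. a * b * norm (f \<omega> * cnj (g \<omega>)))"
      by (intro integrable_mult_right integrable_norm i1)
    then show "integrable M (\<lambda>\<omega>. a * norm (f \<omega>) * (b * norm (g \<omega>)))" by (simp add: norm_mult ac_simps)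
    show "integrable M (\<lambda>\<omega>. ((norm (f \<omega>))\<^sup>2 * a\<^sup>2 + (norm (g \<omega>))\<^sup>2 * b\<^sup>2) / 2)" using i2 by auto
    show "a * norm (f \<omega>) * (b * norm (g \<omega>)) \<le> ((norm (f \<omega>))\<^sup>2 * a\<^sup>2 + (norm (g \<omega>))\<^sup>2 * b\<^sup>2) / 2" for \<omega>
      using sum_squares_bound[of "a * norm (f \<omega>)" "b * norm (g \<omega>)"] by (simp add: power_mult_distrib ac_simps)
  qed
  also have "\<dots> = (expectation (\<lambda>\<omega>. (norm (f \<omega>))\<^sup>2) * a\<^sup>2 + expectation (\<lambda>\<omega>. (norm (g \<omega>))\<^sup>2) * b\<^sup>2) / 2"
    using i2 by simp
  also have "\<dots> \<le> c"
  proof -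
    have "(x + y) / 2 \<le> z" if "x \<le> z" "y \<le> z" for x y z :: real using that by simp
    then show ?thesis using m by blast
  qed
  finally show ?thesis .
qed

context levy_sample
begin

lemma block_independence:
  fixes f g :: "(nat \<Rightarrow> real) \<Rightarrow> complex"
  assumes f: "f \<in> borel_measurable (PiM {..<n} (\<lambda>_. borel))" and g: "g \<in> borel_measurable (PiM {n..<2*n} (\<lambda>_. borel))"
    and F: "\<And>\<omega>. F \<omega> = f (restrict (\<lambda>i. Z i \<omega>) {..<n})" and G: "\<And>\<omega>. G \<omega> = g (restrict (\<lambda>i. Z i \<omega>) {n..<2*n})"
    and i: "integrable M F" "integrable M G"
  shows "expectation (\<lambda>\<omega>. F \<omega> * G \<omega>) = expectation F * expectation G" "integrable M (\<lambda>\<omega>. F \<omega> * G \<omega>)"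
proof -
  have "indep_var (PiM {..<n} (\<lambda>_. borel)) (\<lambda>\<omega>. restrict (\<lambda>i. Z i \<omega>) {..<n})
       (PiM {n..<2*n} (\<lambda>_. borel)) (\<lambda>\<omega>. restrict (\<lambda>i. Z i \<omega>) {n..<2*n})"
    by (rule indep_var_restrict[OF indep]) auto
  from indep_var_compose[OF this f g]
  have "indep_var borel F borel G" unfolding o_def F[symmetric] G[symmetric] .
  from indep_var_lebesgue_integral[OF this i] indep_var_integrable[OF this i]
  show "expectation (\<lambda>\<omega>. F \<omega> * G \<omega>) = expectation F * expectation G" "integrable M (\<lambda>\<omega>. F \<omega> * G \<omega>)" .
qed

text \<open>
  The only random factor that depends on the second half of the sample; it is centred.
\<close>

definition ecf'_error :: "'a \<Rightarrow> real \<Rightarrow> complex" where "ecf'_error \<omega> u = ecf' \<omega> u - phi' u"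
definition summand :: "nat \<Rightarrow> 'a \<Rightarrow> real \<Rightarrow> complex" where
  "summand i \<omega> u = \<i> * complex_of_real (Z i \<omega>) * iexp (u * Z i \<omega>) - phi' u"

lemma ecf'_error_sum: "ecf'_error \<omega> u = (\<Sum>i\<in>{n..<2*n}. summand i \<omega> u) / of_nat n"
  using n1 by (simp add: ecf'_error_def ecf'_def summand_def sum_subtractf diff_divide_distrib)

lemma summand_meas [measurable]: "i < 2 * n \<Longrightarrow> (\<lambda>\<omega>. summand i \<omega> u) \<in> borel_measurable M"
  unfolding summand_def by measurable

lemma Z_square_integrable: "i < 2 * n \<Longrightarrow> integrable M (\<lambda>\<omega>. (Z i \<omega>)\<^sup>2)"
  using Z_integrable_real[of i "\<lambda>z. z\<^sup>2"] second_moment by simp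

lemma iexp_iz_int: "integrable Q (\<lambda>z. \<i> * complex_of_real z * iexp (u * z))"
proof -
  have "(\<lambda>z. u * z) \<in> borel_measurable Q" by measurable
  from integrable_iexp_mult[OF integrable_ix[OF first_moment] this] show ?thesis by (simp add: mult.commute)
qed

lemma summand_mean: assumes i: "i < 2 * n"
  shows "integrable M (\<lambda>\<omega>. summand i \<omega> u)" "expectation (\<lambda>\<omega>. summand i \<omega> u) = 0"
proof -
  have m: "(\<lambda>z. \<i> * complex_of_real z * iexp (u * z)) \<in> borel_measurable borel" by measurable
  have a: "integrable M (\<lambda>\<omega>. \<i> * complex_of_real (Z i \<omega>) * iexp (u * Z i \<omega>))"
    using Z_integral(2)[OF i m] iexp_iz_int by simp
  then show "integrable M (\<lambda>\<omega>. summand i \<omega> u)" unfolding summand_def by (intro Bochner_Integration.integrable_diff) auto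
  have "expectation (\<lambda>\<omega>. \<i> * complex_of_real (Z i \<omega>) * iexp (u * Z i \<omega>)) = phi' u"
    unfolding Z_integral(1)[OF i m] phi'_def by (simp only: mult.commute)
  then show "expectation (\<lambda>\<omega>. summand i \<omega> u) = 0" unfolding summand_def using a by (simp add: prob_space)
qed

text \<open>
  The product of \<open>i z e\<^sup>i\<^sup>u\<^sup>z\<close> with the conjugate of \<open>i z e\<^sup>i\<^sup>v\<^sup>z\<close> is \<open>z\<^sup>2 e\<^sup>i\<^sup>(\<^sup>u\<^sup>-\<^sup>v\<^sup>)\<^sup>z\<close>, whose expectation is
  \<open>-\<phi>''(u - v)\<close>; this is where the difference of the frequencies comes from.
\<close>

lemma summand_covariance:
  assumes i: "i < 2 * n"
  shows "integrable M (\<lambda>\<omega>. summand i \<omega> u * cnj (summand i \<omega> v))"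
    "norm (expectation (\<lambda>\<omega>. summand i \<omega> u * cnj (summand i \<omega> v))) \<le> norm (phi'' (u - v)) + norm (phi' u) * norm (phi' v)"
proof -
  define g where "g = (\<lambda>w z. \<i> * complex_of_real z * iexp (w * z))"
  have gm[measurable]: "g w \<in> borel_measurable borel" for w unfolding g_def by measurable
  have yg: "summand i \<omega> w = g w (Z i \<omega>) - phi' w" for w \<omega> by (simp add: summand_def g_def)
  have gi: "integrable Q (g w)" for w unfolding g_def by (rule iexp_iz_int)
  have gE: "(\<integral>z. g w z \<partial>Q) = phi' w" for w unfolding g_def phi'_def by (simp only: mult.commute)
  have gc: "g u z * cnj (g v z) = - (iexp ((u - v) * z) * (\<i> * z * (\<i> * z)))" for z
  proof -
    have "cnj (iexp (v * z)) = iexp (- (v * z))" by (simp add: exp_cnj)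
    moreover have "iexp ((u - v) * z) = iexp (u * z) * iexp (- (v * z))" by (simp add: exp_add[symmetric] algebra_simps)
    ultimately show ?thesis by (simp add: g_def)
  qed
  have gci: "integrable Q (\<lambda>z. g u z * cnj (g v z))"
  proof -
    have "(\<lambda>z. (u - v) * z) \<in> borel_measurable Q" by measurable
    from integrable_iexp_mult[OF integrable_ix2[OF second_moment] this] show ?thesis unfolding gc by (rule Bochner_Integration.integrable_minus)
  qed
  have ex: "summand i \<omega> u * cnj (summand i \<omega> v) = g u (Z i \<omega>) * cnj (g v (Z i \<omega>)) - g u (Z i \<omega>) * cnj (phi' v)
      - phi' u * cnj (g v (Z i \<omega>)) + phi' u * cnj (phi' v)" for \<omega>
    unfolding yg by (simp add: algebra_simps)
  have I: "integrable M (\<lambda>\<omega>. g u (Z i \<omega>) * cnj (g v (Z i \<omega>)))" "integrable M (\<lambda>\<omega>. g w (Z i \<omega>))" for w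
    using Z_integral(2)[OF i, of "\<lambda>z. g u z * cnj (g v z)"] Z_integral(2)[OF i, of "g w"] gci gi by auto
  have Ic: "integrable M (\<lambda>\<omega>. cnj (g w (Z i \<omega>)))" for w using I(2)[of w] by simp
  show "integrable M (\<lambda>\<omega>. summand i \<omega> u * cnj (summand i \<omega> v))" unfolding ex using I Ic by (intro Bochner_Integration.integrable_add Bochner_Integration.integrable_diff integrable_mult_left integrable_mult_right) auto
  have E1: "expectation (\<lambda>\<omega>. g u (Z i \<omega>) * cnj (g v (Z i \<omega>))) = - phi'' (u - v)"
    by (subst Z_integral(1)[OF i, of "\<lambda>z. g u z * cnj (g v z)"]) (auto simp: gc phi''_def)
  have E2: "expectation (\<lambda>\<omega>. g w (Z i \<omega>)) = phi' w" for w using Z_integral(1)[OF i gm] gE by simp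
  have E3: "expectation (\<lambda>\<omega>. cnj (g w (Z i \<omega>))) = cnj (phi' w)" for w
    using E2[of w] by (simp add: integral_cnj)
  have "expectation (\<lambda>\<omega>. summand i \<omega> u * cnj (summand i \<omega> v)) = - phi'' (u - v) - phi' u * cnj (phi' v) - phi' u * cnj (phi' v) + phi' u * cnj (phi' v)"
    unfolding ex using I Ic by (simp add: E1 E2 E3 prob_space)
  then have "expectation (\<lambda>\<omega>. summand i \<omega> u * cnj (summand i \<omega> v)) = - phi'' (u - v) - phi' u * cnj (phi' v)" by simp
  then show "norm (expectation (\<lambda>\<omega>. summand i \<omega> u * cnj (summand i \<omega> v))) \<le> norm (phi'' (u - v)) + norm (phi' u) * norm (phi' v)"
    using norm_triangle_ineq4[of "- phi'' (u - v)" "phi' u * cnj (phi' v)"] by (simp add: norm_mult)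
qed

lemma summand_uncorrelated:
  assumes ij: "i < 2 * n" "j < 2 * n" "i \<noteq> j"
  shows "integrable M (\<lambda>\<omega>. summand i \<omega> u * cnj (summand j \<omega> v))" "expectation (\<lambda>\<omega>. summand i \<omega> u * cnj (summand j \<omega> v)) = 0"
proof -
  have "indep_var (PiM {i} (\<lambda>_. borel)) (\<lambda>\<omega>. restrict (\<lambda>i. Z i \<omega>) {i}) (PiM {j} (\<lambda>_. borel)) (\<lambda>\<omega>. restrict (\<lambda>i. Z i \<omega>) {j})"
    by (rule indep_var_restrict[OF indep]) (use ij in auto)
  then have "indep_var borel ((\<lambda>f. \<i> * complex_of_real (f i) * iexp (u * f i) - phi' u) \<circ> (\<lambda>\<omega>. restrict (\<lambda>i. Z i \<omega>) {i}))
     borel ((\<lambda>f. cnj (\<i> * complex_of_real (f j) * iexp (v * f j) - phi' v)) \<circ> (\<lambda>\<omega>. restrict (\<lambda>i. Z i \<omega>) {j}))"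
    by (rule indep_var_compose) measurable
  then have ind: "indep_var borel (\<lambda>\<omega>. summand i \<omega> u) borel (\<lambda>\<omega>. cnj (summand j \<omega> v))" by (simp add: o_def summand_def)
  have ic: "integrable M (\<lambda>\<omega>. cnj (summand j \<omega> v))" using summand_mean(1)[OF ij(2)] by simp
  show "integrable M (\<lambda>\<omega>. summand i \<omega> u * cnj (summand j \<omega> v))" by (rule indep_var_integrable[OF ind summand_mean(1)[OF ij(1)] ic])
  show "expectation (\<lambda>\<omega>. summand i \<omega> u * cnj (summand j \<omega> v)) = 0"
    using indep_var_lebesgue_integral[OF ind summand_mean(1)[OF ij(1)] ic] summand_mean(2)[OF ij(1)] by simp
qed

lemma ecf'_error_mean: "integrable M (\<lambda>\<omega>. ecf'_error \<omega> u)" "expectation (\<lambda>\<omega>. ecf'_error \<omega> u) = 0"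
proof -
  have i: "integrable M (\<lambda>\<omega>. \<Sum>i\<in>{n..<2*n}. summand i \<omega> u)"
    by (intro Bochner_Integration.integrable_sum summand_mean) auto
  then show "integrable M (\<lambda>\<omega>. ecf'_error \<omega> u)" unfolding ecf'_error_sum by (rule integrable_divide_zero)
  have "expectation (\<lambda>\<omega>. \<Sum>i\<in>{n..<2*n}. summand i \<omega> u) = 0"
    by (subst Bochner_Integration.integral_sum) (auto simp: summand_mean)
  then show "expectation (\<lambda>\<omega>. ecf'_error \<omega> u) = 0" unfolding ecf'_error_sum by simp
qed

lemma ecf'_error_covariance:
  "integrable M (\<lambda>\<omega>. ecf'_error \<omega> u * cnj (ecf'_error \<omega> v))"
  "norm (expectation (\<lambda>\<omega>. ecf'_error \<omega> u * cnj (ecf'_error \<omega> v))) \<le> (norm (phi'' (u - v)) + norm (phi' u) * norm (phi' v)) / n"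
proof -
  let ?I = "{n..<2*n}"
  have ex: "ecf'_error \<omega> u * cnj (ecf'_error \<omega> v) = (\<Sum>i\<in>?I. \<Sum>j\<in>?I. summand i \<omega> u * cnj (summand j \<omega> v)) / of_nat (n^2)" for \<omega>
    unfolding ecf'_error_sum by (simp add: sum_product power2_eq_square)
  have ii: "integrable M (\<lambda>\<omega>. summand i \<omega> u * cnj (summand j \<omega> v))" if "i \<in> ?I" "j \<in> ?I" for i j
    using that summand_covariance(1)[of i u v] summand_uncorrelated(1)[of i j u v] by (cases "i = j") auto
  have isum: "integrable M (\<lambda>\<omega>. \<Sum>i\<in>?I. \<Sum>j\<in>?I. summand i \<omega> u * cnj (summand j \<omega> v))"
    by (intro Bochner_Integration.integrable_sum ii)
  then show "integrable M (\<lambda>\<omega>. ecf'_error \<omega> u * cnj (ecf'_error \<omega> v))" unfolding ex by (rule integrable_divide_zero)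
  define c where "c = norm (phi'' (u - v)) + norm (phi' u) * norm (phi' v)"
  have "expectation (\<lambda>\<omega>. \<Sum>i\<in>?I. \<Sum>j\<in>?I. summand i \<omega> u * cnj (summand j \<omega> v)) =
      (\<Sum>i\<in>?I. \<Sum>j\<in>?I. expectation (\<lambda>\<omega>. summand i \<omega> u * cnj (summand j \<omega> v)))"
    by (subst Bochner_Integration.integral_sum, intro Bochner_Integration.integrable_sum ii, assumption+)
       (intro sum.cong refl Bochner_Integration.integral_sum ii)
  also have "\<dots> = (\<Sum>i\<in>?I. expectation (\<lambda>\<omega>. summand i \<omega> u * cnj (summand i \<omega> v)))"
  proof (intro sum.cong refl)
    fix i assume i: "i \<in> ?I"
    have "(\<Sum>j\<in>?I. expectation (\<lambda>\<omega>. summand i \<omega> u * cnj (summand j \<omega> v))) = (\<Sum>j\<in>{i}. expectation (\<lambda>\<omega>. summand i \<omega> u * cnj (summand j \<omega> v)))"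
      by (rule sum.mono_neutral_right) (use i in \<open>auto intro: summand_uncorrelated(2)\<close>)
    then show "(\<Sum>j\<in>?I. expectation (\<lambda>\<omega>. summand i \<omega> u * cnj (summand j \<omega> v))) = expectation (\<lambda>\<omega>. summand i \<omega> u * cnj (summand i \<omega> v))" by simp
  qed
  also have "norm \<dots> \<le> (\<Sum>i\<in>?I. c)"
    unfolding c_def by (rule sum_norm_le, rule summand_covariance(2)) simp
  finally have "norm (expectation (\<lambda>\<omega>. \<Sum>i\<in>?I. \<Sum>j\<in>?I. summand i \<omega> u * cnj (summand j \<omega> v))) \<le> (\<Sum>i\<in>?I. c)" .
  then have "norm (expectation (\<lambda>\<omega>. \<Sum>i\<in>?I. \<Sum>j\<in>?I. summand i \<omega> u * cnj (summand j \<omega> v))) \<le> n * c" by simp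
  then have "norm (expectation (\<lambda>\<omega>. ecf'_error \<omega> u * cnj (ecf'_error \<omega> v))) \<le> n * c / n^2"
    unfolding ex by (simp add: norm_divide divide_right_mono norm_power)
  also have "\<dots> = c / n" using n1 by (simp add: power2_eq_square)
  finally show "norm (expectation (\<lambda>\<omega>. ecf'_error \<omega> u * cnj (ecf'_error \<omega> v))) \<le> (norm (phi'' (u - v)) + norm (phi' u) * norm (phi' v)) / n"
    by (simp add: c_def)
qed

definition ratio_error :: "'a \<Rightarrow> real \<Rightarrow> complex" where "ratio_error \<omega> u = ecf' \<omega> u * inv_ecf \<omega> u - phi' u / char Q u"

text \<open>
  A square integrable bound for the error that is uniform in the frequency; it is far from sharp and
  serves to justify Fubini's theorem.
\<close>

definition ratio_envelope :: "'a \<Rightarrow> real" where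
  "ratio_envelope \<omega> = (\<Sum>i\<in>{n..<2*n}. \<bar>Z i \<omega>\<bar>) * sqrt T + \<Delta> * (\<integral>x. \<bar>x\<bar> \<partial>\<nu>)"

lemma phi'_div: "phi' u / char Q u = \<Delta> * Psi1 u" by (simp add: phi'_eq char_nz)

lemma ratio_error_le: "norm (ratio_error \<omega> u) \<le> ratio_envelope \<omega>"
proof -
  have "norm (ecf' \<omega> u) \<le> (\<Sum>i\<in>{n..<2*n}. \<bar>Z i \<omega>\<bar>) / n"
  proof -
    have "norm (\<Sum>i\<in>{n..<2*n}. \<i> * complex_of_real (Z i \<omega>) * iexp (u * Z i \<omega>)) \<le> (\<Sum>i\<in>{n..<2*n}. \<bar>Z i \<omega>\<bar>)"
      by (rule sum_norm_le) (simp only: norm_mult norm_ii norm_iexp norm_of_real mult_1_left mult_1_right order_refl)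
    then show ?thesis unfolding ecf'_def norm_divide by (simp add: divide_right_mono)
  qed
  also have "\<dots> \<le> (\<Sum>i\<in>{n..<2*n}. \<bar>Z i \<omega>\<bar>) / 1"
    using n1 by (intro divide_left_mono sum_nonneg) auto
  finally have "norm (ecf' \<omega> u) * norm (inv_ecf \<omega> u) \<le> (\<Sum>i\<in>{n..<2*n}. \<bar>Z i \<omega>\<bar>) * sqrt T"
    by (intro mult_mono inv_ecf_le) (auto intro: sum_nonneg)
  moreover have "norm (phi' u / char Q u) \<le> \<Delta> * (\<integral>x. \<bar>x\<bar> \<partial>\<nu>)"
    unfolding phi'_div using Psi1_bound[of u] Delta_pos by (simp add: norm_mult)
  ultimately show ?thesis
    unfolding ratio_error_def ratio_envelope_def using norm_triangle_ineq4[of "ecf' \<omega> u * inv_ecf \<omega> u" "phi' u / char Q u"] by (simp add: norm_mult)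
qed

lemma ratio_envelope_meas [measurable]: "ratio_envelope \<in> borel_measurable M"
  unfolding ratio_envelope_def[abs_def] by (intro borel_measurable_add borel_measurable_times borel_measurable_sum) auto

lemma ratio_envelope_square: "integrable M (\<lambda>\<omega>. (ratio_envelope \<omega>)\<^sup>2)"
proof -
  define S where "S = (\<lambda>\<omega>. \<Sum>i\<in>{n..<2*n}. \<bar>Z i \<omega>\<bar>)"
  define c where "c = \<Delta> * (\<integral>x. \<bar>x\<bar> \<partial>\<nu>)"
  have [measurable]: "S \<in> borel_measurable M" unfolding S_def by (intro borel_measurable_sum) auto
  have "integrable M (\<lambda>\<omega>. 2 * T * (real n * (\<Sum>i\<in>{n..<2*n}. (Z i \<omega>)\<^sup>2)) + 2 * c\<^sup>2)"
    by (intro Bochner_Integration.integrable_add integrable_mult_right Bochner_Integration.integrable_sum Z_square_integrable) auto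
  then show ?thesis
  proof (rule Bochner_Integration.integrable_bound)
    show "AE \<omega> in M. norm ((ratio_envelope \<omega>)\<^sup>2) \<le> norm (2 * T * (real n * (\<Sum>i\<in>{n..<2*n}. (Z i \<omega>)\<^sup>2)) + 2 * c\<^sup>2)"
    proof (rule AE_I2)
      fix \<omega>
      have "(S \<omega>)\<^sup>2 \<le> (\<Sum>i\<in>{n..<2*n}. 1\<^sup>2) * (\<Sum>i\<in>{n..<2*n}. \<bar>Z i \<omega>\<bar>\<^sup>2)"
        unfolding S_def using Cauchy_Schwarz_ineq_sum[of "\<lambda>_. 1" "\<lambda>i. \<bar>Z i \<omega>\<bar>" "{n..<2*n}"] by simp
      then have s: "(S \<omega>)\<^sup>2 \<le> real n * (\<Sum>i\<in>{n..<2*n}. (Z i \<omega>)\<^sup>2)" by simp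
      have "0 \<le> (S \<omega> * sqrt T - c)\<^sup>2" by simp
      then have "(S \<omega> * sqrt T + c)\<^sup>2 \<le> 2 * (S \<omega> * sqrt T)\<^sup>2 + 2 * c\<^sup>2" by (simp add: power2_eq_square algebra_simps)
      also have "(S \<omega> * sqrt T)\<^sup>2 = T * (S \<omega>)\<^sup>2" using T_pos by (simp add: power_mult_distrib)
      also have "2 * (T * (S \<omega>)\<^sup>2) + 2 * c\<^sup>2 \<le> 2 * T * (real n * (\<Sum>i\<in>{n..<2*n}. (Z i \<omega>)\<^sup>2)) + 2 * c\<^sup>2"
        using mult_left_mono[OF s, of "2 * T"] T_pos by simp
      finally have "(ratio_envelope \<omega>)\<^sup>2 \<le> 2 * T * (real n * (\<Sum>i\<in>{n..<2*n}. (Z i \<omega>)\<^sup>2)) + 2 * c\<^sup>2"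
        by (simp add: ratio_envelope_def S_def c_def)
      then show "norm ((ratio_envelope \<omega>)\<^sup>2) \<le> norm (2 * T * (real n * (\<Sum>i\<in>{n..<2*n}. (Z i \<omega>)\<^sup>2)) + 2 * c\<^sup>2)" by simp
    qed
  qed measurable
qed

lemma ratio_error_meas [measurable]: "(\<lambda>\<omega>. ratio_error \<omega> u) \<in> borel_measurable M"
proof -
  have "(\<lambda>\<omega>. ecf' \<omega> u) \<in> borel_measurable M"
    unfolding ecf'_def by (intro borel_measurable_divide borel_measurable_sum borel_measurable_const) auto
  then show ?thesis unfolding ratio_error_def by measurable
qed

lemma ratio_error_joint_meas [measurable]: "(\<lambda>p. ratio_error (fst p) (snd p)) \<in> borel_measurable (M \<Otimes>\<^sub>M borel)"
proof -
  have Zf: "(\<lambda>p. Z i (fst p)) \<in> borel_measurable (M \<Otimes>\<^sub>M borel)" if "i < 2 * n" for i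
    by (rule measurable_compose[OF measurable_fst Z_meas[OF that]])
  have e: "(\<lambda>p. iexp (snd p * Z i (fst p))) \<in> borel_measurable (M \<Otimes>\<^sub>M borel)" if "i < 2 * n" for i
    using Zf[OF that] by measurable
  have p1[measurable]: "(\<lambda>p. ecf (fst p) (snd p)) \<in> borel_measurable (M \<Otimes>\<^sub>M borel)"
    unfolding ecf_def by (intro borel_measurable_divide borel_measurable_sum borel_measurable_const e) auto
  have p2[measurable]: "(\<lambda>p. ecf' (fst p) (snd p)) \<in> borel_measurable (M \<Otimes>\<^sub>M borel)"
    unfolding ecf'_def using Zf
    by (intro borel_measurable_divide borel_measurable_sum borel_measurable_const borel_measurable_times e borel_measurable_of_real) auto
  have [measurable]: "Psi1 \<in> borel_measurable borel" by (rule Psi_meas)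
  show ?thesis unfolding ratio_error_def phi'_div inv_ecf_def by measurable
qed

lemma inv_ecf_covariance: "norm (char Q u) * norm (char Q v) * norm (expectation (\<lambda>\<omega>. inv_ecf \<omega> u * cnj (inv_ecf \<omega> v))) \<le> moment_const"
  using scaled_covariance_le[of "\<lambda>\<omega>. inv_ecf \<omega> u" "\<lambda>\<omega>. inv_ecf \<omega> v" "sqrt T" "sqrt T" "norm (char Q u)" moment_const "norm (char Q v)"]
    inv_ecf_le inv_ecf_moments(2) by simp

lemma inv_ecf_error_le: "norm (inv_ecf \<omega> u - 1 / char Q u) \<le> sqrt T + norm (1 / char Q u)"
  using norm_triangle_ineq4[of "inv_ecf \<omega> u" "1 / char Q u"] inv_ecf_le[of \<omega> u] by linarith

lemma inv_ecf_error_covariance: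
  "(norm (char Q u))\<^sup>2 * (norm (char Q v))\<^sup>2 * norm (expectation (\<lambda>\<omega>. (inv_ecf \<omega> u - 1 / char Q u) * cnj (inv_ecf \<omega> v - 1 / char Q v))) \<le> moment_const / T"
proof -
  have "expectation (\<lambda>\<omega>. (norm (inv_ecf \<omega> w - 1 / char Q w))\<^sup>2) * ((norm (char Q w))\<^sup>2)\<^sup>2 \<le> moment_const / T" for w
    using inv_ecf_moments(1)[of w] by simp
  then show ?thesis by (intro scaled_covariance_le[OF _ _ inv_ecf_error_le inv_ecf_error_le]) auto
qed

text \<open>
  The error is \<open>(\<phi>'\<^sub>n - \<phi>') Y + \<phi>' (Y - 1/\<phi>)\<close>, where \<open>Y\<close> is the truncated inverse. The difference
  \<open>\<phi>'\<^sub>n - \<phi>'\<close> is centred and independent of \<open>Y\<close>, so both mixed terms have expectation 0.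
\<close>

lemma ratio_error_covariance:
  "expectation (\<lambda>\<omega>. ratio_error \<omega> u * cnj (ratio_error \<omega> v)) =
     expectation (\<lambda>\<omega>. inv_ecf \<omega> u * cnj (inv_ecf \<omega> v)) * expectation (\<lambda>\<omega>. ecf'_error \<omega> u * cnj (ecf'_error \<omega> v)) +
     phi' u * cnj (phi' v) * expectation (\<lambda>\<omega>. (inv_ecf \<omega> u - 1 / char Q u) * cnj (inv_ecf \<omega> v - 1 / char Q v))"
proof -
  define d where "d = (\<lambda>w \<omega>. inv_ecf \<omega> w - 1 / char Q w)"
  define pz where "pz = (\<lambda>w z. (\<Sum>i<n. iexp (w * z i)) / of_nat n :: complex)"
  define yz where "yz = (\<lambda>w z. if norm (pz w z) \<ge> T powr (- 1 / 2) then 1 / pz w z else 0)"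
  define vz where "vz = (\<lambda>w z. (\<Sum>i\<in>{n..<2*n}. \<i> * complex_of_real (z i) * iexp (w * z i)) / of_nat n - phi' w)"
  let ?r1 = "\<lambda>\<omega>. restrict (\<lambda>i. Z i \<omega>) {..<n}" and ?r2 = "\<lambda>\<omega>. restrict (\<lambda>i. Z i \<omega>) {n..<2*n}"
  have pm[measurable]: "pz w \<in> borel_measurable (PiM {..<n} (\<lambda>_. borel))" for w
    unfolding pz_def by (intro borel_measurable_divide borel_measurable_sum borel_measurable_const) measurable
  have ym[measurable]: "yz w \<in> borel_measurable (PiM {..<n} (\<lambda>_. borel))" for w
    unfolding yz_def by measurable
  have vm[measurable]: "vz w \<in> borel_measurable (PiM {n..<2*n} (\<lambda>_. borel))" for w
    unfolding vz_def by (intro borel_measurable_diff borel_measurable_divide borel_measurable_sum borel_measurable_const) measurable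
  have Yz: "inv_ecf \<omega> w = yz w (?r1 \<omega>)" for \<omega> w by (simp add: inv_ecf_def yz_def ecf_def pz_def)
  have Vz: "ecf'_error \<omega> w = vz w (?r2 \<omega>)" for \<omega> w by (simp add: ecf'_error_def vz_def ecf'_def)
  have [measurable]: "d w \<in> borel_measurable M" for w unfolding d_def by measurable
  have dl: "norm (d w \<omega>) \<le> sqrt T + norm (1 / char Q w)" for w \<omega>
    unfolding d_def by (rule inv_ecf_error_le)
  have bi: "integrable M (\<lambda>\<omega>. a \<omega> * b \<omega>)"
    if "\<And>\<omega>. norm (a \<omega>) \<le> A" "\<And>\<omega>. norm (b \<omega>) \<le> B" "a \<in> borel_measurable M" "b \<in> borel_measurable M" for a b :: "'a \<Rightarrow> complex" and A B
  proof (rule integrable_const_bound[where B = "A * B"])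
    have "0 \<le> A" using order_trans[OF norm_ge_zero that(1)] .
    then show "AE \<omega> in M. norm (a \<omega> * b \<omega>) \<le> A * B" unfolding norm_mult by (intro AE_I2 mult_mono that) auto
  qed (use that in measurable)
  have iYY: "integrable M (\<lambda>\<omega>. inv_ecf \<omega> u * cnj (inv_ecf \<omega> v))" by (rule bi[of _ "sqrt T" _ "sqrt T"]) (auto intro: inv_ecf_le)
  have iYd: "integrable M (\<lambda>\<omega>. inv_ecf \<omega> u * cnj (d v \<omega>))" by (rule bi[of _ "sqrt T" _ "sqrt T + norm (1 / char Q v)"]) (auto intro: inv_ecf_le dl[unfolded norm_divide norm_one] dl)
  have idY: "integrable M (\<lambda>\<omega>. d u \<omega> * cnj (inv_ecf \<omega> v))" by (rule bi[of _ "sqrt T + norm (1 / char Q u)" _ "sqrt T"]) (auto intro: inv_ecf_le dl)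
  have idd: "integrable M (\<lambda>\<omega>. d u \<omega> * cnj (d v \<omega>))"
    by (rule bi[of _ "sqrt T + norm (1 / char Q u)" _ "sqrt T + norm (1 / char Q v)"]) (simp_all only: complex_mod_cnj dl, measurable)
  have iVc: "integrable M (\<lambda>\<omega>. cnj (ecf'_error \<omega> v))" using ecf'_error_mean(1)[of v] by simp
  have EVc: "expectation (\<lambda>\<omega>. cnj (ecf'_error \<omega> v)) = 0" using ecf'_error_mean(2)[of v] by (simp add: integral_cnj)
  note b1 = block_independence[where f = "\<lambda>z. yz u z * cnj (yz v z)" and g = "\<lambda>z. vz u z * cnj (vz v z)",
      of "\<lambda>\<omega>. inv_ecf \<omega> u * cnj (inv_ecf \<omega> v)" "\<lambda>\<omega>. ecf'_error \<omega> u * cnj (ecf'_error \<omega> v)", OF _ _ _ _ iYY ecf'_error_covariance(1)]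
  note b2 = block_independence[where f = "\<lambda>z. yz u z * cnj (yz v z - 1 / char Q v)" and g = "\<lambda>z. vz u z",
      of "\<lambda>\<omega>. inv_ecf \<omega> u * cnj (d v \<omega>)" "\<lambda>\<omega>. ecf'_error \<omega> u", OF _ _ _ _ iYd ecf'_error_mean(1)]
  note b3 = block_independence[where f = "\<lambda>z. (yz u z - 1 / char Q u) * cnj (yz v z)" and g = "\<lambda>z. cnj (vz v z)",
      of "\<lambda>\<omega>. d u \<omega> * cnj (inv_ecf \<omega> v)" "\<lambda>\<omega>. cnj (ecf'_error \<omega> v)", OF _ _ _ _ idY iVc]
  have B1: "expectation (\<lambda>\<omega>. (inv_ecf \<omega> u * cnj (inv_ecf \<omega> v)) * (ecf'_error \<omega> u * cnj (ecf'_error \<omega> v))) =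
      expectation (\<lambda>\<omega>. inv_ecf \<omega> u * cnj (inv_ecf \<omega> v)) * expectation (\<lambda>\<omega>. ecf'_error \<omega> u * cnj (ecf'_error \<omega> v))"
    "integrable M (\<lambda>\<omega>. (inv_ecf \<omega> u * cnj (inv_ecf \<omega> v)) * (ecf'_error \<omega> u * cnj (ecf'_error \<omega> v)))"
    by (rule b1; (simp only: Yz Vz | measurable))+
  have B2: "expectation (\<lambda>\<omega>. (inv_ecf \<omega> u * cnj (d v \<omega>)) * ecf'_error \<omega> u) = 0"
    "integrable M (\<lambda>\<omega>. (inv_ecf \<omega> u * cnj (d v \<omega>)) * ecf'_error \<omega> u)"
  proof -
    have "expectation (\<lambda>\<omega>. (inv_ecf \<omega> u * cnj (d v \<omega>)) * ecf'_error \<omega> u) = expectation (\<lambda>\<omega>. inv_ecf \<omega> u * cnj (d v \<omega>)) * expectation (\<lambda>\<omega>. ecf'_error \<omega> u)"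
      by (rule b2; (simp only: Yz Vz d_def | measurable))
    then show "expectation (\<lambda>\<omega>. (inv_ecf \<omega> u * cnj (d v \<omega>)) * ecf'_error \<omega> u) = 0" using ecf'_error_mean(2) by simp
    show "integrable M (\<lambda>\<omega>. (inv_ecf \<omega> u * cnj (d v \<omega>)) * ecf'_error \<omega> u)" by (rule b2; (simp only: Yz Vz d_def | measurable))
  qed
  have B3: "expectation (\<lambda>\<omega>. (d u \<omega> * cnj (inv_ecf \<omega> v)) * cnj (ecf'_error \<omega> v)) = 0"
    "integrable M (\<lambda>\<omega>. (d u \<omega> * cnj (inv_ecf \<omega> v)) * cnj (ecf'_error \<omega> v))"
  proof -
    have "expectation (\<lambda>\<omega>. (d u \<omega> * cnj (inv_ecf \<omega> v)) * cnj (ecf'_error \<omega> v)) = expectation (\<lambda>\<omega>. d u \<omega> * cnj (inv_ecf \<omega> v)) * expectation (\<lambda>\<omega>. cnj (ecf'_error \<omega> v))"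
      by (rule b3; (simp only: Yz Vz d_def | measurable))
    then show "expectation (\<lambda>\<omega>. (d u \<omega> * cnj (inv_ecf \<omega> v)) * cnj (ecf'_error \<omega> v)) = 0" using EVc by simp
    show "integrable M (\<lambda>\<omega>. (d u \<omega> * cnj (inv_ecf \<omega> v)) * cnj (ecf'_error \<omega> v))" by (rule b3; (simp only: Yz Vz d_def | measurable))
  qed
  have Rd: "ratio_error \<omega> w = ecf'_error \<omega> w * inv_ecf \<omega> w + phi' w * d w \<omega>" for \<omega> w
    by (simp add: ratio_error_def ecf'_error_def d_def algebra_simps)
  have ex: "ratio_error \<omega> u * cnj (ratio_error \<omega> v) = (inv_ecf \<omega> u * cnj (inv_ecf \<omega> v)) * (ecf'_error \<omega> u * cnj (ecf'_error \<omega> v)) + cnj (phi' v) * ((inv_ecf \<omega> u * cnj (d v \<omega>)) * ecf'_error \<omega> u)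
     + phi' u * ((d u \<omega> * cnj (inv_ecf \<omega> v)) * cnj (ecf'_error \<omega> v)) + phi' u * cnj (phi' v) * (d u \<omega> * cnj (d v \<omega>))" for \<omega>
    unfolding Rd by (simp add: algebra_simps)
  have "expectation (\<lambda>\<omega>. ratio_error \<omega> u * cnj (ratio_error \<omega> v)) =
     expectation (\<lambda>\<omega>. (inv_ecf \<omega> u * cnj (inv_ecf \<omega> v)) * (ecf'_error \<omega> u * cnj (ecf'_error \<omega> v))) + cnj (phi' v) * expectation (\<lambda>\<omega>. (inv_ecf \<omega> u * cnj (d v \<omega>)) * ecf'_error \<omega> u)
     + phi' u * expectation (\<lambda>\<omega>. (d u \<omega> * cnj (inv_ecf \<omega> v)) * cnj (ecf'_error \<omega> v)) + phi' u * cnj (phi' v) * expectation (\<lambda>\<omega>. d u \<omega> * cnj (d v \<omega>))"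
    unfolding ex by (simp only: Bochner_Integration.integral_add Bochner_Integration.integrable_add integrable_mult_right integral_mult_right_zero B1(2) B2(2) B3(2) idd)
  then show ?thesis unfolding B1(1) B2(1) B3(1) by (simp add: d_def)
qed

text \<open>
  The factor \<open>1/n = \<Delta>/T\<close> from the covariance of the empirical derivative meets \<open>\<Delta> |\<Psi>''|\<close>, so \<open>\<Delta>\<^sup>2/T\<close> can be
  taken out; the powers of \<open>\<Delta>\<close> left over are absorbed by \<open>1 + \<Delta>\<close>.
\<close>

lemma ratio_error_covariance_le:
  "norm (expectation (\<lambda>\<omega>. ratio_error \<omega> u * cnj (ratio_error \<omega> v))) * (norm (char Q u) * norm (char Q v)) \<le>
    \<Delta>\<^sup>2 * (moment_const * (1 + \<Delta>) / T) * (norm (Psi2 (u - v)) + (norm (Psi1 (u - v)))\<^sup>2 + norm (Psi1 u) * norm (Psi1 v))"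
proof -
  define a where "a = norm (char Q u)"
  define b where "b = norm (char Q v)"
  define p where "p = norm (Psi2 (u - v))"
  define q where "q = (norm (Psi1 (u - v)))\<^sup>2"
  define r where "r = norm (Psi1 u) * norm (Psi1 v)"
  have ab: "0 < a" "0 < b" "a \<le> 1" "b \<le> 1" using char_nz Q.cmod_char_le_1 by (auto simp: a_def b_def)
  have pqr: "0 \<le> p" "0 \<le> q" "0 \<le> r" by (auto simp: p_def q_def r_def)
  have moment_const: "0 \<le> moment_const" using Delta_pos by (simp add: moment_const_def)
  define EY where "EY = norm (expectation (\<lambda>\<omega>. inv_ecf \<omega> u * cnj (inv_ecf \<omega> v)))"
  define EV where "EV = norm (expectation (\<lambda>\<omega>. ecf'_error \<omega> u * cnj (ecf'_error \<omega> v)))"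
  define Ed where "Ed = norm (expectation (\<lambda>\<omega>. (inv_ecf \<omega> u - 1 / char Q u) * cnj (inv_ecf \<omega> v - 1 / char Q v)))"
  have nphi: "norm (phi' u) * norm (phi' v) = \<Delta>\<^sup>2 * r * (a * b)"
    using Delta_pos by (simp add: phi'_eq norm_mult r_def a_def b_def power2_eq_square)
  have ab1: "a * b \<le> 1" using ab mult_mono[of a 1 b 1] by simp
  have EV: "EV \<le> (\<Delta> * p + \<Delta>\<^sup>2 * q + \<Delta>\<^sup>2 * r) / n"
  proof -
    have "EV \<le> (norm (phi'' (u - v)) + norm (phi' u) * norm (phi' v)) / n" unfolding EV_def by (rule ecf'_error_covariance(2))
    also have "\<dots> \<le> (\<Delta> * p + \<Delta>\<^sup>2 * q + \<Delta>\<^sup>2 * r) / n"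
    proof (intro divide_right_mono add_mono)
      show "norm (phi'' (u - v)) \<le> \<Delta> * p + \<Delta>\<^sup>2 * q" unfolding p_def q_def by (rule phi''_le)
      show "norm (phi' u) * norm (phi' v) \<le> \<Delta>\<^sup>2 * r"
        unfolding nphi using mult_left_mono[OF ab1, of "\<Delta>\<^sup>2 * r"] pqr by simp
    qed simp
    finally show ?thesis .
  qed
  have "norm (expectation (\<lambda>\<omega>. ratio_error \<omega> u * cnj (ratio_error \<omega> v))) \<le> EY * EV + norm (phi' u) * norm (phi' v) * Ed"
    unfolding ratio_error_covariance EY_def EV_def Ed_def by (rule order_trans[OF norm_triangle_ineq]) (simp add: norm_mult)
  then have "norm (expectation (\<lambda>\<omega>. ratio_error \<omega> u * cnj (ratio_error \<omega> v))) * (a * b) \<le> (EY * EV + norm (phi' u) * norm (phi' v) * Ed) * (a * b)"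
    using ab by (intro mult_right_mono) auto
  also have "\<dots> = (a * b * EY) * EV + \<Delta>\<^sup>2 * r * (a\<^sup>2 * b\<^sup>2 * Ed)"
    unfolding nphi by (simp add: algebra_simps power2_eq_square)
  also have "\<dots> \<le> moment_const * ((\<Delta> * p + \<Delta>\<^sup>2 * q + \<Delta>\<^sup>2 * r) / n) + \<Delta>\<^sup>2 * r * (moment_const / T)"
  proof (intro add_mono mult_mono mult_left_mono EV moment_const)
    show "a * b * EY \<le> moment_const" unfolding a_def b_def EY_def by (rule inv_ecf_covariance)
    show "a\<^sup>2 * b\<^sup>2 * Ed \<le> moment_const / T" unfolding a_def b_def Ed_def by (rule inv_ecf_error_covariance)
  qed (use pqr in \<open>auto simp: EV_def Ed_def\<close>)
  also have "\<dots> = \<Delta>\<^sup>2 * (moment_const / T) * (p + \<Delta> * q + (\<Delta> + 1) * r)"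
    using n1 Delta_pos by (simp add: T_def field_simps power2_eq_square)
  also have "\<dots> \<le> \<Delta>\<^sup>2 * (moment_const / T) * ((1 + \<Delta>) * (p + q + r))"
    using pqr Delta_pos moment_const T_pos by (intro mult_left_mono) (auto simp: algebra_simps)
  also have "\<dots> = \<Delta>\<^sup>2 * (moment_const * (1 + \<Delta>) / T) * (p + q + r)" by simp
  finally show ?thesis unfolding a_def b_def p_def q_def r_def .
qed

end

section \<open>The second moment of the stochastic error\<close>

lemma norm_integral_le_nn_integral:
  fixes f :: "'a \<Rightarrow> 'b::{banach, second_countable_topology}"
  shows "ennreal (norm (\<integral>x. f x \<partial>N)) \<le> (\<integral>\<^sup>+x. ennreal (norm (f x)) \<partial>N)"
proof (cases "integrable N f")
  case True then show ?thesis by (rule integral_norm_bound_ennreal)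
next
  case False then show ?thesis by (simp add: not_integrable_integral_eq)
qed

text \<open>
  Expanding the squared modulus of the integral into a double integral and taking the expectation
  inside. The envelope \<open>\<rho>\<close> does not depend on \<open>u\<close>, and \<open>A\<close> is integrable, so both exchanges are
  justified.
\<close>

lemma (in prob_space) second_moment_of_random_integral:
  fixes A :: "real \<Rightarrow> complex" and R :: "'a \<Rightarrow> real \<Rightarrow> complex" and \<rho> :: "'a \<Rightarrow> real"
  assumes A: "integrable lborel A" and Rm[measurable]: "(\<lambda>p. R (fst p) (snd p)) \<in> borel_measurable (M \<Otimes>\<^sub>M borel)"
    and R\<rho>: "\<And>\<omega> u. norm (R \<omega> u) \<le> \<rho> \<omega>" and \<rho>m[measurable]: "\<rho> \<in> borel_measurable M" and \<rho>2: "integrable M (\<lambda>\<omega>. (\<rho> \<omega>)\<^sup>2)"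
  defines "S \<equiv> \<lambda>\<omega>. \<integral>u. A u * R \<omega> u \<partial>lborel"
  shows "(\<integral>\<^sup>+\<omega>. ennreal ((norm (S \<omega>))\<^sup>2) \<partial>M) \<le>
    (\<integral>\<^sup>+u. \<integral>\<^sup>+v. ennreal (norm (A u) * norm (A v) * norm (expectation (\<lambda>\<omega>. R \<omega> u * cnj (R \<omega> v)))) \<partial>lborel \<partial>lborel)"
    and "S \<in> borel_measurable M" and "\<And>\<omega>. \<omega> \<in> space M \<Longrightarrow> integrable lborel (\<lambda>u. A u * R \<omega> u)"
proof -
  have [measurable]: "A \<in> borel_measurable borel" using A by simp
  have Rl[measurable]: "(\<lambda>p. R (fst p) (snd p)) \<in> borel_measurable (M \<Otimes>\<^sub>M lborel)" using Rm by simp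
  have Ru[measurable]: "(\<lambda>\<omega>. R \<omega> u) \<in> borel_measurable M" for u
    using measurable_compose[OF measurable_Pair[OF measurable_ident_sets[OF refl] measurable_const[of u borel M]] Rm] by simp
  have Rw: "(\<lambda>u. R \<omega> u) \<in> borel_measurable borel" if "\<omega> \<in> space M" for \<omega>
    using measurable_compose[OF measurable_Pair[OF measurable_const[of \<omega> M borel] measurable_ident_sets[OF refl]] Rm] that by simp
  have \<rho>nn: "0 \<le> \<rho> \<omega>" for \<omega> using order_trans[OF norm_ge_zero R\<rho>] .
  define c where "c = (\<integral>u. norm (A u) \<partial>lborel)"
  have c0: "0 \<le> c" by (simp add: c_def)
  have cfin: "(\<integral>\<^sup>+u. ennreal (norm (A u)) \<partial>lborel) = ennreal c"
    unfolding c_def by (rule nn_integral_eq_integral) (use A in auto)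
  have iAR: "integrable lborel (\<lambda>u. A u * R \<omega> u)" if "\<omega> \<in> space M" for \<omega>
  proof (rule Bochner_Integration.integrable_bound)
    show "integrable lborel (\<lambda>u. norm (A u) * \<rho> \<omega>)" by (intro integrable_mult_left integrable_norm A)
    show "AE u in lborel. norm (A u * R \<omega> u) \<le> norm (norm (A u) * \<rho> \<omega>)"
      using R\<rho> \<rho>nn by (auto simp: norm_mult intro!: mult_left_mono)
  qed (use Rw[OF that] in measurable)
  then show "\<And>\<omega>. \<omega> \<in> space M \<Longrightarrow> integrable lborel (\<lambda>u. A u * R \<omega> u)" .
  show Sm[measurable]: "S \<in> borel_measurable M"
    unfolding S_def by (rule lborel.borel_measurable_lebesgue_integral) (simp add: case_prod_beta')
  have Sle: "norm (S \<omega>) \<le> c * \<rho> \<omega>" if "\<omega> \<in> space M" for \<omega>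
  proof -
    have "norm (S \<omega>) \<le> (\<integral>u. norm (A u) * \<rho> \<omega> \<partial>lborel)"
      unfolding S_def
      by (rule Bochner_Integration.integral_norm_bound_integral[OF iAR[OF that]])
         (use A R\<rho> in \<open>auto simp: norm_mult intro!: mult_left_mono\<close>)
    then show ?thesis by (simp add: c_def)
  qed
  have \<rho>fin: "(\<integral>\<^sup>+\<omega>. ennreal ((\<rho> \<omega>)\<^sup>2) \<partial>M) < \<infinity>" using \<rho>2 by (simp add: integrable_iff_bounded)
  have sf: "sigma_finite_measure M" by unfold_locales
  have S2: "integrable M (\<lambda>\<omega>. (norm (S \<omega>))\<^sup>2)"
  proof (rule Bochner_Integration.integrable_bound)
    show "integrable M (\<lambda>\<omega>. c\<^sup>2 * (\<rho> \<omega>)\<^sup>2)" by (rule integrable_mult_right[OF \<rho>2])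
    show "AE \<omega> in M. norm ((norm (S \<omega>))\<^sup>2) \<le> norm (c\<^sup>2 * (\<rho> \<omega>)\<^sup>2)"
      using power_mono[OF Sle norm_ge_zero, of _ 2] by (auto simp: power_mult_distrib)
  qed measurable
  have swap2: "(\<integral>\<omega>. R \<omega> u * cnj (S \<omega>) \<partial>M) = (\<integral>v. cnj (A v) * expectation (\<lambda>\<omega>. R \<omega> u * cnj (R \<omega> v)) \<partial>lborel)" for u
  proof -
    have "(\<integral>\<omega>. R \<omega> u * cnj (S \<omega>) \<partial>M) = (\<integral>\<omega>. \<integral>v. cnj (A v) * (R \<omega> u * cnj (R \<omega> v)) \<partial>lborel \<partial>M)"
    proof (intro Bochner_Integration.integral_cong refl)
      fix \<omega> assume "\<omega> \<in> space M"
      have "cnj (S \<omega>) = (\<integral>v. cnj (A v) * cnj (R \<omega> v) \<partial>lborel)"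
        unfolding S_def complex_cnj_mult[symmetric] Bochner_Integration.integral_cnj ..
      then show "R \<omega> u * cnj (S \<omega>) = (\<integral>v. cnj (A v) * (R \<omega> u * cnj (R \<omega> v)) \<partial>lborel)"
        by (simp add: mult.left_commute flip: integral_mult_right_zero)
    qed
    also have "\<dots> = (\<integral>v. \<integral>\<omega>. cnj (A v) * (R \<omega> u * cnj (R \<omega> v)) \<partial>M \<partial>lborel)"
    proof (rule fubini_swap(1)[OF sf lborel.sigma_finite_measure_axioms])
      have m1: "(\<lambda>p. R (fst p) u) \<in> borel_measurable (M \<Otimes>\<^sub>M lborel)" by (rule measurable_compose[OF measurable_fst Ru])
      show "(\<lambda>p. cnj (A (snd p)) * (R (fst p) u * cnj (R (fst p) (snd p)))) \<in> borel_measurable (M \<Otimes>\<^sub>M lborel)"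
        using m1 by measurable
      have "(\<integral>\<^sup>+\<omega>. \<integral>\<^sup>+v. ennreal (norm (cnj (A v) * (R \<omega> u * cnj (R \<omega> v)))) \<partial>lborel \<partial>M) \<le>
          (\<integral>\<^sup>+\<omega>. \<integral>\<^sup>+v. ennreal ((\<rho> \<omega>)\<^sup>2) * ennreal (norm (A v)) \<partial>lborel \<partial>M)"
      proof (intro nn_integral_mono)
        fix \<omega> v
        have "norm (R \<omega> u) * norm (R \<omega> v) \<le> \<rho> \<omega> * \<rho> \<omega>" by (intro mult_mono R\<rho> \<rho>nn) simp
        then have "norm (A v) * (norm (R \<omega> u) * norm (R \<omega> v)) \<le> norm (A v) * (\<rho> \<omega>)\<^sup>2"
          unfolding power2_eq_square by (intro mult_left_mono) auto
        then show "ennreal (norm (cnj (A v) * (R \<omega> u * cnj (R \<omega> v)))) \<le> ennreal ((\<rho> \<omega>)\<^sup>2) * ennreal (norm (A v))"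
          by (simp add: norm_mult ennreal_mult[symmetric] ennreal_leI mult.commute)
      qed
      also have "\<dots> = (\<integral>\<^sup>+\<omega>. ennreal ((\<rho> \<omega>)\<^sup>2) \<partial>M) * ennreal c"
        by (simp add: nn_integral_cmult nn_integral_multc cfin)
      also have "\<dots> < \<infinity>" using \<rho>fin by (simp add: ennreal_mult_less_top)
      finally show "(\<integral>\<^sup>+\<omega>. \<integral>\<^sup>+v. ennreal (norm (cnj (A v) * (R \<omega> u * cnj (R \<omega> v)))) \<partial>lborel \<partial>M) < \<infinity>" .
    qed
    finally show ?thesis by (simp only: integral_mult_right_zero)
  qed
  have "complex_of_real (\<integral>\<omega>. (norm (S \<omega>))\<^sup>2 \<partial>M) = (\<integral>\<omega>. S \<omega> * cnj (S \<omega>) \<partial>M)"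
    by (simp only: complex_norm_square integral_complex_of_real[symmetric])
  also have "\<dots> = (\<integral>\<omega>. \<integral>u. A u * (R \<omega> u * cnj (S \<omega>)) \<partial>lborel \<partial>M)"
    by (simp add: S_def mult.assoc flip: integral_mult_left_zero)
  also have "\<dots> = (\<integral>u. \<integral>\<omega>. A u * (R \<omega> u * cnj (S \<omega>)) \<partial>M \<partial>lborel)"
  proof (rule fubini_swap(1)[OF sf lborel.sigma_finite_measure_axioms])
    have m1: "(\<lambda>p. S (fst p)) \<in> borel_measurable (M \<Otimes>\<^sub>M lborel)" by (rule measurable_compose[OF measurable_fst Sm])
    show "(\<lambda>p. A (snd p) * (R (fst p) (snd p) * cnj (S (fst p)))) \<in> borel_measurable (M \<Otimes>\<^sub>M lborel)"
      using m1 by measurable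
    have "(\<integral>\<^sup>+\<omega>. \<integral>\<^sup>+u. ennreal (norm (A u * (R \<omega> u * cnj (S \<omega>)))) \<partial>lborel \<partial>M) \<le>
        (\<integral>\<^sup>+\<omega>. \<integral>\<^sup>+u. ennreal (c * (\<rho> \<omega>)\<^sup>2) * ennreal (norm (A u)) \<partial>lborel \<partial>M)"
    proof (intro nn_integral_mono)
      fix \<omega> u assume w: "\<omega> \<in> space M"
      have "norm (R \<omega> u) * norm (S \<omega>) \<le> \<rho> \<omega> * (c * \<rho> \<omega>)" by (intro mult_mono R\<rho> \<rho>nn Sle w) simp
      then have "norm (A u) * (norm (R \<omega> u) * norm (S \<omega>)) \<le> norm (A u) * (c * (\<rho> \<omega>)\<^sup>2)"
        by (intro mult_left_mono) (auto simp: power2_eq_square ac_simps)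
      then show "ennreal (norm (A u * (R \<omega> u * cnj (S \<omega>)))) \<le> ennreal (c * (\<rho> \<omega>)\<^sup>2) * ennreal (norm (A u))"
        using c0 by (simp add: norm_mult ennreal_mult[symmetric] ennreal_leI mult.commute)
    qed
    also have "\<dots> = (\<integral>\<^sup>+\<omega>. ennreal c * ennreal ((\<rho> \<omega>)\<^sup>2) \<partial>M) * ennreal c"
      using c0 by (simp add: nn_integral_cmult nn_integral_multc cfin ennreal_mult)
    also have "\<dots> < \<infinity>" using \<rho>fin by (simp add: nn_integral_cmult ennreal_mult_less_top)
    finally show "(\<integral>\<^sup>+\<omega>. \<integral>\<^sup>+u. ennreal (norm (A u * (R \<omega> u * cnj (S \<omega>)))) \<partial>lborel \<partial>M) < \<infinity>" .
  qed
  also have "\<dots> = (\<integral>u. A u * (\<integral>v. cnj (A v) * expectation (\<lambda>\<omega>. R \<omega> u * cnj (R \<omega> v)) \<partial>lborel) \<partial>lborel)"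
    by (simp only: integral_mult_right_zero swap2)
  finally have eq: "complex_of_real (\<integral>\<omega>. (norm (S \<omega>))\<^sup>2 \<partial>M) =
      (\<integral>u. A u * (\<integral>v. cnj (A v) * expectation (\<lambda>\<omega>. R \<omega> u * cnj (R \<omega> v)) \<partial>lborel) \<partial>lborel)" .
  have "(\<integral>\<^sup>+\<omega>. ennreal ((norm (S \<omega>))\<^sup>2) \<partial>M) = ennreal (\<integral>\<omega>. (norm (S \<omega>))\<^sup>2 \<partial>M)"
    by (rule nn_integral_eq_integral[OF S2]) simp
  also have "\<dots> = ennreal (norm (complex_of_real (\<integral>\<omega>. (norm (S \<omega>))\<^sup>2 \<partial>M)))"
    by (simp only: norm_of_real) (simp add: integral_nonneg_AE)
  also have "\<dots> \<le> (\<integral>\<^sup>+u. ennreal (norm (A u * (\<integral>v. cnj (A v) * expectation (\<lambda>\<omega>. R \<omega> u * cnj (R \<omega> v)) \<partial>lborel))) \<partial>lborel)"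
    unfolding eq by (rule norm_integral_le_nn_integral)
  also have "\<dots> \<le> (\<integral>\<^sup>+u. \<integral>\<^sup>+v. ennreal (norm (A u) * norm (A v) * norm (expectation (\<lambda>\<omega>. R \<omega> u * cnj (R \<omega> v)))) \<partial>lborel \<partial>lborel)"
  proof (intro nn_integral_mono)
    fix u
    have "ennreal (norm (A u * (\<integral>v. cnj (A v) * expectation (\<lambda>\<omega>. R \<omega> u * cnj (R \<omega> v)) \<partial>lborel))) =
       ennreal (norm (\<integral>v. A u * (cnj (A v) * expectation (\<lambda>\<omega>. R \<omega> u * cnj (R \<omega> v))) \<partial>lborel))"
      by (simp only: integral_mult_right_zero)
    also have "\<dots> \<le> (\<integral>\<^sup>+v. ennreal (norm (A u * (cnj (A v) * expectation (\<lambda>\<omega>. R \<omega> u * cnj (R \<omega> v))))) \<partial>lborel)"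
      by (rule norm_integral_le_nn_integral)
    finally show "ennreal (norm (A u * (\<integral>v. cnj (A v) * expectation (\<lambda>\<omega>. R \<omega> u * cnj (R \<omega> v)) \<partial>lborel))) \<le>
        (\<integral>\<^sup>+v. ennreal (norm (A u) * norm (A v) * norm (expectation (\<lambda>\<omega>. R \<omega> u * cnj (R \<omega> v)))) \<partial>lborel)"
      by (simp add: norm_mult mult.assoc)
  qed
  finally show "(\<integral>\<^sup>+\<omega>. ennreal ((norm (S \<omega>))\<^sup>2) \<partial>M) \<le>
    (\<integral>\<^sup>+u. \<integral>\<^sup>+v. ennreal (norm (A u) * norm (A v) * norm (expectation (\<lambda>\<omega>. R \<omega> u * cnj (R \<omega> v)))) \<partial>lborel \<partial>lborel)" .
qed

lemma ennreal_mult_le_squares: "a * b \<le> a\<^sup>2 + (b :: ennreal)\<^sup>2"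
proof (cases "a \<le> b")
  case True then have "a * b \<le> b\<^sup>2" by (simp add: power2_eq_square mult_right_mono)
  then show ?thesis by (simp add: add_increasing)
next
  case False then have "a * b \<le> a\<^sup>2" by (simp add: power2_eq_square mult_left_mono)
  then show ?thesis by (simp add: add_increasing2)
qed

text \<open>
  Young's inequality for a convolution kernel in quadratic form, from \<open>a b \<le> a\<^sup>2 + b\<^sup>2\<close> and translation
  invariance. The missing factor 1/2 costs a factor 2 in the constant.
\<close>

lemma young_quadratic:
  fixes G P :: "real \<Rightarrow> ennreal"
  assumes [measurable]: "G \<in> borel_measurable borel" "P \<in> borel_measurable borel"
  shows "(\<integral>\<^sup>+u. \<integral>\<^sup>+v. G u * G v * P (u - v) \<partial>lborel \<partial>lborel) \<le> 2 * ((\<integral>\<^sup>+u. (G u)\<^sup>2 \<partial>lborel) * (\<integral>\<^sup>+w. P w \<partial>lborel))"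
proof -
  have P1: "(\<integral>\<^sup>+v. P (u - v) \<partial>lborel) = (\<integral>\<^sup>+w. P w \<partial>lborel)" for u
    using nn_integral_real_affine[of P "-1" u] by simp
  have P2: "(\<integral>\<^sup>+u. P (u - v) \<partial>lborel) = (\<integral>\<^sup>+w. P w \<partial>lborel)" for v
    using nn_integral_real_affine[of P 1 "- v"] by simp
  have "(\<integral>\<^sup>+u. \<integral>\<^sup>+v. G u * G v * P (u - v) \<partial>lborel \<partial>lborel) \<le>
      (\<integral>\<^sup>+u. \<integral>\<^sup>+v. (G u)\<^sup>2 * P (u - v) + (G v)\<^sup>2 * P (u - v) \<partial>lborel \<partial>lborel)"
    unfolding distrib_right[symmetric] by (intro nn_integral_mono mult_right_mono ennreal_mult_le_squares) simp
  also have "\<dots> = (\<integral>\<^sup>+u. \<integral>\<^sup>+v. (G u)\<^sup>2 * P (u - v) \<partial>lborel \<partial>lborel) + (\<integral>\<^sup>+u. \<integral>\<^sup>+v. (G v)\<^sup>2 * P (u - v) \<partial>lborel \<partial>lborel)"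
    by (simp add: nn_integral_add)
  also have "(\<integral>\<^sup>+u. \<integral>\<^sup>+v. (G v)\<^sup>2 * P (u - v) \<partial>lborel \<partial>lborel) = (\<integral>\<^sup>+v. \<integral>\<^sup>+u. (G v)\<^sup>2 * P (u - v) \<partial>lborel \<partial>lborel)"
    by (rule lborel_pair.Fubini') measurable
  also have "\<dots> = (\<integral>\<^sup>+v. (G v)\<^sup>2 \<partial>lborel) * (\<integral>\<^sup>+w. P w \<partial>lborel)"
    by (simp add: nn_integral_cmult nn_integral_multc P2)
  also have "(\<integral>\<^sup>+u. \<integral>\<^sup>+v. (G u)\<^sup>2 * P (u - v) \<partial>lborel \<partial>lborel) = (\<integral>\<^sup>+v. (G v)\<^sup>2 \<partial>lborel) * (\<integral>\<^sup>+w. P w \<partial>lborel)"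
    by (simp add: nn_integral_cmult nn_integral_multc P1)
  finally show ?thesis by (simp add: mult_2)
qed

text \<open>
  The two bounds behind \<open>C\<^sub>1\<close> and \<open>C\<^sub>2\<close>: the part of convolution type is estimated by Young's
  inequality, the product part by that of Cauchy and Schwarz; alternatively the whole kernel is
  replaced by its supremum.
\<close>

lemma quadratic_form_bounds:
  fixes G p r :: "real \<Rightarrow> ennreal"
  assumes [measurable]: "G \<in> borel_measurable borel" "p \<in> borel_measurable borel" "r \<in> borel_measurable borel"
  defines "I \<equiv> (\<integral>\<^sup>+u. \<integral>\<^sup>+v. G u * G v * (p (u - v) + (r (u - v))\<^sup>2 + r u * r v) \<partial>lborel \<partial>lborel)"
  shows "I \<le> 2 * ((\<integral>\<^sup>+w. p w \<partial>lborel) + 2 * (\<integral>\<^sup>+w. (r w)\<^sup>2 \<partial>lborel)) * (\<integral>\<^sup>+u. (G u)\<^sup>2 \<partial>lborel)"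
    and "I \<le> ((SUP w. p w) + 2 * (SUP w. r w)\<^sup>2) * (\<integral>\<^sup>+u. G u \<partial>lborel)\<^sup>2"
proof -
  define g where "g = (\<integral>\<^sup>+u. (G u)\<^sup>2 \<partial>lborel)"
  define p2 where "p2 = (\<integral>\<^sup>+w. p w \<partial>lborel)"
  define p1 where "p1 = (\<integral>\<^sup>+w. (r w)\<^sup>2 \<partial>lborel)"
  have "I = (\<integral>\<^sup>+u. \<integral>\<^sup>+v. G u * G v * (p (u - v) + (r (u - v))\<^sup>2) + (G u * r u) * (G v * r v) \<partial>lborel \<partial>lborel)"
    unfolding I_def by (simp add: distrib_left ac_simps)
  also have "\<dots> = (\<integral>\<^sup>+u. \<integral>\<^sup>+v. G u * G v * (p (u - v) + (r (u - v))\<^sup>2) \<partial>lborel \<partial>lborel)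
     + (\<integral>\<^sup>+u. \<integral>\<^sup>+v. (G u * r u) * (G v * r v) \<partial>lborel \<partial>lborel)"
    by (simp add: nn_integral_add)
  also have "(\<integral>\<^sup>+u. \<integral>\<^sup>+v. (G u * r u) * (G v * r v) \<partial>lborel \<partial>lborel) = (\<integral>\<^sup>+u. G u * r u \<partial>lborel)\<^sup>2"
    by (simp add: nn_integral_cmult nn_integral_multc power2_eq_square)
  finally have I: "I = (\<integral>\<^sup>+u. \<integral>\<^sup>+v. G u * G v * (p (u - v) + (r (u - v))\<^sup>2) \<partial>lborel \<partial>lborel) + (\<integral>\<^sup>+u. G u * r u \<partial>lborel)\<^sup>2" .
  have "I \<le> 2 * (g * (p2 + p1)) + g * p1"
    unfolding I
  proof (rule add_mono)
    have "(\<integral>\<^sup>+w. p w + (r w)\<^sup>2 \<partial>lborel) = p2 + p1" by (simp add: p2_def p1_def nn_integral_add)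
    then show "(\<integral>\<^sup>+u. \<integral>\<^sup>+v. G u * G v * (p (u - v) + (r (u - v))\<^sup>2) \<partial>lborel \<partial>lborel) \<le> 2 * (g * (p2 + p1))"
      using young_quadratic[of G "\<lambda>w. p w + (r w)\<^sup>2"] by (simp add: g_def)
    show "(\<integral>\<^sup>+u. G u * r u \<partial>lborel)\<^sup>2 \<le> g * p1"
      unfolding g_def p1_def by (rule Cauchy_Schwarz_nn_integral) auto
  qed
  also have "\<dots> \<le> 2 * (g * (p2 + p1)) + 2 * (g * p1)" by (intro add_left_mono) (simp add: mult_2 add_increasing)
  also have "\<dots> = 2 * (p2 + 2 * p1) * g" by (simp only: mult_2 distrib_left distrib_right ac_simps)
  finally show "I \<le> 2 * ((\<integral>\<^sup>+w. p w \<partial>lborel) + 2 * (\<integral>\<^sup>+w. (r w)\<^sup>2 \<partial>lborel)) * (\<integral>\<^sup>+u. (G u)\<^sup>2 \<partial>lborel)"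
    by (simp add: g_def p1_def p2_def)
  define sp where "sp = (SUP w. p w)"
  define sr where "sr = (SUP w. r w)"
  have sp: "p w \<le> sp" and sr: "r w \<le> sr" for w by (auto simp: sp_def sr_def intro: SUP_upper)
  have "I \<le> (\<integral>\<^sup>+u. \<integral>\<^sup>+v. G u * G v * (sp + 2 * sr\<^sup>2) \<partial>lborel \<partial>lborel)"
    unfolding I_def
  proof (intro nn_integral_mono mult_left_mono)
    fix u v
    have "p (u - v) + (r (u - v))\<^sup>2 + r u * r v \<le> sp + sr\<^sup>2 + sr * sr"
      by (intro add_mono mult_mono power_mono sp sr) auto
    then show "p (u - v) + (r (u - v))\<^sup>2 + r u * r v \<le> sp + 2 * sr\<^sup>2" by (simp only: mult_2 power2_eq_square add.assoc)
  qed simp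
  also have "\<dots> = (sp + 2 * sr\<^sup>2) * (\<integral>\<^sup>+u. G u \<partial>lborel)\<^sup>2"
    by (simp add: nn_integral_cmult nn_integral_multc power2_eq_square ac_simps)
  finally show "I \<le> ((SUP w. p w) + 2 * (SUP w. r w)\<^sup>2) * (\<integral>\<^sup>+u. G u \<partial>lborel)\<^sup>2" by (simp add: sp_def sr_def)
qed

context levy_sample
begin

definition error_integral :: "(real \<Rightarrow> complex) \<Rightarrow> 'a \<Rightarrow> complex" where "error_integral A \<omega> = (\<integral>u. A u * ratio_error \<omega> u \<partial>lborel)"

lemma stochastic_error:
  fixes A :: "real \<Rightarrow> complex"
  assumes A: "integrable lborel A"
  defines "G \<equiv> \<lambda>u. ennreal (norm (A u) / norm (char Q u))"
    and "p \<equiv> \<lambda>w. ennreal (norm (Psi2 w))" and "r \<equiv> \<lambda>w. ennreal (norm (Psi1 w))"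
    and "k \<equiv> ennreal (\<Delta>\<^sup>2 * (moment_const * (1 + \<Delta>) / T))"
  shows "(\<integral>\<^sup>+\<omega>. ennreal ((norm (error_integral A \<omega>))\<^sup>2) \<partial>M) \<le>
      k * (2 * ((\<integral>\<^sup>+w. p w \<partial>lborel) + 2 * (\<integral>\<^sup>+w. (r w)\<^sup>2 \<partial>lborel)) * (\<integral>\<^sup>+u. (G u)\<^sup>2 \<partial>lborel))"
    and "(\<integral>\<^sup>+\<omega>. ennreal ((norm (error_integral A \<omega>))\<^sup>2) \<partial>M) \<le> k * (((SUP w. p w) + 2 * (SUP w. r w)\<^sup>2) * (\<integral>\<^sup>+u. G u \<partial>lborel)\<^sup>2)"
    and "error_integral A \<in> borel_measurable M" "\<And>\<omega>. \<omega> \<in> space M \<Longrightarrow> integrable lborel (\<lambda>u. A u * ratio_error \<omega> u)"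
proof -
  note sm = second_moment_of_random_integral[OF A ratio_error_joint_meas ratio_error_le ratio_envelope_meas ratio_envelope_square, folded error_integral_def]
  have [measurable]: "A \<in> borel_measurable borel" using A by simp
  have [measurable]: "G \<in> borel_measurable borel" "p \<in> borel_measurable borel" "r \<in> borel_measurable borel"
    unfolding G_def p_def r_def by measurable
  have "(\<integral>\<^sup>+\<omega>. ennreal ((norm (error_integral A \<omega>))\<^sup>2) \<partial>M) \<le>
     (\<integral>\<^sup>+u. \<integral>\<^sup>+v. ennreal (norm (A u) * norm (A v) * norm (expectation (\<lambda>\<omega>. ratio_error \<omega> u * cnj (ratio_error \<omega> v)))) \<partial>lborel \<partial>lborel)"
    by (rule sm(1))
  also have "\<dots> \<le> (\<integral>\<^sup>+u. \<integral>\<^sup>+v. k * (G u * G v * (p (u - v) + (r (u - v))\<^sup>2 + r u * r v)) \<partial>lborel \<partial>lborel)"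
  proof (intro nn_integral_mono)
    fix u v
    define a where "a = norm (char Q u)"
    define b where "b = norm (char Q v)"
    have ab: "0 < a" "0 < b" using char_nz by (auto simp: a_def b_def)
    define X where "X = norm (Psi2 (u - v)) + (norm (Psi1 (u - v)))\<^sup>2 + norm (Psi1 u) * norm (Psi1 v)"
    define kk where "kk = \<Delta>\<^sup>2 * (moment_const * (1 + \<Delta>) / T)"
    have kk: "0 \<le> kk" using Delta_pos T_pos by (simp add: kk_def moment_const_def)
    have X: "0 \<le> X" by (simp add: X_def)
    have "norm (expectation (\<lambda>\<omega>. ratio_error \<omega> u * cnj (ratio_error \<omega> v))) \<le> kk * X / (a * b)"
      using ratio_error_covariance_le[of u v, folded a_def b_def kk_def X_def] ab by (simp add: pos_le_divide_eq)
    then have "norm (A u) * norm (A v) * norm (expectation (\<lambda>\<omega>. ratio_error \<omega> u * cnj (ratio_error \<omega> v))) \<le> norm (A u) * norm (A v) * (kk * X / (a * b))"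
      by (intro mult_left_mono) auto
    also have "\<dots> = kk * ((norm (A u) / a) * (norm (A v) / b) * X)" by simp
    finally have "ennreal (norm (A u) * norm (A v) * norm (expectation (\<lambda>\<omega>. ratio_error \<omega> u * cnj (ratio_error \<omega> v)))) \<le>
       ennreal (kk * ((norm (A u) / a) * (norm (A v) / b) * X))" by (rule ennreal_leI)
    also have "\<dots> = k * (G u * G v * ennreal X)"
    proof -
      have em: "ennreal (kk * (\<alpha> * \<beta> * X)) = ennreal kk * (ennreal \<alpha> * ennreal \<beta> * ennreal X)" if "0 \<le> \<alpha>" "0 \<le> \<beta>" for \<alpha> \<beta>
        using that kk X by (simp add: ennreal_mult)
      show ?thesis unfolding k_def kk_def[symmetric] G_def a_def[symmetric] b_def[symmetric]
        by (rule em) (use ab in auto)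
    qed
    also have "ennreal X = p (u - v) + (r (u - v))\<^sup>2 + r u * r v"
      by (simp add: X_def p_def r_def ennreal_plus ennreal_power ennreal_mult)
    finally show "ennreal (norm (A u) * norm (A v) * norm (expectation (\<lambda>\<omega>. ratio_error \<omega> u * cnj (ratio_error \<omega> v)))) \<le>
       k * (G u * G v * (p (u - v) + (r (u - v))\<^sup>2 + r u * r v))" .
  qed
  also have "\<dots> = k * (\<integral>\<^sup>+u. \<integral>\<^sup>+v. G u * G v * (p (u - v) + (r (u - v))\<^sup>2 + r u * r v) \<partial>lborel \<partial>lborel)"
    by (simp add: nn_integral_cmult)
  finally have *: "(\<integral>\<^sup>+\<omega>. ennreal ((norm (error_integral A \<omega>))\<^sup>2) \<partial>M) \<le> \<dots>" .
  show "(\<integral>\<^sup>+\<omega>. ennreal ((norm (error_integral A \<omega>))\<^sup>2) \<partial>M) \<le>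
      k * (2 * ((\<integral>\<^sup>+w. p w \<partial>lborel) + 2 * (\<integral>\<^sup>+w. (r w)\<^sup>2 \<partial>lborel)) * (\<integral>\<^sup>+u. (G u)\<^sup>2 \<partial>lborel))"
    by (rule order_trans[OF *]) (intro mult_left_mono quadratic_form_bounds; simp)
  show "(\<integral>\<^sup>+\<omega>. ennreal ((norm (error_integral A \<omega>))\<^sup>2) \<partial>M) \<le> k * (((SUP w. p w) + 2 * (SUP w. r w)\<^sup>2) * (\<integral>\<^sup>+u. G u \<partial>lborel)\<^sup>2)"
    by (rule order_trans[OF *]) (intro mult_left_mono quadratic_form_bounds; simp)
  show "error_integral A \<in> borel_measurable M" using sm(2) by (simp add: error_integral_def[abs_def])
  show "\<And>\<omega>. \<omega> \<in> space M \<Longrightarrow> integrable lborel (\<lambda>u. A u * ratio_error \<omega> u)" by (rule sm(3))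
qed

end

section \<open>The risk bound\<close>

lemma fourier_real_scaled:
  assumes "h > 0" shows "fourier_real (scaled K h) u = fourier_real K (h * u)"
proof -
  have "fourier_real (scaled K h) u = \<bar>h\<bar> *\<^sub>R (\<integral>x. iexp (u * (0 + h * x)) * complex_of_real (scaled K h (0 + h * x)) \<partial>lborel)"
    unfolding fourier_real_def fourier_def by (rule lborel_integral_real_affine) (use assms in simp)
  also have "\<dots> = (\<integral>x. \<bar>h\<bar> *\<^sub>R (iexp (u * (0 + h * x)) * complex_of_real (scaled K h (0 + h * x))) \<partial>lborel)"
    by (rule integral_scaleR_right[symmetric])
  also have "\<dots> = fourier_real K (h * u)"
    unfolding fourier_real_def fourier_def
    by (intro Bochner_Integration.integral_cong refl)
       (use assms in \<open>simp add: scaled_def scaleR_conv_of_real mult.left_commute mult.commute\<close>)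
  finally show ?thesis .
qed

text \<open>
  Independence and stationarity of the increments along the grid \<open>0, \<Delta>, 2\<Delta>, \<dots>\<close>
\<close>

lemma levy_process_sample:
  assumes P: "pure_jump_levy M X \<nu>" and \<Delta>: "0 < \<Delta>" and n: "1 \<le> n"
  shows "levy_sample \<nu> (distr M borel (X \<Delta>)) \<Delta> M (\<lambda>i. incr X \<Delta> (Suc i)) n"
proof -
  have lp: "levy_process M X" using P by (simp add: pure_jump_levy_def)
  interpret levy_increment \<nu> "distr M borel (X \<Delta>)" \<Delta> by (rule pure_jump_levy_increment[OF P \<Delta>])
  interpret M: prob_space M using lp by (simp add: levy_process_def)
  have inc: "incr X \<Delta> (Suc i) = (\<lambda>\<omega>. X (real (Suc i) * \<Delta>) \<omega> - X (real i * \<Delta>) \<omega>)" for i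
    by (rule ext) (simp add: incr_def)
  show ?thesis
  proof unfold_locales
    show "1 \<le> n" by fact
    have mono: "mono (\<lambda>i::nat. real i * \<Delta>)" using \<Delta> by (auto intro!: monoI mult_right_mono)
    have "\<forall>(t :: nat \<Rightarrow> real) m. 0 \<le> t 0 \<and> mono t \<longrightarrow>
        prob_space.indep_vars M (\<lambda>_. borel) (\<lambda>i \<omega>. X (t (Suc i)) \<omega> - X (t i) \<omega>) {..<m}"
      using lp by (simp add: levy_process_def)
    from this[rule_format, of "\<lambda>i. real i * \<Delta>" "2 * n"] mono
    show "M.indep_vars (\<lambda>_. borel) (\<lambda>i. incr X \<Delta> (Suc i)) {..<2 * n}" unfolding inc by simp
    fix i
    have "\<forall>s\<ge>0. \<forall>t\<ge>0. distr M borel (\<lambda>\<omega>. X (s + t) \<omega> - X s \<omega>) = distr M borel (X t)"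
      using lp by (simp add: levy_process_def)
    from this[rule_format, of "real i * \<Delta>" \<Delta>] \<Delta>
    have "distr M borel (\<lambda>\<omega>. X (real i * \<Delta> + \<Delta>) \<omega> - X (real i * \<Delta>) \<omega>) = distr M borel (X \<Delta>)" by simp
    moreover have "real i * \<Delta> + \<Delta> = real (Suc i) * \<Delta>" by (simp add: algebra_simps)
    ultimately show "distr M borel (incr X \<Delta> (Suc i)) = distr M borel (X \<Delta>)" unfolding inc by simp
  qed
qed

lemma min_mult_le:
  fixes x k a b :: ennreal
  assumes "x \<le> k * a" "x \<le> k * b" shows "x \<le> k * min a b"
  using assms by (simp add: min_def)

theorem theorem3p1:
  fixes \<Delta>max :: real
  assumes "0 < \<Delta>max"
  shows "\<exists>C>0. \<forall>(M :: 'a measure) X \<nu> F K \<theta> \<Delta> n h.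
    0 < \<Delta> \<and> \<Delta> \<le> \<Delta>max \<and> 1 \<le> n \<and> 0 < h \<and>
    pure_jump_levy M X \<nu> \<and> admissible_functional F \<and> admissible_kernel F K \<and>
    has_pairing F \<nu> (\<lambda>x. x) \<theta> \<longrightarrow>
      C2_const C \<nu> < \<infinity> \<and>
      (\<forall>\<theta>h. has_pairing F lborel (conv_mu (scaled K h) \<nu>) \<theta>h \<longrightarrow>
        (\<integral>\<^sup>+ \<omega>. ennreal ((norm (\<theta> - theta_hat F K X \<Delta> h n \<omega>))\<^sup>2) \<partial>M)
        \<le> ennreal (2 * (norm (\<theta> - \<theta>h))\<^sup>2) +
          ennreal (1 / (\<Delta> * real n) / (2 * pi\<^sup>2)) *
          min
            (C1_const C \<nu> *
              (\<integral>\<^sup>+ u. ennreal ((norm (fourier_real K (h * u)))\<^sup>2 *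
                 (norm (fourier_fnl F (- u) / char_at M X \<Delta> u))\<^sup>2) \<partial>lborel))
            (C2_const C \<nu> *
              (\<integral>\<^sup>+ u. ennreal (norm (fourier_real K (h * u)) *
                 norm (fourier_fnl F (- u) / char_at M X \<Delta> u)) \<partial>lborel)\<^sup>2))"
proof -
  \<comment> \<open>the moment constant at the largest \<open>\<Delta>\<close>, times \<open>1 + \<Delta>\<close> for lower order terms and 2 from the quadratic form\<close>
  define C where "C = 2 * ((4 + 32 * \<Delta>max + 512 * \<Delta>max^2) * (1 + \<Delta>max))"
  have C: "C > 0" using assms by (simp add: C_def add_pos_pos)
  show ?thesis
  proof (rule exI[of _ C], intro conjI allI impI C)
    fix M :: "'a measure" and X :: "real \<Rightarrow> 'a \<Rightarrow> real" and \<nu> :: "real measure" and F :: functional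
      and K :: "real \<Rightarrow> real" and \<theta> :: complex and \<Delta> :: real and n :: nat and h :: real
    assume asm: "0 < \<Delta> \<and> \<Delta> \<le> \<Delta>max \<and> 1 \<le> n \<and> 0 < h \<and>
      pure_jump_levy M X \<nu> \<and> admissible_functional F \<and> admissible_kernel F K \<and> has_pairing F \<nu> (\<lambda>x. x) \<theta>"
    then have \<Delta>: "0 < \<Delta>" "\<Delta> \<le> \<Delta>max" and n: "1 \<le> n" and h: "0 < h" and P: "pure_jump_levy M X \<nu>"
      and F: "admissible_functional F" and K: "admissible_kernel F K" by auto
    interpret levy_sample \<nu> "distr M borel (X \<Delta>)" \<Delta> M "\<lambda>i. incr X \<Delta> (Suc i)" n
      by (rule levy_process_sample[OF P \<Delta>(1) n])
    show "C2_const C \<nu> < \<infinity>"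
    proof -
      have s2: "(SUP x. ennreal (norm (Psi2 x))) \<le> ennreal (\<integral>y. y\<^sup>2 \<partial>\<nu>)"
        by (intro SUP_least ennreal_leI Psi2_bound)
      have s1: "(SUP x. ennreal (norm (Psi1 x))) \<le> ennreal (\<integral>y. \<bar>y\<bar> \<partial>\<nu>)"
        by (intro SUP_least ennreal_leI Psi1_bound)
      have "(SUP x. ennreal (norm (Psi2 x))) < \<infinity>" "(SUP x. ennreal (norm (Psi1 x))) < \<infinity>"
        using s1 s2 by (auto intro: le_less_trans)
      then show ?thesis
        unfolding C2_const_def nderiv_Psi1 nderiv_Psi2
        by (simp add: ennreal_mult_less_top power_less_top_ennreal)
    qed
    fix \<theta>h :: complex assume Ph: "has_pairing F lborel (conv_mu (scaled K h) \<nu>) \<theta>h"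
    define A where "A = (\<lambda>u. fourier_fnl F (- u) * fourier_real (scaled K h) u)"
    have A: "integrable lborel A"
      using K h unfolding A_def admissible_kernel_def by (simp add: mult.commute)
    have Am[measurable]: "A \<in> borel_measurable borel" using A by simp
    have th: "\<theta>h = 1 / (2 * complex_of_real pi) * (\<integral>u. A u * Fmu u \<partial>lborel)"
      unfolding A_def by (rule pairing_fourier[OF F K h Ph])
    note err = stochastic_error[OF A]
    have iAF: "integrable lborel (\<lambda>u. A u * Fmu u)"
    proof (rule Bochner_Integration.integrable_bound)
      show "integrable lborel (\<lambda>u. A u * complex_of_real (measure N (space N)))" by (rule integrable_mult_left[OF A])
      show "AE u in lborel. norm (A u * Fmu u) \<le> norm (A u * complex_of_real (measure N (space N)))"
        unfolding norm_mult by (intro AE_I2 mult_left_mono) (use Fmu_le in auto)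
    qed measurable
    \<comment> \<open>the stochastic error, as \<open>\<phi>'/\<phi> = i \<Delta> F\<mu>\<close>\<close>
    have hat: "theta_hat F K X \<Delta> h n \<omega> = \<theta>h + 1 / (2 * complex_of_real pi * (complex_of_real \<Delta> * \<i>)) * error_integral A \<omega>"
      if w: "\<omega> \<in> space M" for \<omega>
    proof -
      have p: "phi_hat X \<Delta> n \<omega> u = ecf \<omega> u" for u
        unfolding phi_hat_def ecf_def by (simp add: sum.atLeast1_atMost_eq)
      have p': "phi_hat' X \<Delta> n \<omega> u = ecf' \<omega> u" for u
      proof -
        have e: "{n + 1..2 * n} = Suc ` {n..<2 * n}" by (auto simp: image_Suc_atLeastLessThan)
        have "(\<Sum>k=n+1..2*n. \<i> * complex_of_real (incr X \<Delta> k \<omega>) * iexp (u * incr X \<Delta> k \<omega>)) =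
           (\<Sum>i\<in>{n..<2*n}. \<i> * complex_of_real (incr X \<Delta> (Suc i) \<omega>) * iexp (u * incr X \<Delta> (Suc i) \<omega>))"
          unfolding e by (subst sum.reindex) (auto simp: o_def)
        then show ?thesis unfolding phi_hat'_def ecf'_def by (simp only:)
      qed
      have y: "inv_phi_tilde X \<Delta> n \<omega> u = inv_ecf \<omega> u" for u
        unfolding inv_phi_tilde_def inv_ecf_def p T_def ..
      have pt: "fourier_fnl F (- u) * fourier_real (scaled K h) u * (phi_hat' X \<Delta> n \<omega> u / complex_of_real \<Delta> / \<i> * inv_phi_tilde X \<Delta> n \<omega> u) =
         A u * Fmu u + 1 / (complex_of_real \<Delta> * \<i>) * (A u * ratio_error \<omega> u)" for u
      proof -
        have nz: "complex_of_real \<Delta> * \<i> \<noteq> 0" using \<Delta>(1) by simp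
        have "ecf' \<omega> u * inv_ecf \<omega> u = ratio_error \<omega> u + (complex_of_real \<Delta> * \<i>) * Fmu u"
          unfolding ratio_error_def phi'_div Psi1_Fmu by simp
        then have "ecf' \<omega> u * inv_ecf \<omega> u / (complex_of_real \<Delta> * \<i>) = Fmu u + 1 / (complex_of_real \<Delta> * \<i>) * ratio_error \<omega> u"
          using nz by (simp add: add_divide_distrib)
        moreover have "phi_hat' X \<Delta> n \<omega> u / complex_of_real \<Delta> / \<i> * inv_phi_tilde X \<Delta> n \<omega> u = ecf' \<omega> u * inv_ecf \<omega> u / (complex_of_real \<Delta> * \<i>)"
          unfolding p' y by (simp only: divide_divide_eq_left times_divide_eq_left)
        ultimately show ?thesis unfolding A_def by (simp add: distrib_left)
      qed
      have "(\<integral>u. A u * Fmu u + 1 / (complex_of_real \<Delta> * \<i>) * (A u * ratio_error \<omega> u) \<partial>lborel) =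
          (\<integral>u. A u * Fmu u \<partial>lborel) + 1 / (complex_of_real \<Delta> * \<i>) * error_integral A \<omega>"
        unfolding error_integral_def using err(4)[OF w]
        by (subst Bochner_Integration.integral_add[OF iAF integrable_mult_right]) (simp_all only: integral_mult_right_zero)
      then show ?thesis unfolding theta_hat_def pt th by (simp add: distrib_left)
    qed
    \<comment> \<open>twice the squared modulus of the factor \<open>1/(2\<pi>i\<Delta>)\<close>\<close>
    define c where "c = 1 / (2 * pi\<^sup>2 * \<Delta>\<^sup>2)"
    have c: "c \<ge> 0" by (simp add: c_def)
    have bound: "(norm (\<theta> - theta_hat F K X \<Delta> h n \<omega>))\<^sup>2 \<le> 2 * (norm (\<theta> - \<theta>h))\<^sup>2 + c * (norm (error_integral A \<omega>))\<^sup>2"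
      if w: "\<omega> \<in> space M" for \<omega>
    proof -
      define s where "s = 1 / (2 * complex_of_real pi * (complex_of_real \<Delta> * \<i>)) * error_integral A \<omega>"
      have ns: "norm s = norm (error_integral A \<omega>) / (2 * pi * \<Delta>)"
        unfolding s_def using \<Delta>(1) by (simp add: norm_mult norm_divide)
      have "norm (\<theta> - theta_hat F K X \<Delta> h n \<omega>) \<le> norm (\<theta> - \<theta>h) + norm s"
        unfolding hat[OF w] s_def[symmetric] using norm_triangle_ineq4[of "\<theta> - \<theta>h" s] by (simp add: diff_diff_eq)
      then have "(norm (\<theta> - theta_hat F K X \<Delta> h n \<omega>))\<^sup>2 \<le> (norm (\<theta> - \<theta>h) + norm s)\<^sup>2" by (intro power_mono) auto
      also have "\<dots> \<le> 2 * (norm (\<theta> - \<theta>h))\<^sup>2 + 2 * (norm s)\<^sup>2"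
      proof -
        have "0 \<le> (norm (\<theta> - \<theta>h) - norm s)\<^sup>2" by simp
        then show ?thesis by (simp add: power2_eq_square algebra_simps)
      qed
      also have "2 * (norm s)\<^sup>2 = c * (norm (error_integral A \<omega>))\<^sup>2"
        unfolding ns c_def by (simp add: power_divide power_mult_distrib)
      finally show ?thesis .
    qed
    have "(\<integral>\<^sup>+ \<omega>. ennreal ((norm (\<theta> - theta_hat F K X \<Delta> h n \<omega>))\<^sup>2) \<partial>M) \<le>
       (\<integral>\<^sup>+ \<omega>. ennreal (2 * (norm (\<theta> - \<theta>h))\<^sup>2) + ennreal c * ennreal ((norm (error_integral A \<omega>))\<^sup>2) \<partial>M)"
    proof (intro nn_integral_mono)
      fix \<omega> assume "\<omega> \<in> space M"
      from ennreal_leI[OF bound[OF this]] c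
      show "ennreal ((norm (\<theta> - theta_hat F K X \<Delta> h n \<omega>))\<^sup>2) \<le> ennreal (2 * (norm (\<theta> - \<theta>h))\<^sup>2) + ennreal c * ennreal ((norm (error_integral A \<omega>))\<^sup>2)"
        by (simp add: ennreal_plus ennreal_mult[symmetric])
    qed
    also have "\<dots> = ennreal (2 * (norm (\<theta> - \<theta>h))\<^sup>2) + ennreal c * (\<integral>\<^sup>+ \<omega>. ennreal ((norm (error_integral A \<omega>))\<^sup>2) \<partial>M)"
      using err(3) by (subst nn_integral_add) (auto simp: nn_integral_cmult emeasure_space_1)
    finally have main: "(\<integral>\<^sup>+ \<omega>. ennreal ((norm (\<theta> - theta_hat F K X \<Delta> h n \<omega>))\<^sup>2) \<partial>M) \<le> \<dots>" .
    define G where "G = (\<lambda>u. ennreal (norm (A u) / norm (char (distr M borel (X \<Delta>)) u)))"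
    define k where "k = ennreal (1 / (\<Delta> * real n) / (2 * pi\<^sup>2))"
    define B where "B = moment_const * (1 + \<Delta>)"
    have B: "0 \<le> B" "2 * B \<le> C"
    proof -
      have "\<Delta>^2 \<le> \<Delta>max^2" using \<Delta> by (intro power_mono) auto
      then have "moment_const \<le> 4 + 32 * \<Delta>max + 512 * \<Delta>max^2" using \<Delta> unfolding moment_const_def by linarith
      then have "B \<le> (4 + 32 * \<Delta>max + 512 * \<Delta>max^2) * (1 + \<Delta>max)"
        unfolding B_def using \<Delta> by (intro mult_mono) auto
      then show "2 * B \<le> C" by (simp add: C_def)
      show "0 \<le> B" using \<Delta> by (simp add: B_def moment_const_def)
    qed
    have fac: "ennreal c * ennreal (\<Delta>\<^sup>2 * (moment_const * (1 + \<Delta>) / T)) = k * ennreal B"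
    proof -
      have "c * (\<Delta>\<^sup>2 * (moment_const * (1 + \<Delta>) / T)) = 1 / (\<Delta> * real n) / (2 * pi\<^sup>2) * B"
        using \<Delta>(1) unfolding c_def T_def B_def by simp
      then show ?thesis unfolding k_def using c B(1) \<Delta>(1) T_pos
        by (simp add: ennreal_mult[symmetric] B_def[symmetric])
    qed
    have G1: "(\<integral>\<^sup>+ u. ennreal (norm (fourier_real K (h * u)) * norm (fourier_fnl F (- u) / char_at M X \<Delta> u)) \<partial>lborel) = (\<integral>\<^sup>+u. G u \<partial>lborel)"
      by (simp add: G_def A_def norm_mult norm_divide char_at_def fourier_real_scaled[OF h] mult.commute)
    have G2: "(\<integral>\<^sup>+ u. ennreal ((norm (fourier_real K (h * u)))\<^sup>2 * (norm (fourier_fnl F (- u) / char_at M X \<Delta> u))\<^sup>2) \<partial>lborel) = (\<integral>\<^sup>+u. (G u)\<^sup>2 \<partial>lborel)"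
      by (simp add: G_def A_def norm_mult norm_divide char_at_def fourier_real_scaled[OF h] mult.commute ennreal_power flip: power_mult_distrib)
    have BC: "2 * ennreal B \<le> ennreal C"
      using ennreal_leI[OF B(2)] B(1) by (simp add: ennreal_mult)
    have BC': "ennreal B \<le> ennreal C" using B by (intro ennreal_leI) linarith
    have sq: "(\<integral>\<^sup>+w. (ennreal (norm (Psi1 w)))\<^sup>2 \<partial>lborel) = (\<integral>\<^sup>+w. ennreal ((norm (Psi1 w))\<^sup>2) \<partial>lborel)"
      by (simp add: ennreal_power)
    show "(\<integral>\<^sup>+ \<omega>. ennreal ((norm (\<theta> - theta_hat F K X \<Delta> h n \<omega>))\<^sup>2) \<partial>M)
        \<le> ennreal (2 * (norm (\<theta> - \<theta>h))\<^sup>2) +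
          ennreal (1 / (\<Delta> * real n) / (2 * pi\<^sup>2)) *
          min
            (C1_const C \<nu> *
              (\<integral>\<^sup>+ u. ennreal ((norm (fourier_real K (h * u)))\<^sup>2 *
                 (norm (fourier_fnl F (- u) / char_at M X \<Delta> u))\<^sup>2) \<partial>lborel))
            (C2_const C \<nu> *
              (\<integral>\<^sup>+ u. ennreal (norm (fourier_real K (h * u)) *
                 norm (fourier_fnl F (- u) / char_at M X \<Delta> u)) \<partial>lborel)\<^sup>2)"
      unfolding G1 G2 k_def[symmetric]
    proof (rule order_trans[OF main], intro add_left_mono min_mult_le)
      have "ennreal c * (\<integral>\<^sup>+ \<omega>. ennreal ((norm (error_integral A \<omega>))\<^sup>2) \<partial>M) \<le>
        ennreal c * (ennreal (\<Delta>\<^sup>2 * (moment_const * (1 + \<Delta>) / T)) * (2 * ((\<integral>\<^sup>+w. ennreal (norm (Psi2 w)) \<partial>lborel) + 2 * (\<integral>\<^sup>+w. (ennreal (norm (Psi1 w)))\<^sup>2 \<partial>lborel)) * (\<integral>\<^sup>+u. (G u)\<^sup>2 \<partial>lborel)))"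
        unfolding G_def by (intro mult_left_mono err(1)) simp
      also have "\<dots> = k * ((2 * ennreal B) * ((\<integral>\<^sup>+w. ennreal (norm (Psi2 w)) \<partial>lborel) + 2 * (\<integral>\<^sup>+w. (ennreal (norm (Psi1 w)))\<^sup>2 \<partial>lborel)) * (\<integral>\<^sup>+u. (G u)\<^sup>2 \<partial>lborel))"
        unfolding mult.assoc[of "ennreal c", symmetric] fac by (simp only: ac_simps)
      also have "\<dots> \<le> k * (ennreal C * ((\<integral>\<^sup>+w. ennreal (norm (Psi2 w)) \<partial>lborel) + 2 * (\<integral>\<^sup>+w. (ennreal (norm (Psi1 w)))\<^sup>2 \<partial>lborel)) * (\<integral>\<^sup>+u. (G u)\<^sup>2 \<partial>lborel))"
        by (intro mult_left_mono mult_right_mono BC) auto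
      finally show "ennreal c * (\<integral>\<^sup>+ \<omega>. ennreal ((norm (error_integral A \<omega>))\<^sup>2) \<partial>M) \<le> k * (C1_const C \<nu> * (\<integral>\<^sup>+u. (G u)\<^sup>2 \<partial>lborel))"
        unfolding C1_const_def nderiv_Psi1 nderiv_Psi2 sq .
      have "ennreal c * (\<integral>\<^sup>+ \<omega>. ennreal ((norm (error_integral A \<omega>))\<^sup>2) \<partial>M) \<le>
        ennreal c * (ennreal (\<Delta>\<^sup>2 * (moment_const * (1 + \<Delta>) / T)) * (((SUP w. ennreal (norm (Psi2 w))) + 2 * (SUP w. ennreal (norm (Psi1 w)))\<^sup>2) * (\<integral>\<^sup>+u. G u \<partial>lborel)\<^sup>2))"
        unfolding G_def by (intro mult_left_mono err(2)) simp
      also have "\<dots> = k * (ennreal B * ((SUP w. ennreal (norm (Psi2 w))) + 2 * (SUP w. ennreal (norm (Psi1 w)))\<^sup>2) * (\<integral>\<^sup>+u. G u \<partial>lborel)\<^sup>2)"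
        unfolding mult.assoc[of "ennreal c", symmetric] fac by (simp only: ac_simps)
      also have "\<dots> \<le> k * (ennreal C * ((SUP w. ennreal (norm (Psi2 w))) + 2 * (SUP w. ennreal (norm (Psi1 w)))\<^sup>2) * (\<integral>\<^sup>+u. G u \<partial>lborel)\<^sup>2)"
        by (intro mult_left_mono mult_right_mono BC') auto
      finally show "ennreal c * (\<integral>\<^sup>+ \<omega>. ennreal ((norm (error_integral A \<omega>))\<^sup>2) \<partial>M) \<le> k * (C2_const C \<nu> * (\<integral>\<^sup>+u. G u \<partial>lborel)\<^sup>2)"
        unfolding C2_const_def nderiv_Psi1 nderiv_Psi2 .
    qed
  qed
qed

end
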